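(* Let $\kappa>0$, $\lambda\ge0$, $\varepsilon>0$ and let $f_0,f_1\in L^2(0,1)$. There exists an admissible path $(f,v,z)\in\mathcal A(f_0,f_1)$ minimizing over $\mathcal A(f_0,f_1)$ the action $$A_{\kappa,\lambda,\varepsilon}(f,v,z)=\frac12\int_0^1\int_0^1\kappa v^2+\lambda v_x^2+\varepsilon v_{xx}^2+z^2\,dx\,dt.$$
   Context: Let $\mathcal V=L^2((0,1),H^2(0,1)\cap H^1_0(0,1))$ (time in the outer interval, space in the inner one). For $f_0,f_1\in L^2(0,1)$ the set of admissible paths $\mathcal A(f_0,f_1)$ consists of all triples $(f,v,z)$ of functions of $(x,t)\in(0,1)\times(0,1)$ with $f\in L^2((0,1),L^2(0,1))\cap C([0,1],H^{-1}(0,1))$, $v\in\mathcal V$, $z\in L^2((0,1),L^2(0,1))$, $f(\cdot,0)=f_0$, $f(\cdot,1)=f_1$, and $\partial_t f+\partial_x f\cdot v=z$ weakly, i.e. for every $\phi\in C^\infty([0,1]^2)$, $$-\int_0^1\!\!\int_0^1 f\,\partial_t\phi\,dx\,dt+\int_0^1 f_1(x)\phi(x,1)\,dx-\int_0^1 f_0(x)\phi(x,0)\,dx=\int_0^1\!\!\int_0^1 f\phi\,\partial_x v\,dx\,dt+\int_0^1\!\!\int_0^1 f\,\partial_x\phi\, v\,dx\,dt+\int_0^1\!\!\int_0^1\phi z\,dx\,dt.$$ *)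

theory Defs
  imports "HOL-Analysis.Analysis"
begin

text \<open>
  Elements of function spaces on (0,1) are represented by functions of type
  real to real, of which only the almost-everywhere class of the restriction to (0,1)
  matters: every norm, integral and membership condition below is invariant under changes on
  null sets. A function of space and time is curried with time first, so that
  \<open>f t\<close> is the spatial function at time \<open>t\<close>; this is the Bochner-space
  point of view. Lebesgue measure is used in its completed form, so that changing
  \<open>f t\<close> for a null set of times cannot destroy measurability.
\<close>

abbreviation unit_leb :: "real measure" where
  "unit_leb \<equiv> lebesgue_on {0<..<1}"

section \<open>Sobolev spaces on the unit interval\<close>

definition L2 :: "(real \<Rightarrow> real) set" where
  "L2 = {u. u \<in> borel_measurable unit_leb \<and> integrable unit_leb (\<lambda>x. (u x)\<^sup>2)}"

definition L2_norm :: "(real \<Rightarrow> real) \<Rightarrow> real" where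
  "L2_norm u = sqrt (LINT x|unit_leb. (u x)\<^sup>2)"

text \<open>The space of smooth functions with compact support in (0,1).\<close>

definition test_functions :: "(real \<Rightarrow> real) set" where
  "test_functions =
     {\<phi>. (\<forall>n x. ((deriv ^^ n) \<phi>) differentiable (at x)) \<and> closure {x. \<phi> x \<noteq> 0} \<subseteq> {0<..<1}}"

definition is_weak_deriv :: "(real \<Rightarrow> real) \<Rightarrow> (real \<Rightarrow> real) \<Rightarrow> bool" where
  "is_weak_deriv u g \<longleftrightarrow>
     (\<forall>\<phi>\<in>test_functions. (LINT x|unit_leb. u x * deriv \<phi> x) = - (LINT x|unit_leb. g x * \<phi> x))"

definition H1 :: "(real \<Rightarrow> real) set" where
  "H1 = {u \<in> L2. \<exists>g\<in>L2. is_weak_deriv u g}"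

text \<open>A representative of the weak derivative, which is unique up to null sets.\<close>

definition weak_deriv :: "(real \<Rightarrow> real) \<Rightarrow> real \<Rightarrow> real" where
  "weak_deriv u = (SOME g. g \<in> L2 \<and> is_weak_deriv u g)"

definition H1_norm :: "(real \<Rightarrow> real) \<Rightarrow> real" where
  "H1_norm u = sqrt ((L2_norm u)\<^sup>2 + (L2_norm (weak_deriv u))\<^sup>2)"

definition H2 :: "(real \<Rightarrow> real) set" where
  "H2 = {u \<in> H1. weak_deriv u \<in> H1}"

definition H2_norm :: "(real \<Rightarrow> real) \<Rightarrow> real" where
  "H2_norm u =
     sqrt ((L2_norm u)\<^sup>2 + (L2_norm (weak_deriv u))\<^sup>2 + (L2_norm (weak_deriv (weak_deriv u)))\<^sup>2)"

text \<open>The closure of the test functions in the norm of \<open>H1\<close>.\<close>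

definition H10 :: "(real \<Rightarrow> real) set" where
  "H10 = {u \<in> H1. \<exists>\<phi>. (\<forall>n::nat. \<phi> n \<in> test_functions) \<and>
                       (\<lambda>n. H1_norm (\<lambda>x. u x - \<phi> n x)) \<longlonglongrightarrow> 0}"

text \<open>
  The dual of \<open>H10\<close>. Only the values of a functional on \<open>H10\<close> matter, and
  boundedness forces it to respect almost-everywhere equality.
\<close>

definition Hm1 :: "((real \<Rightarrow> real) \<Rightarrow> real) set" where
  "Hm1 = {l. (\<forall>u\<in>H10. \<forall>w\<in>H10. l (\<lambda>x. u x + w x) = l u + l w) \<and>
             (\<forall>c. \<forall>u\<in>H10. l (\<lambda>x. c * u x) = c * l u) \<and>
             (\<exists>C. \<forall>u\<in>H10. \<bar>l u\<bar> \<le> C * H1_norm u)}"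

definition Hm1_norm :: "((real \<Rightarrow> real) \<Rightarrow> real) \<Rightarrow> real" where
  "Hm1_norm l = (SUP u\<in>{u \<in> H10. H1_norm u \<le> 1}. \<bar>l u\<bar>)"

text \<open>
  \<open>represents l g\<close>: the functional \<open>l\<close> is the image of \<open>g\<close> under
  the canonical embedding of \<open>L2\<close> into \<open>Hm1\<close>.
\<close>

definition represents :: "((real \<Rightarrow> real) \<Rightarrow> real) \<Rightarrow> (real \<Rightarrow> real) \<Rightarrow> bool" where
  "represents l g \<longleftrightarrow> (\<forall>u\<in>H10. l u = (LINT x|unit_leb. g x * u x))"

section \<open>Time-dependent functions\<close>

text \<open>
  \<open>Bochner_L2 X N\<close> is the space of square-integrable functions on (0,1) with
  values in the space \<open>X\<close> normed by \<open>N\<close>. Strong measurability is stated in the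
  usual form, as almost-everywhere approximability by simple functions with values in \<open>X\<close>.
\<close>

definition strongly_measurable ::
  "(real \<Rightarrow> real) set \<Rightarrow> ((real \<Rightarrow> real) \<Rightarrow> real) \<Rightarrow> (real \<Rightarrow> real \<Rightarrow> real) \<Rightarrow> bool" where
  "strongly_measurable X N u \<longleftrightarrow>
     (\<exists>s. (\<forall>n::nat. simple_function unit_leb (s n) \<and> (\<forall>t\<in>{0<..<1}. s n t \<in> X)) \<and>
          (AE t in unit_leb. (\<lambda>n. N (\<lambda>x. s n t x - u t x)) \<longlonglongrightarrow> 0))"

definition Bochner_L2 ::
  "(real \<Rightarrow> real) set \<Rightarrow> ((real \<Rightarrow> real) \<Rightarrow> real) \<Rightarrow> (real \<Rightarrow> real \<Rightarrow> real) set" where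
  "Bochner_L2 X N =
     {u. (AE t in unit_leb. u t \<in> X) \<and> strongly_measurable X N u \<and>
         integrable unit_leb (\<lambda>t. (N (u t))\<^sup>2)}"

definition C_Hm1 :: "(real \<Rightarrow> (real \<Rightarrow> real) \<Rightarrow> real) set" where
  "C_Hm1 =
     {F. (\<forall>t\<in>{0..1}. F t \<in> Hm1) \<and>
         (\<forall>s\<in>{0..1}. ((\<lambda>t. Hm1_norm (\<lambda>u. F t u - F s u)) \<longlongrightarrow> 0) (at s within {0..1}))}"

text \<open>
  Smoothness up to the boundary on the closed unit square: \<open>D i j\<close> is the partial
  derivative of order \<open>i\<close> in space and \<open>j\<close> in time, one-sided at the boundary.
  The argument of \<open>\<phi>\<close> is the pair of position and time.
\<close>

definition smooth_square :: "(real \<times> real \<Rightarrow> real) set" where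
  "smooth_square =
     {\<phi>. \<exists>D :: nat \<Rightarrow> nat \<Rightarrow> real \<times> real \<Rightarrow> real.
           (\<forall>p\<in>{0..1} \<times> {0..1}. D 0 0 p = \<phi> p) \<and>
           (\<forall>i j. \<forall>p\<in>{0..1} \<times> {0..1}.
              (D i j has_derivative (\<lambda>(h, k). D (Suc i) j p * h + D i (Suc j) p * k))
                (at p within {0..1} \<times> {0..1}))}"

section \<open>Admissible paths and the action\<close>

text \<open>
  Double integrals are iterated, space inside and time outside; the spatial derivative of
  \<open>v\<close> at time \<open>t\<close> is the weak derivative of the function \<open>v t\<close>. The iterated
  integrals depend only on the Bochner class of the integrands, not on the
  representatives chosen at each time.
\<close>

definition weak_transport ::
  "(real \<Rightarrow> real) \<Rightarrow> (real \<Rightarrow> real) \<Rightarrow>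
   (real \<Rightarrow> real \<Rightarrow> real) \<Rightarrow> (real \<Rightarrow> real \<Rightarrow> real) \<Rightarrow> (real \<Rightarrow> real \<Rightarrow> real) \<Rightarrow> bool" where
  "weak_transport f0 f1 f v z \<longleftrightarrow>
     (\<forall>\<phi>\<in>smooth_square.
        - (LINT t|unit_leb. LINT x|unit_leb. f t x * deriv (\<lambda>s. \<phi> (x, s)) t)
        + (LINT x|unit_leb. f1 x * \<phi> (x, 1)) - (LINT x|unit_leb. f0 x * \<phi> (x, 0))
      = (LINT t|unit_leb. LINT x|unit_leb. f t x * \<phi> (x, t) * weak_deriv (v t) x)
        + (LINT t|unit_leb. LINT x|unit_leb. f t x * deriv (\<lambda>y. \<phi> (y, t)) x * v t x)
        + (LINT t|unit_leb. LINT x|unit_leb. \<phi> (x, t) * z t x))"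

text \<open>
  Membership of \<open>f\<close> in the continuous functions with values in \<open>Hm1\<close>, and its
  values at the times 0 and 1, refer to the continuous representative \<open>F\<close> of the
  class of \<open>f\<close>.
\<close>

definition admissible ::
  "(real \<Rightarrow> real) \<Rightarrow> (real \<Rightarrow> real) \<Rightarrow>
   ((real \<Rightarrow> real \<Rightarrow> real) \<times> (real \<Rightarrow> real \<Rightarrow> real) \<times> (real \<Rightarrow> real \<Rightarrow> real)) set" where
  "admissible f0 f1 =
     {(f, v, z).
        f \<in> Bochner_L2 L2 L2_norm \<and>
        (\<exists>F\<in>C_Hm1. (AE t in unit_leb. represents (F t) (f t)) \<and>
                   represents (F 0) f0 \<and> represents (F 1) f1) \<and>
        v \<in> Bochner_L2 (H2 \<inter> H10) H2_norm \<and>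
        z \<in> Bochner_L2 L2 L2_norm \<and>
        weak_transport f0 f1 f v z}"

definition action ::
  "real \<Rightarrow> real \<Rightarrow> real \<Rightarrow>
   (real \<Rightarrow> real \<Rightarrow> real) \<Rightarrow> (real \<Rightarrow> real \<Rightarrow> real) \<Rightarrow> (real \<Rightarrow> real \<Rightarrow> real) \<Rightarrow> real" where
  "action \<kappa> \<mu> \<epsilon> f v z =
     1 / 2 * (LINT t|unit_leb. LINT x|unit_leb.
        \<kappa> * (v t x)\<^sup>2 + \<mu> * (weak_deriv (v t) x)\<^sup>2
        + \<epsilon> * (weak_deriv (weak_deriv (v t)) x)\<^sup>2 + (z t x)\<^sup>2)"

end

theory Submission
  imports Defs "HOL-Library.Diagonal_Subsequence" "HOL-Computational_Algebra.Polynomial"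
begin

text \<open>
  An admissible velocity is determined by \<open>w = v\<^sub>x\<^sub>x\<close>, since \<open>v = G0 w\<close> for the Dirichlet inverse
  \<open>G0\<close> of the second derivative, so a path becomes a triple \<open>(f, w, z)\<close> of square integrable
  functions on the unit square, the action a convex function of \<open>w\<close> and \<open>z\<close>. For a minimizing
  sequence the coercivity of the action bounds \<open>w\<close> and \<open>z\<close>, but says nothing about \<open>f\<close>. The bound for \<open>f\<close>
  comes by duality from the energy estimate for \<open>\<phi>\<^sub>t + (v\<phi>)\<^sub>x\<close>, provided these functions, with \<open>\<phi>\<close> vanishing
  at the final time, are dense; equivalently, provided the homogeneous transport equation has
  only the trivial solution. Neither step needs characteristics or regularization of the velocity.

  With all three components bounded, weakly convergent subsequences exist. Only the product of \<open>f\<close>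
  and \<open>v\<close> is nonlinear in the equation. The moments of \<open>f\<close> in space are equicontinuous in time, so \<open>f\<close> converges
  weakly in space at almost every time; moving the compact operator \<open>G0\<close> from \<open>w\<close> to \<open>f\<close>
  turns this into strong convergence, and the products converge.
\<close>

section \<open>Square integrable functions\<close>

text \<open>The obstacle is that \<open>f\<close> is merely square integrable in space, so its
  equation cannot be tested with \<open>f\<close> itself, while the velocity is only square
  integrable in time. With \<open>w\<close> = v_xx the bounds |v|, |v_x| \<le> 2 |w(t)| hold at each
  time, |w(t)| being the norm in space. So the coefficient in the energy estimate is integrable in
  time and the Gronwall factor depends on the norm of \<open>w\<close> alone: one power of 2 serves
  a whole minimizing sequence. The dual estimate measures \<phi>_t + (v \<phi>)_x in L^1 in time
  with values in L^2, and this makes the bound for \<open>f\<close> uniform in time. With a bound on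
  the square only, the products |f(t)| |w(t)| would be bounded merely in L^1 and the moments of
  \<open>f\<close> would have no common modulus of continuity. The source \<open>z\<close> makes the
  problem feasible: with zero velocity the linear interpolation joins any two end states. The
  continuous dual-valued representative is not carried through the limit but rebuilt from the limit
  equation.\<close>

definition sq_int :: "'a measure \<Rightarrow> ('a \<Rightarrow> real) set" where
  "sq_int M = {f \<in> borel_measurable M. integrable M (\<lambda>x. (f x)\<^sup>2)}"

definition nrm :: "'a measure \<Rightarrow> ('a \<Rightarrow> real) \<Rightarrow> real" where
  "nrm M f = sqrt (LINT x|M. (f x)\<^sup>2)"

lemma sq_int_meas [measurable_dest]: "f \<in> sq_int M \<Longrightarrow> f \<in> borel_measurable M"
  by (simp add: sq_int_def)

lemma sq_int_sq: "f \<in> sq_int M \<Longrightarrow> integrable M (\<lambda>x. (f x)\<^sup>2)"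
  by (simp add: sq_int_def)

lemma sq_int_mult: 
  assumes "f \<in> sq_int M" "g \<in> sq_int M"
  shows "integrable M (\<lambda>x. f x * g x)"
proof (rule Bochner_Integration.integrable_bound)
  show "integrable M (\<lambda>x. (f x)\<^sup>2 + (g x)\<^sup>2)"
    using assms by (simp add: sq_int_def)
  show "(\<lambda>x. f x * g x) \<in> borel_measurable M"
    using assms by measurable
  have "\<bar>a * b\<bar> \<le> a\<^sup>2 + b\<^sup>2" for a b :: real
  proof -
    have "0 \<le> (\<bar>a\<bar> - \<bar>b\<bar>)\<^sup>2" by simp
    then have "2 * (\<bar>a\<bar> * \<bar>b\<bar>) \<le> a\<^sup>2 + b\<^sup>2" by (simp add: power2_diff)
    moreover have "0 \<le> \<bar>a\<bar> * \<bar>b\<bar>" by simp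
    ultimately show ?thesis unfolding abs_mult by linarith
  qed
  then show "AE x in M. norm (f x * g x) \<le> norm ((f x)\<^sup>2 + (g x)\<^sup>2)"
    by (intro AE_I2) (metis abs_ge_self order_trans real_norm_def)
qed

lemma sq_intI: "f \<in> borel_measurable M \<Longrightarrow> integrable M (\<lambda>x. (f x)\<^sup>2) \<Longrightarrow> f \<in> sq_int M"
  by (simp add: sq_int_def)

lemma sq_int_scale: "f \<in> sq_int M \<Longrightarrow> (\<lambda>x. c * f x) \<in> sq_int M"
  by (auto simp: sq_int_def power_mult_distrib)

lemma sq_int_add: 
  assumes "f \<in> sq_int M" "g \<in> sq_int M"
  shows "(\<lambda>x. f x + g x) \<in> sq_int M"
proof -
  have "integrable M (\<lambda>x. (f x)\<^sup>2 + (g x)\<^sup>2 + 2 * (f x * g x))"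
    using assms sq_int_mult[OF assms] by (simp add: sq_int_def)
  then have "integrable M (\<lambda>x. (f x + g x)\<^sup>2)" by (simp add: power2_sum mult.assoc)
  moreover have "(\<lambda>x. f x + g x) \<in> borel_measurable M" using assms by measurable
  ultimately show ?thesis by (intro sq_intI)
qed

lemma sq_int_minus: "f \<in> sq_int M \<Longrightarrow> (\<lambda>x. - f x) \<in> sq_int M"
  using sq_int_scale[of f M "-1"] by simp

lemma sq_int_diff: 
  assumes "f \<in> sq_int M" "g \<in> sq_int M"
  shows "(\<lambda>x. f x - g x) \<in> sq_int M"
  using sq_int_add[OF assms(1) sq_int_minus[OF assms(2)]] by simp

lemma sq_int_zero: "(\<lambda>x. 0) \<in> sq_int M"
  by (simp add: sq_int_def)

lemma sq_int_sum: "(\<And>i. i \<in> I \<Longrightarrow> f i \<in> sq_int M) \<Longrightarrow> (\<lambda>x. \<Sum>i\<in>I. f i x) \<in> sq_int M"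
  by (induction I rule: infinite_finite_induct) (auto intro: sq_int_add sq_int_zero)

lemma sq_int_cong_AE:
  assumes "f \<in> sq_int M" "g \<in> borel_measurable M" "AE x in M. g x = f x"
  shows "g \<in> sq_int M"
proof -
  have "integrable M (\<lambda>x. (g x)\<^sup>2)"
    by (rule integrable_cong_AE_imp[of M "\<lambda>x. (f x)\<^sup>2"]) (use assms in \<open>auto simp: sq_int_def\<close>)
  then show ?thesis using assms by (simp add: sq_int_def)
qed

lemma nrm_nonneg [simp]: "0 \<le> nrm M f"
  by (simp add: nrm_def)

lemma nrm_sq: "(nrm M f)\<^sup>2 = (LINT x|M. (f x)\<^sup>2)"
  by (simp add: nrm_def)

lemma nrm_scale: "nrm M (\<lambda>x. c * f x) = \<bar>c\<bar> * nrm M f"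
  by (simp add: nrm_def power_mult_distrib real_sqrt_mult)

lemma nrm_minus_commute: "nrm M (\<lambda>x. f x - g x) = nrm M (\<lambda>x. g x - f x)"
  by (simp add: nrm_def power2_commute)

text \<open>The discriminant criterion, with the degenerate leading coefficient included. With
  \<open>a\<close> = 0 it says that a quadratic which is nonnegative and vanishes at 0 has no linear
  term; this is how first variations are evaluated below.\<close>

lemma quad_nonneg_discr:
  fixes a b c :: real
  assumes "\<And>s. 0 \<le> a + 2 * s * b + s\<^sup>2 * c"
  shows "b\<^sup>2 \<le> a * c"
proof (cases "c = 0")
  case True
  have "b = 0"
  proof (rule ccontr)
    assume "b \<noteq> 0"
    \<comment> \<open>At this argument the affine function takes the value -1.\<close>
    have "0 \<le> a + 2 * (- (a + 1) / (2 * b)) * b" using assms[of "- (a + 1) / (2 * b)"] True by simp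
    then show False using \<open>b \<noteq> 0\<close> by (simp add: field_simps)
  qed
  then show ?thesis using True by simp
next
  case False
  have "c > 0"
  proof (rule ccontr)
    assume "\<not> c > 0"
    then have "c < 0" using False by simp
    \<comment> \<open>Chosen so that \<open>s\<close> is at least 1 and \<open>s * c\<close> lies
      below -|a| - 2|b|, which pushes the whole quadratic below zero.\<close>
    define s where "s = (\<bar>a\<bar> + 2 * \<bar>b\<bar> + 1) / (- c) + 1"
    have s1: "s \<ge> 1" using \<open>c < 0\<close> by (simp add: s_def divide_nonneg_neg)
    have "- c * s = \<bar>a\<bar> + 2 * \<bar>b\<bar> + 1 - c" using \<open>c < 0\<close> by (simp add: s_def field_simps)
    then have "s * c < - \<bar>a\<bar> - 2 * \<bar>b\<bar>" using \<open>c < 0\<close> by (simp add: mult.commute)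
    then have "s * (s * c) < s * (- \<bar>a\<bar> - 2 * \<bar>b\<bar>)" using s1 by simp
    moreover have "s * \<bar>a\<bar> \<ge> \<bar>a\<bar>" using s1 by (simp add: mult_le_cancel_right1)
    moreover have "s * b \<le> s * \<bar>b\<bar>" using s1 by (intro mult_left_mono) auto
    ultimately have "a + 2 * s * b + s\<^sup>2 * c < 0" by (simp add: power2_eq_square algebra_simps)
    then show False using assms[of s] by simp
  qed
  have "0 \<le> a + 2 * (- b / c) * b + (- b / c)\<^sup>2 * c" using assms by blast
  also have "\<dots> = a - b\<^sup>2 / c" using \<open>c > 0\<close> by (simp add: field_simps power2_eq_square)
  finally show ?thesis using \<open>c > 0\<close> by (simp add: field_simps)
qed

lemma integral_quad:
  assumes "f \<in> sq_int M" "g \<in> sq_int M"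
  shows "(LINT x|M. (f x + s * g x)\<^sup>2) = 
     (LINT x|M. (f x)\<^sup>2) + 2 * s * (LINT x|M. f x * g x) + s\<^sup>2 * (LINT x|M. (g x)\<^sup>2)"
proof -
  have "(LINT x|M. (f x + s * g x)\<^sup>2) = (LINT x|M. (f x)\<^sup>2 + (2 * s) * (f x * g x) + s\<^sup>2 * (g x)\<^sup>2)"
    by (intro Bochner_Integration.integral_cong refl) (simp add: power2_sum power_mult_distrib mult_ac)
  also have "\<dots> = (LINT x|M. (f x)\<^sup>2) + 2 * s * (LINT x|M. f x * g x) + s\<^sup>2 * (LINT x|M. (g x)\<^sup>2)"
    using assms sq_int_mult[OF assms] by (simp add: sq_int_def)
  finally show ?thesis .
qed

lemma cauchy_schwarz:
  assumes "f \<in> sq_int M" "g \<in> sq_int M"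
  shows "\<bar>LINT x|M. f x * g x\<bar> \<le> nrm M f * nrm M g"
proof -
  have "(LINT x|M. f x * g x)\<^sup>2 \<le> (LINT x|M. (f x)\<^sup>2) * (LINT x|M. (g x)\<^sup>2)"
  proof (rule quad_nonneg_discr)
    fix s
    have "0 \<le> (LINT x|M. (f x + s * g x)\<^sup>2)" by simp
    then show "0 \<le> (LINT x|M. (f x)\<^sup>2) + 2 * s * (LINT x|M. f x * g x) + s\<^sup>2 * (LINT x|M. (g x)\<^sup>2)"
      by (simp add: integral_quad[OF assms])
  qed
  then have "sqrt ((LINT x|M. f x * g x)\<^sup>2) \<le> sqrt ((LINT x|M. (f x)\<^sup>2) * (LINT x|M. (g x)\<^sup>2))"
    by (rule real_sqrt_le_mono)
  then show ?thesis by (simp add: nrm_def real_sqrt_mult)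
qed

lemma nrm_triangle:
  assumes "f \<in> sq_int M" "g \<in> sq_int M"
  shows "nrm M (\<lambda>x. f x + g x) \<le> nrm M f + nrm M g"
proof (rule power2_le_imp_le)
  have "(nrm M (\<lambda>x. f x + g x))\<^sup>2 = (nrm M f)\<^sup>2 + 2 * (LINT x|M. f x * g x) + (nrm M g)\<^sup>2"
    using integral_quad[OF assms, of 1] by (simp add: nrm_sq)
  also have "\<dots> \<le> (nrm M f)\<^sup>2 + 2 * (nrm M f * nrm M g) + (nrm M g)\<^sup>2"
    using cauchy_schwarz[OF assms] by simp
  also have "\<dots> = (nrm M f + nrm M g)\<^sup>2" by (simp add: power2_sum)
  finally show "(nrm M (\<lambda>x. f x + g x))\<^sup>2 \<le> (nrm M f + nrm M g)\<^sup>2" .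
qed simp

lemma nrm_triangle_diff:
  assumes "f \<in> sq_int M" "g \<in> sq_int M" "h \<in> sq_int M"
  shows "nrm M (\<lambda>x. f x - h x) \<le> nrm M (\<lambda>x. f x - g x) + nrm M (\<lambda>x. g x - h x)"
  using nrm_triangle[OF sq_int_diff[OF assms(1,2)] sq_int_diff[OF assms(2,3)]] by simp

lemma nrm_triangle2:
  assumes "f \<in> sq_int M" "g \<in> sq_int M"
  shows "nrm M f \<le> nrm M (\<lambda>x. f x - g x) + nrm M g"
  using nrm_triangle[OF sq_int_diff[OF assms] assms(2)] by simp

lemma nrm_cong_AE:
  assumes "AE x in M. f x = g x" "f \<in> borel_measurable M" "g \<in> borel_measurable M"
  shows "nrm M f = nrm M g"
proof -
  have "(LINT x|M. (f x)\<^sup>2) = (LINT x|M. (g x)\<^sup>2)"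
    by (rule integral_cong_AE) (use assms in auto)
  then show ?thesis by (simp add: nrm_def)
qed

lemma nrm_zero_AE:
  assumes "f \<in> sq_int M" "nrm M f = 0"
  shows "AE x in M. f x = 0"
proof -
  have "(LINT x|M. (f x)\<^sup>2) = 0" using assms(2) nrm_sq[of M f] by simp
  then have "AE x in M. (f x)\<^sup>2 = 0"
    using integral_nonneg_eq_0_iff_AE[OF sq_int_sq[OF assms(1)]] by simp
  then show ?thesis by simp
qed

lemma ip_tendsto:
  assumes "\<And>n. h n \<in> sq_int M" "x \<in> sq_int M" "g \<in> sq_int M"
    and "(\<lambda>n. nrm M (\<lambda>y. h n y - x y)) \<longlonglongrightarrow> 0"
  shows "(\<lambda>n. LINT y|M. h n y * g y) \<longlonglongrightarrow> (LINT y|M. x y * g y)"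
proof -
  have "(\<lambda>n. (LINT y|M. h n y * g y) - (LINT y|M. x y * g y)) \<longlonglongrightarrow> 0"
  proof (rule Lim_null_comparison)
    show "(\<lambda>n. nrm M (\<lambda>y. h n y - x y) * nrm M g) \<longlonglongrightarrow> 0"
      using tendsto_mult_left_zero[OF assms(4)] by simp
    have "(LINT y|M. h n y * g y) - (LINT y|M. x y * g y) = (LINT y|M. (h n y - x y) * g y)" for n
      using assms by (simp add: left_diff_distrib sq_int_mult)
    then show "\<forall>\<^sub>F n in sequentially. norm ((LINT y|M. h n y * g y) - (LINT y|M. x y * g y)) 
        \<le> nrm M (\<lambda>y. h n y - x y) * nrm M g"
      using cauchy_schwarz[OF sq_int_diff[OF assms(1) assms(2)] assms(3)] by simp
  qed
  then show ?thesis by (simp add: LIM_zero_iff)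
qed

lemma nrm_tendsto:
  assumes "\<And>n. h n \<in> sq_int M" "x \<in> sq_int M"
    and "(\<lambda>n. nrm M (\<lambda>y. h n y - x y)) \<longlonglongrightarrow> 0"
  shows "(\<lambda>n. nrm M (h n)) \<longlonglongrightarrow> nrm M x"
proof -
  have "(\<lambda>n. nrm M (h n) - nrm M x) \<longlonglongrightarrow> 0"
  proof (rule Lim_null_comparison[OF _ assms(3)])
    have "\<bar>nrm M (h n) - nrm M x\<bar> \<le> nrm M (\<lambda>y. h n y - x y)" for n
      using nrm_triangle2[OF assms(1)[of n] assms(2)] nrm_triangle2[OF assms(2) assms(1)[of n]]
        nrm_minus_commute[of M x "h n"] by linarith
    then show "\<forall>\<^sub>F n in sequentially. norm (nrm M (h n) - nrm M x) \<le> nrm M (\<lambda>y. h n y - x y)"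
      by simp
  qed
  then show ?thesis by (simp add: LIM_zero_iff)
qed

text \<open>Monotone convergence: the series of absolute values has a finite integral, hence a
  finite sum almost everywhere. Both uses extract pointwise limits from rapid convergence in
  norm.\<close>

lemma AE_summable_L1:
  fixes h :: "nat \<Rightarrow> 'a \<Rightarrow> real"
  assumes h: "\<And>k. integrable M (h k)" and s: "summable (\<lambda>k. LINT x|M. \<bar>h k x\<bar>)"
  shows "AE x in M. summable (\<lambda>k. \<bar>h k x\<bar>)"
proof -
  note [measurable] = borel_measurable_integrable[OF h]
  have "(\<integral>\<^sup>+x. (\<Sum>k. ennreal \<bar>h k x\<bar>) \<partial>M) = (\<Sum>k. \<integral>\<^sup>+x. ennreal \<bar>h k x\<bar> \<partial>M)"
    by (rule nn_integral_suminf) auto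
  also have "\<dots> = (\<Sum>k. ennreal (LINT x|M. \<bar>h k x\<bar>))"
    using h by (intro suminf_cong nn_integral_eq_integral) auto
  also have "\<dots> = ennreal (\<Sum>k. LINT x|M. \<bar>h k x\<bar>)"
    by (rule suminf_ennreal2[OF _ s]) simp
  finally have "(\<integral>\<^sup>+x. (\<Sum>k. ennreal \<bar>h k x\<bar>) \<partial>M) \<noteq> \<infinity>" by simp
  then have "AE x in M. (\<Sum>k. ennreal \<bar>h k x\<bar>) \<noteq> \<infinity>"
    by (intro nn_integral_PInf_AE) auto
  then show ?thesis
    by eventually_elim (auto intro: summable_suminf_not_top)
qed

section \<open>Completeness, Riesz representation, projection and weak compactness\<close>

context finite_measure
begin

lemma sq_int_bounded:
  assumes "f \<in> borel_measurable M" "AE x in M. \<bar>f x\<bar> \<le> C"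
  shows "f \<in> sq_int M"
proof -
  have "integrable M (\<lambda>x. (f x)\<^sup>2)"
  proof (rule integrable_const_bound[where B="C\<^sup>2"])
    show "AE x in M. norm ((f x)\<^sup>2) \<le> C\<^sup>2"
      using assms(2) by eventually_elim (simp add: abs_le_square_iff[symmetric])
  qed (use assms in simp)
  then show ?thesis using assms by (simp add: sq_int_def)
qed

lemma sq_int_const: "(\<lambda>x. c) \<in> sq_int M"
  by (rule sq_int_bounded[where C="\<bar>c\<bar>"]) auto

lemma sq_int_integrable:
  assumes "f \<in> sq_int M"
  shows "integrable M f"
  using sq_int_mult[OF assms sq_int_const[of 1]] by simp

lemma sq_int_L1:
  assumes "f \<in> sq_int M"
  shows "(LINT x|M. \<bar>f x\<bar>) \<le> sqrt (measure M (space M)) * nrm M f"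
proof -
  have "(\<lambda>x. \<bar>f x\<bar>) \<in> sq_int M" 
    using assms by (auto simp: sq_int_def)
  from cauchy_schwarz[OF sq_int_const[of 1] this] show ?thesis
    by (simp add: nrm_def)
qed

lemma sq_int_mult_bounded:
  assumes "f \<in> sq_int M" "g \<in> borel_measurable M" "AE x in M. \<bar>g x\<bar> \<le> C"
  shows "(\<lambda>x. f x * g x) \<in> sq_int M"
proof -
  have "integrable M (\<lambda>x. (f x * g x)\<^sup>2)"
  proof (rule Bochner_Integration.integrable_bound)
    show "integrable M (\<lambda>x. C\<^sup>2 * (f x)\<^sup>2)" using assms by (simp add: sq_int_def)
    show "(\<lambda>x. (f x * g x)\<^sup>2) \<in> borel_measurable M" using assms(1,2) by measurable
    show "AE x in M. norm ((f x * g x)\<^sup>2) \<le> norm (C\<^sup>2 * (f x)\<^sup>2)"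
      using assms(3)
    proof eventually_elim
      case (elim x)
      then have "(g x)\<^sup>2 \<le> C\<^sup>2" by (simp add: abs_le_square_iff[symmetric])
      then have "(g x)\<^sup>2 * (f x)\<^sup>2 \<le> C\<^sup>2 * (f x)\<^sup>2" by (intro mult_right_mono) auto
      then show ?case by (simp add: power_mult_distrib mult.commute)
    qed
  qed
  moreover have "(\<lambda>x. f x * g x) \<in> borel_measurable M" using assms(1,2) by measurable
  ultimately show ?thesis by (intro sq_intI)
qed

text \<open>Riesz-Fischer: a subsequence with geometrically small steps converges almost everywhere,
  and Fatou's lemma identifies its pointwise limit as the norm limit of the full sequence.\<close>

lemma sq_int_complete:
  assumes h: "\<And>n. h n \<in> sq_int M"
    and cau: "\<And>e. e > 0 \<Longrightarrow> \<exists>N. \<forall>m\<ge>N. \<forall>n\<ge>N. nrm M (\<lambda>x. h m x - h n x) < e"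
  obtains x where "x \<in> sq_int M" "(\<lambda>n. nrm M (\<lambda>y. h n y - x y)) \<longlonglongrightarrow> 0"
proof -
  have "\<forall>k. \<exists>N. \<forall>m\<ge>N. \<forall>n\<ge>N. nrm M (\<lambda>x. h m x - h n x) < (1/2)^k"
    using cau by simp
  then obtain N where N: "\<And>k m n. m \<ge> N k \<Longrightarrow> n \<ge> N k \<Longrightarrow> nrm M (\<lambda>x. h m x - h n x) < (1/2)^k"
    by metis
  \<comment> \<open>The maximum keeps \<open>r\<close> strictly increasing and beyond the thresholds
    \<open>N\<close> at once.\<close>
  define r where "r = rec_nat (N 0) (\<lambda>k p. max (Suc p) (N (Suc k)))"
  have r0: "r k \<ge> N k" for k by (cases k) (simp_all add: r_def)
  have rS: "r k < r (Suc k)" for k by (simp add: r_def)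
  have rm: "strict_mono r" using rS by (simp add: strict_mono_Suc_iff)
  define d where "d k x = h (r (Suc k)) x - h (r k) x" for k x
  have dsq: "d k \<in> sq_int M" for k unfolding d_def by (intro sq_int_diff h)
  note [measurable] = sq_int_meas[OF dsq] sq_int_meas[OF h]
  have dn: "nrm M (d k) \<le> (1/2)^k" for k
    unfolding d_def using N[of k "r (Suc k)" "r k"] r0[of k] rS[of k] by fastforce
  have "summable (\<lambda>k. LINT x|M. \<bar>d k x\<bar>)"
  proof (rule summable_comparison_test')
    show "summable (\<lambda>k. sqrt (measure M (space M)) * (1/2)^k)" by (intro summable_mult) auto
    show "norm (LINT x|M. \<bar>d k x\<bar>) \<le> sqrt (measure M (space M)) * (1/2)^k" for k
      using sq_int_L1[OF dsq[of k]] mult_left_mono[OF dn[of k], of "sqrt (measure M (space M))"] by simp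
  qed
  from AE_summable_L1[OF sq_int_integrable[OF dsq] this]
  have "AE x in M. summable (\<lambda>k. \<bar>d k x\<bar>)" .
  then have conv: "AE x in M. convergent (\<lambda>k. h (r k) x)"
  proof eventually_elim
    case (elim x)
    then have "summable (\<lambda>k. d k x)" by (rule summable_rabs_cancel)
    then have "convergent (\<lambda>n. \<Sum>k<n. d k x)" by (simp add: summable_iff_convergent)
    moreover have "(\<Sum>k<n. d k x) = h (r n) x - h (r 0) x" for n
      unfolding d_def by (rule sum_lessThan_telescope)
    ultimately have "convergent (\<lambda>n. h (r n) x - h (r 0) x)" by simp
    then show ?case by (simp add: convergent_diff_const_right_iff)
  qed
  define y where "y x = lim (\<lambda>k. h (r k) x)" for x
  have ym [measurable]: "y \<in> borel_measurable M"
    unfolding y_def by (rule borel_measurable_lim_metric) auto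
  have lim: "AE x in M. (\<lambda>k. h (r k) x) \<longlonglongrightarrow> y x"
    using conv by eventually_elim (simp add: y_def convergent_LIMSEQ_iff)
  \<comment> \<open>Fatou along the subsequence gives integrability and the rate together, and for
    every \<open>n\<close> beyond the threshold, not only for members of the subsequence.\<close>
  have main: "integrable M (\<lambda>x. (h n x - y x)\<^sup>2) \<and> nrm M (\<lambda>x. h n x - y x) \<le> (1/2)^k" 
    if "n \<ge> N k" for n k
  proof -
    have A: "(\<integral>\<^sup>+x. ennreal ((h n x - h (r j) x)\<^sup>2) \<partial>M) \<le> ennreal (((1/2)^k)\<^sup>2)" if "j \<ge> k" for j
    proof -
      have "r j \<ge> N k" using r0[of k] strict_mono_mono[OF rm] that by (meson le_trans monoD)
      then have "nrm M (\<lambda>x. h n x - h (r j) x) \<le> (1/2)^k" using N[OF \<open>n \<ge> N k\<close>] by (simp add: less_imp_le)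
      then have "(nrm M (\<lambda>x. h n x - h (r j) x))\<^sup>2 \<le> ((1/2)^k)\<^sup>2" by (intro power_mono) auto
      moreover have "(\<integral>\<^sup>+x. ennreal ((h n x - h (r j) x)\<^sup>2) \<partial>M) = ennreal ((nrm M (\<lambda>x. h n x - h (r j) x))\<^sup>2)"
        unfolding nrm_sq by (rule nn_integral_eq_integral) (use sq_int_sq[OF sq_int_diff[OF h h]] in auto)
      ultimately show ?thesis by (simp add: ennreal_leI)
    qed
    have "(\<integral>\<^sup>+x. ennreal ((h n x - y x)\<^sup>2) \<partial>M) \<le> (\<integral>\<^sup>+x. liminf (\<lambda>j. ennreal ((h n x - h (r j) x)\<^sup>2)) \<partial>M)"
    proof (rule nn_integral_mono_AE)
      show "AE x in M. ennreal ((h n x - y x)\<^sup>2) \<le> liminf (\<lambda>j. ennreal ((h n x - h (r j) x)\<^sup>2))"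
        using lim
      proof eventually_elim
        case (elim x)
        have "(\<lambda>j. ennreal ((h n x - h (r j) x)\<^sup>2)) \<longlonglongrightarrow> ennreal ((h n x - y x)\<^sup>2)"
          by (intro tendsto_ennrealI tendsto_intros elim) 
        from lim_imp_Liminf[OF _ this] show ?case by simp
      qed
    qed
    also have "\<dots> \<le> liminf (\<lambda>j. \<integral>\<^sup>+x. ennreal ((h n x - h (r j) x)\<^sup>2) \<partial>M)"
      by (rule nn_integral_liminf) auto
    also have "\<dots> \<le> liminf (\<lambda>j. ennreal (((1/2)^k)\<^sup>2))"
      by (rule Liminf_mono) (use A in \<open>auto simp: eventually_sequentially\<close>)
    also have "\<dots> = ennreal (((1/2)^k)\<^sup>2)" by (rule Liminf_const) simp
    finally have B: "(\<integral>\<^sup>+x. ennreal ((h n x - y x)\<^sup>2) \<partial>M) \<le> ennreal (((1/2)^k)\<^sup>2)" .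
    have I: "integrable M (\<lambda>x. (h n x - y x)\<^sup>2)"
      by (rule integrableI_nonneg) (use B in \<open>auto simp: less_top[symmetric] top_unique\<close>)
    have "ennreal ((nrm M (\<lambda>x. h n x - y x))\<^sup>2) \<le> ennreal (((1/2)^k)\<^sup>2)"
      unfolding nrm_sq using B by (subst nn_integral_eq_integral[symmetric, OF I]) auto
    then have "(nrm M (\<lambda>x. h n x - y x))\<^sup>2 \<le> ((1/2)^k)\<^sup>2" by (subst (asm) ennreal_le_iff) auto
    then have "nrm M (\<lambda>x. h n x - y x) \<le> (1/2)^k" by (rule power2_le_imp_le) simp
    with I show ?thesis by simp
  qed
  have "(\<lambda>x. h (N 0) x - y x) \<in> sq_int M" using main[of 0 "N 0"] by (intro sq_intI) auto
  from sq_int_diff[OF h[of "N 0"] this] have "y \<in> sq_int M" by simp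
  moreover have "(\<lambda>n. nrm M (\<lambda>x. h n x - y x)) \<longlonglongrightarrow> 0"
  proof (rule LIMSEQ_I)
    fix e :: real assume "e > 0"
    then obtain k where k: "(1/2)^k < e" using real_arch_pow_inv[of e "1/2"] by auto
    then show "\<exists>no. \<forall>n\<ge>no. norm (nrm M (\<lambda>x. h n x - y x) - 0) < e"
      using main by (intro exI[of _ "N k"]) (fastforce dest: le_less_trans)
  qed
  ultimately show ?thesis using that by blast
qed

text \<open>The quadratic functional |h|^2 - 2 l(h) is minimized over \<open>V\<close>; a minimizing
  sequence is Cauchy by the parallelogram law, and vanishing of the first variation at its limit
  \<open>x\<close> is the representation. \<open>V\<close> need not be closed, so \<open>x\<close>
  comes with a sequence in \<open>V\<close> converging to it; with this the lemma also yields
  orthogonal projections.\<close>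

lemma riesz_subspace:
  assumes V: "V \<subseteq> sq_int M" "(\<lambda>x. 0) \<in> V"
    and Vadd: "\<And>g h. g \<in> V \<Longrightarrow> h \<in> V \<Longrightarrow> (\<lambda>x. g x + h x) \<in> V"
    and Vscale: "\<And>c h. h \<in> V \<Longrightarrow> (\<lambda>x. c * h x) \<in> V"
    and ladd: "\<And>g h. g \<in> V \<Longrightarrow> h \<in> V \<Longrightarrow> l (\<lambda>x. g x + h x) = l g + l h"
    and lscale: "\<And>c h. h \<in> V \<Longrightarrow> l (\<lambda>x. c * h x) = c * l h"
    and lbd: "\<And>h. h \<in> V \<Longrightarrow> \<bar>l h\<bar> \<le> C * nrm M h"
  obtains x h where "x \<in> sq_int M" "\<And>n::nat. h n \<in> V" "(\<lambda>n. nrm M (\<lambda>y. h n y - x y)) \<longlonglongrightarrow> 0"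
    "\<And>g. g \<in> V \<Longrightarrow> l g = (LINT y|M. x y * g y)"
proof -
  define \<Phi> where "\<Phi> h = (nrm M h)\<^sup>2 - 2 * l h" for h
  have \<Phi>_lb: "\<Phi> h \<ge> - C\<^sup>2" if "h \<in> V" for h
  proof -
    have "0 \<le> (nrm M h - C)\<^sup>2" by simp
    then have "2 * (C * nrm M h) \<le> (nrm M h)\<^sup>2 + C\<^sup>2" by (simp add: power2_diff mult_ac)
    then show ?thesis using lbd[OF that] unfolding \<Phi>_def by linarith
  qed
  define m where "m = (INF h\<in>V. \<Phi> h)"
  have bdd: "bdd_below (\<Phi> ` V)" using \<Phi>_lb by (auto intro!: bdd_belowI2)
  have m_le: "m \<le> \<Phi> h" if "h \<in> V" for h
    unfolding m_def using bdd that by (rule cINF_lower)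
  have "\<exists>h\<in>V. \<Phi> h < m + 1 / real (Suc n)" for n
  proof (rule ccontr)
    assume "\<not> ?thesis"
    then have "m + 1 / real (Suc n) \<le> m" unfolding m_def
      using V(2) by (intro cINF_greatest) (auto simp: not_less m_def)
    then show False by simp
  qed
  then obtain h where hV: "\<And>n. h n \<in> V" and hm: "\<And>n. \<Phi> (h n) < m + 1 / real (Suc n)"
    by metis
  have hs: "h n \<in> sq_int M" for n using hV V(1) by blast
  have quad: "\<Phi> (\<lambda>x. f x + s * g x) = \<Phi> f + 2 * s * ((LINT y|M. f y * g y) - l g) + s\<^sup>2 * (nrm M g)\<^sup>2"
    if "f \<in> V" "g \<in> V" for f g s
    using integral_quad[of f M g s] that V(1) ladd[OF that(1) Vscale[OF that(2)]] lscale[OF that(2)]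
    unfolding \<Phi>_def nrm_sq by (auto simp: algebra_simps)
  \<comment> \<open>The parallelogram law, read off from the quadratic on the line through
    \<open>f\<close> and \<open>g\<close>: its value at 1 is known and its value at 1/2 is at least
    \<open>m\<close>.\<close>
  have par: "(nrm M (\<lambda>x. f x - g x))\<^sup>2 \<le> 2 * (\<Phi> f - m) + 2 * (\<Phi> g - m)" if "f \<in> V" "g \<in> V" for f g
  proof -
    have d: "(\<lambda>x. g x + (-1) * f x) \<in> V" by (intro Vadd Vscale that)
    have n2: "nrm M (\<lambda>x. f x - g x) = nrm M (\<lambda>x. g x + (-1) * f x)"
      by (simp add: nrm_minus_commute[of M f g])
    have "\<Phi> (\<lambda>x. f x + 1 * (g x + (-1) * f x)) = \<Phi> g" by simp
    moreover have "m \<le> \<Phi> (\<lambda>x. f x + (1/2) * (g x + (-1) * f x))"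
      by (intro m_le Vadd Vscale that)
    ultimately show ?thesis
      using quad[OF that(1) d, of 1] quad[OF that(1) d, of "1/2"] n2
      by (simp add: power2_eq_square)
  qed
  have arith: "X < E" if "X \<le> 2 * (p - m) + 2 * (q - m)" "p < m + u" "q < m + v" "u \<le> w" "v \<le> w" "w < E / 4"
    for X E p q u v w :: real
    using that by argo
  obtain x where x: "x \<in> sq_int M" "(\<lambda>n. nrm M (\<lambda>y. h n y - x y)) \<longlonglongrightarrow> 0"
  proof (rule sq_int_complete[of h])
    show "h n \<in> sq_int M" for n by (rule hs)
    fix e :: real assume "e > 0"
    then obtain N where N: "1 / real (Suc N) < e\<^sup>2 / 4"
      using reals_Archimedean[of "e\<^sup>2 / 4"] by (auto simp: inverse_eq_divide)
    have "nrm M (\<lambda>x. h a x - h b x) < e" if "a \<ge> N" "b \<ge> N" for a b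
    proof (rule power2_less_imp_less)
      have "1 / real (Suc a) \<le> 1 / real (Suc N)" "1 / real (Suc b) \<le> 1 / real (Suc N)"
        using that by (auto simp: field_simps)
      then show "(nrm M (\<lambda>x. h a x - h b x))\<^sup>2 < e\<^sup>2"
        using arith[OF par[OF hV hV, of a b] hm[of a] hm[of b]] N by blast
    qed (use \<open>e > 0\<close> in simp)
    then show "\<exists>N. \<forall>m\<ge>N. \<forall>n\<ge>N. nrm M (\<lambda>x. h m x - h n x) < e" by blast
  qed (rule that)
  have "l g = (LINT y|M. x y * g y)" if g: "g \<in> V" for g
  proof -
    let ?b = "(LINT y|M. x y * g y) - l g"
    have gs: "g \<in> sq_int M" using g V(1) by blast
    have lim: "(\<lambda>n. LINT y|M. h n y * g y) \<longlonglongrightarrow> (LINT y|M. x y * g y)"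
      by (rule ip_tendsto[OF hs x(1) gs x(2)])
    \<comment> \<open>The near-minimality of \<open>h n\<close> becomes exact minimality in the
      limit, so the constant term is 0 and the linear coefficient must vanish.\<close>
    have "0 \<le> 0 + 2 * s * ?b + s\<^sup>2 * (nrm M g)\<^sup>2" for s
    proof (rule LIMSEQ_le_const)
      show "(\<lambda>n. 1 / real (Suc n) + 2 * s * ((LINT y|M. h n y * g y) - l g) + s\<^sup>2 * (nrm M g)\<^sup>2)
          \<longlonglongrightarrow> 0 + 2 * s * ?b + s\<^sup>2 * (nrm M g)\<^sup>2"
        by (intro tendsto_intros lim LIMSEQ_Suc[OF lim_1_over_n])
      have "0 \<le> 1 / real (Suc n) + 2 * s * ((LINT y|M. h n y * g y) - l g) + s\<^sup>2 * (nrm M g)\<^sup>2" for n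
      proof -
        have "m \<le> \<Phi> (\<lambda>x. h n x + s * g x)" by (intro m_le Vadd Vscale g hV)
        then show ?thesis unfolding quad[OF hV g] using hm[of n] by linarith
      qed
      then show "\<exists>N. \<forall>n\<ge>N. 0 \<le> 1 / real (Suc n) + 2 * s * ((LINT y|M. h n y * g y) - l g) + s\<^sup>2 * (nrm M g)\<^sup>2"
        by blast
    qed
    then have "?b\<^sup>2 \<le> 0 * (nrm M g)\<^sup>2" by (rule quad_nonneg_discr)
    then show ?thesis by simp
  qed
  with x(1) hV x(2) show ?thesis by (rule that)
qed

lemma riesz:
  assumes "\<And>g h. g \<in> sq_int M \<Longrightarrow> h \<in> sq_int M \<Longrightarrow> l (\<lambda>x. g x + h x) = l g + l h"
    and "\<And>c h. h \<in> sq_int M \<Longrightarrow> l (\<lambda>x. c * h x) = c * l h"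
    and "\<And>h. h \<in> sq_int M \<Longrightarrow> \<bar>l h\<bar> \<le> C * nrm M h"
  obtains x where "x \<in> sq_int M" "\<And>g. g \<in> sq_int M \<Longrightarrow> l g = (LINT y|M. x y * g y)"
proof -
  obtain x and h :: "nat \<Rightarrow> 'a \<Rightarrow> real" where "x \<in> sq_int M" "\<And>g. g \<in> sq_int M \<Longrightarrow> l g = (LINT y|M. x y * g y)"
    by (rule riesz_subspace[of "sq_int M" l C, OF order_refl sq_int_zero sq_int_add sq_int_scale assms]) auto
  then show ?thesis by (rule that)
qed

text \<open>Represent the functional "inner product with \<open>f\<close>" on \<open>V\<close>: the
  representing function \<open>x\<close> is the projection of \<open>f\<close> onto the closure of
  \<open>V\<close>.\<close>

lemma projection:
  assumes V: "V \<subseteq> sq_int M" "(\<lambda>x. 0) \<in> V"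
    and Vadd: "\<And>g h. g \<in> V \<Longrightarrow> h \<in> V \<Longrightarrow> (\<lambda>x. g x + h x) \<in> V"
    and Vscale: "\<And>c h. h \<in> V \<Longrightarrow> (\<lambda>x. c * h x) \<in> V"
    and f: "f \<in> sq_int M"
  obtains x h where "x \<in> sq_int M" "\<And>n::nat. h n \<in> V" "(\<lambda>n. nrm M (\<lambda>y. h n y - x y)) \<longlonglongrightarrow> 0"
    "\<And>g. g \<in> V \<Longrightarrow> (LINT y|M. f y * g y) = (LINT y|M. x y * g y)"
proof -
  have ladd: "(LINT y|M. f y * (g y + h y)) = (LINT y|M. f y * g y) + (LINT y|M. f y * h y)" 
    if "g \<in> V" "h \<in> V" for g h
    using sq_int_mult[OF f] that V(1) by (simp add: distrib_left subset_iff)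
  have lscale: "(LINT y|M. f y * (c * h y)) = c * (LINT y|M. f y * h y)" for c h
    by (simp add: mult.left_commute)
  have lbd: "\<bar>LINT y|M. f y * h y\<bar> \<le> nrm M f * nrm M h" if "h \<in> V" for h
    using cauchy_schwarz[OF f] that V(1) by blast
  show ?thesis
    by (rule riesz_subspace[of V "\<lambda>g. LINT y|M. f y * g y" "nrm M f", OF V Vadd Vscale ladd lscale lbd])
      (assumption | rule that)+
qed

text \<open>The difference of \<open>f\<close> and its projection is orthogonal to \<open>V\<close>,
  hence zero. This converts uniqueness for the transport equation into density of the functions
  \<open>gen w \<phi>\<close>.\<close>

lemma orthogonal_trivial_dense:
  assumes V: "V \<subseteq> sq_int M" "(\<lambda>x. 0) \<in> V"
    and Vadd: "\<And>g h. g \<in> V \<Longrightarrow> h \<in> V \<Longrightarrow> (\<lambda>x. g x + h x) \<in> V"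
    and Vscale: "\<And>c h. h \<in> V \<Longrightarrow> (\<lambda>x. c * h x) \<in> V"
    and triv: "\<And>d. d \<in> sq_int M \<Longrightarrow> (\<And>g. g \<in> V \<Longrightarrow> (LINT y|M. d y * g y) = 0) \<Longrightarrow> AE y in M. d y = 0"
    and f: "f \<in> sq_int M"
  obtains h where "\<And>n::nat. h n \<in> V" "(\<lambda>n. nrm M (\<lambda>y. h n y - f y)) \<longlonglongrightarrow> 0"
proof -
  obtain x h where x: "x \<in> sq_int M" "\<And>n::nat. h n \<in> V" "(\<lambda>n. nrm M (\<lambda>y. h n y - x y)) \<longlonglongrightarrow> 0"
    and o: "\<And>g. g \<in> V \<Longrightarrow> (LINT y|M. f y * g y) = (LINT y|M. x y * g y)"
    by (rule projection[OF V Vadd Vscale f]) (assumption | blast)+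
  note [measurable] = sq_int_meas[OF x(1)] sq_int_meas[OF f]
  have hs: "h n \<in> sq_int M" for n using x(2) V(1) by blast
  note [measurable] = sq_int_meas[OF hs]
  have "AE y in M. f y - x y = 0"
  proof (rule triv)
    show "(\<lambda>y. f y - x y) \<in> sq_int M" by (intro sq_int_diff f x)
    show "(LINT y|M. (f y - x y) * g y) = 0" if "g \<in> V" for g
      using o[OF that] that V(1) f x(1) by (simp add: left_diff_distrib sq_int_mult subset_iff)
  qed
  then have "nrm M (\<lambda>y. h n y - f y) = nrm M (\<lambda>y. h n y - x y)" for n
    by (intro nrm_cong_AE) auto
  then have "(\<lambda>n. nrm M (\<lambda>y. h n y - f y)) \<longlonglongrightarrow> 0" using x(3) by simp
  with x(2) show ?thesis by (rule that)
qed

text \<open>Separability is replaced by the countable family \<open>f k\<close> itself: a diagonal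
  subsequence makes all inner products with the \<open>f k\<close> converge, then those with their
  closed span, and the component of a test function orthogonal to the span is invisible to the
  sequence. The limit functional is bounded, so it is represented by some \<open>x\<close>.\<close>

lemma weak_compact:
  fixes f :: "nat \<Rightarrow> 'a \<Rightarrow> real"
  assumes f: "\<And>n. f n \<in> sq_int M" and bd: "\<And>n. nrm M (f n) \<le> C"
  obtains r x where "strict_mono (r::nat\<Rightarrow>nat)" "x \<in> sq_int M"
    "\<And>h. h \<in> sq_int M \<Longrightarrow> (\<lambda>n. LINT y|M. f (r n) y * h y) \<longlonglongrightarrow> (LINT y|M. x y * h y)"
proof -
  have C0: "C \<ge> 0" using bd[of 0] nrm_nonneg[of M "f 0"] by linarith
  \<comment> \<open>The properties to be secured one after the other: convergence of the inner
    products with \<open>f k\<close>.\<close>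
  interpret subseqs "\<lambda>k s. convergent (\<lambda>n. LINT y|M. f (s n) y * f k y)"
  proof
    fix k and s :: "nat \<Rightarrow> nat" assume "strict_mono s"
    have "\<bar>LINT y|M. f (s n) y * f k y\<bar> \<le> C * C" for n
      using cauchy_schwarz[OF f f, of "s n" k] mult_mono[OF bd[of "s n"] bd[of k] C0] by simp
    then have "bounded (range (\<lambda>n. LINT y|M. f (s n) y * f k y))"
      by (auto simp: bounded_iff)
    then obtain l r where "strict_mono (r :: nat \<Rightarrow> nat)" "((\<lambda>n. LINT y|M. f (s n) y * f k y) \<circ> r) \<longlonglongrightarrow> l"
      using bounded_imp_convergent_subsequence by blast
    then show "\<exists>r'. strict_mono r' \<and> convergent (\<lambda>n. LINT y|M. f ((s \<circ> r') n) y * f k y)"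
      by (auto simp: o_def convergent_def)
  qed
  define r where "r = diagseq"
  have r: "strict_mono r" unfolding r_def by (rule subseq_diagseq)
  have conv: "convergent (\<lambda>n. LINT y|M. f (r n) y * f k y)" for k
  proof -
    \<comment> \<open>The diagonal sequence is a subsequence of the k-th one only after its first k
      + 1 entries, hence the shift.\<close>
    have "convergent (\<lambda>n. LINT y|M. f ((diagseq \<circ> (+) (Suc k)) n) y * f k y)"
    proof (rule diagseq_holds)
      fix s t :: "nat \<Rightarrow> nat" and j :: nat
      assume "strict_mono t" "convergent (\<lambda>n. LINT y|M. f (s n) y * f j y)"
      then show "convergent (\<lambda>n. LINT y|M. f ((s \<circ> t) n) y * f j y)"
        using convergent_subseq_convergent[of "\<lambda>n. LINT y|M. f (s n) y * f j y" t]
        by (simp add: o_def)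
    qed
    then have "convergent (\<lambda>n. LINT y|M. f (r (n + Suc k)) y * f k y)"
      by (simp add: r_def o_def add.commute)
    then show ?thesis using convergent_ignore_initial_segment[of "\<lambda>n. LINT y|M. f (r n) y * f k y" "Suc k"] by simp
  qed
  define V where "V = {g. \<exists>N c. g = (\<lambda>x. \<Sum>k<N. c k * f k x)}"
  have VI: "(\<lambda>x. \<Sum>k<N. c k * f k x) \<in> V" for N c unfolding V_def by auto
  have Vsq: "V \<subseteq> sq_int M" unfolding V_def by (auto intro!: sq_int_sum sq_int_scale f)
  have V0: "(\<lambda>x. 0) \<in> V" using VI[where N=0] by simp
  have Vscale: "(\<lambda>x. a * h x) \<in> V" if hV: "h \<in> V" for a h
  proof -
    obtain N c where "h = (\<lambda>x. \<Sum>k<N. c k * f k x)" using hV unfolding V_def by auto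
    then have "(\<lambda>x. a * h x) = (\<lambda>x. \<Sum>k<N. (a * c k) * f k x)" by (simp add: sum_distrib_left mult.assoc)
    then show ?thesis by (simp only: VI)
  qed
  have Vadd: "(\<lambda>x. g x + h x) \<in> V" if gh: "g \<in> V" "h \<in> V" for g h
  proof -
    obtain N c where g: "g = (\<lambda>x. \<Sum>k<N. c k * f k x)" using gh(1) unfolding V_def by auto
    obtain N' c' where h: "h = (\<lambda>x. \<Sum>k<N'. c' k * f k x)" using gh(2) unfolding V_def by auto
    have ext: "(\<Sum>k<n. a k * f k x) = (\<Sum>k<n+n'. (if k < n then a k else 0) * f k x)" for n n' a x
      by (rule sum.mono_neutral_cong_left) auto
    have "(\<lambda>x. g x + h x) = (\<lambda>x. \<Sum>k<N+N'. ((if k < N then c k else 0) + (if k < N' then c' k else 0)) * f k x)"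
      unfolding g h distrib_right sum.distrib 
      by (simp only: ext[where a=c and n=N and n'=N'] ext[where a=c' and n=N' and n'=N] add.commute[of N' N])
    then show ?thesis by (simp only: VI)
  qed
  have convV: "convergent (\<lambda>n. LINT y|M. f (r n) y * h y)" if hV: "h \<in> V" for h
  proof -
    obtain N c where h: "h = (\<lambda>x. \<Sum>k<N. c k * f k x)" using hV unfolding V_def by auto
    have "(LINT y|M. f (r n) y * h y) = (\<Sum>k<N. c k * (LINT y|M. f (r n) y * f k y))" for n
    proof -
      have "(LINT y|M. f (r n) y * h y) = (LINT y|M. (\<Sum>k<N. c k * (f (r n) y * f k y)))"
        unfolding h by (simp add: sum_distrib_left mult.left_commute)
      also have "\<dots> = (\<Sum>k<N. c k * (LINT y|M. f (r n) y * f k y))"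
        using sq_int_mult[OF f f] by simp
      finally show ?thesis .
    qed
    moreover have "convergent (\<lambda>n. \<Sum>k<N. c k * (LINT y|M. f (r n) y * f k y))"
      using conv by (intro convergent_sum convergent_mult convergent_const) auto
    ultimately show ?thesis by simp
  qed
  have convall: "convergent (\<lambda>n. LINT y|M. f (r n) y * h y)" if h: "h \<in> sq_int M" for h
  proof -
    obtain x g where x: "x \<in> sq_int M" "\<And>n::nat. g n \<in> V" "(\<lambda>n. nrm M (\<lambda>y. g n y - x y)) \<longlonglongrightarrow> 0"
      and o: "\<And>g. g \<in> V \<Longrightarrow> (LINT y|M. h y * g y) = (LINT y|M. x y * g y)"
      by (rule projection[OF Vsq V0 Vadd Vscale h]) (assumption | blast)+
    have gs: "g n \<in> sq_int M" for n using x(2) Vsq by blast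
    have fV: "f k \<in> V" for k
    proof -
      have "f k = (\<lambda>x. \<Sum>j<Suc k. (if j = k then 1 else 0) * f j x)" 
        by (rule ext) (auto intro!: sum.neutral)
      then show ?thesis by (simp only: VI)
    qed
    \<comment> \<open>Replacing \<open>h\<close> by its projection \<open>x\<close> changes no inner
      product, because every \<open>f (r n)\<close> lies in \<open>V\<close>.\<close>
    have eq: "(LINT y|M. f (r n) y * h y) = (LINT y|M. f (r n) y * x y)" for n
      using o[OF fV[of "r n"]] by (simp add: mult.commute)
    have "Cauchy (\<lambda>n. LINT y|M. f (r n) y * x y)"
    proof (rule metric_CauchyI)
      fix e :: real assume "e > 0"
      then have "e / (3 * (C + 1)) > 0" using C0 by simp
      from LIMSEQ_D[OF x(3) this] obtain k where k: "nrm M (\<lambda>y. g k y - x y) < e / (3 * (C + 1))"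
        by auto
      have close: "\<bar>(LINT y|M. f (r n) y * g k y) - (LINT y|M. f (r n) y * x y)\<bar> < e/3" for n
      proof -
        have "(LINT y|M. f (r n) y * g k y) - (LINT y|M. f (r n) y * x y) = (LINT y|M. f (r n) y * (g k y - x y))"
          using f gs x(1) by (simp add: right_diff_distrib sq_int_mult)
        then have "\<bar>(LINT y|M. f (r n) y * g k y) - (LINT y|M. f (r n) y * x y)\<bar> \<le> nrm M (f (r n)) * nrm M (\<lambda>y. g k y - x y)"
          using cauchy_schwarz[OF f sq_int_diff[OF gs x(1)]] by simp
        also have "\<dots> \<le> (C + 1) * nrm M (\<lambda>y. g k y - x y)"
          using bd[of "r n"] by (intro mult_right_mono) auto
        also have "\<dots> < (C + 1) * (e / (3 * (C + 1)))" using k C0 by (intro mult_strict_left_mono) auto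
        also have "\<dots> = e / 3" using C0 by (simp add: field_simps)
        finally show ?thesis .
      qed
      have "Cauchy (\<lambda>n. LINT y|M. f (r n) y * g k y)"
        using convV[OF x(2)] by (simp add: Cauchy_convergent_iff)
      from metric_CauchyD[OF this, of "e/3"] \<open>e > 0\<close>
      obtain N where N: "\<forall>m\<ge>N. \<forall>n\<ge>N. 
          dist (LINT y|M. f (r m) y * g k y) (LINT y|M. f (r n) y * g k y) < e/3"
        by auto
      have "dist (LINT y|M. f (r m) y * x y) (LINT y|M. f (r n) y * x y) < e" if "m \<ge> N" "n \<ge> N" for m n
        using N[rule_format, OF that] close[of m] close[of n] unfolding dist_real_def by linarith
      then show "\<exists>N. \<forall>m\<ge>N. \<forall>n\<ge>N. dist (LINT y|M. f (r m) y * x y) (LINT y|M. f (r n) y * x y) < e" by blast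
    qed
    then show ?thesis unfolding eq by (simp add: Cauchy_convergent_iff)
  qed
  define l where "l h = lim (\<lambda>n. LINT y|M. f (r n) y * h y)" for h
  have l: "(\<lambda>n. LINT y|M. f (r n) y * h y) \<longlonglongrightarrow> l h" if "h \<in> sq_int M" for h
    unfolding l_def using convall[OF that] by (simp add: convergent_LIMSEQ_iff)
  have ladd: "l (\<lambda>x. g x + h x) = l g + l h" if gh: "g \<in> sq_int M" "h \<in> sq_int M" for g h
  proof -
    have "(\<lambda>n. LINT y|M. f (r n) y * (g y + h y)) \<longlonglongrightarrow> l g + l h"
      using tendsto_add[OF l[OF gh(1)] l[OF gh(2)]] gh f by (simp add: distrib_left sq_int_mult)
    with l[OF sq_int_add[OF gh]] show ?thesis by (rule LIMSEQ_unique)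
  qed
  have lscale: "l (\<lambda>x. c * h x) = c * l h" if h: "h \<in> sq_int M" for c h
  proof -
    have "(\<lambda>n. LINT y|M. f (r n) y * (c * h y)) \<longlonglongrightarrow> c * l h"
      using tendsto_mult_left[OF l[OF h], of c] by (simp add: mult.left_commute)
    with l[OF sq_int_scale[OF h]] show ?thesis by (rule LIMSEQ_unique)
  qed
  have lbd: "\<bar>l h\<bar> \<le> C * nrm M h" if h: "h \<in> sq_int M" for h
  proof (rule LIMSEQ_le_const2[OF tendsto_rabs[OF l[OF h]]])
    have "\<bar>LINT y|M. f (r n) y * h y\<bar> \<le> C * nrm M h" for n
      using cauchy_schwarz[OF f h, of "r n"] mult_right_mono[OF bd[of "r n"], of "nrm M h"] by simp
    then show "\<exists>N. \<forall>n\<ge>N. \<bar>LINT y|M. f (r n) y * h y\<bar> \<le> C * nrm M h" by blast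
  qed
  obtain x where x: "x \<in> sq_int M" "\<And>g. g \<in> sq_int M \<Longrightarrow> l g = (LINT y|M. x y * g y)"
    by (rule riesz[OF ladd lscale lbd]) (assumption | blast)+
  have "(\<lambda>n. LINT y|M. f (r n) y * h y) \<longlonglongrightarrow> (LINT y|M. x y * h y)" if "h \<in> sq_int M" for h
    using l[OF that] x(2)[OF that] by simp
  with r x(1) show ?thesis by (rule that)
qed

end

section \<open>The unit interval and the unit square as probability spaces\<close>

lemma emeasure_unit_leb: "emeasure unit_leb (space unit_leb) = 1"
  by (simp add: space_restrict_space emeasure_restrict_space)

global_interpretation U: finite_measure unit_leb
  by standard (simp only: emeasure_unit_leb, simp)

lemma measure_unit_leb [simp]: "measure unit_leb {0<..<1} = 1"
  using emeasure_unit_leb by (simp add: measure_def)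

abbreviation unit_sq :: "(real \<times> real) measure" where
  "unit_sq \<equiv> unit_leb \<Otimes>\<^sub>M unit_leb"

global_interpretation UU: pair_sigma_finite unit_leb unit_leb ..

lemma emeasure_unit_sq: "emeasure unit_sq (space unit_sq) = 1"
proof -
  have "emeasure unit_sq (space unit_leb \<times> space unit_leb) = emeasure unit_leb (space unit_leb) * emeasure unit_leb (space unit_leb)"
    by (rule U.emeasure_pair_measure_Times) auto
  then show ?thesis using emeasure_unit_leb by (simp add: space_pair_measure)
qed

global_interpretation Q: finite_measure unit_sq
  by standard (simp only: emeasure_unit_sq, simp)

lemma meas_id [measurable]: "(\<lambda>x. x) \<in> borel_measurable unit_leb"
  by (rule measurable_restrict_space1) (rule measurable_completion, simp)

lemma meas_fst [measurable]: "fst \<in> borel_measurable unit_sq"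
  using measurable_compose[OF measurable_fst meas_id] by simp

lemma meas_snd [measurable]: "snd \<in> borel_measurable unit_sq"
  using measurable_compose[OF measurable_snd meas_id] by simp

lemma borel_imp_unit_leb: "f \<in> borel_measurable borel \<Longrightarrow> f \<in> borel_measurable unit_leb"
  using measurable_compose[OF meas_id] by blast

lemma cont_imp_unit_leb:
  fixes f :: "real \<Rightarrow> real"
  assumes "continuous_on {0..1} f" shows "f \<in> borel_measurable unit_leb"
  by (rule continuous_imp_measurable_on_sets_lebesgue[OF continuous_on_subset[OF assms]]) auto

lemma L2_eq_sq_int: "L2 = sq_int unit_leb"
  by (simp add: L2_def sq_int_def)

lemma L2_norm_eq_nrm: "L2_norm = nrm unit_leb"
  by (simp add: L2_norm_def nrm_def fun_eq_iff)

lemma cont_bounded_unit: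
  fixes f :: "real \<Rightarrow> real"
  assumes "continuous_on {0..1} f" 
  obtains C where "C \<ge> 0" "\<And>x. x \<in> {0..1} \<Longrightarrow> \<bar>f x\<bar> \<le> C"
proof -
  have "bounded (f ` {0..1})" using assms by (intro compact_imp_bounded compact_continuous_image) auto
  then obtain C where "\<forall>x\<in>{0..1}. \<bar>f x\<bar> \<le> C" unfolding bounded_iff by auto
  then have C: "\<bar>f x\<bar> \<le> C" if "x \<in> {0..1}" for x using that by blast
  moreover have "C \<ge> 0" using C[of 0] by auto
  ultimately show ?thesis using that by blast
qed

lemma cont_sq_int:
  fixes f :: "real \<Rightarrow> real"
  assumes "continuous_on {0..1} f" shows "f \<in> sq_int unit_leb"
proof -
  obtain C where "C \<ge> 0" "\<And>x. x \<in> {0..1} \<Longrightarrow> \<bar>f x\<bar> \<le> C" using cont_bounded_unit[OF assms] by blast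
  then show ?thesis
    by (intro U.sq_int_bounded[where C=C] cont_imp_unit_leb assms AE_I2) auto
qed

lemma poly_sq_int: "poly p \<in> sq_int unit_leb"
  by (intro cont_sq_int continuous_intros)

lemma nrm_le_const:
  assumes "f \<in> borel_measurable unit_leb" "AE x in unit_leb. \<bar>f x\<bar> \<le> C" "C \<ge> 0"
  shows "nrm unit_leb f \<le> C"
proof -
  have "(LINT x|unit_leb. (f x)\<^sup>2) \<le> (LINT x|unit_leb. C\<^sup>2)"
  proof (rule integral_mono_AE)
    show "integrable unit_leb (\<lambda>x. (f x)\<^sup>2)" using U.sq_int_bounded[OF assms(1,2)] by (rule sq_int_sq)
    show "AE x in unit_leb. (f x)\<^sup>2 \<le> C\<^sup>2" using assms(2) by eventually_elim (simp add: abs_le_square_iff[symmetric])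
  qed simp
  then show ?thesis using assms(3) unfolding nrm_def by (simp add: real_le_lsqrt)
qed

section \<open>Density of continuous functions and polynomials\<close>

lemma nrm_dominated:
  assumes "\<And>n. h n \<in> borel_measurable M" "x \<in> borel_measurable M" "g \<in> sq_int M"
    and "AE y in M. (\<lambda>n. h n y) \<longlonglongrightarrow> x y" and "\<And>n. AE y in M. \<bar>h n y - x y\<bar> \<le> g y"
  shows "(\<lambda>n. nrm M (\<lambda>y. h n y - x y)) \<longlonglongrightarrow> 0"
proof -
  note [measurable] = assms(1,2)
  have "(\<lambda>n. LINT y|M. (h n y - x y)\<^sup>2) \<longlonglongrightarrow> (LINT y|M. 0)"
  proof (rule integral_dominated_convergence[where w="\<lambda>y. (g y)\<^sup>2"])
    show "AE y in M. (\<lambda>n. (h n y - x y)\<^sup>2) \<longlonglongrightarrow> 0"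
      using assms(4)
    proof eventually_elim
      case (elim y)
      have "(\<lambda>n. (h n y - x y)\<^sup>2) \<longlonglongrightarrow> (x y - x y)\<^sup>2" by (intro tendsto_intros elim)
      then show ?case by simp
    qed
    show "AE y in M. norm ((h n y - x y)\<^sup>2) \<le> (g y)\<^sup>2" for n
      using assms(5)[of n] by eventually_elim (simp add: abs_le_square_iff[symmetric])
  qed (use assms in \<open>auto simp: sq_int_sq\<close>)
  from tendsto_real_sqrt[OF this] show ?thesis by (simp add: nrm_def)
qed

lemma clamp_dense:
  assumes u: "u \<in> sq_int M"
  shows "(\<lambda>n. nrm M (\<lambda>y. max (- real n) (min (real n) (u y)) - u y)) \<longlonglongrightarrow> 0"
proof (rule nrm_dominated[where g="\<lambda>y. \<bar>u y\<bar>"])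
  note [measurable] = sq_int_meas[OF u]
  show "(\<lambda>y. max (- real n) (min (real n) (u y))) \<in> borel_measurable M" for n by measurable
  show "(\<lambda>y. \<bar>u y\<bar>) \<in> sq_int M" using u by (auto simp: sq_int_def)
  show "AE y in M. (\<lambda>n. max (- real n) (min (real n) (u y))) \<longlonglongrightarrow> u y"
  proof (rule AE_I2)
    fix y
    obtain N where N: "\<bar>u y\<bar> \<le> real N" using real_arch_simple by blast
    have "\<forall>\<^sub>F n in sequentially. max (- real n) (min (real n) (u y)) = u y"
      using eventually_ge_at_top[of N]
    proof eventually_elim
      case (elim n)
      then have "real N \<le> real n" by simp
      then show ?case using N by (auto simp: max_def min_def)
    qed
    then show "(\<lambda>n. max (- real n) (min (real n) (u y))) \<longlonglongrightarrow> u y" by (rule tendsto_eventually)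
  qed
qed (use u in \<open>auto\<close>)

text \<open>The function is clamped at a level \<open>k\<close>, the continuous functions
  approximating the clamped one almost everywhere are clamped at the same level, and dominated
  convergence with the constant 2k applies.\<close>

lemma continuous_dense:
  assumes u: "u \<in> sq_int unit_leb" and e: "e > 0"
  obtains g where "continuous_on UNIV g" "nrm unit_leb (\<lambda>x. u x - g x) < e"
proof -
  obtain k where k: "nrm unit_leb (\<lambda>y. max (- real k) (min (real k) (u y)) - u y) < e / 2"
    using LIMSEQ_D[OF clamp_dense[OF u], of "e/2"] e by auto
  define b where "b y = max (- real k) (min (real k) (u y))" for y
  note [measurable] = sq_int_meas[OF u]
  have bm [measurable]: "b \<in> borel_measurable unit_leb" unfolding b_def by measurable
  \<comment> \<open>\<open>measurable_on\<close> asks precisely for almost everywhere approximation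
    by continuous functions, so this is the source of the approximants.\<close>
  have "b measurable_on {0<..<1}"
    using bm by (subst measurable_on_iff_borel_measurable) auto
  then obtain N g where N: "negligible N" and gc: "\<And>n. continuous_on UNIV (g n)"
    and gl: "\<And>x. x \<notin> N \<Longrightarrow> (\<lambda>n. g n x) \<longlonglongrightarrow> (if x \<in> {0<..<1} then b x else (0::real))"
    unfolding measurable_on_def by metis
  define h where "h n x = max (- real k) (min (real k) (g n x))" for n :: nat and x
  have hc: "continuous_on UNIV (h n)" for n unfolding h_def by (intro continuous_intros gc)
  have bs: "b \<in> sq_int unit_leb" by (rule U.sq_int_bounded[where C="real k"]) (auto simp: b_def)
  have hs: "h n \<in> sq_int unit_leb" for n using hc by (intro cont_sq_int) (auto intro: continuous_on_subset)
  have "(\<lambda>n. nrm unit_leb (\<lambda>y. h n y - b y)) \<longlonglongrightarrow> 0"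
  proof (rule nrm_dominated[where g="\<lambda>_. 2 * real k"])
    have "AE x in unit_leb. x \<notin> N"
    proof -
      have "N \<in> null_sets lebesgue" using N by (simp add: negligible_iff_null_sets)
      then have "AE x in lebesgue. x \<notin> N" by (rule AE_not_in)
      then show ?thesis by (subst AE_restrict_space_iff) auto
    qed
    then show "AE x in unit_leb. (\<lambda>n. h n x) \<longlonglongrightarrow> b x"
      using AE_space
    proof eventually_elim
      case (elim x)
      have bb: "b x = max (- real k) (min (real k) (b x))" by (simp add: b_def)
      have "(\<lambda>n. g n x) \<longlonglongrightarrow> b x" using gl[OF elim(1)] elim(2) by simp
      then have "(\<lambda>n. max (- real k) (min (real k) (g n x))) \<longlonglongrightarrow> max (- real k) (min (real k) (b x))"
        by (intro tendsto_intros)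
      then show ?case unfolding h_def using bb by simp
    qed
    show "AE y in unit_leb. \<bar>h n y - b y\<bar> \<le> 2 * real k" for n
    proof (rule AE_I2)
      fix y
      have "\<bar>h n y\<bar> \<le> real k" "\<bar>b y\<bar> \<le> real k" by (auto simp: h_def b_def)
      then show "\<bar>h n y - b y\<bar> \<le> 2 * real k" by linarith
    qed
  qed (use hs bs U.sq_int_const in \<open>auto\<close>)
  from LIMSEQ_D[OF this, of "e/2"] e obtain n where n: "nrm unit_leb (\<lambda>y. h n y - b y) < e/2" by auto
  have "nrm unit_leb (\<lambda>x. u x - h n x) \<le> nrm unit_leb (\<lambda>x. u x - b x) + nrm unit_leb (\<lambda>x. b x - h n x)"
    by (rule nrm_triangle_diff[OF u bs hs])
  also have "\<dots> < e"
    using k n nrm_minus_commute[of unit_leb u b] nrm_minus_commute[of unit_leb b "h n"] unfolding b_def by simp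
  finally show ?thesis using that hc by blast
qed

lemma Bernstein_poly: "\<exists>p. \<forall>x. Bernstein n k x = poly p x"
proof
  show "\<forall>x. Bernstein n k x = poly (smult (of_nat (n choose k)) ([:0,1:]^k * [:1,-1:]^(n-k))) x"
    by (simp add: Bernstein_def poly_power mult.assoc)
qed

text \<open>Bernstein polynomials approximate a continuous approximant uniformly, and on a space of
  measure 1 the uniform bound controls the norm.\<close>

lemma poly_dense:
  assumes u: "u \<in> sq_int unit_leb" and e: "e > 0"
  obtains p where "nrm unit_leb (\<lambda>x. u x - poly p x) < e"
proof -
  obtain g where g: "continuous_on UNIV g" "nrm unit_leb (\<lambda>x. u x - g x) < e/2"
    using continuous_dense[OF u, of "e/2"] e by auto
  have gs: "g \<in> sq_int unit_leb" using g(1) by (intro cont_sq_int) (auto intro: continuous_on_subset)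
  have "continuous_on {0..1} g" using g(1) by (rule continuous_on_subset) auto
  from Bernstein_Weierstrass[OF this, of "e/2"] e
  obtain N where N: "\<And>x. x \<in> {0..1} \<Longrightarrow> \<bar>g x - (\<Sum>k\<le>N. g (k/N) * Bernstein N k x)\<bar> < e/2"
    by (metis half_gt_zero order_refl)
  obtain B where B: "\<And>k x. Bernstein N k x = poly (B k) x" using Bernstein_poly by metis
  define p where "p = (\<Sum>k\<le>N. smult (g (k/N)) (B k))"
  have p: "poly p x = (\<Sum>k\<le>N. g (k/N) * Bernstein N k x)" for x
    unfolding p_def B poly_sum by simp
  have "nrm unit_leb (\<lambda>x. g x - poly p x) \<le> e/2"
  proof (rule nrm_le_const)
    show "AE x in unit_leb. \<bar>g x - poly p x\<bar> \<le> e/2"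
      by (rule AE_I2) (use N p in \<open>fastforce intro: less_imp_le\<close>)
  qed (use e gs poly_sq_int in auto)
  then have "nrm unit_leb (\<lambda>x. u x - poly p x) < e"
    using nrm_triangle_diff[OF u gs poly_sq_int, of p] g(2) by simp
  then show ?thesis by (rule that)
qed

text \<open>If \<open>u\<close> were nonzero, some \<open>p\<close> in \<open>V\<close> would
  satisfy |u - p| < |u|; but then |u|^2 = <u, u - p> < |u|^2. Applied to the polynomials and to the
  test functions.\<close>

lemma dense_orthogonal_zero:
  assumes u: "u \<in> sq_int M" and V: "V \<subseteq> sq_int M"
    and dense: "\<And>e. e > 0 \<Longrightarrow> \<exists>p\<in>V. nrm M (\<lambda>x. u x - p x) < e"
    and o: "\<And>p. p \<in> V \<Longrightarrow> (LINT x|M. u x * p x) = 0"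
  shows "AE x in M. u x = 0"
proof (rule nrm_zero_AE[OF u], rule ccontr)
  assume "nrm M u \<noteq> 0"
  then have pos: "nrm M u > 0" using nrm_nonneg[of M u] by linarith
  then obtain p where pV: "p \<in> V" and p: "nrm M (\<lambda>x. u x - p x) < nrm M u"
    using dense by blast
  have ps: "p \<in> sq_int M" using pV V by blast
  have "(nrm M u)\<^sup>2 = (LINT x|M. u x * (u x - p x))"
    using o[OF pV] sq_int_mult[OF u ps] sq_int_mult[OF u u]
    unfolding nrm_sq by (simp add: power2_eq_square right_diff_distrib)
  also have "\<dots> \<le> nrm M u * nrm M (\<lambda>x. u x - p x)"
    using cauchy_schwarz[OF u sq_int_diff[OF u ps]] by linarith
  also have "\<dots> < nrm M u * nrm M u" using p pos by (intro mult_strict_left_mono)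
  finally show False by (simp add: power2_eq_square)
qed

lemma poly_orthogonal_zero:
  assumes u: "u \<in> sq_int unit_leb" and o: "\<And>p. (LINT x|unit_leb. u x * poly p x) = 0"
  shows "AE x in unit_leb. u x = 0"
proof (rule dense_orthogonal_zero[OF u, of "range poly"])
  show "\<exists>p\<in>range poly. nrm unit_leb (\<lambda>x. u x - p x) < e" if "e > 0" for e
    using poly_dense[OF u that] by (metis rangeI)
qed (use o poly_sq_int in auto)

section \<open>Primitives\<close>

text \<open>The primitive vanishing at 0, written as an integral of a truncated function over the
  whole interval. It is thereby total on the real line and constant on either side of the interval,
  and Fubini and dominated convergence apply to it directly.\<close>

definition prim :: "(real \<Rightarrow> real) \<Rightarrow> real \<Rightarrow> real" where
  "prim g x = (LINT y|unit_leb. (if y < x then g y else 0))"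

lemma integrable_if_less:
  fixes g :: "real \<Rightarrow> real"
  assumes "integrable unit_leb g"
  shows "integrable unit_leb (\<lambda>y. if y < x then g y else 0)"
proof (rule Bochner_Integration.integrable_bound[OF assms])
  note [measurable] = borel_measurable_integrable[OF assms]
  show "(\<lambda>y. if y < x then g y else 0) \<in> borel_measurable unit_leb" by measurable
qed auto

lemma AE_unit_neq: "AE y in unit_leb. y \<noteq> (x::real)"
proof -
  have "AE y in lebesgue. y \<notin> {x}" by (rule AE_not_in) (simp add: null_sets_def)
  then show ?thesis by (subst AE_restrict_space_iff) auto
qed

lemma prim_0: "x \<le> 0 \<Longrightarrow> prim g x = 0"
  unfolding prim_def 
  by (subst Bochner_Integration.integral_cong[OF refl, of _ _ "\<lambda>_. 0"]) auto

lemma prim_1: "x \<ge> 1 \<Longrightarrow> prim g x = (LINT y|unit_leb. g y)"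
  unfolding prim_def by (rule Bochner_Integration.integral_cong) auto

lemma prim_add:
  assumes "integrable unit_leb f" "integrable unit_leb g"
  shows "prim (\<lambda>y. f y + g y) x = prim f x + prim g x"
proof -
  have "prim (\<lambda>y. f y + g y) x = (LINT y|unit_leb. (if y < x then f y else 0) + (if y < x then g y else 0))"
    unfolding prim_def by (rule Bochner_Integration.integral_cong) auto
  then show ?thesis using assms by (simp add: prim_def integrable_if_less)
qed

lemma prim_cmult: "prim (\<lambda>y. c * f y) x = c * prim f x"
proof -
  have "prim (\<lambda>y. c * f y) x = (LINT y|unit_leb. c * (if y < x then f y else 0))"
    unfolding prim_def by (rule Bochner_Integration.integral_cong) auto
  then show ?thesis by (simp add: prim_def)
qed

lemma prim_diff:
  assumes "integrable unit_leb f" "integrable unit_leb g"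
  shows "prim (\<lambda>y. f y - g y) x = prim f x - prim g x"
  using prim_add[OF assms(1), of "\<lambda>y. (-1) * g y" x] assms(2) prim_cmult[of "-1" g x] by simp

lemma prim_cong_AE:
  assumes "AE y in unit_leb. f y = g y" "f \<in> borel_measurable unit_leb" "g \<in> borel_measurable unit_leb"
  shows "prim f x = prim g x"
  unfolding prim_def
proof (rule integral_cong_AE)
  note [measurable] = assms(2,3)
  show "(\<lambda>y. if y < x then f y else 0) \<in> borel_measurable unit_leb" by measurable
  show "(\<lambda>y. if y < x then g y else 0) \<in> borel_measurable unit_leb" by measurable
  show "AE y in unit_leb. (if y < x then f y else 0) = (if y < x then g y else 0)"
    using assms(1) by eventually_elim auto
qed

lemma prim_abs_le:
  assumes "integrable unit_leb g"
  shows "\<bar>prim g x\<bar> \<le> prim (\<lambda>y. \<bar>g y\<bar>) x"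
proof -
  have "\<bar>prim g x\<bar> \<le> (LINT y|unit_leb. \<bar>(if y < x then g y else 0)\<bar>)"
    unfolding prim_def by (rule integral_abs_bound)
  also have "\<dots> = prim (\<lambda>y. \<bar>g y\<bar>) x"
    unfolding prim_def by (rule Bochner_Integration.integral_cong) auto
  finally show ?thesis .
qed

lemma prim_mono_nonneg:
  assumes "integrable unit_leb g" "\<And>y. y \<in> {0<..<1} \<Longrightarrow> 0 \<le> g y" "x \<le> x'"
  shows "prim g x \<le> prim g x'"
  unfolding prim_def by (intro integral_mono integrable_if_less) (use assms in auto)

lemma prim_bound:
  assumes "integrable unit_leb g"
  shows "\<bar>prim g x\<bar> \<le> (LINT y|unit_leb. \<bar>g y\<bar>)"
proof -
  have "prim (\<lambda>y. \<bar>g y\<bar>) x \<le> prim (\<lambda>y. \<bar>g y\<bar>) (max x 1)"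
    by (rule prim_mono_nonneg) (use assms in auto)
  then show ?thesis using prim_abs_le[OF assms, of x] prim_1[of "max x 1" "\<lambda>y. \<bar>g y\<bar>"] by simp
qed

text \<open>Dominated convergence: the truncated integrands converge except at the point
  \<open>x\<close>, which is a null set.\<close>

lemma prim_continuous:
  assumes g: "integrable unit_leb g"
  shows "continuous_on S (prim g)"
proof -
  note [measurable] = borel_measurable_integrable[OF g]
  have "isCont (prim g) x" for x
    unfolding continuous_at_sequentially o_def
  proof (intro allI impI)
    fix u :: "nat \<Rightarrow> real" assume u: "u \<longlonglongrightarrow> x"
    show "(\<lambda>n. prim g (u n)) \<longlonglongrightarrow> prim g x"
      unfolding prim_def
    proof (rule integral_dominated_convergence[where w="\<lambda>y. \<bar>g y\<bar>"])
      show "AE y in unit_leb. (\<lambda>n. if y < u n then g y else 0) \<longlonglongrightarrow> (if y < x then g y else 0)"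
        using AE_unit_neq[of x]
      proof eventually_elim
        case (elim y)
        show ?case
        proof (cases "y < x")
          case True
          have "\<forall>\<^sub>F n in sequentially. y < u n" using order_tendstoD(1)[OF u True] .
          then have "\<forall>\<^sub>F n in sequentially. (if y < u n then g y else 0) = g y" by eventually_elim simp
          then show ?thesis using True by (simp add: tendsto_eventually)
        next
          case False
          then have "x < y" using elim by simp
          from order_tendstoD(2)[OF u this]
          have "\<forall>\<^sub>F n in sequentially. (if y < u n then g y else 0) = 0" by eventually_elim simp
          then show ?thesis using False by (simp add: tendsto_eventually)
        qed
      qed
    qed (use g in auto)
  qed
  then show ?thesis by (simp add: continuous_at_imp_continuous_on)
qed

lemma prim_borel: "integrable unit_leb g \<Longrightarrow> prim g \<in> borel_measurable borel"
  by (rule borel_measurable_continuous_onI) (rule prim_continuous)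

lemma prim_meas: "integrable unit_leb g \<Longrightarrow> prim g \<in> borel_measurable unit_leb"
  by (rule borel_imp_unit_leb) (rule prim_borel)

lemma prim_sq_int: "integrable unit_leb g \<Longrightarrow> prim g \<in> sq_int unit_leb"
  by (intro cont_sq_int prim_continuous)

lemma integrable_mult_prim:
  fixes f g :: "real \<Rightarrow> real"
  assumes "integrable unit_leb f" "integrable unit_leb g"
  shows "integrable unit_leb (\<lambda>x. f x * prim g x)"
proof (rule Bochner_Integration.integrable_bound)
  show "integrable unit_leb (\<lambda>x. (LINT y|unit_leb. \<bar>g y\<bar>) * f x)" using assms(1) by simp
  note [measurable] = borel_measurable_integrable[OF assms(1)] prim_meas[OF assms(2)]
  show "(\<lambda>x. f x * prim g x) \<in> borel_measurable unit_leb" by measurable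
  have "\<bar>f x\<bar> * \<bar>prim g x\<bar> \<le> (LINT y|unit_leb. \<bar>g y\<bar>) * \<bar>f x\<bar>" for x
    using mult_left_mono[OF prim_bound[OF assms(2), of x], of "\<bar>f x\<bar>"] by (simp add: mult.commute)
  then show "AE x in unit_leb. norm (f x * prim g x) \<le> norm ((LINT y|unit_leb. \<bar>g y\<bar>) * f x)"
    by (intro AE_I2) (simp add: abs_mult)
qed

lemma integrable_tensor:
  fixes f g :: "real \<Rightarrow> real"
  assumes "integrable unit_leb f" "integrable unit_leb g"
  shows "integrable unit_sq (\<lambda>(x, y). f x * g y)"
proof -
  note [measurable] = borel_measurable_integrable[OF assms(1)] borel_measurable_integrable[OF assms(2)]
  have "integrable unit_leb (\<lambda>x. \<bar>f x\<bar> * (LINT y|unit_leb. \<bar>g y\<bar>))" using assms by simp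
  then show ?thesis
    by (intro UU.Fubini_integrable) (use assms in \<open>auto simp: abs_mult\<close>)
qed

text \<open>Fubini on the two triangles of the square.\<close>

lemma prim_by_parts_full:
  assumes f: "integrable unit_leb f" and g: "integrable unit_leb g"
  shows "(LINT x|unit_leb. f x * prim g x) + (LINT x|unit_leb. prim f x * g x) = 
    (LINT x|unit_leb. f x) * (LINT x|unit_leb. g x)"
proof -
  note [measurable] = borel_measurable_integrable[OF f] borel_measurable_integrable[OF g]
  have T: "integrable unit_sq (\<lambda>(x, y). f x * g y)" by (rule integrable_tensor[OF f g])
  have A: "integrable unit_sq (\<lambda>(x, y). if y < x then f x * g y else 0)"
    by (rule Bochner_Integration.integrable_bound[OF T]) auto
  have B: "integrable unit_sq (\<lambda>(x, y). if x < y then f x * g y else 0)"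
    by (rule Bochner_Integration.integrable_bound[OF T]) auto
  have 1: "(LINT x|unit_leb. f x * prim g x) = (LINT (x, y)|unit_sq. (if y < x then f x * g y else 0))"
  proof -
    have "f x * prim g x = (LINT y|unit_leb. (if y < x then f x * g y else 0))" for x
    proof -
      have "f x * prim g x = (LINT y|unit_leb. f x * (if y < x then g y else 0))"
        by (simp add: prim_def)
      also have "\<dots> = (LINT y|unit_leb. (if y < x then f x * g y else 0))"
        by (rule Bochner_Integration.integral_cong) auto
      finally show ?thesis .
    qed
    then show ?thesis using UU.integral_fst'[OF A] by simp
  qed
  have 2: "(LINT x|unit_leb. prim f x * g x) = (LINT (x, y)|unit_sq. (if x < y then f x * g y else 0))"
  proof -
    have "prim f y * g y = (LINT x|unit_leb. (if x < y then f x * g y else 0))" for y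
    proof -
      have "prim f y * g y = (LINT x|unit_leb. (if x < y then f x else 0) * g y)"
        by (simp add: prim_def)
      also have "\<dots> = (LINT x|unit_leb. (if x < y then f x * g y else 0))"
        by (rule Bochner_Integration.integral_cong) auto
      finally show ?thesis .
    qed
    then show ?thesis using UU.integral_snd[of "\<lambda>x y. if x < y then f x * g y else 0"] B by simp
  qed
  have "(LINT x|unit_leb. f x) * (LINT x|unit_leb. g x) = (LINT x|unit_leb. LINT y|unit_leb. f x * g y)"
    by simp
  \<comment> \<open>The two triangles exhaust the square up to the diagonal, which meets each slice
    in one point.\<close>
  also have "\<dots> = (LINT x|unit_leb. LINT y|unit_leb. (if y < x then f x * g y else 0) + (if x < y then f x * g y else 0))"
  proof (rule Bochner_Integration.integral_cong[OF refl], rule integral_cong_AE)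
    fix x
    show "AE y in unit_leb. f x * g y = (if y < x then f x * g y else 0) + (if x < y then f x * g y else 0)"
      using AE_unit_neq[of x] by eventually_elim auto
  qed auto
  also have "\<dots> = (LINT (x, y)|unit_sq. (if y < x then f x * g y else 0) + (if x < y then f x * g y else 0))"
    using UU.integral_fst'[OF Bochner_Integration.integrable_add[OF A B]] by (simp add: case_prod_unfold cong: if_cong)
  also have "\<dots> = (LINT (x, y)|unit_sq. (if y < x then f x * g y else 0)) + (LINT (x, y)|unit_sq. (if x < y then f x * g y else 0))"
    using Bochner_Integration.integral_add[OF A B] by (simp add: case_prod_unfold cong: if_cong)
  finally show ?thesis using 1 2 by simp
qed

lemma prim_trunc: "prim (\<lambda>y. if y < x then g y else 0) z = prim g (min x z)"
  unfolding prim_def by (rule Bochner_Integration.integral_cong) auto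

text \<open>The product rule in integrated form, valid for merely integrable \<open>f\<close> and
  \<open>g\<close>: it is integration by parts on the full interval for the two functions cut off at
  \<open>x\<close>.\<close>

lemma prim_product:
  assumes f: "integrable unit_leb f" and g: "integrable unit_leb g"
  shows "prim f x * prim g x = prim (\<lambda>y. f y * prim g y + prim f y * g y) x"
proof -
  let ?f = "\<lambda>y. if y < x then f y else 0" and ?g = "\<lambda>y. if y < x then g y else 0"
  have "(LINT y|unit_leb. ?f y * prim ?g y) + (LINT y|unit_leb. prim ?f y * ?g y) = prim f x * prim g x"
    using prim_by_parts_full[OF integrable_if_less[OF f, of x] integrable_if_less[OF g, of x]] 
    by (simp add: prim_def)
  moreover have "(LINT y|unit_leb. ?f y * prim ?g y) = prim (\<lambda>y. f y * prim g y) x"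
    unfolding prim_trunc by (subst (2) prim_def) (auto intro!: Bochner_Integration.integral_cong)
  moreover have "(LINT y|unit_leb. prim ?f y * ?g y) = prim (\<lambda>y. prim f y * g y) x"
    unfolding prim_trunc by (subst (2) prim_def) (auto intro!: Bochner_Integration.integral_cong)
  ultimately show ?thesis
    using prim_add[OF integrable_mult_prim[OF f g], of "\<lambda>y. prim f y * g y" x] integrable_mult_prim[OF g f]
    by (simp add: mult.commute)
qed

text \<open>The library theorem is about \<open>lborel\<close> and closed intervals,
  \<open>prim\<close> about completed Lebesgue measure on the open one; the proof matches the two.
  Derivatives at the end points are one-sided, as they are for test functions on the closed
  square.\<close>

lemma prim_FTC:
  assumes d: "\<And>x. x \<in> {0..1} \<Longrightarrow> (F has_real_derivative f x) (at x within {0..1})"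
    and c: "continuous_on {0..1} f" and x: "x \<in> {0..1}"
  shows "prim f x = F x - F 0"
proof -
  have "(LINT y|lborel. indicator {0..x} y *\<^sub>R f y) = F x - F 0"
  proof (rule integral_FTC_atLeastAtMost)
    show "(F has_vector_derivative f y) (at y within {0..x})" if "0 \<le> y" "y \<le> x" for y
      unfolding has_real_derivative_iff_has_vector_derivative[symmetric]
      by (rule DERIV_subset[OF d]) (use that x in auto)
    show "continuous_on {0..x} f" by (rule continuous_on_subset[OF c]) (use x in auto)
  qed (use x in auto)
  moreover have "prim f x = (LINT y|lebesgue. indicator {0..x} y *\<^sub>R f y)"
  proof -
    have "prim f x = (LINT y|lebesgue. indicator {0<..<1} y *\<^sub>R (if y < x then f y else 0))"
      unfolding prim_def by (subst integral_restrict_space) auto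
    also have "\<dots> = (LINT y|lebesgue. indicator {0..x} y *\<^sub>R f y)"
    proof (rule integral_cong_AE)
      \<comment> \<open>Continuity of \<open>f\<close> is known on the closed interval only;
        extension by zero makes it measurable on the line.\<close>
      define h where "h y = indicator {0..1} y *\<^sub>R f y" for y
      have [measurable]: "h \<in> borel_measurable lebesgue"
        unfolding h_def using borel_measurable_continuous_on_indicator[OF _ c] by (simp add: measurable_completion)
      have [measurable]: "(\<lambda>y::real. y) \<in> borel_measurable lebesgue"
        by (rule measurable_completion) simp
      have "(\<lambda>y. indicator {0<..<1} y *\<^sub>R (if y < x then f y else 0)) = 
        (\<lambda>y. if 0 < y \<and> y < x then h y else 0)"
        using x by (auto simp: fun_eq_iff indicator_def h_def)
      moreover have "(\<lambda>y. if 0 < y \<and> y < x then h y else 0) \<in> borel_measurable lebesgue"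
        by measurable
      ultimately show "(\<lambda>y. indicator {0<..<1} y *\<^sub>R (if y < x then f y else 0)) \<in> borel_measurable lebesgue"
        by simp
      have "(\<lambda>y. indicator {0..x} y *\<^sub>R f y) = (\<lambda>y. if 0 \<le> y \<and> y \<le> x then h y else 0)"
        using x by (auto simp: fun_eq_iff indicator_def h_def)
      moreover have "(\<lambda>y. if 0 \<le> y \<and> y \<le> x then h y else 0) \<in> borel_measurable lebesgue"
        by measurable
      ultimately show "(\<lambda>y. indicator {0..x} y *\<^sub>R f y) \<in> borel_measurable lebesgue"
        by simp
      have "AE y in lebesgue. y \<notin> {0, x}" 
        by (rule AE_not_in) (simp add: null_sets_def emeasure_lborel_countable)
      then show "AE y in lebesgue. indicator {0<..<1} y *\<^sub>R (if y < x then f y else 0) = indicator {0..x} y *\<^sub>R f y"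
        by eventually_elim (use x in \<open>auto simp: indicator_def\<close>)
    qed
    finally show ?thesis .
  qed
  moreover have "(LINT y|lebesgue. indicator {0..x} y *\<^sub>R f y) = (LINT y|lborel. indicator {0..x} y *\<^sub>R f y)"
    using borel_measurable_continuous_on_indicator[OF _ continuous_on_subset[OF c], of "{0..x}"] x
    by (intro integral_completion) auto
  ultimately show ?thesis by simp
qed

section \<open>Test functions\<close>

definition smooth :: "(real \<Rightarrow> real) \<Rightarrow> bool" where
  "smooth f \<longleftrightarrow> (\<forall>n x. ((deriv ^^ n) f) differentiable (at x))"

text \<open>Membership in a set of differentiable functions that is stable under
  \<open>deriv\<close> replaces explicit formulas for higher derivatives.\<close>

lemma smooth_coinduct:
  assumes "f \<in> S" "\<And>g x. g \<in> S \<Longrightarrow> g differentiable (at x)" "\<And>g. g \<in> S \<Longrightarrow> deriv g \<in> S"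
  shows "smooth f"
proof -
  have "(deriv ^^ n) f \<in> S" for n
    by (induction n) (use assms in auto)
  then show ?thesis using assms(2) unfolding smooth_def by blast
qed

lemma smooth_deriv: "smooth f \<Longrightarrow> smooth (deriv f)"
  unfolding smooth_def by (metis comp_apply funpow_Suc_right)

lemma smooth_DERIV: 
  assumes "smooth f" shows "(f has_real_derivative deriv f x) (at x)"
proof -
  have "f differentiable (at x)" using assms unfolding smooth_def by (metis funpow_0)
  then show ?thesis using DERIV_deriv_iff_real_differentiable by blast
qed

lemma smooth_continuous: "smooth f \<Longrightarrow> continuous_on S f"
  by (meson DERIV_isCont continuous_at_imp_continuous_on smooth_DERIV)

text \<open>Closing the smooth functions under sums and products gives a set that the product rule
  maps into itself, so products are smooth without Leibniz's formula.\<close>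

inductive_set smooth_alg :: "(real \<Rightarrow> real) set" where
  base: "smooth f \<Longrightarrow> f \<in> smooth_alg"
| add: "f \<in> smooth_alg \<Longrightarrow> g \<in> smooth_alg \<Longrightarrow> (\<lambda>x. f x + g x) \<in> smooth_alg"
| mult: "f \<in> smooth_alg \<Longrightarrow> g \<in> smooth_alg \<Longrightarrow> (\<lambda>x. f x * g x) \<in> smooth_alg"

lemma smooth_alg_deriv:
  assumes "f \<in> smooth_alg"
  shows "\<exists>f'\<in>smooth_alg. \<forall>x. (f has_real_derivative f' x) (at x)"
  using assms
proof induction
  case (base f)
  then show ?case using smooth_DERIV smooth_deriv smooth_alg.base by blast
next
  case (add f g)
  then obtain f' g' where "f' \<in> smooth_alg" "g' \<in> smooth_alg" 
    "\<And>x. (f has_real_derivative f' x) (at x)" "\<And>x. (g has_real_derivative g' x) (at x)" by blast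
  then show ?case by (intro bexI[of _ "\<lambda>x. f' x + g' x"] smooth_alg.add allI DERIV_add)
next
  case (mult f g)
  then obtain f' g' where f': "f' \<in> smooth_alg" "g' \<in> smooth_alg" 
    "\<And>x. (f has_real_derivative f' x) (at x)" "\<And>x. (g has_real_derivative g' x) (at x)" by blast
  have "((\<lambda>x. f x * g x) has_real_derivative (f' x * g x + g' x * f x)) (at x)" for x
    by (intro DERIV_mult f')
  moreover have "(\<lambda>x. f' x * g x + g' x * f x) \<in> smooth_alg"
    by (intro smooth_alg.add smooth_alg.mult f' mult.hyps)
  ultimately show ?case by (intro bexI[of _ "\<lambda>x. f' x * g x + g' x * f x"]) auto
qed

lemma smooth_algD: "f \<in> smooth_alg \<Longrightarrow> smooth f"
proof (rule smooth_coinduct[of f smooth_alg])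
  fix g x assume "g \<in> smooth_alg"
  then obtain g' where g': "g' \<in> smooth_alg" "\<And>x. (g has_real_derivative g' x) (at x)"
    using smooth_alg_deriv by blast
  then show "g differentiable (at x)" using real_differentiable_def by blast
next
  fix g assume "g \<in> smooth_alg"
  then obtain g' where g': "g' \<in> smooth_alg" "\<And>x. (g has_real_derivative g' x) (at x)"
    using smooth_alg_deriv by blast
  then have "deriv g = g'" using DERIV_imp_deriv by blast
  then show "deriv g \<in> smooth_alg" using g' by simp
qed

lemma smooth_add: "smooth f \<Longrightarrow> smooth g \<Longrightarrow> smooth (\<lambda>x. f x + g x)"
  by (rule smooth_algD, rule smooth_alg.add) (rule smooth_alg.base, assumption)+

lemma smooth_mult: "smooth f \<Longrightarrow> smooth g \<Longrightarrow> smooth (\<lambda>x. f x * g x)"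
  by (rule smooth_algD, rule smooth_alg.mult) (rule smooth_alg.base, assumption)+

lemma smooth_poly: "smooth (poly p)"
proof (rule smooth_coinduct[of _ "range poly"])
  fix g x assume "g \<in> range (poly :: real poly \<Rightarrow> _)"
  then obtain q where q: "g = poly q" by blast
  show "g differentiable (at x)" unfolding q by (rule poly_differentiable)
  show "deriv g \<in> range poly" 
    unfolding q by (rule range_eqI[of _ _ "pderiv q"]) (auto simp: fun_eq_iff intro: DERIV_imp_deriv poly_DERIV)
qed auto

lemma smooth_const: "smooth (\<lambda>x. c)"
proof -
  have "poly [:c:] = (\<lambda>x. c)" by (rule ext) simp
  then show ?thesis using smooth_poly[of "[:c:]"] by simp
qed

lemma smooth_antideriv:
  assumes "\<And>x. (f has_real_derivative g x) (at x)" "smooth g"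
  shows "smooth f"
proof (rule smooth_coinduct[of f "insert f {h. smooth h}"])
  have "deriv f = g" using assms(1) DERIV_imp_deriv by blast
  then show "deriv h \<in> insert f {h. smooth h}" if "h \<in> insert f {h. smooth h}" for h
    using that assms(2) smooth_deriv by auto
  show "h differentiable (at x)" if "h \<in> insert f {h. smooth h}" for h x
    using that assms(1) smooth_DERIV real_differentiable_def by blast
qed auto

lemma smooth_affine:
  assumes "smooth f" shows "smooth (\<lambda>x. f (a + b * x))"
\<comment> \<open>The free factor \<open>c\<close> absorbs the powers of \<open>b\<close> that the
  chain rule produces.\<close>
proof (rule smooth_coinduct[of _ "{\<lambda>x. c * g (a + b * x) |c g. smooth g}"])
  show "(\<lambda>x. f (a + b * x)) \<in> {\<lambda>x. c * g (a + b * x) |c g. smooth g}"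
    using assms by (auto intro!: exI[of _ 1] exI[of _ f])
  have D: "((\<lambda>x. c * g (a + b * x)) has_real_derivative ((c * b) * deriv g (a + b * x))) (at x)" 
    if "smooth g" for c g x
  proof -
    have "((\<lambda>x. g (a + b * x)) has_real_derivative (deriv g (a + b * x) * b)) (at x)"
      by (rule DERIV_chain2[OF smooth_DERIV[OF that]]) (auto intro!: derivative_eq_intros)
    from DERIV_cmult[OF this, of c] show ?thesis by (simp add: mult_ac)
  qed
  fix h assume "h \<in> {\<lambda>x. c * g (a + b * x) |c g. smooth g}"
  then obtain c g where h: "h = (\<lambda>x. c * g (a + b * x))" "smooth g" by blast
  show "h differentiable (at x)" for x using D[OF h(2)] h(1) real_differentiable_def by blast
  have "deriv h = (\<lambda>x. (c * b) * deriv g (a + b * x))" unfolding h(1) using D[OF h(2)] DERIV_imp_deriv by blast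
  then show "deriv h \<in> {\<lambda>x. c * g (a + b * x) |c g. smooth g}" using smooth_deriv[OF h(2)] by blast
qed

section \<open>Smooth functions of compact support\<close>

text \<open>The classical exp(-1/x), extended by zero, with a polynomial factor in 1/x; the factor
  makes the family stable under differentiation.\<close>

definition flat :: "real poly \<Rightarrow> real \<Rightarrow> real" where
  "flat p x = (if x > 0 then poly p (1/x) * exp (- (1/x)) else 0)"

lemma poly_exp_tendsto_0: "((\<lambda>x. poly p x * exp (- x)) \<longlongrightarrow> (0::real)) at_top"
proof -
  have "((\<lambda>x::real. \<Sum>i\<le>degree p. coeff p i * (x ^ i / exp x)) \<longlongrightarrow> (\<Sum>i\<le>degree p. coeff p i * 0)) at_top"
    by (intro tendsto_intros tendsto_power_div_exp_0)
  moreover have "(\<Sum>i\<le>degree p. coeff p i * (x ^ i / exp x)) = poly p x * exp (- x)" for x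
    by (simp add: poly_altdef sum_distrib_right exp_minus divide_inverse mult.assoc)
  ultimately show ?thesis by simp
qed

text \<open>With y = 1/x, differentiating p(y) exp(-y) gives y^2 (p(y) - p'(y)) exp(-y), whence the
  polynomial factor \<open>[:0,0,1:]\<close>. At 0 the exponential beats every power.\<close>

lemma flat_deriv:
  "(flat p has_real_derivative flat ([:0,0,1:] * (p - pderiv p)) x) (at x)"
proof -
  consider "x > 0" | "x < 0" | "x = 0" by linarith
  then show ?thesis
  proof cases
    case 1
    have "((\<lambda>x. poly p (1/x) * exp (- (1/x))) has_real_derivative 
        (poly (pderiv p) (1/x) * (- 1/x^2)) * exp (- (1/x)) + (exp (- (1/x)) * (1/x^2)) * poly p (1/x)) (at x)"
      using 1 by (auto intro!: derivative_eq_intros DERIV_chain2[OF poly_DERIV] simp: power2_eq_square field_simps)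
    moreover have "(poly (pderiv p) (1/x) * (- 1/x^2)) * exp (- (1/x)) + (exp (- (1/x)) * (1/x^2)) * poly p (1/x)
        = flat ([:0,0,1:] * (p - pderiv p)) x"
      using 1 by (simp add: flat_def field_simps power2_eq_square)
    ultimately have "((\<lambda>x. poly p (1/x) * exp (- (1/x))) has_real_derivative flat ([:0,0,1:] * (p - pderiv p)) x) (at x)"
      by simp
    then show ?thesis
      by (rule has_field_derivative_transform_within_open[of _ _ _ "{0<..}"]) (use 1 in \<open>auto simp: flat_def\<close>)
  next
    case 2
    have "((\<lambda>x. 0) has_real_derivative 0) (at x)" by simp
    then have "(flat p has_real_derivative 0) (at x)"
      by (rule has_field_derivative_transform_within_open[of _ _ _ "{..<0}"]) (use 2 in \<open>auto simp: flat_def\<close>)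
    then show ?thesis using 2 by (simp add: flat_def)
  next
    case 3
    have R: "((\<lambda>h. flat p h / h) \<longlongrightarrow> 0) (at_right 0)"
    \<comment> \<open>The difference quotient at 0 is y p(y) exp(-y) with y = 1/h tending to
      infinity; \<open>pCons 0 p\<close> is y p(y).\<close>
    proof (rule filterlim_compose[of _ _ _ "inverse", THEN tendsto_cong[THEN iffD1, rotated]])
      show "((\<lambda>y. poly (pCons 0 p) y * exp (- y)) \<longlongrightarrow> 0) at_top" by (rule poly_exp_tendsto_0)
      show "filterlim inverse at_top (at_right (0::real))" by (rule filterlim_inverse_at_top_right)
      show "\<forall>\<^sub>F x in at_right 0. poly (pCons 0 p) (inverse x) * exp (- inverse x) = flat p x / x"
        using eventually_at_right_less[of "0::real"] by eventually_elim (simp add: flat_def field_simps)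
    qed
    have L: "((\<lambda>h. flat p h / h) \<longlongrightarrow> 0) (at_left 0)"
    proof (rule tendsto_eventually)
      show "\<forall>\<^sub>F x in at_left 0. flat p x / x = 0"
        by (auto simp: flat_def eventually_at_filter)
    qed
    have "((\<lambda>h. flat p h / h) \<longlongrightarrow> 0) (at 0)" using L R by (simp add: filterlim_split_at)
    then show ?thesis using 3 by (simp add: DERIV_def flat_def)
  qed
qed

lemma smooth_flat: "smooth (flat p)"
proof (rule smooth_coinduct[of _ "range flat"])
  fix g x assume "g \<in> range flat"
  then obtain q where q: "g = flat q" by blast
  show "g differentiable (at x)" unfolding q using flat_deriv real_differentiable_def by blast
  have "deriv (flat q) = flat ([:0,0,1:] * (q - pderiv q))"
    using flat_deriv DERIV_imp_deriv by blast
  then show "deriv g \<in> range flat" unfolding q by blast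
qed auto

definition bump :: "real \<Rightarrow> real \<Rightarrow> real" where
  "bump a x = flat 1 (x - a) * flat 1 (1 - a - x)"

lemma smooth_bump: "smooth (bump a)"
  unfolding bump_def 
  using smooth_affine[OF smooth_flat, of 1 "-a" 1] smooth_affine[OF smooth_flat, of 1 "1 - a" "-1"]
  by (intro smooth_mult) (simp_all add: algebra_simps)

lemma bump_pos: "a < x \<Longrightarrow> x < 1 - a \<Longrightarrow> bump a x > 0"
  by (simp add: bump_def flat_def)

lemma bump_nonneg: "bump a x \<ge> 0"
  by (simp add: bump_def flat_def)

lemma bump_zero: "x \<notin> {a..1-a} \<Longrightarrow> bump a x = 0"
  by (auto simp: bump_def flat_def)

lemma bump_le_1: "bump a x \<le> 1"
proof -
  have "0 \<le> flat 1 y \<and> flat 1 y \<le> 1" for y by (simp add: flat_def)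
  then show ?thesis unfolding bump_def using mult_le_one by blast
qed

lemma test_functionsI:
  assumes "smooth f" "a > 0" "\<And>x. x \<notin> {a..1-a} \<Longrightarrow> f x = 0"
  shows "f \<in> test_functions"
proof -
  have "closure {x. f x \<noteq> 0} \<subseteq> {a..1-a}"
    by (rule closure_minimal) (use assms(3) in blast, simp)
  also have "\<dots> \<subseteq> {0<..<1}" using assms(2) by auto
  finally show ?thesis using assms(1) by (simp add: test_functions_def smooth_def)
qed

text \<open>Compactness of the support is turned into a margin \<open>a\<close>, a form in which
  supports are easily compared. The cap 1/4 in the proof keeps \<open>{a..1-a}\<close>
  nonempty.\<close>

lemma test_functionsE:
  assumes "f \<in> test_functions"
  obtains a where "smooth f" "a > 0" "a < 1/2" "\<And>x. x \<notin> {a..1-a} \<Longrightarrow> f x = 0"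
proof -
  let ?K = "closure {x. f x \<noteq> 0}"
  have s: "smooth f" using assms by (simp add: test_functions_def smooth_def)
  have K: "?K \<subseteq> {0<..<1}" using assms by (simp add: test_functions_def)
  have "compact ?K" using K bounded_subset[of "{0<..<1::real}" ?K] by (simp add: compact_eq_bounded_closed)
  have "\<exists>a>0. a < 1/2 \<and> ?K \<subseteq> {a..1-a}"
  proof (cases "?K = {}")
    case True then show ?thesis by (intro exI[of _ "1/4"]) auto
  next
    case False
    obtain l where l: "l \<in> ?K" "\<And>x. x \<in> ?K \<Longrightarrow> l \<le> x" 
      using continuous_attains_inf[OF \<open>compact ?K\<close> False continuous_on_id] by auto
    obtain u where u: "u \<in> ?K" "\<And>x. x \<in> ?K \<Longrightarrow> x \<le> u" 
      using continuous_attains_sup[OF \<open>compact ?K\<close> False continuous_on_id] by auto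
    define a where "a = min (1/4) (min l (1 - u))"
    have "a > 0" using K l(1) u(1) by (auto simp: a_def)
    moreover have "?K \<subseteq> {a..1-a}" using l(2) u(2) by (force simp: a_def)
    moreover have "a < 1/2" using min.cobounded1[of "1/4" "min l (1 - u)"] unfolding a_def by linarith
    ultimately show ?thesis by blast
  qed
  then obtain a where a: "a > 0" "a < 1/2" "?K \<subseteq> {a..1-a}" by blast
  have "f x = 0" if "x \<notin> {a..1-a}" for x
    using a(3) that closure_subset[of "{x. f x \<noteq> 0}"] by blast
  then show ?thesis using that s a by blast
qed

lemma test_mult_smooth:
  assumes "f \<in> test_functions" "smooth g" shows "(\<lambda>x. f x * g x) \<in> test_functions"
proof -
  obtain a where a: "smooth f" "a > 0" "a < 1/2" "\<And>x. x \<notin> {a..1-a} \<Longrightarrow> f x = 0"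
    using test_functionsE[OF assms(1)] by blast
  show ?thesis by (rule test_functionsI[of _ a]) (use a smooth_mult assms in auto)
qed

lemma test_scale: "f \<in> test_functions \<Longrightarrow> (\<lambda>x. c * f x) \<in> test_functions"
  using test_mult_smooth[OF _ smooth_const, of f c] by (simp add: mult.commute)

lemma test_add:
  assumes "f \<in> test_functions" "g \<in> test_functions" shows "(\<lambda>x. f x + g x) \<in> test_functions"
proof -
  obtain a where a: "smooth f" "a > 0" "a < 1/2" "\<And>x. x \<notin> {a..1-a} \<Longrightarrow> f x = 0"
    using test_functionsE[OF assms(1)] by blast
  obtain b where b: "smooth g" "b > 0" "b < 1/2" "\<And>x. x \<notin> {b..1-b} \<Longrightarrow> g x = 0"
    using test_functionsE[OF assms(2)] by blast
  have "f x + g x = 0" if "x \<notin> {min a b..1 - min a b}" for x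
  proof -
    have "x \<notin> {a..1-a}" "x \<notin> {b..1-b}" using that by auto
    then show ?thesis using a(4) b(4) by simp
  qed
  then show ?thesis using a b by (intro test_functionsI[of _ "min a b"] smooth_add) auto
qed

lemma test_diff:
  assumes "f \<in> test_functions" "g \<in> test_functions" shows "(\<lambda>x. f x - g x) \<in> test_functions"
  using test_add[OF assms(1) test_scale[OF assms(2), of "-1"]] by simp

lemma test_deriv:
  assumes "f \<in> test_functions" shows "deriv f \<in> test_functions"
proof -
  obtain a where a: "smooth f" "a > 0" "a < 1/2" "\<And>x. x \<notin> {a..1-a} \<Longrightarrow> f x = 0"
    using test_functionsE[OF assms(1)] by blast
  have "deriv f x = 0" if "x \<notin> {a..1-a}" for x
  proof (rule DERIV_imp_deriv)
    have "((\<lambda>x. 0) has_real_derivative 0) (at x)" by simp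
    then show "(f has_real_derivative 0) (at x)"
      by (rule has_field_derivative_transform_within_open[of _ _ _ "- {a..1-a}"]) (use that a(4) in auto)
  qed
  then show ?thesis using a smooth_deriv by (intro test_functionsI[of _ a]) auto
qed

lemma test_continuous: "f \<in> test_functions \<Longrightarrow> continuous_on S f"
  using test_functionsE smooth_continuous by metis

lemma test_sq_int: "f \<in> test_functions \<Longrightarrow> f \<in> sq_int unit_leb"
  by (intro cont_sq_int test_continuous)

lemma test_zero: "f \<in> test_functions \<Longrightarrow> x \<notin> {0<..<1} \<Longrightarrow> f x = 0"
  using closure_subset[of "{x. f x \<noteq> 0}"] unfolding test_functions_def by blast

lemma test_prim_deriv: 
  assumes "f \<in> test_functions" shows "prim (deriv f) = f"
proof
  fix x
  have s: "smooth f" using assms test_functionsE by blast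
  have F: "prim (deriv f) x = f x - f 0" if "x \<in> {0..1}" for x
    by (rule prim_FTC) (use that smooth_DERIV[OF s] smooth_continuous[OF smooth_deriv[OF s]] 
        has_field_derivative_at_within in blast)+
  show "prim (deriv f) x = f x"
  proof (cases "x \<in> {0..1}")
    case True then show ?thesis using F[OF True] test_zero[OF assms, of 0] by simp
  next
    case False
    then have "prim (deriv f) x = 0"
      using F[of 1] prim_0[of x] prim_1[of x "deriv f"] prim_1[of 1 "deriv f"]
        test_zero[OF assms, of 0] test_zero[OF assms, of 1] by (cases "x \<le> 0") auto
    moreover have "x \<notin> {0<..<1}" using False by auto
    ultimately show ?thesis using test_zero[OF assms, of x] by simp
  qed
qed

lemma test_integral_deriv: 
  assumes "f \<in> test_functions" shows "(LINT x|unit_leb. deriv f x) = 0"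
  using prim_1[of 1 "deriv f"] test_prim_deriv[OF assms] test_zero[OF assms, of 1] by simp

text \<open>Mean zero is what makes the primitive vanish to the right of the support, so that it has
  compact support again.\<close>

lemma test_antideriv:
  assumes f: "f \<in> test_functions" and 0: "(LINT x|unit_leb. f x) = 0"
  shows "prim f \<in> test_functions" "deriv (prim f) = f"
proof -
  obtain a where a: "smooth f" "a > 0" "a < 1/2" "\<And>x. x \<notin> {a..1-a} \<Longrightarrow> f x = 0"
    using test_functionsE[OF f] by blast
  have lo: "prim f x = 0" if "x \<le> a" for x
  proof -
    have "(if y < x then f y else 0) = 0" for y using a(4)[of y] that by auto
    then show ?thesis by (simp add: prim_def)
  qed
  have hi: "prim f x = 0" if "x \<ge> 1 - a" for x
  proof -
    have "prim f x = (LINT y|unit_leb. f y)"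
      unfolding prim_def
    proof (rule integral_cong_AE)
      note [measurable] = sq_int_meas[OF test_sq_int[OF f]]
      show "(\<lambda>y. if y < x then f y else 0) \<in> borel_measurable unit_leb" by measurable
      show "AE y in unit_leb. (if y < x then f y else 0) = f y"
        using AE_unit_neq[of "1-a"]
      proof eventually_elim
        case (elim y)
        then show ?case using a(4)[of y] that by auto
      qed
    qed (rule sq_int_meas[OF test_sq_int[OF f]])
    then show ?thesis using 0 by simp
  qed
  obtain g where g: "\<And>x. x \<in> {0..1} \<Longrightarrow> (g has_vector_derivative f x) (at x within {0..1})"
    using antiderivative_continuous[of 0 1 f] test_continuous[OF f] by blast
  have pg: "prim f x = g x - g 0" if "x \<in> {0..1}" for x
    by (rule prim_FTC) (use g test_continuous[OF f] that in \<open>auto simp: has_real_derivative_iff_has_vector_derivative\<close>)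
  have D: "(prim f has_real_derivative f x) (at x)" for x
  proof -
    \<comment> \<open>Three open sets covering the line: the primitive vanishes on the outer two,
      and on the inner one it agrees with a differentiable antiderivative.\<close>
    consider "x < a" | "x > 1 - a" | "x \<in> {0<..<1}" using a by force
    then show ?thesis
    proof cases
      case 1
      have "((\<lambda>x. 0) has_real_derivative 0) (at x)" by simp
      then have "(prim f has_real_derivative 0) (at x)"
        by (rule has_field_derivative_transform_within_open[of _ _ _ "{..<a}"]) (use 1 lo in auto)
      then show ?thesis using 1 a(4) by simp
    next
      case 2
      have "((\<lambda>x. 0) has_real_derivative 0) (at x)" by simp
      then have "(prim f has_real_derivative 0) (at x)"
        by (rule has_field_derivative_transform_within_open[of _ _ _ "{1-a<..}"]) (use 2 hi in auto)
      then show ?thesis using 2 a(4) by simp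
    next
      case 3
      have "(g has_real_derivative f x) (at x within {0..1})"
        using g 3 by (auto simp: has_real_derivative_iff_has_vector_derivative)
      then have "(g has_real_derivative f x) (at x)" using 3 at_within_Icc_at[of 0 x 1] by auto
      then have "((\<lambda>x. g x - g 0) has_real_derivative f x) (at x)" by (auto intro!: derivative_eq_intros)
      then show ?thesis
        by (rule has_field_derivative_transform_within_open[of _ _ _ "{0<..<1}"]) (use 3 pg in auto)
    qed
  qed
  show "deriv (prim f) = f" using D DERIV_imp_deriv by blast
  have "smooth (prim f)" using smooth_antideriv[of "prim f" f] D a(1) by blast
  then show "prim f \<in> test_functions"
  proof (rule test_functionsI[OF _ a(2)])
    fix x assume "x \<notin> {a..1-a}"
    then have "x \<le> a \<or> x \<ge> 1 - a" by auto
    then show "prim f x = 0" using lo hi by blast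
  qed
qed

lemma bump_test: "a > 0 \<Longrightarrow> bump a \<in> test_functions"
  by (rule test_functionsI[OF smooth_bump]) (assumption, rule bump_zero)

lemma unit_mass_test: 
  obtains \<rho> where "\<rho> \<in> test_functions" "(LINT x|unit_leb. \<rho> x) = 1"
proof -
  let ?b = "bump (1/4)"
  have b: "?b \<in> test_functions" by (rule bump_test) simp
  have i: "integrable unit_leb ?b" by (intro U.sq_int_integrable test_sq_int b)
  have "(LINT x|unit_leb. ?b x) \<noteq> 0"
  proof
    assume "(LINT x|unit_leb. ?b x) = 0"
    then have "AE x in unit_leb. ?b x = 0"
      using integral_nonneg_eq_0_iff_AE[OF i AE_I2[OF bump_nonneg]] by blast
    then have "AE x in unit_leb. x \<notin> {1/4<..<3/4}"
    proof eventually_elim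
      case (elim x)
      then show ?case using bump_pos[of "1/4" x] by auto
    qed
    moreover have S: "{1/4<..<3/4::real} \<in> sets unit_leb"
      by (rule sets_restrict_space_iff[THEN iffD2]) auto
    ultimately have "emeasure unit_leb {1/4<..<3/4} = 0"
      using AE_iff_null_sets[OF S] by blast
    moreover have "emeasure unit_leb {1/4<..<3/4} = emeasure lebesgue {1/4<..<3/4::real}"
      by (rule emeasure_restrict_space) auto
    ultimately show False by simp
  qed
  then show ?thesis
    by (intro that[OF test_scale[OF b, of "1 / (LINT x|unit_leb. ?b x)"]]) simp
qed

text \<open>Cut \<open>u\<close> off near the end points, divide by a bump function that is bounded
  below where the cut-off lives, approximate the quotient by a polynomial, and multiply the bump
  function back in.\<close>

lemma test_dense:
  assumes u: "u \<in> sq_int unit_leb" and e: "e > 0"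
  obtains f where "f \<in> test_functions" "nrm unit_leb (\<lambda>x. u x - f x) < e"
proof -
  note [measurable] = sq_int_meas[OF u]
  define c where "c n x = (if 2 / real (n + 5) \<le> x \<and> x \<le> 1 - 2 / real (n + 5) then u x else 0)" for n :: nat and x
  have cm: "c n \<in> borel_measurable unit_leb" for n unfolding c_def by measurable
  have ua: "(\<lambda>y. \<bar>u y\<bar>) \<in> sq_int unit_leb" using u by (auto simp: sq_int_def)
  have lim0: "(\<lambda>n. 2 / real (n + 5)) \<longlonglongrightarrow> 0"
    using LIMSEQ_ignore_initial_segment[OF lim_const_over_n[of 2], of 5] by simp
  have "(\<lambda>n. nrm unit_leb (\<lambda>y. c n y - u y)) \<longlonglongrightarrow> 0"
  proof (rule nrm_dominated[OF cm sq_int_meas[OF u] ua])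
    show "AE y in unit_leb. (\<lambda>n. c n y) \<longlonglongrightarrow> u y"
    proof (rule AE_I2)
      fix y assume "y \<in> space unit_leb"
      then have y: "0 < min y (1 - y)" by simp
      have "\<forall>\<^sub>F n in sequentially. c n y = u y"
        using order_tendstoD(2)[OF lim0 y] by eventually_elim (auto simp: c_def)
      then show "(\<lambda>n. c n y) \<longlonglongrightarrow> u y" by (rule tendsto_eventually)
    qed
  qed (auto simp: c_def)
  from LIMSEQ_D[OF this, of "e/2"] e obtain n where n: "nrm unit_leb (\<lambda>y. c n y - u y) < e/2" by auto
  \<comment> \<open>The cut-off starts at 2a while the bump function is positive beyond a, so it has
    a positive minimum on the set in question. The shift by 5 in \<open>n + 5\<close> keeps this set
    nonempty.\<close>
  define a where "a = 1 / real (n + 5)"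
  have a: "a > 0" "a \<le> 1/5" by (auto simp: a_def field_simps)
  have a2: "2 / real (n + 5) = 2 * a" by (simp add: a_def)
  have bc: "continuous_on {2*a..1-2*a} (bump a)" by (rule smooth_continuous[OF smooth_bump])
  obtain m where m: "m \<in> {2*a..1-2*a}" "\<And>x. x \<in> {2*a..1-2*a} \<Longrightarrow> bump a m \<le> bump a x"
  proof -
    have ne: "{2*a..1-2*a} \<noteq> {}" using a by simp
    show ?thesis using continuous_attains_inf[OF compact_Icc ne bc] that by blast
  qed
  have mp: "bump a m > 0" using m(1) a by (intro bump_pos) auto
  note [measurable] = cont_imp_unit_leb[OF smooth_continuous[OF smooth_bump[of a]]]
  define q where "q x = c n x * (if 2*a \<le> x \<and> x \<le> 1 - 2*a then 1 / bump a x else 0)" for x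
  have cs: "c n \<in> sq_int unit_leb"
  proof -
    have "c n = (\<lambda>x. u x * (if 2 / real (n + 5) \<le> x \<and> x \<le> 1 - 2 / real (n + 5) then 1 else 0))"
      by (auto simp: c_def)
    also have "\<dots> \<in> sq_int unit_leb" by (rule U.sq_int_mult_bounded[where C=1, OF u]) auto
    finally show ?thesis .
  qed
  have qs: "q \<in> sq_int unit_leb" unfolding q_def
  proof (rule U.sq_int_mult_bounded[where C="1 / bump a m", OF cs])
    show "(\<lambda>x. if 2 * a \<le> x \<and> x \<le> 1 - 2 * a then 1 / bump a x else 0) \<in> borel_measurable unit_leb"
      by measurable
    show "AE x in unit_leb. \<bar>if 2 * a \<le> x \<and> x \<le> 1 - 2 * a then 1 / bump a x else 0\<bar> \<le> 1 / bump a m"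
    proof (rule AE_I2)
      fix x
      show "\<bar>if 2 * a \<le> x \<and> x \<le> 1 - 2 * a then 1 / bump a x else 0\<bar> \<le> 1 / bump a m"
      proof (cases "2 * a \<le> x \<and> x \<le> 1 - 2 * a")
        case True
        then have "bump a m \<le> bump a x" using m(2) by simp
        then have "1 / bump a x \<le> 1 / bump a m" using mp by (intro frac_le) auto
        then show ?thesis using True bump_nonneg[of a x] by simp
      next
        case False
        show ?thesis unfolding if_not_P[OF False] using mp by simp
      qed
    qed
  qed
  have qc: "q x * bump a x = c n x" for x
  proof (cases "2 * a \<le> x \<and> x \<le> 1 - 2 * a")
    case True
    then have "bump a x > 0" using a by (intro bump_pos) auto
    then show ?thesis using True by (simp add: q_def)
  next
    case False
    then have nc: "\<not> (2 / real (n + 5) \<le> x \<and> x \<le> 1 - 2 / real (n + 5))" unfolding a2 .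
    show ?thesis unfolding q_def c_def if_not_P[OF nc] if_not_P[OF False] by simp
  qed
  obtain p where p: "nrm unit_leb (\<lambda>x. q x - poly p x) < e/2"
    using poly_dense[OF qs, of "e/2"] e by auto
  define f where "f x = bump a x * poly p x" for x
  have f: "f \<in> test_functions"
    unfolding f_def by (rule test_mult_smooth[OF bump_test smooth_poly]) (rule a(1))
  have d: "(\<lambda>x. q x - poly p x) \<in> sq_int unit_leb" by (intro sq_int_diff qs poly_sq_int)
  \<comment> \<open>Multiplication by the bump function is a contraction, since its values lie
    between 0 and 1.\<close>
  have "nrm unit_leb (\<lambda>x. c n x - f x) \<le> nrm unit_leb (\<lambda>x. q x - poly p x)"
  proof -
    have "c n x - f x = (q x - poly p x) * bump a x" for x
      unfolding f_def using qc[of x] by (simp add: algebra_simps)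
    moreover have "(LINT x|unit_leb. ((q x - poly p x) * bump a x)\<^sup>2) \<le> (LINT x|unit_leb. (q x - poly p x)\<^sup>2)"
    proof (rule integral_mono)
      have "(\<lambda>x. (q x - poly p x) * bump a x) \<in> sq_int unit_leb"
        by (rule U.sq_int_mult_bounded[where C=1, OF d]) (use bump_le_1[of a] bump_nonneg[of a] in auto)
      then show "integrable unit_leb (\<lambda>x. ((q x - poly p x) * bump a x)\<^sup>2)" by (rule sq_int_sq)
      show "integrable unit_leb (\<lambda>x. (q x - poly p x)\<^sup>2)" using d by (rule sq_int_sq)
      show "((q x - poly p x) * bump a x)\<^sup>2 \<le> (q x - poly p x)\<^sup>2" for x
        using bump_le_1[of a x] bump_nonneg[of a x] 
        by (simp add: power_mult_distrib mult_left_le power_le_one)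
    qed
    ultimately show ?thesis by (simp add: nrm_def)
  qed
  then have "nrm unit_leb (\<lambda>x. u x - f x) < e"
    using nrm_triangle_diff[OF u cs test_sq_int[OF f]] n p nrm_minus_commute[of unit_leb u "c n"] by simp
  then show ?thesis using that f by blast
qed

lemma test_orthogonal_zero:
  assumes u: "u \<in> sq_int unit_leb" and o: "\<And>f. f \<in> test_functions \<Longrightarrow> (LINT x|unit_leb. u x * f x) = 0"
  shows "AE x in unit_leb. u x = 0"
proof (rule dense_orthogonal_zero[OF u, of test_functions])
  show "\<exists>p\<in>test_functions. nrm unit_leb (\<lambda>x. u x - p x) < e" if "e > 0" for e
    using test_dense[OF u that] by metis
qed (use o test_sq_int in auto)

section \<open>Sobolev functions as primitives\<close>

lemma is_weak_deriv_cong_AE: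
  assumes "AE x in unit_leb. u x = u' x" "u \<in> borel_measurable unit_leb" "u' \<in> borel_measurable unit_leb"
  shows "is_weak_deriv u g \<longleftrightarrow> is_weak_deriv u' g"
proof -
  have "(LINT x|unit_leb. u x * deriv \<phi> x) = (LINT x|unit_leb. u' x * deriv \<phi> x)" if "\<phi> \<in> test_functions" for \<phi>
  proof (rule integral_cong_AE)
    note [measurable] = sq_int_meas[OF test_sq_int[OF test_deriv[OF that]]] assms(2,3)
    show "(\<lambda>x. u x * deriv \<phi> x) \<in> borel_measurable unit_leb" by measurable
    show "(\<lambda>x. u' x * deriv \<phi> x) \<in> borel_measurable unit_leb" by measurable
    show "AE x in unit_leb. u x * deriv \<phi> x = u' x * deriv \<phi> x" using assms(1) by eventually_elim simp
  qed
  then show ?thesis unfolding is_weak_deriv_def by simp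
qed

lemma prim_weak_deriv:
  assumes g: "g \<in> sq_int unit_leb"
  shows "is_weak_deriv (\<lambda>x. c + prim g x) g"
  unfolding is_weak_deriv_def
proof
  fix \<phi> assume t: "\<phi> \<in> test_functions"
  have gi: "integrable unit_leb g" using g by (rule U.sq_int_integrable)
  have di: "integrable unit_leb (deriv \<phi>)" by (intro U.sq_int_integrable test_sq_int test_deriv t)
  have "(LINT x|unit_leb. (c + prim g x) * deriv \<phi> x) = (LINT x|unit_leb. c * deriv \<phi> x + deriv \<phi> x * prim g x)"
    by (rule Bochner_Integration.integral_cong) (auto simp: algebra_simps)
  also have "\<dots> = c * (LINT x|unit_leb. deriv \<phi> x) + (LINT x|unit_leb. deriv \<phi> x * prim g x)"
    using di integrable_mult_prim[OF di gi] by simp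
  also have "\<dots> = - (LINT x|unit_leb. g x * \<phi> x)"
    using prim_by_parts_full[OF di gi] test_integral_deriv[OF t] test_prim_deriv[OF t]
    by (simp add: mult.commute)
  finally show "(LINT x|unit_leb. (c + prim g x) * deriv \<phi> x) = - (LINT x|unit_leb. g x * \<phi> x)" .
qed

lemma weak_deriv_unique:
  assumes g: "g \<in> sq_int unit_leb" and h: "h \<in> sq_int unit_leb" and "is_weak_deriv u g" "is_weak_deriv u h"
  shows "AE x in unit_leb. g x = h x"
proof -
  have "AE x in unit_leb. g x - h x = 0"
  proof (rule test_orthogonal_zero)
    show "(\<lambda>x. g x - h x) \<in> sq_int unit_leb" by (intro sq_int_diff g h)
    fix f assume f: "f \<in> test_functions"
    show "(LINT x|unit_leb. (g x - h x) * f x) = 0"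
      using assms(3,4) f sq_int_mult[OF g test_sq_int[OF f]] sq_int_mult[OF h test_sq_int[OF f]]
      unfolding is_weak_deriv_def by (simp add: left_diff_distrib)
  qed
  then show ?thesis by eventually_elim simp
qed

text \<open>The difference \<open>v\<close> of \<open>u\<close> and \<open>prim g\<close>
  annihilates derivatives of test functions. A test function minus its mean times a fixed
  \<open>\<rho>\<close> of mass 1 is such a derivative, so \<open>v\<close> minus its pairing with
  \<open>\<rho>\<close> annihilates all test functions.\<close>

lemma du_bois_reymond:
  assumes u: "u \<in> sq_int unit_leb" and g: "g \<in> sq_int unit_leb" and wd: "is_weak_deriv u g"
  obtains c where "AE x in unit_leb. u x = c + prim g x"
proof -
  obtain \<rho> where \<rho>: "\<rho> \<in> test_functions" "(LINT x|unit_leb. \<rho> x) = 1" by (rule unit_mass_test)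
  have ps: "prim g \<in> sq_int unit_leb" by (intro prim_sq_int U.sq_int_integrable g)
  define v where "v x = u x - prim g x" for x
  have v: "v \<in> sq_int unit_leb" unfolding v_def by (intro sq_int_diff u ps)
  define c where "c = (LINT x|unit_leb. v x * \<rho> x)"
  have v0: "(LINT x|unit_leb. v x * deriv \<phi> x) = 0" if t: "\<phi> \<in> test_functions" for \<phi>
  proof -
    have ds: "deriv \<phi> \<in> sq_int unit_leb" by (intro test_sq_int test_deriv t)
    show ?thesis
      using wd prim_weak_deriv[OF g, of 0] t sq_int_mult[OF u ds] sq_int_mult[OF ps ds]
      unfolding is_weak_deriv_def v_def by (simp add: left_diff_distrib)
  qed
  have "AE x in unit_leb. v x - c = 0"
  proof (rule test_orthogonal_zero)
    show "(\<lambda>x. v x - c) \<in> sq_int unit_leb" by (intro sq_int_diff v U.sq_int_const)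
    fix \<psi> assume \<psi>: "\<psi> \<in> test_functions"
    define m where "m = (LINT x|unit_leb. \<psi> x)"
    define f where "f x = \<psi> x - m * \<rho> x" for x
    have f: "f \<in> test_functions" unfolding f_def by (intro test_diff test_scale \<psi> \<rho>)
    have psi: "\<psi> \<in> sq_int unit_leb" "\<rho> \<in> sq_int unit_leb" by (intro test_sq_int \<psi> \<rho>)+
    have "(LINT x|unit_leb. f x) = 0"
      unfolding f_def using U.sq_int_integrable[OF psi(1)] U.sq_int_integrable[OF psi(2)] \<rho>(2) by (simp add: m_def)
    then have "(LINT x|unit_leb. v x * f x) = 0" using v0[of "prim f"] test_antideriv[OF f] by simp
    moreover have "(LINT x|unit_leb. v x * f x) = (LINT x|unit_leb. v x * \<psi> x - m * (v x * \<rho> x))"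
      unfolding f_def by (rule Bochner_Integration.integral_cong) (auto simp: algebra_simps)
    moreover have "\<dots> = (LINT x|unit_leb. v x * \<psi> x) - m * c"
      using sq_int_mult[OF v psi(1)] sq_int_mult[OF v psi(2)] by (simp add: c_def)
    moreover have "(LINT x|unit_leb. (v x - c) * \<psi> x) = (LINT x|unit_leb. v x * \<psi> x) - c * m"
      using sq_int_mult[OF v psi(1)] U.sq_int_integrable[OF psi(1)] by (simp add: left_diff_distrib m_def)
    ultimately show "(LINT x|unit_leb. (v x - c) * \<psi> x) = 0" by simp
  qed
  then have "AE x in unit_leb. u x = c + prim g x" by eventually_elim (simp add: v_def)
  then show ?thesis by (rule that)
qed

lemma H1D:
  assumes "u \<in> H1"
  shows "u \<in> sq_int unit_leb" "weak_deriv u \<in> sq_int unit_leb" "is_weak_deriv u (weak_deriv u)"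
proof -
  show "u \<in> sq_int unit_leb" using assms by (simp add: H1_def L2_eq_sq_int)
  have "\<exists>g. g \<in> L2 \<and> is_weak_deriv u g" using assms by (auto simp: H1_def)
  from someI_ex[OF this] show "weak_deriv u \<in> sq_int unit_leb" "is_weak_deriv u (weak_deriv u)"
    unfolding weak_deriv_def by (simp_all add: L2_eq_sq_int)
qed

lemma H1_primI:
  assumes u: "u \<in> borel_measurable unit_leb" and g: "g \<in> sq_int unit_leb" and AE: "AE x in unit_leb. u x = c + prim g x"
  shows "u \<in> H1" "AE x in unit_leb. weak_deriv u x = g x"
proof -
  have ps: "prim g \<in> sq_int unit_leb" by (intro prim_sq_int U.sq_int_integrable g)
  have cs: "(\<lambda>x. c + prim g x) \<in> sq_int unit_leb" by (intro sq_int_add U.sq_int_const ps)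
  have us: "u \<in> sq_int unit_leb" by (rule sq_int_cong_AE[OF cs u AE])
  have wd: "is_weak_deriv u g"
    using is_weak_deriv_cong_AE[OF AE u sq_int_meas[OF cs]] prim_weak_deriv[OF g] by simp
  show "u \<in> H1" using us g wd by (auto simp: H1_def L2_eq_sq_int)
  from weak_deriv_unique[OF H1D(2)[OF this] g H1D(3)[OF this] wd]
  show "AE x in unit_leb. weak_deriv u x = g x" .
qed

lemma H1_rep:
  assumes "u \<in> H1"
  obtains c where "AE x in unit_leb. u x = c + prim (weak_deriv u) x"
  using du_bois_reymond[OF H1D[OF assms]] by blast

lemma test_H1:
  assumes t: "f \<in> test_functions"
  shows "f \<in> H1" "AE x in unit_leb. weak_deriv f x = deriv f x"
  using H1_primI[OF sq_int_meas[OF test_sq_int[OF t]] test_sq_int[OF test_deriv[OF t]], of 0] test_prim_deriv[OF t]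
  by simp_all

lemma prim_nrm_bound:
  assumes "g \<in> sq_int unit_leb" shows "\<bar>prim g x\<bar> \<le> nrm unit_leb g"
  using prim_bound[OF U.sq_int_integrable[OF assms], of x] U.sq_int_L1[OF assms] by simp

lemma H1_lincomb:
  assumes u: "u \<in> H1" and v: "v \<in> H1"
  shows "(\<lambda>x. u x + c * v x) \<in> H1" "AE x in unit_leb. weak_deriv (\<lambda>x. u x + c * v x) x = weak_deriv u x + c * weak_deriv v x"
proof -
  obtain k where k: "AE x in unit_leb. u x = k + prim (weak_deriv u) x" by (rule H1_rep[OF u])
  obtain d where d: "AE x in unit_leb. v x = d + prim (weak_deriv v) x" by (rule H1_rep[OF v])
  have i: "integrable unit_leb (weak_deriv u)" "integrable unit_leb (\<lambda>x. c * weak_deriv v x)"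
    using U.sq_int_integrable[OF H1D(2)[OF u]] U.sq_int_integrable[OF H1D(2)[OF v]] by auto
  have AE: "AE x in unit_leb. u x + c * v x = (k + c * d) + prim (\<lambda>x. weak_deriv u x + c * weak_deriv v x) x"
    using k d by eventually_elim (simp add: prim_add[OF i] prim_cmult algebra_simps)
  have m: "(\<lambda>x. u x + c * v x) \<in> borel_measurable unit_leb"
    by (rule sq_int_meas) (intro sq_int_add sq_int_scale H1D u v)
  have s: "(\<lambda>x. weak_deriv u x + c * weak_deriv v x) \<in> sq_int unit_leb" by (intro sq_int_add sq_int_scale H1D u v)
  show "(\<lambda>x. u x + c * v x) \<in> H1" "AE x in unit_leb. weak_deriv (\<lambda>x. u x + c * v x) x = weak_deriv u x + c * weak_deriv v x"
    using H1_primI[OF m s AE] by auto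
qed

lemma H1_diff:
  assumes u: "u \<in> H1" and v: "v \<in> H1"
  shows "(\<lambda>x. u x - v x) \<in> H1" "AE x in unit_leb. weak_deriv (\<lambda>x. u x - v x) x = weak_deriv u x - weak_deriv v x"
  using H1_lincomb[OF u v, of "- 1"] by simp_all

lemma H1_norm_ge:
  shows "nrm unit_leb u \<le> H1_norm u" "nrm unit_leb (weak_deriv u) \<le> H1_norm u"
  unfolding H1_norm_def L2_norm_eq_nrm by (auto intro: real_le_rsqrt)

text \<open>The concrete form of the closure: primitives of mean-zero functions, that is, primitives
  vanishing at both ends. In one direction the mean of the derivative and the constant of
  integration are continuous in the norm of \<open>H1\<close> and vanish on test functions; in the
  other the derivative is approximated, its mean corrected, and the result integrated.\<close>

lemma H10_iff:
  "u \<in> H10 \<longleftrightarrow> u \<in> borel_measurable unit_leb \<and> 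
    (\<exists>p\<in>sq_int unit_leb. (LINT x|unit_leb. p x) = 0 \<and> (AE x in unit_leb. u x = prim p x))"
proof
  assume u: "u \<in> H10"
  then have u1: "u \<in> H1" by (simp add: H10_def)
  obtain \<phi> where t: "\<And>n::nat. \<phi> n \<in> test_functions" and l: "(\<lambda>n. H1_norm (\<lambda>x. u x - \<phi> n x)) \<longlonglongrightarrow> 0"
    using u by (auto simp: H10_def)
  define p where "p = weak_deriv u"
  have ps: "p \<in> sq_int unit_leb" unfolding p_def by (rule H1D[OF u1])
  obtain c where c: "AE x in unit_leb. u x = c + prim p x" unfolding p_def by (rule H1_rep[OF u1])
  have dt: "deriv (\<phi> n) \<in> sq_int unit_leb" for n by (intro test_sq_int test_deriv t)
  define q where "q n x = p x - deriv (\<phi> n) x" for n x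
  have qs: "q n \<in> sq_int unit_leb" for n unfolding q_def by (intro sq_int_diff ps dt)
  have q_le: "nrm unit_leb (q n) \<le> H1_norm (\<lambda>x. u x - \<phi> n x)" for n
  proof -
    have "AE x in unit_leb. weak_deriv (\<lambda>x. u x - \<phi> n x) x = q n x"
      using H1_diff(2)[OF u1 test_H1(1)[OF t[of n]]] test_H1(2)[OF t[of n]] by eventually_elim (simp add: q_def p_def)
    then have "nrm unit_leb (weak_deriv (\<lambda>x. u x - \<phi> n x)) = nrm unit_leb (q n)"
      by (rule nrm_cong_AE) (use H1D(2)[OF H1_diff(1)[OF u1 test_H1(1)[OF t]]] qs sq_int_meas in auto)
    then show ?thesis using H1_norm_ge(2)[of "\<lambda>x. u x - \<phi> n x"] by simp
  qed
  have ip: "\<bar>LINT x|unit_leb. p x\<bar> \<le> H1_norm (\<lambda>x. u x - \<phi> n x)" for n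
  proof -
    have "(LINT x|unit_leb. p x) = (LINT x|unit_leb. q n x)"
      unfolding q_def using U.sq_int_integrable[OF ps] U.sq_int_integrable[OF dt] test_integral_deriv[OF t] by simp
    also have "\<bar>\<dots>\<bar> \<le> nrm unit_leb (q n)"
      using prim_nrm_bound[OF qs, of n 1] prim_1[of 1 "q n"] by simp
    finally show ?thesis using q_le[of n] by simp
  qed
  \<comment> \<open>The constant is the difference of a function small in L^2 and a primitive of a
    small function, which costs a factor 2.\<close>
  have cp: "\<bar>c\<bar> \<le> 2 * H1_norm (\<lambda>x. u x - \<phi> n x)" for n
  proof -
    have ts: "(\<lambda>x. u x - \<phi> n x) \<in> sq_int unit_leb" by (intro sq_int_diff H1D u1 test_sq_int t)
    have pq: "prim (q n) \<in> sq_int unit_leb" by (intro prim_sq_int U.sq_int_integrable qs)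
    have "AE x in unit_leb. c = u x - \<phi> n x - prim (q n) x"
      using c by eventually_elim (simp add: q_def[abs_def] prim_diff[OF U.sq_int_integrable[OF ps] U.sq_int_integrable[OF dt]] 
        test_prim_deriv[OF t])
    then have "nrm unit_leb (\<lambda>x. c) = nrm unit_leb (\<lambda>x. (u x - \<phi> n x) - prim (q n) x)"
      by (rule nrm_cong_AE) (auto intro!: sq_int_meas sq_int_diff ts pq)
    also have "\<dots> = nrm unit_leb (\<lambda>x. (u x - \<phi> n x) + (-1) * prim (q n) x)" by simp
    also have "\<dots> \<le> nrm unit_leb (\<lambda>x. u x - \<phi> n x) + nrm unit_leb (\<lambda>x. (-1) * prim (q n) x)"
      by (rule nrm_triangle[OF ts sq_int_scale[OF pq]])
    also have "\<dots> \<le> H1_norm (\<lambda>x. u x - \<phi> n x) + nrm unit_leb (q n)"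
      unfolding nrm_scale
      using H1_norm_ge(1)[of "\<lambda>x. u x - \<phi> n x"] nrm_le_const[OF sq_int_meas[OF pq], of "nrm unit_leb (q n)"] 
        prim_nrm_bound[OF qs, of n] by simp
    finally show ?thesis using q_le[of n] by (simp add: nrm_def)
  qed
  have "(LINT x|unit_leb. p x) = 0"
    using LIMSEQ_le_const[OF l, of "\<bar>LINT x|unit_leb. p x\<bar>"] ip by auto
  moreover have "c = 0"
  proof -
    have "(\<lambda>n. 2 * H1_norm (\<lambda>x. u x - \<phi> n x)) \<longlonglongrightarrow> 0" using tendsto_mult_left[OF l, of 2] by simp
    from LIMSEQ_le_const[OF this, of "\<bar>c\<bar>"] cp show ?thesis by auto
  qed
  ultimately show "u \<in> borel_measurable unit_leb \<and> 
    (\<exists>p\<in>sq_int unit_leb. (LINT x|unit_leb. p x) = 0 \<and> (AE x in unit_leb. u x = prim p x))"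
    using ps c sq_int_meas[OF H1D(1)[OF u1]] by auto
next
  assume "u \<in> borel_measurable unit_leb \<and> 
    (\<exists>p\<in>sq_int unit_leb. (LINT x|unit_leb. p x) = 0 \<and> (AE x in unit_leb. u x = prim p x))"
  then obtain p where um: "u \<in> borel_measurable unit_leb" and ps: "p \<in> sq_int unit_leb" 
    and p0: "(LINT x|unit_leb. p x) = 0" and up: "AE x in unit_leb. u x = prim p x" by blast
  have u1: "u \<in> H1" and wu: "AE x in unit_leb. weak_deriv u x = p x"
    using H1_primI[OF um ps, of 0] up by auto
  obtain \<rho> where \<rho>: "\<rho> \<in> test_functions" "(LINT x|unit_leb. \<rho> x) = 1" by (rule unit_mass_test)
  have "\<exists>q. q \<in> test_functions \<and> nrm unit_leb (\<lambda>x. p x - q x) < 1 / real (Suc n)" for n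
    using test_dense[OF ps, of "1 / real (Suc n)"] by (metis zero_less_divide_1_iff of_nat_0_less_iff zero_less_Suc)
  then obtain q where q: "\<And>n. q n \<in> test_functions" and qn: "\<And>n. nrm unit_leb (\<lambda>x. p x - q n x) < 1 / real (Suc n)"
    by metis
  have qs: "q n \<in> sq_int unit_leb" and \<rho>s: "\<rho> \<in> sq_int unit_leb" for n by (intro test_sq_int q \<rho>)+
  define m where "m n = (LINT x|unit_leb. q n x)" for n
  \<comment> \<open>Subtracting a multiple of \<open>\<rho>\<close> restores mean zero, so that the
    primitive of \<open>r n\<close> is a test function.\<close>
  define r where "r n x = q n x - m n * \<rho> x" for n x
  have r: "r n \<in> test_functions" for n unfolding r_def by (intro test_diff test_scale q \<rho>)
  have rs: "r n \<in> sq_int unit_leb" for n by (intro test_sq_int r)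
  have r0: "(LINT x|unit_leb. r n x) = 0" for n
    unfolding r_def using U.sq_int_integrable[OF qs] U.sq_int_integrable[OF \<rho>s] \<rho>(2) by (simp add: m_def)
  define \<phi> where "\<phi> n = prim (r n)" for n
  have t: "\<phi> n \<in> test_functions" "deriv (\<phi> n) = r n" for n
    unfolding \<phi>_def using test_antideriv[OF r r0] by auto
  \<comment> \<open>The 1 is for the approximation of \<open>p\<close> by \<open>q n\<close>, the
    norm of \<open>\<rho>\<close> for the mean correction; both errors are at most 1/(n+1) times
    these.\<close>
  define K where "K = 1 + nrm unit_leb \<rho>"
  have prn: "nrm unit_leb (\<lambda>x. p x - r n x) \<le> K * (1 / real (Suc n))" for n
  proof -
    have "\<bar>m n\<bar> \<le> nrm unit_leb (\<lambda>x. p x - q n x)"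
    proof -
      have "m n = - prim (\<lambda>x. p x - q n x) 1"
        using prim_1[of 1] p0 U.sq_int_integrable[OF ps] U.sq_int_integrable[OF qs] by (simp add: m_def)
      then show ?thesis using prim_nrm_bound[OF sq_int_diff[OF ps qs], of n 1] by simp
    qed
    then have m: "\<bar>m n\<bar> \<le> 1 / real (Suc n)" using qn[of n] by linarith
    have "nrm unit_leb (\<lambda>x. p x - r n x) = nrm unit_leb (\<lambda>x. (p x - q n x) + m n * \<rho> x)"
      by (simp add: r_def algebra_simps)
    also have "\<dots> \<le> nrm unit_leb (\<lambda>x. p x - q n x) + \<bar>m n\<bar> * nrm unit_leb \<rho>"
      using nrm_triangle[OF sq_int_diff[OF ps qs] sq_int_scale[OF \<rho>s]] nrm_scale[of unit_leb "m n" \<rho>] by metis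
    also have "\<dots> \<le> 1 / real (Suc n) + 1 / real (Suc n) * nrm unit_leb \<rho>"
      using qn[of n] m by (intro add_mono mult_right_mono) auto
    finally show ?thesis by (simp add: K_def algebra_simps)
  qed
  have H: "H1_norm (\<lambda>x. u x - \<phi> n x) \<le> 2 * (K * (1 / real (Suc n)))" for n
  proof -
    let ?s = "\<lambda>x. p x - r n x"
    have ss: "?s \<in> sq_int unit_leb" by (intro sq_int_diff ps rs)
    have sm: "(\<lambda>x. u x - \<phi> n x) \<in> borel_measurable unit_leb"
      using um sq_int_meas[OF test_sq_int[OF t(1)[of n]]] by measurable
    have "AE x in unit_leb. u x - \<phi> n x = 0 + prim ?s x"
      using up by eventually_elim (simp add: \<phi>_def prim_diff[OF U.sq_int_integrable[OF ps] U.sq_int_integrable[OF rs]])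
    note H1_primI[OF sm ss this] this
    then have "nrm unit_leb (weak_deriv (\<lambda>x. u x - \<phi> n x)) = nrm unit_leb ?s" 
      "nrm unit_leb (\<lambda>x. u x - \<phi> n x) = nrm unit_leb (prim ?s)"
      by (auto intro!: nrm_cong_AE sm sq_int_meas[OF ss] prim_meas U.sq_int_integrable ss sq_int_meas[OF H1D(2)])
    moreover have "nrm unit_leb (prim ?s) \<le> nrm unit_leb ?s"
      by (rule nrm_le_const) (use prim_nrm_bound[OF ss] ss in \<open>auto intro!: prim_meas U.sq_int_integrable\<close>)
    ultimately have "H1_norm (\<lambda>x. u x - \<phi> n x) \<le> nrm unit_leb ?s + nrm unit_leb ?s"
      unfolding H1_norm_def L2_norm_eq_nrm 
      using sqrt_sum_squares_le_sum[of "nrm unit_leb (prim ?s)" "nrm unit_leb ?s"] by simp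
    then show ?thesis using prn[of n] by simp
  qed
  have "(\<lambda>n. 2 * (K * (1 / real (Suc n)))) \<longlonglongrightarrow> 2 * (K * 0)"
    by (intro tendsto_intros LIMSEQ_Suc[OF lim_1_over_n])
  then have L: "(\<lambda>n. 2 * (K * (1 / real (Suc n)))) \<longlonglongrightarrow> 0" by simp
  have "(\<lambda>n. H1_norm (\<lambda>x. u x - \<phi> n x)) \<longlonglongrightarrow> 0"
    by (rule Lim_null_comparison[OF _ L]) (use H in \<open>auto simp: H1_norm_def\<close>)
  then show "u \<in> H10" using u1 t by (auto simp: H10_def)
qed

text \<open>\<open>G0\<close> inverts the second derivative under Dirichlet boundary conditions, and \<open>G1\<close> is 
  the derivative of \<open>G0\<close>.\<close>

definition G1 :: "(real \<Rightarrow> real) \<Rightarrow> real \<Rightarrow> real" where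
  "G1 w x = prim w x - (LINT y|unit_leb. (1 - y) * w y)"

definition G0 :: "(real \<Rightarrow> real) \<Rightarrow> real \<Rightarrow> real" where
  "G0 w = prim (G1 w)"

lemma weight_integrable:
  assumes w: "integrable unit_leb w" shows "integrable unit_leb (\<lambda>y. (1 - y) * w y)"
proof (rule Bochner_Integration.integrable_bound[OF w])
  note [measurable] = borel_measurable_integrable[OF w]
  show "(\<lambda>y. (1 - y) * w y) \<in> borel_measurable unit_leb" by measurable
  show "AE y in unit_leb. norm ((1 - y) * w y) \<le> norm (w y)"
    by (rule AE_I2) (auto simp: abs_mult intro!: mult_left_le_one_le)
qed

lemma G1_continuous: "integrable unit_leb w \<Longrightarrow> continuous_on S (G1 w)"
  unfolding G1_def by (intro continuous_intros prim_continuous)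

lemma G1_sq_int: "integrable unit_leb w \<Longrightarrow> G1 w \<in> sq_int unit_leb"
  by (intro cont_sq_int G1_continuous)

lemma G1_integrable: "integrable unit_leb w \<Longrightarrow> integrable unit_leb (G1 w)"
  by (rule U.sq_int_integrable[OF G1_sq_int])

lemma G0_continuous: "integrable unit_leb w \<Longrightarrow> continuous_on S (G0 w)"
  unfolding G0_def by (intro prim_continuous G1_integrable)

lemma G0_sq_int: "integrable unit_leb w \<Longrightarrow> G0 w \<in> sq_int unit_leb"
  by (intro cont_sq_int G0_continuous)

lemma weight_bound:
  assumes w: "integrable unit_leb w" 
  shows "\<bar>LINT y|unit_leb. (1 - y) * w y\<bar> \<le> (LINT y|unit_leb. \<bar>w y\<bar>)"
proof -
  have "\<bar>LINT y|unit_leb. (1 - y) * w y\<bar> \<le> (LINT y|unit_leb. \<bar>(1 - y) * w y\<bar>)" by (rule integral_abs_bound)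
  also have "\<dots> \<le> (LINT y|unit_leb. \<bar>w y\<bar>)"
    by (rule integral_mono[OF integrable_abs[OF weight_integrable[OF w]] integrable_abs[OF w]])
      (auto simp: abs_mult intro!: mult_left_le_one_le)
  finally show ?thesis .
qed

lemma G1_bound:
  assumes w: "integrable unit_leb w" 
  shows "\<bar>G1 w x\<bar> \<le> 2 * (LINT y|unit_leb. \<bar>w y\<bar>)"
  using weight_bound[OF w] prim_bound[OF w, of x] unfolding G1_def by linarith

lemma G0_bound:
  assumes w: "integrable unit_leb w" 
  shows "\<bar>G0 w x\<bar> \<le> 2 * (LINT y|unit_leb. \<bar>w y\<bar>)"
proof -
  have "\<bar>G0 w x\<bar> \<le> (LINT y|unit_leb. \<bar>G1 w y\<bar>)" unfolding G0_def by (rule prim_bound[OF G1_integrable[OF w]])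
  also have "\<dots> \<le> (LINT y|unit_leb. 2 * (LINT y|unit_leb. \<bar>w y\<bar>))"
    by (rule integral_mono) (use G1_integrable[OF w] G1_bound[OF w] in auto)
  finally show ?thesis by simp
qed

lemma prim_const: "x \<in> {0..1} \<Longrightarrow> prim (\<lambda>y. c) x = c * x"
  using prim_FTC[of "\<lambda>y. c * y" "\<lambda>y. c" x] by (auto intro!: derivative_eq_intros)

text \<open>Integration by parts against the constant 1, whose primitive is x. Hence the weighted
  integral subtracted in \<open>G1\<close> is the mean of \<open>prim w\<close>, and
  \<open>G0 w\<close> vanishes at 1 as well as at 0.\<close>

lemma integral_prim:
  assumes w: "integrable unit_leb w"
  shows "(LINT x|unit_leb. prim w x) = (LINT y|unit_leb. (1 - y) * w y)"
proof -
  have "(LINT x|unit_leb. prim w x) + (LINT x|unit_leb. prim (\<lambda>_. 1) x * w x) = (LINT x|unit_leb. w x)"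
    using prim_by_parts_full[of "\<lambda>_. 1" w] w by simp
  moreover have "(LINT x|unit_leb. prim (\<lambda>_. 1) x * w x) = (LINT x|unit_leb. x * w x)"
    by (rule Bochner_Integration.integral_cong) (auto simp: prim_const)
  moreover have "(LINT y|unit_leb. (1 - y) * w y) = (LINT x|unit_leb. w x) - (LINT x|unit_leb. x * w x)"
  proof -
    have "integrable unit_leb (\<lambda>y. w y - (1 - y) * w y)" using w weight_integrable[OF w] by simp
    then have "integrable unit_leb (\<lambda>y. y * w y)" by (simp add: left_diff_distrib)
    then show ?thesis using w by (simp add: left_diff_distrib)
  qed
  ultimately show ?thesis by simp
qed

lemma integral_G1:
  assumes w: "integrable unit_leb w"
  shows "(LINT x|unit_leb. G1 w x) = 0"
  unfolding G1_def using integral_prim[OF w] U.sq_int_integrable[OF prim_sq_int[OF w]] by simp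

lemma G1_diff:
  assumes "integrable unit_leb u" "integrable unit_leb w"
  shows "G1 (\<lambda>y. u y - w y) x = G1 u x - G1 w x"
proof -
  have "(LINT y|unit_leb. (1 - y) * (u y - w y)) = (LINT y|unit_leb. (1 - y) * u y) - (LINT y|unit_leb. (1 - y) * w y)"
    using weight_integrable assms by (simp add: right_diff_distrib)
  then show ?thesis unfolding G1_def by (simp add: prim_diff[OF assms])
qed

lemma G0_diff:
  assumes "integrable unit_leb u" "integrable unit_leb w"
  shows "G0 (\<lambda>y. u y - w y) x = G0 u x - G0 w x"
proof -
  have "G1 (\<lambda>y. u y - w y) = (\<lambda>x. G1 u x - G1 w x)" using G1_diff[OF assms] by blast
  then show ?thesis unfolding G0_def using prim_diff[OF G1_integrable G1_integrable, OF assms] by simp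
qed

lemma G0_H2_H10:
  assumes w: "w \<in> sq_int unit_leb"
  shows "G0 w \<in> H2 \<inter> H10" "AE x in unit_leb. weak_deriv (G0 w) x = G1 w x"
    "AE x in unit_leb. weak_deriv (weak_deriv (G0 w)) x = w x"
proof -
  have wi: "integrable unit_leb w" by (rule U.sq_int_integrable[OF w])
  have m: "G0 w \<in> borel_measurable unit_leb" by (rule sq_int_meas[OF G0_sq_int[OF wi]])
  have 1: "G0 w \<in> H1" "AE x in unit_leb. weak_deriv (G0 w) x = G1 w x"
    using H1_primI[OF m G1_sq_int[OF wi], of 0] by (simp_all add: G0_def)
  then show "AE x in unit_leb. weak_deriv (G0 w) x = G1 w x" by simp
  have "AE x in unit_leb. weak_deriv (G0 w) x = - (LINT y|unit_leb. (1 - y) * w y) + prim w x"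
    using 1(2) by eventually_elim (simp add: G1_def)
  note 2 = H1_primI[OF sq_int_meas[OF H1D(2)[OF 1(1)]] w this]
  then show "AE x in unit_leb. weak_deriv (weak_deriv (G0 w)) x = w x" by simp
  have "G0 w \<in> H10" unfolding H10_iff
    using m G1_sq_int[OF wi] integral_G1[OF wi] by (auto simp: G0_def intro!: bexI[of _ "G1 w"])
  then show "G0 w \<in> H2 \<inter> H10" using 1 2 by (auto simp: H2_def)
qed

text \<open>Integrating the second derivative leaves one constant in \<open>weak_deriv v\<close>;
  the boundary condition forces that derivative to have mean zero, which is the constant built into
  \<open>G1\<close>.\<close>

lemma H2_H10_rep:
  assumes v: "v \<in> H2" "v \<in> H10"
  defines "w \<equiv> weak_deriv (weak_deriv v)"
  shows "w \<in> sq_int unit_leb" "AE x in unit_leb. weak_deriv v x = G1 w x" "AE x in unit_leb. v x = G0 w x"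
proof -
  have v1: "v \<in> H1" "weak_deriv v \<in> H1" using v by (auto simp: H2_def)
  show w: "w \<in> sq_int unit_leb" unfolding w_def by (rule H1D[OF v1(2)])
  have wi: "integrable unit_leb w" by (rule U.sq_int_integrable[OF w])
  obtain c where c: "AE x in unit_leb. weak_deriv v x = c + prim w x"
    unfolding w_def by (rule H1_rep[OF v1(2)])
  obtain p where p: "p \<in> sq_int unit_leb" "(LINT x|unit_leb. p x) = 0" "AE x in unit_leb. v x = prim p x"
    using v(2) unfolding H10_iff by blast
  have pv: "AE x in unit_leb. weak_deriv v x = p x"
    using H1_primI(2)[of v p 0] p sq_int_meas[OF H1D(1)[OF v1(1)]] by simp
  have pc: "AE x in unit_leb. p x = c + prim w x" using c pv by eventually_elim simp
  have ps: "prim w \<in> sq_int unit_leb" by (rule prim_sq_int[OF wi])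
  have "(LINT x|unit_leb. p x) = (LINT x|unit_leb. c + prim w x)"
    by (rule integral_cong_AE[OF _ _ pc]) (intro sq_int_meas sq_int_add U.sq_int_const ps p)+
  also have "\<dots> = c + (LINT y|unit_leb. (1 - y) * w y)"
    using U.sq_int_integrable[OF ps] integral_prim[OF wi] by simp
  finally have c0: "c = - (LINT y|unit_leb. (1 - y) * w y)" using p(2) by simp
  show G: "AE x in unit_leb. weak_deriv v x = G1 w x" using c by eventually_elim (simp add: G1_def c0)
  have "AE x in unit_leb. p x = G1 w x" using G pv by eventually_elim simp
  then have "prim p x = G0 w x" for x
    unfolding G0_def by (rule prim_cong_AE) (intro sq_int_meas p G1_sq_int wi)+
  then show "AE x in unit_leb. v x = G0 w x" using p(3) by simp
qed

text \<open>The sup bounds for \<open>G0 w\<close> and \<open>G1 w\<close> give 4 + 4 + 1 times the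
  squared norm of \<open>w\<close>, so 5 is a comfortable constant. It transfers approximation of
  \<open>w\<close> to approximation of the velocity in \<open>H2_norm\<close>.\<close>

lemma H2_norm_G0:
  assumes w: "w \<in> sq_int unit_leb"
  shows "H2_norm (G0 w) = sqrt ((nrm unit_leb (G0 w))\<^sup>2 + (nrm unit_leb (G1 w))\<^sup>2 + (nrm unit_leb w)\<^sup>2)"
    "H2_norm (G0 w) \<le> 5 * nrm unit_leb w"
proof -
  have wi: "integrable unit_leb w" by (rule U.sq_int_integrable[OF w])
  have H: "G0 w \<in> H1" "weak_deriv (G0 w) \<in> H1" using G0_H2_H10(1)[OF w] by (auto simp: H2_def)
  have 1: "nrm unit_leb (weak_deriv (G0 w)) = nrm unit_leb (G1 w)"
    by (rule nrm_cong_AE[OF G0_H2_H10(2)[OF w]]) (intro sq_int_meas H1D H G1_sq_int wi)+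
  have 2: "nrm unit_leb (weak_deriv (weak_deriv (G0 w))) = nrm unit_leb w"
    by (rule nrm_cong_AE[OF G0_H2_H10(3)[OF w]]) (intro sq_int_meas H1D H w)+
  show e: "H2_norm (G0 w) = sqrt ((nrm unit_leb (G0 w))\<^sup>2 + (nrm unit_leb (G1 w))\<^sup>2 + (nrm unit_leb w)\<^sup>2)"
    unfolding H2_norm_def L2_norm_eq_nrm 1 2 ..
  have L: "(LINT y|unit_leb. \<bar>w y\<bar>) \<le> nrm unit_leb w" using U.sq_int_L1[OF w] by simp
  have b0: "nrm unit_leb (G0 w) \<le> 2 * nrm unit_leb w"
  proof (rule nrm_le_const[OF sq_int_meas[OF G0_sq_int[OF wi]]])
    have "\<bar>G0 w x\<bar> \<le> 2 * nrm unit_leb w" for x using G0_bound[OF wi, of x] L by linarith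
    then show "AE x in unit_leb. \<bar>G0 w x\<bar> \<le> 2 * nrm unit_leb w" by simp
  qed simp
  have b1: "nrm unit_leb (G1 w) \<le> 2 * nrm unit_leb w"
  proof (rule nrm_le_const[OF sq_int_meas[OF G1_sq_int[OF wi]]])
    have "\<bar>G1 w x\<bar> \<le> 2 * nrm unit_leb w" for x using G1_bound[OF wi, of x] L by linarith
    then show "AE x in unit_leb. \<bar>G1 w x\<bar> \<le> 2 * nrm unit_leb w" by simp
  qed simp
  have "(nrm unit_leb (G0 w))\<^sup>2 + (nrm unit_leb (G1 w))\<^sup>2 + (nrm unit_leb w)\<^sup>2 
    \<le> (2 * nrm unit_leb w)\<^sup>2 + (2 * nrm unit_leb w)\<^sup>2 + (nrm unit_leb w)\<^sup>2"
    by (intro add_mono power_mono b0 b1) auto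
  also have "\<dots> \<le> (5 * nrm unit_leb w)\<^sup>2" by (simp add: power_mult_distrib)
  finally show "H2_norm (G0 w) \<le> 5 * nrm unit_leb w" unfolding e by (intro real_le_lsqrt) auto
qed

section \<open>Functions on the unit square\<close>

lemma slice_meas:
  assumes "F \<in> borel_measurable unit_sq" "t \<in> {0<..<1}"
  shows "(\<lambda>x. F (t, x)) \<in> borel_measurable unit_leb"
  using measurable_compose[OF measurable_Pair1' assms(1), of t] assms(2) by simp

text \<open>Functions of (time, position). Square integrability is demanded of every time slice, not
  almost every one, so that slicewise operators such as \<open>G0\<close> can be applied without
  exceptional times; \<open>sq_int_regular\<close> supplies such representatives.\<close>

definition sqQ :: "(real \<times> real \<Rightarrow> real) set" where
  "sqQ = {F \<in> sq_int unit_sq. \<forall>t\<in>{0<..<1}. (\<lambda>x. F (t, x)) \<in> sq_int unit_leb}"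

lemma sqQ_sq_int: "F \<in> sqQ \<Longrightarrow> F \<in> sq_int unit_sq"
  by (simp add: sqQ_def)

lemma sqQ_meas: "F \<in> sqQ \<Longrightarrow> F \<in> borel_measurable unit_sq"
  by (simp add: sqQ_def sq_int_meas)

lemma sqQ_slice: "F \<in> sqQ \<Longrightarrow> t \<in> {0<..<1} \<Longrightarrow> (\<lambda>x. F (t, x)) \<in> sq_int unit_leb"
  by (simp add: sqQ_def)

lemma sqQ_slice_int: "F \<in> sqQ \<Longrightarrow> t \<in> {0<..<1} \<Longrightarrow> integrable unit_leb (\<lambda>x. F (t, x))"
  by (intro U.sq_int_integrable sqQ_slice)

lemma sqQ_add: "F \<in> sqQ \<Longrightarrow> G \<in> sqQ \<Longrightarrow> (\<lambda>p. F p + G p) \<in> sqQ"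
  by (simp add: sqQ_def sq_int_add)

lemma sqQ_diff: "F \<in> sqQ \<Longrightarrow> G \<in> sqQ \<Longrightarrow> (\<lambda>p. F p - G p) \<in> sqQ"
  by (simp add: sqQ_def sq_int_diff)

lemma integral_iterated:
  fixes F :: "real \<times> real \<Rightarrow> real"
  assumes "integrable unit_sq F"
  shows "(LINT p|unit_sq. F p) = (LINT t|unit_leb. LINT x|unit_leb. F (t, x))"
  using UU.integral_fst'[OF assms] by simp

text \<open>The times with a slice that is not square integrable form a measurable null set; on it
  the function is replaced by zero.\<close>

lemma sq_int_regular:
  assumes F: "F \<in> sq_int unit_sq"
  obtains G where "G \<in> sqQ" "AE p in unit_sq. G p = F p" 
    "AE t in unit_leb. \<forall>x. G (t, x) = F (t, x)"
proof -
  note [measurable] = sq_int_meas[OF F]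
  have [measurable]: "Measurable.pred unit_leb (\<lambda>t. integrable unit_leb (\<lambda>x. (F (t, x))\<^sup>2))"
    by measurable
  have [measurable]: "Measurable.pred unit_sq (\<lambda>p. integrable unit_leb (\<lambda>x. (F (fst p, x))\<^sup>2))"
    by measurable
  define G where "G p = (if integrable unit_leb (\<lambda>x. (F (fst p, x))\<^sup>2) then F p else 0)" for p
  have [measurable]: "G \<in> borel_measurable unit_sq" unfolding G_def by measurable
  have "AE t in unit_leb. integrable unit_leb (\<lambda>x. (F (t, x))\<^sup>2)"
    using UU.AE_integrable_fst'[OF sq_int_sq[OF F]] by simp
  then have A: "AE t in unit_leb. \<forall>x. G (t, x) = F (t, x)"
    by eventually_elim (simp add: G_def)
  have B: "AE p in unit_sq. G p = F p"
    by (subst UU.AE_pair_iff[symmetric, of "\<lambda>t x. G (t, x) = F (t, x)", simplified]) 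
      (use A in \<open>auto elim!: eventually_mono\<close>)
  have "G \<in> sq_int unit_sq" by (rule sq_int_cong_AE[OF F _ B]) measurable
  moreover have "(\<lambda>x. G (t, x)) \<in> sq_int unit_leb" if t: "t \<in> {0<..<1}" for t
  proof (cases "integrable unit_leb (\<lambda>x. (F (t, x))\<^sup>2)")
    case True
    then show ?thesis unfolding G_def using slice_meas[OF sq_int_meas[OF F] t] by (auto intro!: sq_intI)
  next
    case False
    then show ?thesis unfolding G_def by (simp add: sq_int_zero)
  qed
  ultimately have "G \<in> sqQ" by (simp add: sqQ_def)
  then show ?thesis using A B that by blast
qed

lemma nrm_slice_meas:
  assumes [measurable]: "F \<in> borel_measurable unit_sq"
  shows "(\<lambda>t. nrm unit_leb (\<lambda>x. F (t, x))) \<in> borel_measurable unit_leb"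
  unfolding nrm_def by measurable

lemma nrm_slice:
  assumes F: "F \<in> sq_int unit_sq"
  shows "(\<lambda>t. nrm unit_leb (\<lambda>x. F (t, x))) \<in> sq_int unit_leb"
    "nrm unit_leb (\<lambda>t. nrm unit_leb (\<lambda>x. F (t, x))) = nrm unit_sq F"
proof -
  have "integrable unit_leb (\<lambda>t. (nrm unit_leb (\<lambda>x. F (t, x)))\<^sup>2)"
    using UU.integrable_fst'[OF sq_int_sq[OF F]] by (simp add: nrm_sq)
  then show "(\<lambda>t. nrm unit_leb (\<lambda>x. F (t, x))) \<in> sq_int unit_leb"
    by (rule sq_intI[OF nrm_slice_meas[OF sq_int_meas[OF F]]])
  show "nrm unit_leb (\<lambda>t. nrm unit_leb (\<lambda>x. F (t, x))) = nrm unit_sq F"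
    unfolding nrm_def[of unit_sq] integral_iterated[OF sq_int_sq[OF F]]
    by (subst nrm_def) (simp add: nrm_sq)
qed

lemma sq_int_time:
  assumes a: "a \<in> sq_int unit_leb"
  shows "(\<lambda>p. a (fst p)) \<in> sq_int unit_sq" "nrm unit_sq (\<lambda>p. a (fst p)) = nrm unit_leb a"
proof -
  have m: "(\<lambda>p. a (fst p)) \<in> borel_measurable unit_sq"
    by (rule measurable_compose[OF measurable_fst sq_int_meas[OF a]])
  have "integrable unit_sq (\<lambda>p. (a (fst p))\<^sup>2)"
    using integrable_tensor[OF sq_int_sq[OF a], of "\<lambda>_. 1"] by (simp add: case_prod_unfold)
  then show s: "(\<lambda>p. a (fst p)) \<in> sq_int unit_sq" by (intro sq_intI m)
  show "nrm unit_sq (\<lambda>p. a (fst p)) = nrm unit_leb a"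
    unfolding nrm_def[of unit_sq] integral_iterated[OF sq_int_sq[OF s]] by (simp add: nrm_def)
qed

lemma sq_int_space:
  assumes a: "a \<in> sq_int unit_leb"
  shows "(\<lambda>p. a (snd p)) \<in> sqQ"
proof -
  have m: "(\<lambda>p. a (snd p)) \<in> borel_measurable unit_sq"
    by (rule measurable_compose[OF measurable_snd sq_int_meas[OF a]])
  have "integrable unit_sq (\<lambda>p. (a (snd p))\<^sup>2)"
    using integrable_tensor[OF _ sq_int_sq[OF a], of "\<lambda>_. 1"] by (simp add: case_prod_unfold)
  then have "(\<lambda>p. a (snd p)) \<in> sq_int unit_sq" by (intro sq_intI m)
  then show "(\<lambda>p. a (snd p)) \<in> sqQ" using a by (simp add: sqQ_def)
qed

lemma AE_Q_I: 
  assumes "\<And>t x. t \<in> {0<..<1} \<Longrightarrow> x \<in> {0<..<1} \<Longrightarrow> P (t, x)"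
  shows "AE p in unit_sq. P p"
  by (rule AE_I2) (use assms in \<open>auto simp: space_pair_measure\<close>)

lemma sqQ_dominated:
  assumes m: "F \<in> borel_measurable unit_sq" and a: "a \<in> sq_int unit_leb"
    and le: "\<And>t x. t \<in> {0<..<1} \<Longrightarrow> x \<in> {0<..<1} \<Longrightarrow> \<bar>F (t, x)\<bar> \<le> a t"
  shows "F \<in> sqQ" "nrm unit_sq F \<le> nrm unit_leb a"
proof -
  note A = sq_int_time[OF a]
  have le2: "AE p in unit_sq. (F p)\<^sup>2 \<le> (a (fst p))\<^sup>2"
  proof (rule AE_Q_I)
    fix t x :: real assume "t \<in> {0<..<1}" "x \<in> {0<..<1}"
    from le[OF this] show "(F (t, x))\<^sup>2 \<le> (a (fst (t, x)))\<^sup>2" 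
      by (simp add: abs_le_square_iff[symmetric])
  qed
  have i: "integrable unit_sq (\<lambda>p. (F p)\<^sup>2)"
    by (rule Bochner_Integration.integrable_bound[OF sq_int_sq[OF A(1)]]) (use m le2 in auto)
  then have s: "F \<in> sq_int unit_sq" by (intro sq_intI m)
  have "(\<lambda>x. F (t, x)) \<in> sq_int unit_leb" if "t \<in> {0<..<1}" for t
    by (rule U.sq_int_bounded[where C="a t", OF slice_meas[OF m that]]) (use le[OF that] in auto)
  then show "F \<in> sqQ" using s by (simp add: sqQ_def)
  have "(LINT p|unit_sq. (F p)\<^sup>2) \<le> (LINT p|unit_sq. (a (fst p))\<^sup>2)"
    by (rule integral_mono_AE[OF i sq_int_sq[OF A(1)] le2])
  then have "nrm unit_sq F \<le> nrm unit_sq (\<lambda>p. a (fst p))" unfolding nrm_def by (rule real_sqrt_le_mono)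
  then show "nrm unit_sq F \<le> nrm unit_leb a" unfolding A(2) .
qed

text \<open>Cauchy-Schwarz is applied in space only. Keeping the time norms separate allows the
  pairing of a bound uniform in time with one integrable in time.\<close>

lemma mixed_cauchy_schwarz:
  assumes F: "F \<in> sqQ" and G: "G \<in> sqQ"
  shows "\<bar>LINT p|unit_sq. F p * G p\<bar> \<le> 
    (LINT t|unit_leb. nrm unit_leb (\<lambda>x. F (t, x)) * nrm unit_leb (\<lambda>x. G (t, x)))"
proof -
  have i: "integrable unit_sq (\<lambda>p. F p * G p)" by (intro sq_int_mult sqQ_sq_int F G)
  have "(LINT p|unit_sq. F p * G p) = (LINT t|unit_leb. LINT x|unit_leb. F (t, x) * G (t, x))"
    by (rule integral_iterated[OF i])
  also have "\<bar>\<dots>\<bar> \<le> (LINT t|unit_leb. \<bar>LINT x|unit_leb. F (t, x) * G (t, x)\<bar>)"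
    by (rule integral_abs_bound)
  also have "\<dots> \<le> (LINT t|unit_leb. nrm unit_leb (\<lambda>x. F (t, x)) * nrm unit_leb (\<lambda>x. G (t, x)))"
  proof (rule integral_mono)
    show "integrable unit_leb (\<lambda>t. \<bar>LINT x|unit_leb. F (t, x) * G (t, x)\<bar>)"
      using UU.integrable_fst'[OF i] by simp
    show "integrable unit_leb (\<lambda>t. nrm unit_leb (\<lambda>x. F (t, x)) * nrm unit_leb (\<lambda>x. G (t, x)))"
      by (intro sq_int_mult nrm_slice sqQ_sq_int F G)
    show "\<bar>LINT x|unit_leb. F (t, x) * G (t, x)\<bar> \<le> nrm unit_leb (\<lambda>x. F (t, x)) * nrm unit_leb (\<lambda>x. G (t, x))"
      if "t \<in> space unit_leb" for t
      using that by (intro cauchy_schwarz sqQ_slice F G) auto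
  qed
  finally show ?thesis .
qed

section \<open>Slicewise primitives and the velocity on the square\<close>

definition PX :: "(real \<times> real \<Rightarrow> real) \<Rightarrow> real \<times> real \<Rightarrow> real" where
  "PX F p = prim (\<lambda>y. F (fst p, y)) (snd p)"

text \<open>For the velocity v with v_xx = \<open>w\<close>, \<open>V1 w\<close> is v_x and
  \<open>V0 w\<close> is v.\<close>

definition V1 :: "(real \<times> real \<Rightarrow> real) \<Rightarrow> real \<times> real \<Rightarrow> real" where
  "V1 w p = G1 (\<lambda>y. w (fst p, y)) (snd p)"

definition V0 :: "(real \<times> real \<Rightarrow> real) \<Rightarrow> real \<times> real \<Rightarrow> real" where
  "V0 w p = G0 (\<lambda>y. w (fst p, y)) (snd p)"

text \<open>The truncated integrand is measurable on the product of the square with a third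
  interval, so integrating out the last variable leaves a jointly measurable function.\<close>

lemma PX_meas:
  assumes [measurable]: "F \<in> borel_measurable unit_sq"
  shows "PX F \<in> borel_measurable unit_sq"
proof -
  have [measurable]: "(\<lambda>q. snd (fst q)) \<in> borel_measurable (unit_sq \<Otimes>\<^sub>M unit_leb)"
    by (rule measurable_compose[OF measurable_fst meas_snd])
  have [measurable]: "(\<lambda>q. snd q) \<in> borel_measurable (unit_sq \<Otimes>\<^sub>M unit_leb)"
    by (rule measurable_compose[OF measurable_snd meas_id])
  have [measurable]: "(\<lambda>q. F (fst (fst q), snd q)) \<in> borel_measurable (unit_sq \<Otimes>\<^sub>M unit_leb)"
    by measurable
  have "(\<lambda>q. if snd q < snd (fst q) then F (fst (fst q), snd q) else 0) \<in> borel_measurable (unit_sq \<Otimes>\<^sub>M unit_leb)"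
    by measurable
  then have "(\<lambda>(p, y). if y < snd p then F (fst p, y) else 0) \<in> borel_measurable (unit_sq \<Otimes>\<^sub>M unit_leb)"
    by (simp add: case_prod_unfold)
  from U.borel_measurable_lebesgue_integral[OF this] show ?thesis
    by (simp add: PX_def[abs_def] prim_def)
qed

lemma V1_meas:
  assumes F [measurable]: "w \<in> borel_measurable unit_sq"
  shows "V1 w \<in> borel_measurable unit_sq"
proof -
  have [measurable]: "(\<lambda>q. snd q) \<in> borel_measurable (unit_sq \<Otimes>\<^sub>M unit_leb)"
    by (rule measurable_compose[OF measurable_snd meas_id])
  have [measurable]: "(\<lambda>q. w (fst (fst q), snd q)) \<in> borel_measurable (unit_sq \<Otimes>\<^sub>M unit_leb)"
    by measurable
  have "(\<lambda>q. (1 - snd q) * w (fst (fst q), snd q)) \<in> borel_measurable (unit_sq \<Otimes>\<^sub>M unit_leb)"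
    by measurable
  then have "(\<lambda>(p, y). (1 - y) * w (fst p, y)) \<in> borel_measurable (unit_sq \<Otimes>\<^sub>M unit_leb)"
    by (simp add: case_prod_unfold)
  from U.borel_measurable_lebesgue_integral[OF this] PX_meas[OF F] show ?thesis
    unfolding V1_def[abs_def] G1_def PX_def[abs_def] by measurable
qed

lemma V0_PX: "V0 w = PX (V1 w)"
  by (simp add: fun_eq_iff V0_def PX_def G0_def V1_def)

lemma V0_meas: "w \<in> borel_measurable unit_sq \<Longrightarrow> V0 w \<in> borel_measurable unit_sq"
  unfolding V0_PX by (intro PX_meas V1_meas)

lemma L1_le_nrm: "u \<in> sq_int unit_leb \<Longrightarrow> (LINT y|unit_leb. \<bar>u y\<bar>) \<le> nrm unit_leb u"
  using U.sq_int_L1[of u] by simp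

text \<open>Sup bounds in space by the norm of \<open>w\<close> at the same time: v and v_x are
  bounded functions of position, with a bound square integrable in time. All later energy estimates
  live on this.\<close>

lemma V_bound:
  assumes w: "w \<in> sqQ" and t: "t \<in> {0<..<1}"
  shows "\<bar>V1 w (t, x)\<bar> \<le> 2 * nrm unit_leb (\<lambda>y. w (t, y))" "\<bar>V0 w (t, x)\<bar> \<le> 2 * nrm unit_leb (\<lambda>y. w (t, y))"
  using G1_bound[OF sqQ_slice_int[OF w t], of x] G0_bound[OF sqQ_slice_int[OF w t], of x] L1_le_nrm[OF sqQ_slice[OF w t]]
  unfolding V1_def V0_def by auto

lemma V_sqQ:
  assumes w: "w \<in> sqQ"
  shows "V1 w \<in> sqQ" "V0 w \<in> sqQ"
proof -
  note a = sq_int_scale[OF nrm_slice(1)[OF sqQ_sq_int[OF w]], of 2]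
  show "V1 w \<in> sqQ"
    using sqQ_dominated[OF V1_meas[OF sqQ_meas[OF w]] a V_bound(1)[OF w]] by auto
  show "V0 w \<in> sqQ"
    using sqQ_dominated[OF V0_meas[OF sqQ_meas[OF w]] a V_bound(2)[OF w]] by auto
qed

section \<open>Smooth functions on the closed square\<close>

text \<open>Test functions take the position first, functions on the square take the time first.
  \<open>sw\<close>, \<open>dx\<close> and \<open>dt\<close> all deliver functions in the second
  convention.\<close>

definition sw :: "(real \<times> real \<Rightarrow> real) \<Rightarrow> real \<times> real \<Rightarrow> real" where
  "sw \<phi> p = \<phi> (snd p, fst p)"

definition dx :: "(real \<times> real \<Rightarrow> real) \<Rightarrow> real \<times> real \<Rightarrow> real" where
  "dx \<phi> p = deriv (\<lambda>y. \<phi> (y, fst p)) (snd p)"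

definition dt :: "(real \<times> real \<Rightarrow> real) \<Rightarrow> real \<times> real \<Rightarrow> real" where
  "dt \<phi> p = deriv (\<lambda>s. \<phi> (snd p, s)) (fst p)"

text \<open>The first-order content of \<open>smooth_square\<close>. The one-sided derivatives exist
  on the closed intervals, while the two-sided \<open>deriv\<close> agrees with them only in the
  interior of the variable of differentiation; hence the mixture of open and closed intervals in the
  last two clauses.\<close>

definition C1_data :: "(real \<times> real \<Rightarrow> real) \<Rightarrow> (real \<times> real \<Rightarrow> real) \<Rightarrow> (real \<times> real \<Rightarrow> real) \<Rightarrow> bool" where
  "C1_data \<phi> \<phi>x \<phi>t \<longleftrightarrow>
    continuous_on ({0..1} \<times> {0..1}) \<phi> \<and> continuous_on ({0..1} \<times> {0..1}) \<phi>x \<and> continuous_on ({0..1} \<times> {0..1}) \<phi>t \<and>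
    (\<forall>x\<in>{0..1}. \<forall>t\<in>{0..1}. ((\<lambda>y. \<phi> (y, t)) has_real_derivative \<phi>x (x, t)) (at x within {0..1})) \<and>
    (\<forall>x\<in>{0..1}. \<forall>t\<in>{0..1}. ((\<lambda>s. \<phi> (x, s)) has_real_derivative \<phi>t (x, t)) (at t within {0..1})) \<and>
    (\<forall>x\<in>{0<..<1}. \<forall>t\<in>{0..1}. dx \<phi> (t, x) = \<phi>x (x, t)) \<and>
    (\<forall>x\<in>{0..1}. \<forall>t\<in>{0<..<1}. dt \<phi> (t, x) = \<phi>t (x, t))"

lemma C1_dataD:
  assumes "C1_data \<phi> \<phi>x \<phi>t"
  shows "continuous_on ({0..1} \<times> {0..1}) \<phi>" "continuous_on ({0..1} \<times> {0..1}) \<phi>x" "continuous_on ({0..1} \<times> {0..1}) \<phi>t"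
    "\<And>x t. x \<in> {0..1} \<Longrightarrow> t \<in> {0..1} \<Longrightarrow> ((\<lambda>y. \<phi> (y, t)) has_real_derivative \<phi>x (x, t)) (at x within {0..1})"
    "\<And>x t. x \<in> {0..1} \<Longrightarrow> t \<in> {0..1} \<Longrightarrow> ((\<lambda>s. \<phi> (x, s)) has_real_derivative \<phi>t (x, t)) (at t within {0..1})"
    "\<And>x t. x \<in> {0<..<1} \<Longrightarrow> t \<in> {0..1} \<Longrightarrow> dx \<phi> (t, x) = \<phi>x (x, t)"
    "\<And>x t. x \<in> {0..1} \<Longrightarrow> t \<in> {0<..<1} \<Longrightarrow> dt \<phi> (t, x) = \<phi>t (x, t)"
  using assms unfolding C1_data_def by blast+

lemma smooth_square_C1:
  assumes "\<phi> \<in> smooth_square"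
  shows "\<exists>\<phi>x \<phi>t. C1_data \<phi> \<phi>x \<phi>t"
proof -
  let ?S = "{0..1} \<times> {0..1} :: (real \<times> real) set"
  obtain D where D0: "\<And>p. p \<in> ?S \<Longrightarrow> D 0 0 p = \<phi> p"
    and D: "\<And>i j p. p \<in> ?S \<Longrightarrow> (D i j has_derivative (\<lambda>(h, k). D (Suc i) j p * h + D i (Suc j) p * k)) (at p within ?S)"
    using assms unfolding smooth_square_def by blast
  have cont: "continuous_on ?S (D i j)" for i j
    by (rule has_derivative_continuous_on[OF D])
  have Dphi: "(\<phi> has_derivative (\<lambda>(h, k). D (Suc 0) 0 p * h + D 0 (Suc 0) p * k)) (at p within ?S)" if "p \<in> ?S" for p
    by (rule has_derivative_transform[OF that _ D[OF that]]) (use D0 in auto)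
  have X: "((\<lambda>y. \<phi> (y, t)) has_real_derivative D (Suc 0) 0 (x, t)) (at x within {0..1})"
    if "x \<in> {0..1}" "t \<in> {0..1}" for x t
  proof -
    have g: "((\<lambda>y. (y, t)) has_derivative (\<lambda>h. (h, 0))) (at x within {0..1})"
      by (auto intro!: derivative_eq_intros)
    have "(\<phi> has_derivative (\<lambda>(h, k). D (Suc 0) 0 (x, t) * h + D 0 (Suc 0) (x, t) * k)) (at (x, t) within (\<lambda>y. (y, t)) ` {0..1})"
      by (rule has_derivative_subset[OF Dphi]) (use that in auto)
    from has_derivative_in_compose[OF g this] show ?thesis
      by (simp add: has_field_derivative_def)
  qed
  have T: "((\<lambda>s. \<phi> (x, s)) has_real_derivative D 0 (Suc 0) (x, t)) (at t within {0..1})"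
    if "x \<in> {0..1}" "t \<in> {0..1}" for x t
  proof -
    have g: "((\<lambda>s. (x, s)) has_derivative (\<lambda>h. (0, h))) (at t within {0..1})"
      by (auto intro!: derivative_eq_intros)
    have "(\<phi> has_derivative (\<lambda>(h, k). D (Suc 0) 0 (x, t) * h + D 0 (Suc 0) (x, t) * k)) (at (x, t) within (\<lambda>s. (x, s)) ` {0..1})"
      by (rule has_derivative_subset[OF Dphi]) (use that in auto)
    from has_derivative_in_compose[OF g this] show ?thesis
      by (simp add: has_field_derivative_def)
  qed
  have X': "dx \<phi> (t, x) = D (Suc 0) 0 (x, t)" if "x \<in> {0<..<1}" "t \<in> {0..1}" for x t
    unfolding dx_def using X[of x t] that by (auto intro!: DERIV_imp_deriv simp: at_within_Icc_at)
  have T': "dt \<phi> (t, x) = D 0 (Suc 0) (x, t)" if "x \<in> {0..1}" "t \<in> {0<..<1}" for x t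
    unfolding dt_def using T[of x t] that by (auto intro!: DERIV_imp_deriv simp: at_within_Icc_at)
  have "continuous_on ?S \<phi>" using cont[of 0 0] D0 by (simp cong: continuous_on_cong)
  then have "C1_data \<phi> (D (Suc 0) 0) (D 0 (Suc 0))"
    unfolding C1_data_def by (intro conjI ballI cont X T X' T')
  then show ?thesis by blast
qed

lemma cont_square_meas:
  fixes f :: "real \<times> real \<Rightarrow> real"
  assumes c: "continuous_on ({0..1} \<times> {0..1}) f"
  shows "(\<lambda>p. f (snd p, fst p)) \<in> borel_measurable unit_sq"
proof -
  have m: "(\<lambda>q. indicator ({0..1} \<times> {0..1}) q *\<^sub>R f q) \<in> borel_measurable borel"
    by (rule borel_measurable_continuous_on_indicator[OF _ c]) (auto intro: borel_closed closed_Times)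
  have "(\<lambda>p. (snd p, fst p)) \<in> unit_sq \<rightarrow>\<^sub>M (borel :: (real \<times> real) measure)"
    unfolding borel_prod[symmetric] by measurable
  from measurable_compose[OF this m]
  have "(\<lambda>p. indicator ({0..1} \<times> {0..1}) (snd p, fst p) *\<^sub>R f (snd p, fst p)) \<in> borel_measurable unit_sq" .
  then show ?thesis
    by (rule measurable_cong[THEN iffD1, rotated]) (auto simp: space_pair_measure indicator_def)
qed

lemma cont_square_bounded:
  fixes f :: "real \<times> real \<Rightarrow> real"
  assumes c: "continuous_on ({0..1} \<times> {0..1}) f"
  obtains C where "\<And>x t. x \<in> {0..1} \<Longrightarrow> t \<in> {0..1} \<Longrightarrow> \<bar>f (x, t)\<bar> \<le> C"
proof -
  have "compact ({0..1} \<times> {0..1} :: (real \<times> real) set)" by (intro compact_Times) auto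
  then have "bounded (f ` ({0..1} \<times> {0..1}))" using c by (intro compact_imp_bounded compact_continuous_image) 
  then obtain C where "\<forall>p\<in>{0..1} \<times> {0..1}. \<bar>f p\<bar> \<le> C" unfolding bounded_iff by auto
  then show ?thesis using that[of C] by blast
qed

lemma cont_square_slices:
  fixes f :: "real \<times> real \<Rightarrow> real"
  assumes "continuous_on ({0..1} \<times> {0..1}) f"
  shows "t \<in> {0..1} \<Longrightarrow> continuous_on {0..1} (\<lambda>x. f (x, t))" "x \<in> {0..1} \<Longrightarrow> continuous_on {0..1} (\<lambda>t. f (x, t))"
  by (auto intro!: continuous_on_compose2[OF assms] continuous_intros)

lemma smooth_square_bounded:
  assumes "\<phi> \<in> smooth_square"
  obtains C where "C \<ge> 0" "\<And>x t. x \<in> {0..1} \<Longrightarrow> t \<in> {0..1} \<Longrightarrow> \<bar>\<phi> (x, t)\<bar> \<le> C"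
   "\<And>x t. x \<in> {0<..<1} \<Longrightarrow> t \<in> {0<..<1} \<Longrightarrow> \<bar>dx \<phi> (t, x)\<bar> \<le> C"
   "\<And>x t. x \<in> {0<..<1} \<Longrightarrow> t \<in> {0<..<1} \<Longrightarrow> \<bar>dt \<phi> (t, x)\<bar> \<le> C"
proof -
  obtain \<phi>x \<phi>t where C: "C1_data \<phi> \<phi>x \<phi>t"
    using smooth_square_C1[OF assms] by blast
  note c = C1_dataD(1-3)[OF C] and x = C1_dataD(6)[OF C] and t = C1_dataD(7)[OF C]
  obtain A where A: "\<And>x t. x \<in> {0..1} \<Longrightarrow> t \<in> {0..1} \<Longrightarrow> \<bar>\<phi> (x, t)\<bar> \<le> A" using cont_square_bounded[OF c(1)] by blast
  obtain B where B: "\<And>x t. x \<in> {0..1} \<Longrightarrow> t \<in> {0..1} \<Longrightarrow> \<bar>\<phi>x (x, t)\<bar> \<le> B" using cont_square_bounded[OF c(2)] by blast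
  obtain E where E: "\<And>x t. x \<in> {0..1} \<Longrightarrow> t \<in> {0..1} \<Longrightarrow> \<bar>\<phi>t (x, t)\<bar> \<le> E" using cont_square_bounded[OF c(3)] by blast
  define C where "C = max A (max B E)"
  have "C \<ge> 0" using A[of 0 0] unfolding C_def by auto
  moreover have "\<bar>\<phi> (x, t)\<bar> \<le> C" if "x \<in> {0..1}" "t \<in> {0..1}" for x t using A[OF that] unfolding C_def by auto
  moreover have "\<bar>dx \<phi> (t, x)\<bar> \<le> C" if "x \<in> {0<..<1}" "t \<in> {0<..<1}" for x t 
    using B[of x t] that x[of x t] unfolding C_def by auto
  moreover have "\<bar>dt \<phi> (t, x)\<bar> \<le> C" if "x \<in> {0<..<1}" "t \<in> {0<..<1}" for x t 
    using E[of x t] that t[of x t] unfolding C_def by auto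
  ultimately show ?thesis using that by blast
qed

lemma smooth_square_meas:
  assumes "\<phi> \<in> smooth_square"
  shows "sw \<phi> \<in> borel_measurable unit_sq" "dx \<phi> \<in> borel_measurable unit_sq" "dt \<phi> \<in> borel_measurable unit_sq"
proof -
  obtain \<phi>x \<phi>t where C: "C1_data \<phi> \<phi>x \<phi>t"
    using smooth_square_C1[OF assms] by blast
  note c = C1_dataD(1-3)[OF C] and x = C1_dataD(6)[OF C] and t = C1_dataD(7)[OF C]
  show "sw \<phi> \<in> borel_measurable unit_sq" using cont_square_meas[OF c(1)] by (simp add: sw_def[abs_def])
  show "dx \<phi> \<in> borel_measurable unit_sq"
    using cont_square_meas[OF c(2)] by (rule measurable_cong[THEN iffD1, rotated]) (auto simp: space_pair_measure x)
  show "dt \<phi> \<in> borel_measurable unit_sq"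
    using cont_square_meas[OF c(3)] by (rule measurable_cong[THEN iffD1, rotated]) (auto simp: space_pair_measure t)
qed

lemma smooth_square_sqQ:
  assumes "\<phi> \<in> smooth_square"
  shows "sw \<phi> \<in> sqQ" "dx \<phi> \<in> sqQ" "dt \<phi> \<in> sqQ"
proof -
  obtain C where C: "C \<ge> 0" "\<And>x t. x \<in> {0..1} \<Longrightarrow> t \<in> {0..1} \<Longrightarrow> \<bar>\<phi> (x, t)\<bar> \<le> C"
   "\<And>x t. x \<in> {0<..<1} \<Longrightarrow> t \<in> {0<..<1} \<Longrightarrow> \<bar>dx \<phi> (t, x)\<bar> \<le> C"
   "\<And>x t. x \<in> {0<..<1} \<Longrightarrow> t \<in> {0<..<1} \<Longrightarrow> \<bar>dt \<phi> (t, x)\<bar> \<le> C"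
    using smooth_square_bounded[OF assms] by blast
  note m = smooth_square_meas[OF assms]
  show "sw \<phi> \<in> sqQ" by (rule sqQ_dominated[OF m(1) U.sq_int_const[of C]]) (use C in \<open>auto simp: sw_def\<close>)
  show "dx \<phi> \<in> sqQ" by (rule sqQ_dominated[OF m(2) U.sq_int_const[of C]]) (use C in auto)
  show "dt \<phi> \<in> sqQ" by (rule sqQ_dominated[OF m(3) U.sq_int_const[of C]]) (use C in auto)
qed

lemma smooth_square_slice_sq_int:
  assumes "\<phi> \<in> smooth_square" "t \<in> {0..1}" shows "(\<lambda>x. \<phi> (x, t)) \<in> sq_int unit_leb"
proof -
  obtain \<phi>x \<phi>t where "C1_data \<phi> \<phi>x \<phi>t"
    using smooth_square_C1[OF assms(1)] by blast
  then show ?thesis by (intro cont_sq_int cont_square_slices(1) assms(2) C1_dataD(1))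
qed

lemma prim_cong:
  assumes "\<And>y. y \<in> {0<..<1} \<Longrightarrow> f y = g y" shows "prim f x = prim g x"
  unfolding prim_def by (rule Bochner_Integration.integral_cong) (use assms in auto)

lemma smooth_square_FTC_x:
  assumes "\<phi> \<in> smooth_square" "t \<in> {0..1}" "x \<in> {0..1}"
  shows "prim (\<lambda>y. dx \<phi> (t, y)) x = \<phi> (x, t) - \<phi> (0, t)"
proof -
  obtain \<phi>x \<phi>t where C: "C1_data \<phi> \<phi>x \<phi>t"
    using smooth_square_C1[OF assms(1)] by blast
  note c = C1_dataD(2)[OF C] and d = C1_dataD(4)[OF C] and t = C1_dataD(6)[OF C]
  have "prim (\<lambda>y. dx \<phi> (t, y)) x = prim (\<lambda>y. \<phi>x (y, t)) x"
    by (rule prim_cong) (use t assms in auto)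
  also have "\<dots> = \<phi> (x, t) - \<phi> (0, t)"
    by (rule prim_FTC[OF d]) (use assms cont_square_slices(1)[OF c] in auto)
  finally show ?thesis .
qed

lemma smooth_square_lincomb:
  assumes "\<phi> \<in> smooth_square" "\<psi> \<in> smooth_square"
  shows "(\<lambda>p. \<phi> p + c * \<psi> p) \<in> smooth_square"
    "\<And>t x. t \<in> {0<..<1} \<Longrightarrow> x \<in> {0<..<1} \<Longrightarrow> dx (\<lambda>p. \<phi> p + c * \<psi> p) (t, x) = dx \<phi> (t, x) + c * dx \<psi> (t, x)"
    "\<And>t x. t \<in> {0<..<1} \<Longrightarrow> x \<in> {0<..<1} \<Longrightarrow> dt (\<lambda>p. \<phi> p + c * \<psi> p) (t, x) = dt \<phi> (t, x) + c * dt \<psi> (t, x)"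
proof -
  let ?S = "{0..1} \<times> {0..1} :: (real \<times> real) set"
  obtain D where D: "\<And>p. p \<in> ?S \<Longrightarrow> D 0 0 p = \<phi> p"
    "\<And>i j p. p \<in> ?S \<Longrightarrow> (D i j has_derivative (\<lambda>(h, k). D (Suc i) j p * h + D i (Suc j) p * k)) (at p within ?S)"
    using assms(1) unfolding smooth_square_def by blast
  obtain E where E: "\<And>p. p \<in> ?S \<Longrightarrow> E 0 0 p = \<psi> p"
    "\<And>i j p. p \<in> ?S \<Longrightarrow> (E i j has_derivative (\<lambda>(h, k). E (Suc i) j p * h + E i (Suc j) p * k)) (at p within ?S)"
    using assms(2) unfolding smooth_square_def by blast
  have "((\<lambda>p. D i j p + c * E i j p) has_derivative 
      (\<lambda>(h, k). (D (Suc i) j p + c * E (Suc i) j p) * h + (D i (Suc j) p + c * E i (Suc j) p) * k)) (at p within ?S)"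
    if "p \<in> ?S" for i j p
    by (rule has_derivative_eq_rhs[OF has_derivative_add[OF D(2)[OF that] has_derivative_mult_right[OF E(2)[OF that], of c]]])
      (auto simp: fun_eq_iff algebra_simps)
  then show "(\<lambda>p. \<phi> p + c * \<psi> p) \<in> smooth_square"
    unfolding smooth_square_def using D(1) E(1) by (intro CollectI exI[of _ "\<lambda>i j p. D i j p + c * E i j p"]) auto
  fix t x :: real assume tx: "t \<in> {0<..<1}" "x \<in> {0<..<1}"
  obtain \<phi>x \<phi>t where C: "C1_data \<phi> \<phi>x \<phi>t"
    using smooth_square_C1[OF assms(1)] by blast
  note p = C1_dataD(4-7)[OF C]
  obtain \<psi>x \<psi>t where C2: "C1_data \<psi> \<psi>x \<psi>t"
    using smooth_square_C1[OF assms(2)] by blast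
  note q = C1_dataD(4-7)[OF C2]
  have A: "((\<lambda>y. \<phi> (y, t)) has_real_derivative \<phi>x (x, t)) (at x)" "((\<lambda>y. \<psi> (y, t)) has_real_derivative \<psi>x (x, t)) (at x)"
    "((\<lambda>s. \<phi> (x, s)) has_real_derivative \<phi>t (x, t)) (at t)" "((\<lambda>s. \<psi> (x, s)) has_real_derivative \<psi>t (x, t)) (at t)"
    using p(1,2)[of x t] q(1,2)[of x t] tx at_within_Icc_at[of 0 x 1] at_within_Icc_at[of 0 t 1] by auto
  show "dx (\<lambda>p. \<phi> p + c * \<psi> p) (t, x) = dx \<phi> (t, x) + c * dx \<psi> (t, x)"
    using p(3)[of x t] q(3)[of x t] tx DERIV_imp_deriv[OF DERIV_add[OF A(1) DERIV_cmult[OF A(2), of c]]]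
    by (simp add: dx_def)
  show "dt (\<lambda>p. \<phi> p + c * \<psi> p) (t, x) = dt \<phi> (t, x) + c * dt \<psi> (t, x)"
    using p(4)[of x t] q(4)[of x t] tx DERIV_imp_deriv[OF DERIV_add[OF A(3) DERIV_cmult[OF A(4), of c]]]
    by (simp add: dt_def)
qed

text \<open>Products of a polynomial in space and one in time are the only test functions needed in
  explicit form: their moments determine square integrable functions.\<close>

lemma poly_tensor_smooth:
  "(\<lambda>(x, t). poly p x * poly q t) \<in> smooth_square"
  "dx (\<lambda>(x, t). poly p x * poly q t) (t, x) = poly (pderiv p) x * poly q t"
  "dt (\<lambda>(x, t). poly p x * poly q t) (t, x) = poly p x * poly (pderiv q) t"
proof -
  define D where "D i j = (\<lambda>r. poly ((pderiv ^^ i) p) (fst r) * poly ((pderiv ^^ j) q) (snd r))" for i j :: nat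
  have poly_d: "(poly r has_derivative (\<lambda>h. poly (pderiv r) y * h)) (at y within S)" for r :: "real poly" and y S
    using has_field_derivative_at_within[OF poly_DERIV[of r y]] by (simp add: has_field_derivative_def)
  have "(D i j has_derivative (\<lambda>(h, k). D (Suc i) j r * h + D i (Suc j) r * k)) (at r within S)" for i j r S
  proof -
    have a: "((\<lambda>r. poly ((pderiv ^^ i) p) (fst r)) has_derivative (\<lambda>h. poly (pderiv ((pderiv ^^ i) p)) (fst r) * fst h)) (at r within S)"
      by (rule has_derivative_compose[OF has_derivative_fst[OF has_derivative_ident] poly_d])
    have b: "((\<lambda>r. poly ((pderiv ^^ j) q) (snd r)) has_derivative (\<lambda>h. poly (pderiv ((pderiv ^^ j) q)) (snd r) * snd h)) (at r within S)"
      by (rule has_derivative_compose[OF has_derivative_snd[OF has_derivative_ident] poly_d])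
    show ?thesis unfolding D_def
      by (rule has_derivative_eq_rhs[OF has_derivative_mult[OF a b]]) (auto simp: fun_eq_iff algebra_simps)
  qed
  then show "(\<lambda>(x, t). poly p x * poly q t) \<in> smooth_square"
    unfolding smooth_square_def by (intro CollectI exI[of _ D]) (auto simp: D_def)
  have "((\<lambda>y. poly p y * poly q t) has_real_derivative poly (pderiv p) x * poly q t) (at x)"
    using DERIV_cmult[OF poly_DERIV[of p x], of "poly q t"] by (simp add: mult.commute)
  from DERIV_imp_deriv[OF this] 
  show "dx (\<lambda>(x, t). poly p x * poly q t) (t, x) = poly (pderiv p) x * poly q t"
    by (simp add: dx_def)
  from DERIV_imp_deriv[OF DERIV_cmult[OF poly_DERIV[of q t], of "poly p x"]] 
  show "dt (\<lambda>(x, t). poly p x * poly q t) (t, x) = poly p x * poly (pderiv q) t"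
    by (simp add: dt_def)
qed

section \<open>Gronwall's inequality\<close>

lemma prim_increment_le:
  assumes e: "integrable unit_leb e" and h: "integrable unit_leb h" and uv: "u \<le> v"
    and le: "AE s in unit_leb. u \<le> s \<longrightarrow> s < v \<longrightarrow> \<bar>e s\<bar> \<le> h s"
  shows "\<bar>prim e v - prim e u\<bar> \<le> prim h v - prim h u"
proof -
  note [measurable] = borel_measurable_integrable[OF e] borel_measurable_integrable[OF h]
  have i: "integrable unit_leb (\<lambda>s. if u \<le> s \<and> s < v then g s else 0)" if "integrable unit_leb g" for g :: "real \<Rightarrow> real"
  proof (rule Bochner_Integration.integrable_bound[OF that])
    note [measurable] = borel_measurable_integrable[OF that]
    show "(\<lambda>s. if u \<le> s \<and> s < v then g s else 0) \<in> borel_measurable unit_leb" by measurable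
  qed auto
  have d: "prim g v - prim g u = (LINT s|unit_leb. (if u \<le> s \<and> s < v then g s else 0))" if "integrable unit_leb g" for g
  proof -
    have "prim g v - prim g u = (LINT s|unit_leb. (if s < v then g s else 0) - (if s < u then g s else 0))"
      unfolding prim_def by (rule Bochner_Integration.integral_diff[symmetric]) (intro integrable_if_less that)+
    also have "\<dots> = (LINT s|unit_leb. (if u \<le> s \<and> s < v then g s else 0))"
      by (rule Bochner_Integration.integral_cong) (use uv in auto)
    finally show ?thesis .
  qed
  have "\<bar>prim e v - prim e u\<bar> \<le> (LINT s|unit_leb. \<bar>(if u \<le> s \<and> s < v then e s else 0)\<bar>)"
    unfolding d[OF e] by (rule integral_abs_bound)
  also have "\<dots> \<le> (LINT s|unit_leb. (if u \<le> s \<and> s < v then h s else 0))"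
    by (rule integral_mono_AE[OF integrable_abs[OF i[OF e]] i[OF h]]) (use le in \<open>eventually_elim, auto\<close>)
  finally show ?thesis unfolding d[OF h] .
qed

text \<open>On a time interval over which \<open>\<beta>\<close> has mass at most 1/2, the maximum of \<open>Y\<close> absorbs itself;
  finitely many such intervals cover the unit interval.\<close>

lemma gronwall:
  assumes e: "integrable unit_leb e" and \<beta>: "integrable unit_leb \<beta>" and \<alpha>: "integrable unit_leb \<alpha>"
    and \<beta>0: "\<And>s. s \<in> {0<..<1} \<Longrightarrow> 0 \<le> \<beta> s" and \<alpha>0: "\<And>s. s \<in> {0<..<1} \<Longrightarrow> 0 \<le> \<alpha> s"
    and Y: "\<And>t. t \<in> {0..1} \<Longrightarrow> Y t = c + prim e t" and Y0: "\<And>t. t \<in> {0..1} \<Longrightarrow> 0 \<le> Y t"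
    and le: "AE s in unit_leb. \<bar>e s\<bar> \<le> \<beta> s * Y s + \<alpha> s"
    and N: "(LINT s|unit_leb. \<beta> s) \<le> real N / 2"
    and r: "r \<in> {0..1}" "r' \<in> {0..1}"
  shows "Y r \<le> 2 ^ Suc N * (Y r' + 2 * (LINT s|unit_leb. \<alpha> s))"
proof -
  define A where "A = (LINT s|unit_leb. \<alpha> s)"
  define b where "b = prim \<beta>"
  have A0: "A \<ge> 0" unfolding A_def by (rule integral_nonneg_AE) (use \<alpha>0 in auto)
  have bc: "continuous_on {0..1} b" unfolding b_def by (rule prim_continuous[OF \<beta>])
  have bm: "b u \<le> b v" if "u \<le> v" for u v unfolding b_def by (rule prim_mono_nonneg[OF \<beta> \<beta>0 that])
  have b0: "0 \<le> b u" for u using bm[of "min u 0" u] prim_0[of "min u 0" \<beta>] by (simp add: b_def)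
  have b1: "b u \<le> real N / 2" for u using bm[of u "max u 1"] prim_1[of "max u 1" \<beta>] N by (simp add: b_def)
  have Yc: "continuous_on {0..1} Y"
    by (subst continuous_on_cong[OF refl Y]) (auto intro!: continuous_intros prim_continuous e)
  \<comment> \<open>Only the distance of \<open>b r\<close> and \<open>b r'\<close> enters, so the
    step runs forward and backward in time. The dual estimate uses it from the final time, the
    uniqueness proof from the initial one.\<close>
  have step_le: "Y r + 2 * A \<le> 2 * (Y r' + 2 * A)" if rr: "r \<in> {0..1}" "r' \<in> {0..1}" and small: "\<bar>b r - b r'\<bar> \<le> 1/2" for r r'
  proof -
    define u v where "u = min r r'" and "v = max r r'"
    have uv: "u \<le> v" "{u..v} \<subseteq> {0..1}" "r \<in> {u..v}" "r' \<in> {u..v}" using rr by (auto simp: u_def v_def)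
    have "b v - b u \<le> \<bar>b r - b r'\<bar>" by (cases "r \<le> r'") (simp_all add: u_def v_def)
    then have buv: "b v - b u \<le> 1/2" using small by linarith
    have ne: "{u..v} \<noteq> {}" using uv by auto
    obtain m where m: "m \<in> {u..v}" "\<And>y. y \<in> {u..v} \<Longrightarrow> Y y \<le> Y m"
      using continuous_attains_sup[OF compact_Icc ne continuous_on_subset[OF Yc uv(2)]] by blast
    define h where "h s = Y m * \<beta> s + \<alpha> s" for s
    have hi: "integrable unit_leb h" unfolding h_def using \<beta> \<alpha> by simp
    have inc: "\<bar>Y q' - Y q\<bar> \<le> Y m / 2 + A" if q: "q \<in> {u..v}" "q' \<in> {u..v}" "q \<le> q'" for q q'
    proof -
      have "\<bar>prim e q' - prim e q\<bar> \<le> prim h q' - prim h q"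
      proof (rule prim_increment_le[OF e hi q(3)])
        show "AE s in unit_leb. q \<le> s \<longrightarrow> s < q' \<longrightarrow> \<bar>e s\<bar> \<le> h s"
          using le AE_space
        proof eventually_elim
          case (elim s)
          show ?case
          proof (intro impI)
            assume "q \<le> s" "s < q'"
            then have "Y s \<le> Y m" using q by (intro m) auto
            then have "\<beta> s * Y s \<le> \<beta> s * Y m" using \<beta>0 elim(2) by (intro mult_left_mono) auto
            then show "\<bar>e s\<bar> \<le> h s" using elim(1) by (simp add: h_def mult.commute)
          qed
        qed
      qed
      also have "prim h q' - prim h q = Y m * (b q' - b q) + (prim \<alpha> q' - prim \<alpha> q)"
        unfolding h_def b_def using \<alpha> \<beta> by (simp add: prim_add prim_cmult algebra_simps)
      also have "\<dots> \<le> Y m * (1/2) + A"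
      proof (intro add_mono mult_left_mono)
        show "b q' - b q \<le> 1/2" using buv bm[of u q] bm[of q' v] q by auto
        show "0 \<le> Y m" using Y0 m(1) uv by auto
        have "prim \<alpha> q' \<le> prim \<alpha> (max q' 1)" "prim \<alpha> (min q 0) \<le> prim \<alpha> q"
          by (rule prim_mono_nonneg[OF \<alpha> \<alpha>0]; simp)+
        then show "prim \<alpha> q' - prim \<alpha> q \<le> A" using prim_1[of "max q' 1" \<alpha>] prim_0[of "min q 0" \<alpha>] by (simp add: A_def)
      qed
      finally show ?thesis using Y[of q] Y[of q'] q uv by auto
    qed
    \<comment> \<open>The mass 1/2 of \<beta> leaves half of \<open>Y m\<close> on the right, to be
      moved to the left.\<close>
    have "\<bar>Y m - Y r'\<bar> \<le> Y m / 2 + A"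
    proof (cases "m \<le> r'")
      case True then show ?thesis using inc[OF m(1) uv(4)] by (simp add: abs_minus_commute)
    next
      case False then show ?thesis using inc[OF uv(4) m(1)] by simp
    qed
    then have "Y m \<le> 2 * Y r' + 2 * A" by linarith
    then have "Y r \<le> 2 * Y r' + 2 * A" using m(2)[OF uv(3)] by (rule order_trans[rotated])
    then show ?thesis by (simp add: distrib_left)
  qed
  \<comment> \<open>Each interval of mass 1/2 costs a factor 2; carrying the summand 2A on both
    sides makes the recursion purely multiplicative.\<close>
  have claim: "Y r + 2 * A \<le> 2 ^ Suc n * (Y r' + 2 * A)" if "r \<in> {0..1}" "r' \<in> {0..1}" "\<bar>b r - b r'\<bar> \<le> real (Suc n) / 2" for n r r'
    using that
  proof (induction n arbitrary: r)
    case 0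
    then show ?case using step_le[of r r'] by simp
  next
    case (Suc n)
    have nn: "0 \<le> Y r' + 2 * A" using Y0[OF Suc.prems(2)] A0 by simp
    show ?case
    proof (cases "\<bar>b r - b r'\<bar> \<le> real (Suc n) / 2")
      case True
      have "Y r + 2 * A \<le> 2 ^ Suc n * (Y r' + 2 * A)" by (rule Suc.IH[OF Suc.prems(1,2) True])
      also have "\<dots> \<le> 2 ^ Suc (Suc n) * (Y r' + 2 * A)" using nn by (intro mult_right_mono) auto
      finally show ?thesis .
    next
      case False
      \<comment> \<open>The next base point is one where \<open>b\<close> has moved by exactly 1/2
        towards \<open>b r'\<close>; the intermediate value theorem provides it, although
        \<open>b\<close> may have flat pieces.\<close>
      define y where "y = (if b r > b r' then b r - 1/2 else b r + 1/2)"
      have conn: "connected (b ` {0..1})" by (rule connected_continuous_image[OF bc]) simp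
      have far: "\<bar>b r - b r'\<bar> > 1/2" using False by (simp add: field_simps)
      have "y \<in> b ` {0..1}"
      proof (cases "b r > b r'")
        case True
        then have "b r' \<le> y" "y \<le> b r" using far by (auto simp: y_def)
        then show ?thesis using connectedD_interval[OF conn, of "b r'" "b r" y] Suc.prems by blast
      next
        case F: False
        then have "b r \<le> y" "y \<le> b r'" using far by (auto simp: y_def)
        then show ?thesis using connectedD_interval[OF conn, of "b r" "b r'" y] Suc.prems by blast
      qed
      then obtain q where q: "q \<in> {0..1}" "b q = y" by blast
      have "\<bar>b q - b r'\<bar> \<le> real (Suc n) / 2" using Suc.prems(3) far unfolding q(2) y_def by (auto split: if_splits)
      from Suc.IH[OF q(1) Suc.prems(2) this] have 1: "Y q + 2 * A \<le> 2 ^ Suc n * (Y r' + 2 * A)" .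
      have "\<bar>b r - b q\<bar> \<le> 1/2" unfolding q(2) y_def by auto
      from step_le[OF Suc.prems(1) q(1) this] have "Y r + 2 * A \<le> 2 * (Y q + 2 * A)" .
      also have "\<dots> \<le> 2 * (2 ^ Suc n * (Y r' + 2 * A))" using 1 by simp
      finally show ?thesis by simp
    qed
  qed
  have "\<bar>b r - b r'\<bar> \<le> real (Suc N) / 2" 
  proof (rule abs_leI)
    show "b r - b r' \<le> real (Suc N) / 2" using b0[of r'] b1[of r] by simp
    show "- (b r - b r') \<le> real (Suc N) / 2" using b0[of r] b1[of r'] by simp
  qed
  from claim[OF r this] show ?thesis using A0 unfolding A_def by simp
qed

section \<open>The weak transport equation on the square\<close>

text \<open>The adjoint transport operator \<phi>_t + (v \<phi>)_x. On test functions vanishing at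
  time 1 the weak equation prescribes the pairing of \<open>f\<close> with
  \<open>gen w \<phi>\<close> in terms of \<open>f0\<close> and \<open>z\<close>.\<close>

definition gen :: "(real \<times> real \<Rightarrow> real) \<Rightarrow> (real \<times> real \<Rightarrow> real) \<Rightarrow> real \<times> real \<Rightarrow> real" where
  "gen w \<phi> p = dt \<phi> p + (sw \<phi> p * V1 w p + dx \<phi> p * V0 w p)"

definition weakQ :: "(real \<Rightarrow> real) \<Rightarrow> (real \<Rightarrow> real) \<Rightarrow> (real \<times> real \<Rightarrow> real) \<Rightarrow> (real \<times> real \<Rightarrow> real) \<Rightarrow> (real \<times> real \<Rightarrow> real) \<Rightarrow> bool" where
  "weakQ f0 f1 f w z \<longleftrightarrow> (\<forall>\<phi>\<in>smooth_square.
     - (LINT p|unit_sq. f p * dt \<phi> p) + (LINT x|unit_leb. f1 x * \<phi> (x, 1)) - (LINT x|unit_leb. f0 x * \<phi> (x, 0))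
     = (LINT p|unit_sq. f p * (sw \<phi> p * V1 w p + dx \<phi> p * V0 w p)) + (LINT p|unit_sq. sw \<phi> p * z p))"

lemma sqQ_mult_bounded:
  assumes F: "F \<in> sqQ" and m: "G \<in> borel_measurable unit_sq"
    and le: "\<And>t x. t \<in> {0<..<1} \<Longrightarrow> x \<in> {0<..<1} \<Longrightarrow> \<bar>G (t, x)\<bar> \<le> C"
  shows "(\<lambda>p. F p * G p) \<in> sqQ"
proof -
  have "(\<lambda>p. F p * G p) \<in> sq_int unit_sq"
    by (rule Q.sq_int_mult_bounded[where C=C, OF sqQ_sq_int[OF F] m]) (rule AE_Q_I, rule le)
  moreover have "(\<lambda>x. F (t, x) * G (t, x)) \<in> sq_int unit_leb" if t: "t \<in> {0<..<1}" for t
    by (rule U.sq_int_mult_bounded[where C=C, OF sqQ_slice[OF F t] slice_meas[OF m t]]) (use le[OF t] in auto)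
  ultimately show ?thesis by (simp add: sqQ_def)
qed

lemma transport_terms_sqQ:
  assumes \<phi>: "\<phi> \<in> smooth_square" and w: "w \<in> sqQ"
  shows "(\<lambda>p. sw \<phi> p * V1 w p) \<in> sqQ" "(\<lambda>p. dx \<phi> p * V0 w p) \<in> sqQ"
    "(\<lambda>p. sw \<phi> p * V1 w p + dx \<phi> p * V0 w p) \<in> sqQ" "gen w \<phi> \<in> sqQ"
proof -
  obtain C where C: "C \<ge> 0" "\<And>x t. x \<in> {0..1} \<Longrightarrow> t \<in> {0..1} \<Longrightarrow> \<bar>\<phi> (x, t)\<bar> \<le> C"
   "\<And>x t. x \<in> {0<..<1} \<Longrightarrow> t \<in> {0<..<1} \<Longrightarrow> \<bar>dx \<phi> (t, x)\<bar> \<le> C"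
   "\<And>x t. x \<in> {0<..<1} \<Longrightarrow> t \<in> {0<..<1} \<Longrightarrow> \<bar>dt \<phi> (t, x)\<bar> \<le> C"
    using smooth_square_bounded[OF \<phi>] by blast
  note m = smooth_square_meas[OF \<phi>]
  show 1: "(\<lambda>p. sw \<phi> p * V1 w p) \<in> sqQ"
  proof -
    have "(\<lambda>p. V1 w p * sw \<phi> p) \<in> sqQ"
    proof (rule sqQ_mult_bounded[OF V_sqQ(1)[OF w] m(1)])
      show "\<bar>sw \<phi> (t, x)\<bar> \<le> C" if "t \<in> {0<..<1}" "x \<in> {0<..<1}" for t x
        using C(2)[of x t] that by (simp add: sw_def)
    qed
    then show ?thesis by (simp only: mult.commute)
  qed
  show 2: "(\<lambda>p. dx \<phi> p * V0 w p) \<in> sqQ"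
  proof -
    have "(\<lambda>p. V0 w p * dx \<phi> p) \<in> sqQ"
    proof (rule sqQ_mult_bounded[OF V_sqQ(2)[OF w] m(2)])
      show "\<bar>dx \<phi> (t, x)\<bar> \<le> C" if "t \<in> {0<..<1}" "x \<in> {0<..<1}" for t x
        using C(3)[of x t] that by (simp add: sw_def)
    qed
    then show ?thesis by (simp only: mult.commute)
  qed
  show 3: "(\<lambda>p. sw \<phi> p * V1 w p + dx \<phi> p * V0 w p) \<in> sqQ" by (rule sqQ_add[OF 1 2])
  show "gen w \<phi> \<in> sqQ" unfolding gen_def[abs_def] by (rule sqQ_add[OF smooth_square_sqQ(3)[OF \<phi>] 3])
qed

lemma weakQ_gen:
  assumes wk: "weakQ f0 f1 f w z" and f: "f \<in> sqQ" and w: "w \<in> sqQ" 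
    and \<phi>: "\<phi> \<in> smooth_square" and e: "\<And>x. x \<in> {0..1} \<Longrightarrow> \<phi> (x, 1) = 0"
  shows "(LINT p|unit_sq. f p * gen w \<phi> p) = - (LINT x|unit_leb. f0 x * \<phi> (x, 0)) - (LINT p|unit_sq. sw \<phi> p * z p)"
proof -
  have "(LINT x|unit_leb. f1 x * \<phi> (x, 1)) = (LINT x|unit_leb. 0)"
    by (rule Bochner_Integration.integral_cong) (use e in auto)
  then have "(LINT x|unit_leb. f1 x * \<phi> (x, 1)) = 0" by simp
  moreover have "(LINT p|unit_sq. f p * gen w \<phi> p) = 
      (LINT p|unit_sq. f p * dt \<phi> p) + (LINT p|unit_sq. f p * (sw \<phi> p * V1 w p + dx \<phi> p * V0 w p))"
  proof -
    have "f p * gen w \<phi> p = f p * dt \<phi> p + f p * (sw \<phi> p * V1 w p + dx \<phi> p * V0 w p)" for p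
      unfolding gen_def by (rule distrib_left)
    then show ?thesis
      using sq_int_mult[OF sqQ_sq_int[OF f] sqQ_sq_int[OF smooth_square_sqQ(3)[OF \<phi>]]]
        sq_int_mult[OF sqQ_sq_int[OF f] sqQ_sq_int[OF transport_terms_sqQ(3)[OF \<phi> w]]] by simp
  qed
  moreover note wk[unfolded weakQ_def, rule_format, OF \<phi>]
  ultimately show ?thesis by linarith
qed

text \<open>\<open>\<phi>(v\<phi>)\<^sub>x\<close> integrates to \<open>v\<^sub>x\<phi>\<^sup>2/2\<close>.\<close>

lemma transport_energy_slice:
  assumes u: "integrable unit_leb u" and w: "w \<in> sq_int unit_leb"
    and \<phi>: "\<And>x. x \<in> {0<..<1} \<Longrightarrow> \<phi> x = c + prim u x"
  shows "(LINT x|unit_leb. \<phi> x * (\<phi> x * G1 w x + u x * G0 w x)) = (LINT x|unit_leb. (\<phi> x)\<^sup>2 * G1 w x) / 2"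
proof -
  define P where "P x = c + prim u x" for x
  have wi: "integrable unit_leb w" by (rule U.sq_int_integrable[OF w])
  have Pc: "continuous_on {0..1} P" unfolding P_def by (intro continuous_intros prim_continuous u)
  have uP: "integrable unit_leb (\<lambda>x. u x * P x)"
    unfolding P_def distrib_left using u integrable_mult_prim[OF u u] by (simp add: mult.commute)
  \<comment> \<open>The square of \<phi> is itself a primitive, by the product rule, so the
    integration by parts needs no pointwise derivative.\<close>
  have sq: "(P x)\<^sup>2 = c\<^sup>2 + 2 * prim (\<lambda>x. u x * P x) x" for x
  proof -
    have "prim (\<lambda>x. u x * P x) x = c * prim u x + prim (\<lambda>x. u x * prim u x) x"
      unfolding P_def distrib_left using prim_add[of "\<lambda>x. u x * c" "\<lambda>x. u x * prim u x" x] u integrable_mult_prim[OF u u]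
      by (simp add: prim_cmult mult.commute)
    moreover have "prim u x * prim u x = 2 * prim (\<lambda>x. u x * prim u x) x"
      using prim_product[OF u u, of x] prim_cmult[of 2 "\<lambda>x. u x * prim u x" x] by (simp add: mult.commute)
    ultimately show ?thesis by (simp add: P_def power2_eq_square algebra_simps)
  qed
  have Gi: "integrable unit_leb (G1 w)" by (rule G1_integrable[OF wi])
  have PG: "(\<lambda>x. (P x)\<^sup>2 * G1 w x) \<in> sq_int unit_leb"
    by (intro cont_sq_int continuous_intros Pc G1_continuous wi)
  have "(LINT x|unit_leb. (u x * P x) * G0 w x) + (LINT x|unit_leb. prim (\<lambda>x. u x * P x) x * G1 w x) = 0"
    using prim_by_parts_full[OF uP Gi] integral_G1[OF wi] by (simp add: G0_def)
  moreover have "(LINT x|unit_leb. prim (\<lambda>x. u x * P x) x * G1 w x) = (LINT x|unit_leb. (P x)\<^sup>2 * G1 w x) / 2"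
  proof -
    \<comment> \<open>The constant c^2/2 drops out because \<open>G1 w\<close> has mean zero, that
      is, because the velocity vanishes at both ends.\<close>
    have "prim (\<lambda>x. u x * P x) x * G1 w x = ((P x)\<^sup>2 * G1 w x) / 2 - c\<^sup>2 / 2 * G1 w x" for x
      by (simp add: sq algebra_simps)
    then show ?thesis using U.sq_int_integrable[OF PG] Gi integral_G1[OF wi] by simp
  qed
  moreover have "integrable unit_leb (\<lambda>x. (u x * P x) * G0 w x)"
    using integrable_mult_prim[OF uP Gi] by (simp add: G0_def)
  moreover have "(LINT x|unit_leb. P x * (P x * G1 w x + u x * G0 w x)) = 
      (LINT x|unit_leb. (P x)\<^sup>2 * G1 w x + (u x * P x) * G0 w x)"
    by (rule Bochner_Integration.integral_cong) (auto simp: algebra_simps power2_eq_square)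
  ultimately have "(LINT x|unit_leb. P x * (P x * G1 w x + u x * G0 w x)) = (LINT x|unit_leb. (P x)\<^sup>2 * G1 w x) / 2"
    using U.sq_int_integrable[OF PG] by simp
  moreover have "(LINT x|unit_leb. \<phi> x * (\<phi> x * G1 w x + u x * G0 w x)) = (LINT x|unit_leb. P x * (P x * G1 w x + u x * G0 w x))"
    by (rule Bochner_Integration.integral_cong) (auto simp: \<phi> P_def)
  moreover have "(LINT x|unit_leb. (\<phi> x)\<^sup>2 * G1 w x) = (LINT x|unit_leb. (P x)\<^sup>2 * G1 w x)"
    by (rule Bochner_Integration.integral_cong) (auto simp: \<phi> P_def)
  ultimately show ?thesis by simp
qed

lemma abs_integral_sq_mult_le:
  assumes u: "u \<in> sq_int M" and g: "g \<in> borel_measurable M" and b: "AE x in M. \<bar>g x\<bar> \<le> B" and B: "B \<ge> 0"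
  shows "\<bar>LINT x|M. (u x)\<^sup>2 * g x\<bar> \<le> B * (nrm M u)\<^sup>2"
proof -
  note [measurable] = sq_int_meas[OF u] g
  have le: "AE x in M. \<bar>(u x)\<^sup>2 * g x\<bar> \<le> B * (u x)\<^sup>2"
    using b by eventually_elim (simp add: abs_mult mult.commute mult_right_mono)
  have i: "integrable M (\<lambda>x. (u x)\<^sup>2 * g x)"
    by (rule Bochner_Integration.integrable_bound[of _ "\<lambda>x. B * (u x)\<^sup>2"]) 
      (use sq_int_sq[OF u] le B in auto)
  have "\<bar>LINT x|M. (u x)\<^sup>2 * g x\<bar> \<le> (LINT x|M. \<bar>(u x)\<^sup>2 * g x\<bar>)" by (rule integral_abs_bound)
  also have "\<dots> \<le> (LINT x|M. B * (u x)\<^sup>2)"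
    by (rule integral_mono_AE[OF integrable_abs[OF i] _ le]) (use sq_int_sq[OF u] in simp)
  finally show ?thesis by (simp add: nrm_sq)
qed

text \<open>The fundamental theorem in time at each fixed position, followed by Fubini. The energy
  is thus a primitive on the closed interval, which is the form Gronwall's inequality
  requires.\<close>

lemma smooth_square_time_energy:
  assumes \<phi>: "\<phi> \<in> smooth_square" and t: "t \<in> {0..1}"
  shows "(nrm unit_leb (\<lambda>x. \<phi> (x, t)))\<^sup>2 = (nrm unit_leb (\<lambda>x. \<phi> (x, 0)))\<^sup>2 + 
    prim (\<lambda>s. 2 * (LINT x|unit_leb. \<phi> (x, s) * dt \<phi> (s, x))) t"
    "integrable unit_leb (\<lambda>s. 2 * (LINT x|unit_leb. \<phi> (x, s) * dt \<phi> (s, x)))"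
proof -
  define F where "F p = 2 * (sw \<phi> p * dt \<phi> p)" for p
  have Fi: "integrable unit_sq F" unfolding F_def
    using sq_int_mult[OF sqQ_sq_int[OF smooth_square_sqQ(1)[OF \<phi>]] sqQ_sq_int[OF smooth_square_sqQ(3)[OF \<phi>]]] by simp
  have eq: "(LINT x|unit_leb. F (s, x)) = 2 * (LINT x|unit_leb. \<phi> (x, s) * dt \<phi> (s, x))" for s
    unfolding F_def sw_def by simp
  show "integrable unit_leb (\<lambda>s. 2 * (LINT x|unit_leb. \<phi> (x, s) * dt \<phi> (s, x)))"
    using UU.integrable_fst'[OF Fi] unfolding eq .
  have ptw: "(\<phi> (x, t))\<^sup>2 = (\<phi> (x, 0))\<^sup>2 + prim (\<lambda>s. F (s, x)) t" if x: "x \<in> {0<..<1}" for x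
  proof -
    obtain \<phi>x \<phi>t where C: "C1_data \<phi> \<phi>x \<phi>t" using smooth_square_C1[OF \<phi>] by blast
    have c: "continuous_on {0..1} (\<lambda>s. 2 * (\<phi> (x, s) * \<phi>t (x, s)))"
      by (intro continuous_intros cont_square_slices(2) C1_dataD[OF C]) (use x in auto)
    have "prim (\<lambda>s. F (s, x)) t = prim (\<lambda>s. 2 * (\<phi> (x, s) * \<phi>t (x, s))) t"
      by (rule prim_cong) (use x C1_dataD(7)[OF C] in \<open>auto simp: F_def sw_def\<close>)
    also have "\<dots> = (\<phi> (x, t))\<^sup>2 - (\<phi> (x, 0))\<^sup>2"
    proof (rule prim_FTC[OF _ c t])
      fix s :: real assume "s \<in> {0..1}"
      then have "((\<lambda>s. \<phi> (x, s)) has_real_derivative \<phi>t (x, s)) (at s within {0..1})"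
        using C1_dataD(5)[OF C, of x s] x by auto
      from DERIV_power[OF this, of 2] show "((\<lambda>s. (\<phi> (x, s))\<^sup>2) has_real_derivative 2 * (\<phi> (x, s) * \<phi>t (x, s))) (at s within {0..1})"
        by (simp add: mult_ac)
    qed
    finally show ?thesis by simp
  qed
  have trunc: "integrable unit_sq (\<lambda>p. if fst p < t then F p else 0)"
  proof (rule Bochner_Integration.integrable_bound[OF Fi])
    note [measurable] = borel_measurable_integrable[OF Fi]
    show "(\<lambda>p. if fst p < t then F p else 0) \<in> borel_measurable unit_sq" by measurable
  qed auto
  have "prim (\<lambda>s. LINT x|unit_leb. F (s, x)) t = (LINT s|unit_leb. LINT x|unit_leb. (if s < t then F (s, x) else 0))"
    unfolding prim_def by (rule Bochner_Integration.integral_cong) auto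
  also have "\<dots> = (LINT x|unit_leb. LINT s|unit_leb. (if s < t then F (s, x) else 0))"
    using UU.Fubini_integral[of "\<lambda>s x. if s < t then F (s, x) else 0"] trunc by (simp add: case_prod_unfold cong: if_cong)
  also have "\<dots> = (LINT x|unit_leb. (\<phi> (x, t))\<^sup>2 - (\<phi> (x, 0))\<^sup>2)"
    by (rule Bochner_Integration.integral_cong) (auto simp: ptw prim_def)
  also have "\<dots> = (nrm unit_leb (\<lambda>x. \<phi> (x, t)))\<^sup>2 - (nrm unit_leb (\<lambda>x. \<phi> (x, 0)))\<^sup>2"
    unfolding nrm_sq
    by (rule Bochner_Integration.integral_diff) (intro sq_int_sq smooth_square_slice_sq_int[OF \<phi>], use t in auto)+
  finally show "(nrm unit_leb (\<lambda>x. \<phi> (x, t)))\<^sup>2 = (nrm unit_leb (\<lambda>x. \<phi> (x, 0)))\<^sup>2 + 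
    prim (\<lambda>s. 2 * (LINT x|unit_leb. \<phi> (x, s) * dt \<phi> (s, x))) t" unfolding eq by simp
qed

text \<open>The derivative of |\<phi>|^2 is twice the pairing of \<phi> with
  \<open>gen w \<phi>\<close>, minus the integral of \<phi>^2 v_x. Gronwall is run backward from
  time 1, where \<phi> vanishes. Bounding one factor \<phi> by its maximal norm in time and dividing
  by that maximum leaves only the integral over time of the norm of
  \<open>gen w \<phi>\<close>.\<close>

lemma dual_energy_estimate:
  assumes \<phi>: "\<phi> \<in> smooth_square" and w: "w \<in> sqQ" and e: "\<And>x. x \<in> {0..1} \<Longrightarrow> \<phi> (x, 1) = 0"
    and N: "4 * nrm unit_sq w \<le> real N" and t: "t \<in> {0..1}"
  shows "nrm unit_leb (\<lambda>x. \<phi> (x, t)) \<le> 2 ^ (N + 3) * (LINT s|unit_leb. nrm unit_leb (\<lambda>x. gen w \<phi> (s, x)))"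
proof -
  define y where "y s = nrm unit_leb (\<lambda>x. \<phi> (x, s))" for s
  define n where "n s = nrm unit_leb (\<lambda>x. w (s, x))" for s
  define \<gamma> where "\<gamma> s = nrm unit_leb (\<lambda>x. gen w \<phi> (s, x))" for s
  define E where "E s = 2 * (LINT x|unit_leb. \<phi> (x, s) * dt \<phi> (s, x))" for s
  have Y: "(y s)\<^sup>2 = (y 0)\<^sup>2 + prim E s" if "s \<in> {0..1}" for s
    unfolding y_def E_def by (rule smooth_square_time_energy(1)[OF \<phi> that])
  have Ei: "integrable unit_leb E"
    unfolding E_def by (rule smooth_square_time_energy(2)[OF \<phi> t])
  have ni: "n \<in> sq_int unit_leb" "nrm unit_leb n = nrm unit_sq w"
    unfolding n_def using nrm_slice[OF sqQ_sq_int[OF w]] by auto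
  have \<gamma>i: "integrable unit_leb \<gamma>" unfolding \<gamma>_def
    by (rule U.sq_int_integrable[OF nrm_slice(1)[OF sqQ_sq_int[OF transport_terms_sqQ(4)[OF \<phi> w]]]])
  have "continuous_on {0..1} (\<lambda>s. sqrt ((y 0)\<^sup>2 + prim E s))" by (intro continuous_intros prim_continuous Ei)
  moreover have "sqrt ((y 0)\<^sup>2 + prim E s) = y s" if "s \<in> {0..1}" for s
    unfolding Y[OF that, symmetric] by (simp add: y_def)
  ultimately have "continuous_on {0..1} y" by (rule continuous_on_eq)
  then obtain m where m: "m \<in> {0..1}" "\<And>s. s \<in> {0..1} \<Longrightarrow> y s \<le> y m"
    using continuous_attains_sup[of "{0..1::real}" y] by auto
  have y0: "0 \<le> y s" for s by (simp add: y_def)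
  have est: "\<bar>E s\<bar> \<le> 2 * n s * (y s)\<^sup>2 + 2 * y m * \<gamma> s" if s: "s \<in> {0<..<1}" for s
  proof -
    have s': "s \<in> {0..1}" using s by auto
    have ps: "(\<lambda>x. \<phi> (x, s)) \<in> sq_int unit_leb" by (rule smooth_square_slice_sq_int[OF \<phi> s'])
    have gs: "(\<lambda>x. gen w \<phi> (s, x)) \<in> sq_int unit_leb" by (rule sqQ_slice[OF transport_terms_sqQ(4)[OF \<phi> w] s])
    have ts: "(\<lambda>x. \<phi> (x, s) * V1 w (s, x) + dx \<phi> (s, x) * V0 w (s, x)) \<in> sq_int unit_leb"
      using sqQ_slice[OF transport_terms_sqQ(3)[OF \<phi> w] s] by (simp add: sw_def)
    have ws: "(\<lambda>x. w (s, x)) \<in> sq_int unit_leb" by (rule sqQ_slice[OF w s])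
    have dxi: "integrable unit_leb (\<lambda>x. dx \<phi> (s, x))" by (rule sqQ_slice_int[OF smooth_square_sqQ(2)[OF \<phi>] s])
    have "(LINT x|unit_leb. \<phi> (x, s) * dt \<phi> (s, x)) = 
      (LINT x|unit_leb. \<phi> (x, s) * gen w \<phi> (s, x) - \<phi> (x, s) * (\<phi> (x, s) * V1 w (s, x) + dx \<phi> (s, x) * V0 w (s, x)))"
      by (rule Bochner_Integration.integral_cong) (auto simp: gen_def sw_def algebra_simps)
    also have "\<dots> = (LINT x|unit_leb. \<phi> (x, s) * gen w \<phi> (s, x)) - 
      (LINT x|unit_leb. \<phi> (x, s) * (\<phi> (x, s) * V1 w (s, x) + dx \<phi> (s, x) * V0 w (s, x)))"
      by (rule Bochner_Integration.integral_diff) (intro sq_int_mult ps gs ts)+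
    also have "(LINT x|unit_leb. \<phi> (x, s) * (\<phi> (x, s) * V1 w (s, x) + dx \<phi> (s, x) * V0 w (s, x))) = 
       (LINT x|unit_leb. (\<phi> (x, s))\<^sup>2 * G1 (\<lambda>y. w (s, y)) x) / 2"
      unfolding V1_def V0_def fst_conv snd_conv
      by (rule transport_energy_slice[OF dxi ws, of "\<lambda>x. \<phi> (x, s)" "\<phi> (0, s)"])
        (use smooth_square_FTC_x[OF \<phi> s'] in auto)
    finally have "E s = 2 * (LINT x|unit_leb. \<phi> (x, s) * gen w \<phi> (s, x)) - (LINT x|unit_leb. (\<phi> (x, s))\<^sup>2 * G1 (\<lambda>y. w (s, y)) x)"
      by (simp add: E_def)
    moreover have "\<bar>LINT x|unit_leb. \<phi> (x, s) * gen w \<phi> (s, x)\<bar> \<le> y s * \<gamma> s"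
      unfolding y_def \<gamma>_def by (rule cauchy_schwarz[OF ps gs])
    moreover have "y s * \<gamma> s \<le> y m * \<gamma> s" using m(2)[OF s'] by (intro mult_right_mono) (auto simp: \<gamma>_def)
    moreover have "\<bar>LINT x|unit_leb. (\<phi> (x, s))\<^sup>2 * G1 (\<lambda>y. w (s, y)) x\<bar> \<le> 2 * n s * (y s)\<^sup>2"
      unfolding y_def n_def
      by (rule abs_integral_sq_mult_le[OF ps])
        (use V_bound(1)[OF w s] sq_int_meas[OF G1_sq_int[OF sqQ_slice_int[OF w s]]] in \<open>auto simp: V1_def\<close>)
    ultimately show ?thesis by linarith
  qed
  \<comment> \<open>Here \<beta> = 2 \<open>n\<close> has mass at most 2 |w|, which the hypothesis
    on \<open>N\<close> bounds by N/2. The factors 2^(N+1), 2 and 2 combine to 2^(N+3).\<close>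
  have "(y m)\<^sup>2 \<le> 2 ^ Suc N * ((y 1)\<^sup>2 + 2 * (LINT s|unit_leb. 2 * y m * \<gamma> s))"
  proof (rule gronwall[where Y="\<lambda>s. (y s)\<^sup>2" and e=E and \<beta>="\<lambda>s. 2 * n s"])
    show "integrable unit_leb (\<lambda>s. 2 * n s)" using U.sq_int_integrable[OF ni(1)] by simp
    show "integrable unit_leb (\<lambda>s. 2 * y m * \<gamma> s)" using \<gamma>i by simp
    show "(y s)\<^sup>2 = (y 0)\<^sup>2 + prim E s" if "s \<in> {0..1}" for s by (rule Y[OF that])
    show "AE s in unit_leb. \<bar>E s\<bar> \<le> 2 * n s * (y s)\<^sup>2 + 2 * y m * \<gamma> s" using est by auto
    have "(LINT s|unit_leb. n s) \<le> nrm unit_leb n"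
      using L1_le_nrm[OF ni(1)] by (simp add: n_def)
    then show "(LINT s|unit_leb. 2 * n s) \<le> real N / 2" using N ni(2) by simp
  qed (use m Ei in \<open>auto simp: n_def \<gamma>_def y_def\<close>)
  moreover have "y 1 = 0"
  proof -
    have "(LINT x|unit_leb. (\<phi> (x, 1))\<^sup>2) = (LINT x|unit_leb. 0)"
      by (rule Bochner_Integration.integral_cong) (use e in auto)
    then show ?thesis by (simp add: y_def nrm_def)
  qed
  ultimately have "y m * y m \<le> (2 ^ (N + 3) * (LINT s|unit_leb. \<gamma> s)) * y m"
    by (simp add: power2_eq_square power_add mult_ac)
  moreover have "0 \<le> (LINT s|unit_leb. \<gamma> s)" by (rule integral_nonneg_AE) (simp add: \<gamma>_def)
  ultimately have "y m \<le> 2 ^ (N + 3) * (LINT s|unit_leb. \<gamma> s)"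
    using y0[of m] by (cases "y m = 0") (auto simp: mult_le_cancel_right)
  then show ?thesis using m(2)[OF t] by (simp add: y_def \<gamma>_def)
qed

section \<open>Uniqueness for the transport equation\<close>

text \<open>Uniqueness holds in the mere class of square integrable solutions because the space primitive
  \<open>D\<close> of a solution solves a transport equation of its own, for which the energy
  method needs no regularization: \<open>D\<close> already has a square integrable derivative.\<close>

lemma primitive_transport_slice:
  assumes d: "d \<in> sq_int unit_leb" and w: "w \<in> sq_int unit_leb"
  shows "\<bar>LINT x|unit_leb. (prim (\<lambda>y. d y * G1 w y) x - d x * G0 w x) * prim d x\<bar> \<le> 4 * nrm unit_leb w * (nrm unit_leb (prim d))\<^sup>2"
proof -
  have di: "integrable unit_leb d" and wi: "integrable unit_leb w" by (intro U.sq_int_integrable d w)+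
  define D where "D = prim d"
  have Dc: "continuous_on {0..1} D" unfolding D_def by (rule prim_continuous[OF di])
  have Ds: "D \<in> sq_int unit_leb" by (rule cont_sq_int[OF Dc])
  have Dw: "integrable unit_leb (\<lambda>x. D x * w x)" by (rule sq_int_mult[OF Ds w])
  have dG: "integrable unit_leb (\<lambda>x. d x * G0 w x)" 
    by (rule sq_int_mult[OF d G0_sq_int[OF wi]])
  define c where "c = (LINT y|unit_leb. (1 - y) * w y)"
  \<comment> \<open>Product rule with v_xx = \<open>w\<close>: the primitive of d v_x is D v_x minus
    the primitive of D w, so the derivative \<open>d\<close> is traded for \<open>D\<close>
    itself.\<close>
  have 1: "prim (\<lambda>y. d y * G1 w y) x = D x * G1 w x - prim (\<lambda>y. D y * w y) x" for x
  proof -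
    have "D x * prim w x = prim (\<lambda>y. d y * prim w y) x + prim (\<lambda>y. D y * w y) x"
      unfolding D_def using prim_product[OF di wi, of x] 
        prim_add[OF integrable_mult_prim[OF di wi] Dw[unfolded D_def], of x] by simp
    moreover have "prim (\<lambda>y. d y * G1 w y) x = prim (\<lambda>y. d y * prim w y) x - c * D x"
    proof -
      have "(\<lambda>y. d y * G1 w y) = (\<lambda>y. d y * prim w y - c * d y)"
        by (auto simp: G1_def c_def algebra_simps)
      then show ?thesis using prim_diff[OF integrable_mult_prim[OF di wi], of "\<lambda>y. c * d y" x] di
        by (simp add: prim_cmult D_def)
    qed
    ultimately show ?thesis by (simp add: G1_def c_def algebra_simps)
  qed
  define R where "R = prim (\<lambda>y. D y * w y)"
  have Rs: "R \<in> sq_int unit_leb" unfolding R_def by (rule prim_sq_int[OF Dw])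
  have D2G: "integrable unit_leb (\<lambda>x. (D x)\<^sup>2 * G1 w x)" 
    by (intro U.sq_int_integrable cont_sq_int continuous_intros Dc G1_continuous wi)
  have dGD: "integrable unit_leb (\<lambda>x. d x * (G0 w x * D x))"
    by (intro sq_int_mult d cont_sq_int continuous_intros G0_continuous Dc wi)
  have A: "(LINT x|unit_leb. d x * (G0 w x * D x)) = - (LINT x|unit_leb. (D x)\<^sup>2 * G1 w x) / 2"
  proof -
    have "(LINT x|unit_leb. D x * (D x * G1 w x + d x * G0 w x)) = (LINT x|unit_leb. (D x)\<^sup>2 * G1 w x) / 2"
      by (rule transport_energy_slice[OF di w, of _ 0]) (simp add: D_def)
    moreover have "(LINT x|unit_leb. D x * (D x * G1 w x + d x * G0 w x)) = 
       (LINT x|unit_leb. (D x)\<^sup>2 * G1 w x + d x * (G0 w x * D x))"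
      by (rule Bochner_Integration.integral_cong) (auto simp: algebra_simps power2_eq_square)
    moreover have "\<dots> = (LINT x|unit_leb. (D x)\<^sup>2 * G1 w x) + (LINT x|unit_leb. d x * (G0 w x * D x))"
      by (rule Bochner_Integration.integral_add[OF D2G dGD])
    ultimately show ?thesis by simp
  qed
  have "(LINT x|unit_leb. (prim (\<lambda>y. d y * G1 w y) x - d x * G0 w x) * prim d x) = 
      (LINT x|unit_leb. ((D x)\<^sup>2 * G1 w x - R x * D x) - d x * (G0 w x * D x))"
    by (rule Bochner_Integration.integral_cong) (auto simp: 1 R_def[symmetric] D_def[symmetric] algebra_simps power2_eq_square)
  \<comment> \<open>The term D^2 v_x enters once directly and once with weight 1/2 from d v D. With
    |v_x| \<le> 2 |w| this gives 3, and the remaining term contributes 1 to the final 4.\<close>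
  also have "\<dots> = 3/2 * (LINT x|unit_leb. (D x)\<^sup>2 * G1 w x) - (LINT x|unit_leb. R x * D x)"
    using D2G dGD sq_int_mult[OF Rs Ds] A by simp
  also have "\<bar>\<dots>\<bar> \<le> 3/2 * \<bar>LINT x|unit_leb. (D x)\<^sup>2 * G1 w x\<bar> + \<bar>LINT x|unit_leb. R x * D x\<bar>" by linarith
  also have "\<dots> \<le> 3/2 * (2 * nrm unit_leb w * (nrm unit_leb D)\<^sup>2) + nrm unit_leb w * (nrm unit_leb D)\<^sup>2"
  proof (intro add_mono mult_left_mono)
    show "\<bar>LINT x|unit_leb. (D x)\<^sup>2 * G1 w x\<bar> \<le> 2 * nrm unit_leb w * (nrm unit_leb D)\<^sup>2"
    proof (rule abs_integral_sq_mult_le[OF Ds sq_int_meas[OF G1_sq_int[OF wi]]])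
      show "AE x in unit_leb. \<bar>G1 w x\<bar> \<le> 2 * nrm unit_leb w"
        using G1_bound[OF wi] L1_le_nrm[OF w] by (intro AE_I2) (smt (verit))
    qed simp
    have "\<bar>LINT x|unit_leb. R x * D x\<bar> \<le> nrm unit_leb R * nrm unit_leb D" by (rule cauchy_schwarz[OF Rs Ds])
    also have "nrm unit_leb R \<le> nrm unit_leb D * nrm unit_leb w"
    proof (rule nrm_le_const[OF sq_int_meas[OF Rs]])
      have abs_s: "(\<lambda>x. \<bar>u x\<bar>) \<in> sq_int unit_leb" "nrm unit_leb (\<lambda>x. \<bar>u x\<bar>) = nrm unit_leb u" if "u \<in> sq_int unit_leb" for u
        using that by (auto simp: sq_int_def nrm_def)
      have "(LINT x|unit_leb. \<bar>D x * w x\<bar>) \<le> nrm unit_leb D * nrm unit_leb w"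
        using cauchy_schwarz[OF abs_s(1)[OF Ds] abs_s(1)[OF w]] abs_s(2)[OF Ds] abs_s(2)[OF w] by (simp add: abs_mult)
      then have "\<bar>R x\<bar> \<le> nrm unit_leb D * nrm unit_leb w" for x
        using prim_bound[OF Dw, of x] unfolding R_def by linarith
      then show "AE x in unit_leb. \<bar>R x\<bar> \<le> nrm unit_leb D * nrm unit_leb w" by simp
    qed simp
    then have "nrm unit_leb R * nrm unit_leb D \<le> nrm unit_leb D * nrm unit_leb w * nrm unit_leb D"
      by (rule mult_right_mono) simp
    also have "\<dots> = nrm unit_leb w * (nrm unit_leb D)\<^sup>2" by (simp add: power2_eq_square)
    finally show "\<bar>LINT x|unit_leb. R x * D x\<bar> \<le> nrm unit_leb w * (nrm unit_leb D)\<^sup>2" by simp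
  qed simp
  finally show ?thesis by (simp add: D_def)
qed

text \<open>The antiderivative of -x^k that vanishes at 1. Against it integration by parts has no
  boundary terms: \<open>prim\<close> vanishes at 0 and \<open>mono1\<close> at 1. In time this
  makes admissible dual test functions.\<close>

definition mono1 :: "nat \<Rightarrow> real poly" where
  "mono1 k = smult (1 / real (Suc k)) (1 - monom 1 (Suc k))"

lemma poly_mono1: "poly (mono1 k) x = (1 - x ^ Suc k) / real (Suc k)"
  by (simp add: mono1_def poly_monom)

lemma pderiv_mono1: "pderiv (mono1 k) = - monom 1 k"
proof -
  have "pderiv (mono1 k) = smult (1 / real (Suc k)) (- monom (real (Suc k)) k)"
    by (simp add: mono1_def pderiv_smult pderiv_diff pderiv_monom)
  then show ?thesis by (simp add: smult_monom)
qed

lemma moment_by_parts: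
  assumes a: "integrable unit_leb a"
  shows "(LINT x|unit_leb. a x * poly (mono1 k) x) = (LINT x|unit_leb. prim a x * x ^ k)"
proof -
  have xi: "integrable unit_leb (\<lambda>x::real. x ^ k)"
    by (intro U.sq_int_integrable cont_sq_int continuous_intros)
  have P: "prim (\<lambda>x. x ^ k) x = poly (mono1 k) 0 - poly (mono1 k) x" if "x \<in> {0..1}" for x
  proof -
    have "prim (\<lambda>x. x ^ k) x = (- poly (mono1 k) x) - (- poly (mono1 k) 0)"
    proof (rule prim_FTC[where F="\<lambda>x. - poly (mono1 k) x", OF _ _ that])
      show "((\<lambda>x. - poly (mono1 k) x) has_real_derivative x ^ k) (at x within {0..1})" for x
        using DERIV_minus[OF has_field_derivative_at_within[OF poly_DERIV[of "mono1 k" x]], of "{0..1}"]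
        by (simp add: pderiv_mono1 poly_monom)
    qed (intro continuous_intros)
    then show ?thesis by simp
  qed
  have tot: "(LINT x|unit_leb. x ^ k) = poly (mono1 k) 0"
    using P[of 1] prim_1[of 1 "\<lambda>x. x ^ k"] by (simp add: poly_mono1)
  have "(LINT x|unit_leb. a x * poly (mono1 k) x) = (LINT x|unit_leb. poly (mono1 k) 0 * a x - a x * prim (\<lambda>x. x ^ k) x)"
    by (rule Bochner_Integration.integral_cong) (auto simp: P algebra_simps)
  also have "\<dots> = poly (mono1 k) 0 * (LINT x|unit_leb. a x) - (LINT x|unit_leb. a x * prim (\<lambda>x. x ^ k) x)"
    using a integrable_mult_prim[OF a xi] by simp
  also have "\<dots> = (LINT x|unit_leb. prim a x * x ^ k)"
    using prim_by_parts_full[OF a xi] tot by (simp add: mult.commute)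
  finally show ?thesis .
qed

lemma monomial_orthogonal_zero:
  assumes u: "u \<in> sq_int unit_leb" and o: "\<And>k. (LINT x|unit_leb. u x * x ^ k) = 0"
  shows "AE x in unit_leb. u x = 0"
proof (rule poly_orthogonal_zero[OF u])
  fix p :: "real poly"
  have xs: "(\<lambda>x::real. x ^ k) \<in> sq_int unit_leb" for k by (intro cont_sq_int continuous_intros)
  have "(LINT x|unit_leb. u x * poly p x) = (LINT x|unit_leb. (\<Sum>i\<le>degree p. coeff p i * (u x * x ^ i)))"
    by (rule Bochner_Integration.integral_cong) (auto simp: poly_altdef sum_distrib_left mult_ac)
  also have "\<dots> = (\<Sum>i\<le>degree p. coeff p i * (LINT x|unit_leb. u x * x ^ i))"
    using sq_int_mult[OF u xs] by simp
  also have "\<dots> = 0" using o by simp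
  finally show "(LINT x|unit_leb. u x * poly p x) = 0" .
qed

lemma sq_int_dominated:
  assumes a: "a \<in> sq_int M" and m: "g \<in> borel_measurable M" and le: "AE x in M. \<bar>g x\<bar> \<le> a x"
  shows "g \<in> sq_int M"
proof (rule sq_intI[OF m], rule Bochner_Integration.integrable_bound[OF sq_int_sq[OF a]])
  show "AE x in M. norm ((g x)\<^sup>2) \<le> norm ((a x)\<^sup>2)"
    using le by eventually_elim (simp add: abs_le_square_iff[symmetric])
qed (use m in measurable)

text \<open>The time derivative of the space primitive of a solution of d_t + v d_x = 0: a primitive
  in x of d v_x - (d v)_x.\<close>

definition fluxQ :: "(real \<times> real \<Rightarrow> real) \<Rightarrow> (real \<times> real \<Rightarrow> real) \<Rightarrow> real \<times> real \<Rightarrow> real" where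
  "fluxQ d w p = PX (\<lambda>p. d p * V1 w p) p - d p * V0 w p"

lemma PX_sqQ:
  assumes d: "d \<in> sqQ" shows "PX d \<in> sqQ"
proof (rule sqQ_dominated(1)[OF PX_meas[OF sqQ_meas[OF d]] nrm_slice(1)[OF sqQ_sq_int[OF d]]])
  fix t x :: real assume "t \<in> {0<..<1}"
  then show "\<bar>PX d (t, x)\<bar> \<le> nrm unit_leb (\<lambda>x. d (t, x))"
    unfolding PX_def using prim_nrm_bound[OF sqQ_slice[OF d]] by simp
qed

text \<open>The flux is a product of two functions square integrable in time, hence only integrable;
  the pointwise bound keeps |d(t, x)| so that it can be integrated in either order later.\<close>

lemma fluxQ_props:
  assumes d: "d \<in> sqQ" and w: "w \<in> sqQ"
  shows "fluxQ d w \<in> borel_measurable unit_sq" "integrable unit_sq (fluxQ d w)"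
    "\<And>t x. t \<in> {0<..<1} \<Longrightarrow> \<bar>fluxQ d w (t, x)\<bar> \<le> 
      2 * (nrm unit_leb (\<lambda>y. w (t, y)) * nrm unit_leb (\<lambda>y. d (t, y))) + 2 * nrm unit_leb (\<lambda>y. w (t, y)) * \<bar>d (t, x)\<bar>"
proof -
  note [measurable] = sqQ_meas[OF d] V1_meas[OF sqQ_meas[OF w]] V0_meas[OF sqQ_meas[OF w]]
  have [measurable]: "PX (\<lambda>p. d p * V1 w p) \<in> borel_measurable unit_sq" by (intro PX_meas) measurable
  show m: "fluxQ d w \<in> borel_measurable unit_sq" unfolding fluxQ_def[abs_def] by measurable
  define n where "n t = nrm unit_leb (\<lambda>y. w (t, y))" for t
  define k where "k t = nrm unit_leb (\<lambda>y. d (t, y))" for t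
  have ns: "n \<in> sq_int unit_leb" and ks: "k \<in> sq_int unit_leb"
    unfolding n_def k_def by (intro nrm_slice(1) sqQ_sq_int d w)+
  have B: "\<bar>PX (\<lambda>p. d p * V1 w p) (t, x)\<bar> \<le> 2 * (n t * k t)" if t: "t \<in> {0<..<1}" for t x
  proof -
    have ds: "(\<lambda>y. d (t, y)) \<in> sq_int unit_leb" by (rule sqQ_slice[OF d t])
    have i: "integrable unit_leb (\<lambda>y. d (t, y) * V1 w (t, y))"
      by (rule sq_int_mult[OF ds sqQ_slice[OF V_sqQ(1)[OF w] t]])
    have "\<bar>PX (\<lambda>p. d p * V1 w p) (t, x)\<bar> \<le> (LINT y|unit_leb. \<bar>d (t, y) * V1 w (t, y)\<bar>)"
      unfolding PX_def using prim_bound[OF i, of x] by simp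
    also have "\<dots> \<le> (LINT y|unit_leb. 2 * n t * \<bar>d (t, y)\<bar>)"
    proof (rule integral_mono[OF integrable_abs[OF i]])
      show "integrable unit_leb (\<lambda>y. 2 * n t * \<bar>d (t, y)\<bar>)" using U.sq_int_integrable[OF ds] by simp
      show "\<bar>d (t, y) * V1 w (t, y)\<bar> \<le> 2 * n t * \<bar>d (t, y)\<bar>" for y
        using mult_right_mono[OF V_bound(1)[OF w t, of y], of "\<bar>d (t, y)\<bar>"] by (simp add: abs_mult n_def mult.commute)
    qed
    also have "\<dots> \<le> 2 * n t * k t"
    proof -
      have "2 * n t * (LINT y|unit_leb. \<bar>d (t, y)\<bar>) \<le> 2 * n t * k t"
        using L1_le_nrm[OF ds] by (intro mult_left_mono) (auto simp: n_def k_def)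
      then show ?thesis by simp
    qed
    finally show ?thesis by simp
  qed
  have C: "\<bar>d (t, x) * V0 w (t, x)\<bar> \<le> 2 * n t * \<bar>d (t, x)\<bar>" if t: "t \<in> {0<..<1}" for t x
    using mult_right_mono[OF V_bound(2)[OF w t, of x], of "\<bar>d (t, x)\<bar>"] by (simp add: abs_mult n_def mult.commute)
  show "\<bar>fluxQ d w (t, x)\<bar> \<le> 
      2 * (nrm unit_leb (\<lambda>y. w (t, y)) * nrm unit_leb (\<lambda>y. d (t, y))) + 2 * nrm unit_leb (\<lambda>y. w (t, y)) * \<bar>d (t, x)\<bar>"
    if "t \<in> {0<..<1}" for t x
    using B[OF that, of x] C[OF that, of x] unfolding fluxQ_def n_def k_def by linarith
  have nk: "integrable unit_leb (\<lambda>t. 2 * (n t * k t))" using sq_int_mult[OF ns ks] by simp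
  have "integrable unit_sq (\<lambda>p. 2 * (n (fst p) * k (fst p)))"
    using integrable_tensor[OF nk, of "\<lambda>_. 1"] by (simp add: case_prod_unfold)
  then have "integrable unit_sq (PX (\<lambda>p. d p * V1 w p))"
  proof (rule Bochner_Integration.integrable_bound)
    show "AE p in unit_sq. norm (PX (\<lambda>p. d p * V1 w p) p) \<le> norm (2 * (n (fst p) * k (fst p)))"
    proof (rule AE_Q_I)
      fix t x :: real assume t: "t \<in> {0<..<1}"
      show "norm (PX (\<lambda>p. d p * V1 w p) (t, x)) \<le> norm (2 * (n (fst (t, x)) * k (fst (t, x))))"
        using B[OF t, of x] by (simp add: n_def k_def)
    qed
  qed measurable
  moreover have "integrable unit_sq (\<lambda>p. d p * V0 w p)"
    by (rule sq_int_mult[OF sqQ_sq_int[OF d] sqQ_sq_int[OF V_sqQ(2)[OF w]]])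
  ultimately show "integrable unit_sq (fluxQ d w)" unfolding fluxQ_def[abs_def] by simp
qed

text \<open>Test functions that are products of \<open>mono1 j\<close> in space and
  \<open>- mono1 k\<close> in time vanish at position 1 and at time 1. Integrating by parts in both
  variables turns orthogonality into the vanishing of all time moments of the difference of the two
  sides.\<close>

lemma dual_moments:
  assumes d: "d \<in> sqQ" and w: "w \<in> sqQ"
    and orth: "\<And>\<phi>. \<phi> \<in> smooth_square \<Longrightarrow> (\<And>x. x \<in> {0..1} \<Longrightarrow> \<phi> (x, 1) = 0) \<Longrightarrow> (LINT p|unit_sq. d p * gen w \<phi> p) = 0"
  shows "AE t in unit_leb. (LINT x|unit_leb. PX d (t, x) * x ^ j) = prim (\<lambda>s. LINT x|unit_leb. fluxQ d w (s, x) * x ^ j) t"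
proof -
  define h where "h t = (LINT x|unit_leb. PX d (t, x) * x ^ j)" for t
  define g where "g t = (LINT x|unit_leb. fluxQ d w (t, x) * x ^ j)" for t
  have xs: "(\<lambda>x::real. x ^ j) \<in> sq_int unit_leb" by (intro cont_sq_int continuous_intros)
  have xQ: "(\<lambda>p. (snd p) ^ j) \<in> sqQ" using sq_int_space[OF xs] .
  have hi: "integrable unit_sq (\<lambda>p. PX d p * (snd p) ^ j)"
    by (rule sq_int_mult[OF sqQ_sq_int[OF PX_sqQ[OF d]] sqQ_sq_int[OF xQ]])
  have gi: "integrable unit_sq (\<lambda>p. fluxQ d w p * (snd p) ^ j)"
  proof (rule Bochner_Integration.integrable_bound[OF fluxQ_props(2)[OF d w]])
    note [measurable] = fluxQ_props(1)[OF d w]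
    show "(\<lambda>p. fluxQ d w p * (snd p) ^ j) \<in> borel_measurable unit_sq" by measurable
    show "AE p in unit_sq. norm (fluxQ d w p * (snd p) ^ j) \<le> norm (fluxQ d w p)"
      by (rule AE_Q_I) (auto simp: abs_mult power_abs intro!: mult_left_le power_le_one)
  qed
  have him: "h \<in> borel_measurable unit_leb"
    using borel_measurable_integrable[OF UU.integrable_fst'[OF hi]] by (simp add: h_def[abs_def])
  have g_int: "integrable unit_leb g" using UU.integrable_fst'[OF gi] by (simp add: g_def[abs_def])
  have hs: "h \<in> sq_int unit_leb"
  proof (rule sq_int_dominated[OF nrm_slice(1)[OF sqQ_sq_int[OF PX_sqQ[OF d]]] him], rule AE_I2)
    fix t assume "t \<in> space unit_leb"
    then have t: "t \<in> {0<..<1}" by simp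
    have "\<bar>h t\<bar> \<le> nrm unit_leb (\<lambda>x. PX d (t, x)) * nrm unit_leb (\<lambda>x. x ^ j)"
      unfolding h_def by (rule cauchy_schwarz[OF sqQ_slice[OF PX_sqQ[OF d] t] xs])
    also have "\<dots> \<le> nrm unit_leb (\<lambda>x. PX d (t, x)) * 1"
      by (intro mult_left_mono nrm_le_const sq_int_meas[OF xs]) (auto simp: power_abs intro!: power_le_one AE_I2)
    finally show "\<bar>h t\<bar> \<le> nrm unit_leb (\<lambda>x. PX d (t, x))" by simp
  qed
  have slice: "(LINT x|unit_leb. d (t, x) * poly (mono1 j) x) = h t"
    "(LINT x|unit_leb. d (t, x) * (poly (mono1 j) x * V1 w (t, x) - x ^ j * V0 w (t, x))) = g t"
    "integrable unit_leb (\<lambda>x. d (t, x) * (poly (mono1 j) x * V1 w (t, x) - x ^ j * V0 w (t, x)))"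
    if t: "t \<in> {0<..<1}" for t
  proof -
    have ds: "(\<lambda>x. d (t, x)) \<in> sq_int unit_leb" by (rule sqQ_slice[OF d t])
    show "(LINT x|unit_leb. d (t, x) * poly (mono1 j) x) = h t"
      using moment_by_parts[OF sqQ_slice_int[OF d t], of j] by (simp add: h_def PX_def)
    have wi: "integrable unit_leb (\<lambda>x. w (t, x))" by (rule sqQ_slice_int[OF w t])
    have V1c: "continuous_on {0..1} (\<lambda>x. V1 w (t, x))" and V0c: "continuous_on {0..1} (\<lambda>x. V0 w (t, x))"
      unfolding V1_def V0_def fst_conv snd_conv
      using G1_continuous[OF wi] G0_continuous[OF wi] by auto
    have i1: "integrable unit_leb (\<lambda>x. d (t, x) * V1 w (t, x))" 
      by (intro sq_int_mult ds cont_sq_int V1c)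
    have i2: "integrable unit_leb (\<lambda>x. d (t, x) * (V1 w (t, x) * poly (mono1 j) x))" 
      by (intro sq_int_mult ds cont_sq_int continuous_intros V1c)
    have i3: "integrable unit_leb (\<lambda>x. d (t, x) * (V0 w (t, x) * x ^ j))" 
      by (intro sq_int_mult ds cont_sq_int continuous_intros V0c)
    have eq: "d (t, x) * (poly (mono1 j) x * V1 w (t, x) - x ^ j * V0 w (t, x)) =
      d (t, x) * (V1 w (t, x) * poly (mono1 j) x) - d (t, x) * (V0 w (t, x) * x ^ j)" for x
      by (simp add: algebra_simps)
    show "integrable unit_leb (\<lambda>x. d (t, x) * (poly (mono1 j) x * V1 w (t, x) - x ^ j * V0 w (t, x)))"
      unfolding eq using i2 i3 by simp
    have pi: "integrable unit_leb (\<lambda>x. PX (\<lambda>p. d p * V1 w p) (t, x) * x ^ j)"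
      unfolding PX_def fst_conv snd_conv by (rule sq_int_mult[OF prim_sq_int[OF i1] xs])
    have "(LINT x|unit_leb. d (t, x) * (poly (mono1 j) x * V1 w (t, x) - x ^ j * V0 w (t, x))) = 
       (LINT x|unit_leb. d (t, x) * (V1 w (t, x) * poly (mono1 j) x)) - (LINT x|unit_leb. d (t, x) * (V0 w (t, x) * x ^ j))"
      unfolding eq by (rule Bochner_Integration.integral_diff[OF i2 i3])
    also have "(LINT x|unit_leb. d (t, x) * (V1 w (t, x) * poly (mono1 j) x)) = (LINT x|unit_leb. PX (\<lambda>p. d p * V1 w p) (t, x) * x ^ j)"
      using moment_by_parts[OF i1, of j] by (simp add: PX_def mult.assoc)
    also have "(LINT x|unit_leb. PX (\<lambda>p. d p * V1 w p) (t, x) * x ^ j) - (LINT x|unit_leb. d (t, x) * (V0 w (t, x) * x ^ j)) = g t"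
      unfolding g_def fluxQ_def using Bochner_Integration.integral_diff[OF pi i3] by (simp add: left_diff_distrib mult.assoc)
    finally show "(LINT x|unit_leb. d (t, x) * (poly (mono1 j) x * V1 w (t, x) - x ^ j * V0 w (t, x))) = g t" .
  qed
  have "AE t in unit_leb. h t - prim g t = 0"
  proof (rule monomial_orthogonal_zero)
    have ps: "prim g \<in> sq_int unit_leb" by (rule prim_sq_int[OF g_int])
    show "(\<lambda>t. h t - prim g t) \<in> sq_int unit_leb" by (rule sq_int_diff[OF hs ps])
    fix k
    have ts: "(\<lambda>x::real. x ^ k) \<in> sq_int unit_leb" by (intro cont_sq_int continuous_intros)
    \<comment> \<open>The sign makes the time derivative of the second factor t^k.\<close>
    define \<phi> where "\<phi> = (\<lambda>(x, t). poly (mono1 j) x * poly (- mono1 k) t)"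
    have \<phi>: "\<phi> \<in> smooth_square" unfolding \<phi>_def by (rule poly_tensor_smooth(1))
    have gen: "gen w \<phi> (t, x) = t ^ k * poly (mono1 j) x - poly (mono1 k) t * (poly (mono1 j) x * V1 w (t, x) - x ^ j * V0 w (t, x))" for t x
      unfolding gen_def \<phi>_def poly_tensor_smooth(2,3) sw_def
      by (simp add: pderiv_minus pderiv_mono1 poly_monom algebra_simps)
    have di: "integrable unit_sq (\<lambda>p. d p * gen w \<phi> p)"
      by (intro sq_int_mult sqQ_sq_int d transport_terms_sqQ(4) \<phi> w)
    have "0 = (LINT p|unit_sq. d p * gen w \<phi> p)"
      using orth[OF \<phi>] by (simp add: \<phi>_def poly_mono1)
    also have "\<dots> = (LINT t|unit_leb. LINT x|unit_leb. d (t, x) * gen w \<phi> (t, x))" by (rule integral_iterated[OF di])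
    also have "\<dots> = (LINT t|unit_leb. h t * t ^ k - g t * poly (mono1 k) t)"
    proof (rule Bochner_Integration.integral_cong[OF refl])
      fix t assume "t \<in> space unit_leb"
      then have t: "t \<in> {0<..<1}" by simp
      have i: "integrable unit_leb (\<lambda>x. d (t, x) * poly (mono1 j) x)" by (intro sq_int_mult sqQ_slice[OF d t] poly_sq_int)
      have "(LINT x|unit_leb. d (t, x) * gen w \<phi> (t, x)) = 
        (LINT x|unit_leb. t ^ k * (d (t, x) * poly (mono1 j) x) - poly (mono1 k) t * (d (t, x) * (poly (mono1 j) x * V1 w (t, x) - x ^ j * V0 w (t, x))))"
        unfolding gen by (rule Bochner_Integration.integral_cong) (auto simp: algebra_simps)
      also have "\<dots> = h t * t ^ k - g t * poly (mono1 k) t"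
        using i slice[OF t] by simp
      finally show "(LINT x|unit_leb. d (t, x) * gen w \<phi> (t, x)) = h t * t ^ k - g t * poly (mono1 k) t" .
    qed
    also have "\<dots> = (LINT t|unit_leb. h t * t ^ k) - (LINT t|unit_leb. g t * poly (mono1 k) t)"
    proof (rule Bochner_Integration.integral_diff[OF sq_int_mult[OF hs ts]])
      obtain C where C: "C \<ge> 0" "\<And>x. x \<in> {0..1} \<Longrightarrow> \<bar>poly (mono1 k) x\<bar> \<le> C" 
        using cont_bounded_unit[of "poly (mono1 k)"] continuous_on_poly[OF continuous_on_id] by blast
      have gm: "(\<lambda>t. g t * poly (mono1 k) t) \<in> borel_measurable unit_leb"
        using borel_measurable_integrable[OF g_int] sq_int_meas[OF poly_sq_int[of "mono1 k"]] by measurable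
      show "integrable unit_leb (\<lambda>t. g t * poly (mono1 k) t)"
      proof (rule Bochner_Integration.integrable_bound[of _ "\<lambda>t. C * g t", OF _ gm])
        show "integrable unit_leb (\<lambda>t. C * g t)" using g_int by simp
        show "AE t in unit_leb. norm (g t * poly (mono1 k) t) \<le> norm (C * g t)"
        proof (rule AE_I2)
          fix t assume "t \<in> space unit_leb"
          then have "\<bar>poly (mono1 k) t\<bar> \<le> C" using C(2)[of t] by simp
          then show "norm (g t * poly (mono1 k) t) \<le> norm (C * g t)"
            using C(1) mult_right_mono[of "\<bar>poly (mono1 k) t\<bar>" C "\<bar>g t\<bar>"] by (simp add: abs_mult mult.commute)
        qed
      qed
    qed
    also have "\<dots> = (LINT t|unit_leb. (h t - prim g t) * t ^ k)"
      unfolding moment_by_parts[OF g_int] left_diff_distrib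
      by (rule Bochner_Integration.integral_diff[OF sq_int_mult[OF hs ts] sq_int_mult[OF ps ts], symmetric])
    finally show "(LINT t|unit_leb. (h t - prim g t) * t ^ k) = 0" by simp
  qed
  then show ?thesis unfolding h_def g_def by eventually_elim simp
qed

lemma swap_sq_int:
  assumes "d \<in> sq_int unit_sq" shows "(\<lambda>p. d (snd p, fst p)) \<in> sq_int unit_sq"
proof (rule sq_intI)
  note [measurable] = sq_int_meas[OF assms]
  show "(\<lambda>p. d (snd p, fst p)) \<in> borel_measurable unit_sq" by measurable
  show "integrable unit_sq (\<lambda>p. (d (snd p, fst p))\<^sup>2)"
    using UU.integrable_product_swap[OF sq_int_sq[OF assms]] by (simp add: case_prod_unfold)
qed

lemma AE_Q_collect:
  assumes "{p \<in> space unit_sq. P p} \<in> sets unit_sq" "AE t in unit_leb. AE x in unit_leb. P (t, x)"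
  shows "AE p in unit_sq. P p"
  by (rule UU.AE_pair_measure[OF assms])

text \<open>The exceptional set is enclosed in a measurable null set first: the product measure
  space is not completed, and no measurability of \<open>P\<close> is assumed.\<close>

lemma AE_Q_snd:
  assumes "AE x in unit_leb. P x"
  shows "AE p in unit_sq. P (snd p)"
proof -
  obtain N where N: "{x \<in> space unit_leb. \<not> P x} \<subseteq> N" "emeasure unit_leb N = 0" "N \<in> sets unit_leb"
    using AE_E[OF assms] by blast
  have n: "AE x in unit_leb. x \<notin> N" using N by (intro AE_not_in null_setsI)
  have "AE p in unit_sq. snd p \<notin> N"
    by (rule AE_Q_collect) (use N(3) n in auto)
  then show ?thesis using AE_space
  proof eventually_elim
    case (elim p)
    then show ?case using N(1) by (auto simp: space_pair_measure)
  qed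
qed

text \<open>The space primitive of \<open>d\<close> agrees at almost every time with
  \<open>R\<close>, the time integral of the flux. \<open>R\<close> is a primitive in time at almost
  every position, so its square obeys the product rule; Gronwall from \<open>R\<close> = 0 at time 0
  gives \<open>R\<close> = 0, and then \<open>d\<close> is a weak derivative of zero.\<close>

lemma dual_trivial:
  assumes d: "d \<in> sqQ" and w: "w \<in> sqQ"
    and orth: "\<And>\<phi>. \<phi> \<in> smooth_square \<Longrightarrow> (\<And>x. x \<in> {0..1} \<Longrightarrow> \<phi> (x, 1) = 0) \<Longrightarrow> (LINT p|unit_sq. d p * gen w \<phi> p) = 0"
  shows "AE p in unit_sq. d p = 0"
proof -
  define E where "E = fluxQ d w"
  have Em [measurable]: "E \<in> borel_measurable unit_sq" and Ei: "integrable unit_sq E"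
    unfolding E_def by (rule fluxQ_props[OF d w])+
  note [measurable] = PX_meas[OF sqQ_meas[OF d]]
  define R where "R p = prim (\<lambda>s. E (s, snd p)) (fst p)" for p
  have Es [measurable]: "(\<lambda>p. E (snd p, fst p)) \<in> borel_measurable unit_sq" by measurable
  have Rm [measurable]: "R \<in> borel_measurable unit_sq"
  proof -
    have sm: "(\<lambda>p. (snd p, fst p)) \<in> measurable unit_sq unit_sq" by measurable
    have "(\<lambda>p. PX (\<lambda>p. E (snd p, fst p)) (snd p, fst p)) \<in> borel_measurable unit_sq"
      by (rule measurable_compose[OF sm PX_meas[OF Es]])
    then show ?thesis by (simp add: PX_def R_def[abs_def])
  qed
  define n where "n t = nrm unit_leb (\<lambda>y. w (t, y))" for t
  define k where "k t = nrm unit_leb (\<lambda>y. d (t, y))" for t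
  define m where "m x = nrm unit_leb (\<lambda>t. d (t, x))" for x
  have ns: "n \<in> sq_int unit_leb" "nrm unit_leb n = nrm unit_sq w" and ks: "k \<in> sq_int unit_leb"
    unfolding n_def k_def using nrm_slice[OF sqQ_sq_int[OF w]] nrm_slice[OF sqQ_sq_int[OF d]] by auto
  have ms: "m \<in> sq_int unit_leb"
    unfolding m_def using nrm_slice(1)[OF swap_sq_int[OF sqQ_sq_int[OF d]]] by simp
  define a where "a = (LINT t|unit_leb. 2 * (n t * k t))"
  \<comment> \<open>A bound for \<open>R\<close> at position \<open>x\<close> that is uniform in
    time; it is square integrable in \<open>x\<close>, which makes the product of flux and
    \<open>R\<close> integrable on the square.\<close>
  define b where "b x = a + 2 * nrm unit_leb n * m x" for x
  have bs: "b \<in> sq_int unit_leb" unfolding b_def by (intro sq_int_add U.sq_int_const sq_int_scale ms)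
  have good: "AE x in unit_leb. integrable unit_leb (\<lambda>s. E (s, x)) \<and> (\<lambda>s. d (s, x)) \<in> sq_int unit_leb"
  proof -
    have "AE x in unit_leb. integrable unit_leb (\<lambda>s. E (s, x))"
      using UU.AE_integrable_snd[of "\<lambda>s x. E (s, x)"] Ei by simp
    moreover have "AE x in unit_leb. integrable unit_leb (\<lambda>s. (d (s, x))\<^sup>2)"
      using UU.AE_integrable_fst'[OF sq_int_sq[OF swap_sq_int[OF sqQ_sq_int[OF d]]]] by simp
    moreover have "AE x in unit_leb. (\<lambda>s. d (s, x)) \<in> borel_measurable unit_leb"
      using slice_meas[OF sq_int_meas[OF swap_sq_int[OF sqQ_sq_int[OF d]]]] by (intro AE_I2) simp
    ultimately show ?thesis by eventually_elim (auto intro: sq_intI)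
  qed
  have Rb: "AE x in unit_leb. \<forall>t. \<bar>R (t, x)\<bar> \<le> b x"
    using good
  proof eventually_elim
    case (elim x)
    then have Ex: "integrable unit_leb (\<lambda>s. E (s, x))" and dx: "(\<lambda>s. d (s, x)) \<in> sq_int unit_leb" by auto
    have nd: "(\<lambda>s. \<bar>d (s, x)\<bar>) \<in> sq_int unit_leb" "nrm unit_leb (\<lambda>s. \<bar>d (s, x)\<bar>) = m x"
      using dx by (auto simp: sq_int_def nrm_def m_def)
    show ?case
    proof
      fix t
      have "\<bar>R (t, x)\<bar> \<le> (LINT s|unit_leb. \<bar>E (s, x)\<bar>)"
        unfolding R_def using prim_bound[OF Ex, of t] by simp
      also have "\<dots> \<le> (LINT s|unit_leb. 2 * (n s * k s) + 2 * (n s * \<bar>d (s, x)\<bar>))"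
      proof (rule integral_mono)
        show "integrable unit_leb (\<lambda>s. \<bar>E (s, x)\<bar>)" using Ex by simp
        show "integrable unit_leb (\<lambda>s. 2 * (n s * k s) + 2 * (n s * \<bar>d (s, x)\<bar>))"
          using sq_int_mult[OF ns(1) ks] sq_int_mult[OF ns(1) nd(1)] by simp
        show "\<bar>E (s, x)\<bar> \<le> 2 * (n s * k s) + 2 * (n s * \<bar>d (s, x)\<bar>)" if "s \<in> space unit_leb" for s
          using fluxQ_props(3)[OF d w, of s x] that by (simp add: E_def n_def k_def)
      qed
      also have "\<dots> = a + 2 * (LINT s|unit_leb. n s * \<bar>d (s, x)\<bar>)"
        using sq_int_mult[OF ns(1) ks] sq_int_mult[OF ns(1) nd(1)] by (simp add: a_def)
      also have "\<dots> \<le> a + 2 * (nrm unit_leb n * m x)"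
        using cauchy_schwarz[OF ns(1) nd(1)] nd(2) by simp
      finally show "\<bar>R (t, x)\<bar> \<le> b x" by (simp add: b_def)
    qed
  qed
  \<comment> \<open>Needed at every time, end points included: \<open>R\<close> is the
    representative whose energy is continuous.\<close>
  have Rs: "(\<lambda>x. R (t, x)) \<in> sq_int unit_leb" for t
  proof -
    have "(\<lambda>x. PX (\<lambda>p. E (snd p, fst p)) (x, t)) \<in> borel_measurable unit_leb"
    proof (cases "t \<in> {0<..<1}")
      case True
      have "(\<lambda>x. (x, t)) \<in> measurable unit_leb unit_sq" using True by (intro measurable_Pair2') simp
      from measurable_compose[OF this PX_meas[OF Es]] show ?thesis .
    next
      case False
      then consider "t \<le> 0" | "t \<ge> 1" by force
      then show ?thesis
      proof cases
        case 1 then show ?thesis by (simp add: PX_def prim_0)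
      next
        case 2 then show ?thesis using UU.integrable_fst'[OF UU.integrable_product_swap[OF Ei]]
          by (simp add: PX_def prim_1 borel_measurable_integrable)
      qed
    qed
    then have "(\<lambda>x. R (t, x)) \<in> borel_measurable unit_leb" by (simp add: PX_def R_def)
    then show ?thesis by (rule sq_int_dominated[OF bs]) (use Rb in \<open>eventually_elim, auto\<close>)
  qed
  have xs: "(\<lambda>x::real. x ^ j) \<in> sq_int unit_leb" for j by (intro cont_sq_int continuous_intros)
  have moments: "AE t in unit_leb. (LINT x|unit_leb. PX d (t, x) * x ^ j) = (LINT x|unit_leb. R (t, x) * x ^ j)" for j
  proof -
    have "prim (\<lambda>s. LINT x|unit_leb. E (s, x) * x ^ j) t = (LINT x|unit_leb. R (t, x) * x ^ j)" for t
    proof -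
      have i: "integrable unit_sq (\<lambda>p. if fst p < t then E p * (snd p) ^ j else 0)"
      proof (rule Bochner_Integration.integrable_bound[OF Ei])
        show "(\<lambda>p. if fst p < t then E p * (snd p) ^ j else 0) \<in> borel_measurable unit_sq" by measurable
        show "AE p in unit_sq. norm (if fst p < t then E p * (snd p) ^ j else 0) \<le> norm (E p)"
          by (rule AE_Q_I) (auto simp: abs_mult power_abs intro!: mult_left_le power_le_one)
      qed
      have "prim (\<lambda>s. LINT x|unit_leb. E (s, x) * x ^ j) t = (LINT s|unit_leb. LINT x|unit_leb. (if s < t then E (s, x) * x ^ j else 0))"
        unfolding prim_def by (rule Bochner_Integration.integral_cong) auto
      also have "\<dots> = (LINT x|unit_leb. LINT s|unit_leb. (if s < t then E (s, x) * x ^ j else 0))"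
        using UU.Fubini_integral[of "\<lambda>s x. if s < t then E (s, x) * x ^ j else 0"] i by (simp add: case_prod_unfold cong: if_cong)
      also have "\<dots> = (LINT x|unit_leb. R (t, x) * x ^ j)"
      proof (rule Bochner_Integration.integral_cong[OF refl])
        fix x
        have "(LINT s|unit_leb. (if s < t then E (s, x) * x ^ j else 0)) = (LINT s|unit_leb. (if s < t then E (s, x) else 0) * x ^ j)"
          by (rule Bochner_Integration.integral_cong) auto
        then show "(LINT s|unit_leb. (if s < t then E (s, x) * x ^ j else 0)) = R (t, x) * x ^ j"
          by (simp add: R_def prim_def)
      qed
      finally show ?thesis .
    qed
    then show ?thesis using dual_moments[OF d w orth, of j] by (simp add: E_def)
  qed
  \<comment> \<open>Countably many moments share one null set of times, and moments determine the
    slice.\<close>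
  have PXR: "AE t in unit_leb. AE x in unit_leb. PX d (t, x) = R (t, x)"
  proof -
    have "AE t in unit_leb. \<forall>j. (LINT x|unit_leb. PX d (t, x) * x ^ j) = (LINT x|unit_leb. R (t, x) * x ^ j)"
      unfolding AE_all_countable using moments by blast
    then show ?thesis using AE_space
    proof eventually_elim
      case (elim t)
      then have t: "t \<in> {0<..<1}" by simp
      have ps: "(\<lambda>x. PX d (t, x)) \<in> sq_int unit_leb" by (rule sqQ_slice[OF PX_sqQ[OF d] t])
      have "AE x in unit_leb. PX d (t, x) - R (t, x) = 0"
      proof (rule monomial_orthogonal_zero)
        show "(\<lambda>x. PX d (t, x) - R (t, x)) \<in> sq_int unit_leb" by (rule sq_int_diff[OF ps Rs])
        show "(LINT x|unit_leb. (PX d (t, x) - R (t, x)) * x ^ j) = 0" for j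
          using elim(1) sq_int_mult[OF ps xs] sq_int_mult[OF Rs xs] by (simp add: left_diff_distrib)
      qed
      then show ?case by eventually_elim simp
    qed
  qed
  have ER: "integrable unit_sq (\<lambda>p. 2 * (E p * R p))"
  proof -
    have bQ: "(\<lambda>p. n (fst p) * b (snd p)) \<in> sq_int unit_sq"
      using integrable_tensor[OF sq_int_sq[OF ns(1)] sq_int_sq[OF bs]] sq_int_meas[OF ns(1)] sq_int_meas[OF bs]
      by (intro sq_intI) (auto simp: power_mult_distrib case_prod_unfold)
    have "integrable unit_sq (\<lambda>p. 4 * ((n (fst p) * k (fst p)) * b (snd p)))"
      using integrable_tensor[OF sq_int_mult[OF ns(1) ks] U.sq_int_integrable[OF bs]] by (simp add: case_prod_unfold)
    moreover have "integrable unit_sq (\<lambda>p. 4 * \<bar>d p * (n (fst p) * b (snd p))\<bar>)"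
      using sq_int_mult[OF sqQ_sq_int[OF d] bQ] by simp
    ultimately have i: "integrable unit_sq (\<lambda>p. 4 * ((n (fst p) * k (fst p)) * b (snd p)) + 4 * \<bar>d p * (n (fst p) * b (snd p))\<bar>)"
      by simp
    have le: "AE p in unit_sq. \<bar>2 * (E p * R p)\<bar> \<le> 4 * ((n (fst p) * k (fst p)) * b (snd p)) + 4 * \<bar>d p * (n (fst p) * b (snd p))\<bar>"
      using AE_Q_snd[OF Rb] AE_space
    proof eventually_elim
      case (elim p)
      obtain t x where p: "p = (t, x)" by fastforce
      have t: "t \<in> {0<..<1}" using elim(2) by (simp add: p space_pair_measure)
      have R: "\<bar>R (t, x)\<bar> \<le> b x" using elim(1) by (simp add: p)
      have n0: "0 \<le> n t" by (simp add: n_def)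
      have b0: "0 \<le> b x" using R by linarith
      have E': "\<bar>E (t, x)\<bar> \<le> 2 * (n t * k t) + 2 * n t * \<bar>d (t, x)\<bar>"
        using fluxQ_props(3)[OF d w t, of x] by (simp add: E_def n_def k_def)
      have "\<bar>E (t, x)\<bar> * \<bar>R (t, x)\<bar> \<le> (2 * (n t * k t) + 2 * n t * \<bar>d (t, x)\<bar>) * b x"
        by (rule mult_mono[OF E' R]) (use E' in auto)
      moreover have "\<bar>d (t, x) * (n t * b x)\<bar> = n t * \<bar>d (t, x)\<bar> * b x" using n0 b0 by (simp add: abs_mult)
      moreover have "2 * ((2 * (n t * k t) + 2 * n t * \<bar>d (t, x)\<bar>) * b x) = 
          4 * ((n t * k t) * b x) + 4 * (n t * \<bar>d (t, x)\<bar> * b x)" by (simp add: algebra_simps)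
      moreover have "\<bar>2 * (E (t, x) * R (t, x))\<bar> = 2 * (\<bar>E (t, x)\<bar> * \<bar>R (t, x)\<bar>)" by (simp add: abs_mult)
      ultimately show ?case unfolding p fst_conv snd_conv by linarith
    qed
    show ?thesis
    proof (rule Bochner_Integration.integrable_bound[OF i])
      show "(\<lambda>p. 2 * (E p * R p)) \<in> borel_measurable unit_sq" by measurable
      show "AE p in unit_sq. norm (2 * (E p * R p)) \<le> norm (4 * ((n (fst p) * k (fst p)) * b (snd p)) + 4 * \<bar>d p * (n (fst p) * b (snd p))\<bar>)"
        using le by eventually_elim simp
    qed
  qed
  define e where "e s = (LINT x|unit_leb. 2 * (E (s, x) * R (s, x)))" for s
  define Y where "Y t = (nrm unit_leb (\<lambda>x. R (t, x)))\<^sup>2" for t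
  have ei: "integrable unit_leb e" unfolding e_def using UU.integrable_fst'[OF ER] .
  have Y: "Y t = 0 + prim e t" for t
  proof -
    have ptw: "AE x in unit_leb. (R (t, x))\<^sup>2 = (LINT s|unit_leb. (if s < t then 2 * (E (s, x) * R (s, x)) else 0))"
      using good
    proof eventually_elim
      case (elim x)
      then have i: "integrable unit_leb (\<lambda>s. E (s, x))" by simp
      have "(R (t, x))\<^sup>2 = prim (\<lambda>s. 2 * (E (s, x) * R (s, x))) t"
        using prim_product[OF i i, of t] by (simp add: R_def power2_eq_square mult.commute)
      then show ?case by (simp add: prim_def)
    qed
    have tr: "integrable unit_sq (\<lambda>p. if fst p < t then 2 * (E p * R p) else 0)"
    proof (rule Bochner_Integration.integrable_bound[OF ER])
      note m = borel_measurable_integrable[OF ER]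
      have "Measurable.pred unit_sq (\<lambda>p. fst p < t)" by measurable
      then show "(\<lambda>p. if fst p < t then 2 * (E p * R p) else 0) \<in> borel_measurable unit_sq"
        using m by (intro measurable_If) auto
    qed auto
    have tr': "integrable unit_sq (case_prod (\<lambda>s x. if s < t then 2 * (E (s, x) * R (s, x)) else 0))"
      using tr by (simp add: case_prod_unfold cong: if_cong)
    have "Y t = (LINT x|unit_leb. (R (t, x))\<^sup>2)" by (simp add: Y_def nrm_sq)
    also have "\<dots> = (LINT x|unit_leb. LINT s|unit_leb. (if s < t then 2 * (E (s, x) * R (s, x)) else 0))"
    proof (rule integral_cong_AE[OF _ _ ptw])
      show "(\<lambda>x. (R (t, x))\<^sup>2) \<in> borel_measurable unit_leb" using sq_int_meas[OF Rs[of t]] by measurable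
      show "(\<lambda>x. LINT s|unit_leb. (if s < t then 2 * (E (s, x) * R (s, x)) else 0)) \<in> borel_measurable unit_leb"
        by (rule borel_measurable_integrable[OF UU.integrable_snd[OF tr']])
    qed
    also have "\<dots> = (LINT s|unit_leb. LINT x|unit_leb. (if s < t then 2 * (E (s, x) * R (s, x)) else 0))"
      by (rule UU.Fubini_integral[OF tr'])
    also have "\<dots> = prim e t" unfolding prim_def e_def
      by (rule Bochner_Integration.integral_cong) auto
    finally show ?thesis by simp
  qed
  \<comment> \<open>The factor 8 is 2, from differentiating a square, times 4 from
    \<open>primitive_transport_slice\<close>. That estimate is for \<open>PX d\<close>, which may
    replace \<open>R\<close> at almost every time.\<close>
  have est: "AE s in unit_leb. \<bar>e s\<bar> \<le> 8 * n s * Y s + 0"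
    using PXR AE_space
  proof eventually_elim
    case (elim s)
    then have s: "s \<in> {0<..<1}" by simp
    note ms = slice_meas[OF Em s] slice_meas[OF sqQ_meas[OF PX_sqQ[OF d]] s] sq_int_meas[OF Rs[of s]]
    have "e s = (LINT x|unit_leb. 2 * (E (s, x) * PX d (s, x)))"
      unfolding e_def
    proof (rule integral_cong_AE)
      note [measurable] = ms
      show "(\<lambda>x. 2 * (E (s, x) * R (s, x))) \<in> borel_measurable unit_leb" 
        "(\<lambda>x. 2 * (E (s, x) * PX d (s, x))) \<in> borel_measurable unit_leb" by measurable
      show "AE x in unit_leb. 2 * (E (s, x) * R (s, x)) = 2 * (E (s, x) * PX d (s, x))"
        using elim(1) by eventually_elim simp
    qed
    also have "\<dots> = 2 * (LINT x|unit_leb. E (s, x) * PX d (s, x))" by simp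
    finally have "\<bar>e s\<bar> = 2 * \<bar>LINT x|unit_leb. E (s, x) * PX d (s, x)\<bar>" by simp
    also have "\<bar>LINT x|unit_leb. E (s, x) * PX d (s, x)\<bar> \<le> 4 * n s * (nrm unit_leb (\<lambda>x. PX d (s, x)))\<^sup>2"
      using primitive_transport_slice[OF sqQ_slice[OF d s] sqQ_slice[OF w s]]
      by (simp add: E_def fluxQ_def PX_def V1_def V0_def n_def)
    also have "nrm unit_leb (\<lambda>x. PX d (s, x)) = nrm unit_leb (\<lambda>x. R (s, x))"
      by (rule nrm_cong_AE[OF elim(1) ms(2,3)])
    finally show ?case by (simp add: Y_def)
  qed
  obtain N :: nat where "16 * (LINT s|unit_leb. n s) \<le> real N" using real_arch_simple by blast
  then have N: "(LINT s|unit_leb. 8 * n s) \<le> real N / 2" by simp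
  have Yz: "Y t = 0" if t: "t \<in> {0..1}" for t
  proof -
    have "Y t \<le> 2 ^ Suc N * (Y 0 + 2 * (LINT s|unit_leb. 0))"
    proof (rule gronwall[where Y=Y and e=e and \<beta>="\<lambda>s. 8 * n s" and \<alpha>="\<lambda>_. 0" and c=0, OF ei _ _ _ _ Y _ est N t])
      show "integrable unit_leb (\<lambda>s. 8 * n s)" using U.sq_int_integrable[OF ns(1)] by simp
    qed (auto simp: n_def Y_def)
    moreover have "Y 0 = 0" using Y[of 0] by (simp add: prim_0)
    ultimately show ?thesis by (simp add: Y_def)
  qed
  have "AE t in unit_leb. AE x in unit_leb. d (t, x) = 0"
    using PXR AE_space
  proof eventually_elim
    case (elim t)
    then have t: "t \<in> {0<..<1}" by simp
    have "nrm unit_leb (\<lambda>x. R (t, x)) = 0" using Yz[of t] t by (simp add: Y_def)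
    then have "AE x in unit_leb. R (t, x) = 0" by (rule nrm_zero_AE[OF Rs])
    \<comment> \<open>The zero function is a primitive of the slice of \<open>d\<close>; uniqueness
      of weak derivatives finishes.\<close>
    with elim(1) have D0: "AE x in unit_leb. 0 = 0 + prim (\<lambda>y. d (t, y)) x"
      by eventually_elim (simp add: PX_def)
    have "AE x in unit_leb. weak_deriv (\<lambda>_. 0) x = d (t, x)"
      by (rule H1_primI(2)[OF _ sqQ_slice[OF d t] D0]) simp
    moreover have "AE x in unit_leb. weak_deriv (\<lambda>_. 0) x = (0::real)"
      by (rule H1_primI(2)[OF _ sq_int_zero, of _ 0]) (simp_all add: prim_def)
    ultimately show ?case by eventually_elim simp
  qed
  then show ?thesis
    by (rule AE_Q_collect[rotated]) (use sqQ_meas[OF d] in measurable)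
qed

section \<open>A priori bound\<close>

text \<open>By \<open>dual_trivial\<close> a function orthogonal to all \<open>gen w \<phi>\<close>
  vanishes, and a subspace with trivial orthogonal complement is dense.\<close>

lemma generators_dense:
  assumes w: "w \<in> sqQ" and g: "g \<in> sqQ"
  obtains \<phi> where "\<And>k::nat. \<phi> k \<in> smooth_square" "\<And>k x. x \<in> {0..1} \<Longrightarrow> \<phi> k (x, 1) = 0"
    "(\<lambda>k. nrm unit_sq (\<lambda>p. gen w (\<phi> k) p - g p)) \<longlonglongrightarrow> 0"
proof -
  define T where "T = {\<phi> \<in> smooth_square. \<forall>x\<in>{0..1}. \<phi> (x, 1) = 0}"
  \<comment> \<open>Linearity of \<open>gen\<close> in \<phi> is known only inside the open square,
    where \<open>deriv\<close> is a genuine derivative; \<open>V\<close> therefore compares values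
    there only.\<close>
  define V where "V = {h \<in> sq_int unit_sq. \<exists>\<phi>\<in>T. \<forall>t\<in>{0<..<1}. \<forall>x\<in>{0<..<1}. h (t, x) = gen w \<phi> (t, x)}"
  have lin: "(\<lambda>p. \<phi> p + c * \<psi> p) \<in> T \<and> (\<forall>t\<in>{0<..<1}. \<forall>x\<in>{0<..<1}. gen w (\<lambda>p. \<phi> p + c * \<psi> p) (t, x) = gen w \<phi> (t, x) + c * gen w \<psi> (t, x))"
    if "\<phi> \<in> T" "\<psi> \<in> T" for \<phi> \<psi> c
    using that smooth_square_lincomb(1)[of \<phi> \<psi> c] smooth_square_lincomb(2,3)[where \<phi>=\<phi> and \<psi>=\<psi> and c=c]
    by (auto simp: T_def gen_def sw_def algebra_simps)
  have zT: "(\<lambda>(x, t). poly 0 x * poly 0 t) \<in> T" using poly_tensor_smooth(1)[of 0 0] by (simp add: T_def)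
  have zg: "gen w (\<lambda>(x, t). poly 0 x * poly 0 t) (t, x) = 0" for t x
    using poly_tensor_smooth(2,3)[of 0 0 t x] by (simp add: gen_def sw_def)
  have VI: "h \<in> V" if "h \<in> sq_int unit_sq" "\<phi> \<in> T" "\<And>t x. t \<in> {0<..<1} \<Longrightarrow> x \<in> {0<..<1} \<Longrightarrow> h (t, x) = gen w \<phi> (t, x)" for h \<phi>
    using that unfolding V_def by blast
  have V0: "(\<lambda>p. 0) \<in> V" by (rule VI[OF sq_int_zero zT]) (use zg in simp)
  have Vadd: "(\<lambda>p. g p + h p) \<in> V" if gh: "g \<in> V" "h \<in> V" for g h
  proof -
    obtain \<phi> where \<phi>: "\<phi> \<in> T" "\<forall>t\<in>{0<..<1}. \<forall>x\<in>{0<..<1}. g (t, x) = gen w \<phi> (t, x)" using gh(1) unfolding V_def by blast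
    obtain \<psi> where \<psi>: "\<psi> \<in> T" "\<forall>t\<in>{0<..<1}. \<forall>x\<in>{0<..<1}. h (t, x) = gen w \<psi> (t, x)" using gh(2) unfolding V_def by blast
    show ?thesis
      by (rule VI[of _ "\<lambda>p. \<phi> p + 1 * \<psi> p"]) (use lin[OF \<phi>(1) \<psi>(1), of 1] \<phi>(2) \<psi>(2) gh in \<open>auto simp: V_def intro: sq_int_add\<close>)
  qed
  have Vscale: "(\<lambda>p. c * h p) \<in> V" if h: "h \<in> V" for c h
  proof -
    obtain \<psi> where \<psi>: "\<psi> \<in> T" "\<forall>t\<in>{0<..<1}. \<forall>x\<in>{0<..<1}. h (t, x) = gen w \<psi> (t, x)" using h unfolding V_def by blast
    show ?thesis
      by (rule VI[of _ "\<lambda>p. (\<lambda>(x, t). poly 0 x * poly 0 t) p + c * \<psi> p"]) 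
        (use lin[OF zT \<psi>(1), of c] zg \<psi>(2) h in \<open>auto simp: V_def intro: sq_int_scale\<close>)
  qed
  have genV: "gen w \<phi> \<in> V" if "\<phi> \<in> T" for \<phi>
    by (rule VI[OF _ that]) (use that transport_terms_sqQ(4)[OF _ w] in \<open>auto simp: T_def sqQ_def\<close>)
  have triv: "AE p in unit_sq. d p = 0" if d: "d \<in> sq_int unit_sq" and o: "\<And>g. g \<in> V \<Longrightarrow> (LINT p|unit_sq. d p * g p) = 0" for d
  proof -
    obtain d' where d': "d' \<in> sqQ" "AE p in unit_sq. d' p = d p" using sq_int_regular[OF d] by blast
    have "AE p in unit_sq. d' p = 0"
    proof (rule dual_trivial[OF d'(1) w])
      fix \<phi> assume \<phi>: "\<phi> \<in> smooth_square" "\<And>x. x \<in> {0..1} \<Longrightarrow> \<phi> (x, 1) = 0"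
      then have T: "\<phi> \<in> T" by (simp add: T_def)
      note [measurable] = sqQ_meas[OF d'(1)] sq_int_meas[OF d] sqQ_meas[OF transport_terms_sqQ(4)[OF \<phi>(1) w]]
      have "(LINT p|unit_sq. d' p * gen w \<phi> p) = (LINT p|unit_sq. d p * gen w \<phi> p)"
      proof (rule integral_cong_AE)
        show "AE p in unit_sq. d' p * gen w \<phi> p = d p * gen w \<phi> p" using d'(2) by eventually_elim simp
      qed measurable
      then show "(LINT p|unit_sq. d' p * gen w \<phi> p) = 0" using o[OF genV[OF T]] by simp
    qed
    with d'(2) show ?thesis by eventually_elim simp
  qed
  have Vsub: "V \<subseteq> sq_int unit_sq" by (auto simp: V_def)
  obtain h where h: "\<And>k::nat. h k \<in> V" "(\<lambda>k. nrm unit_sq (\<lambda>p. h k p - g p)) \<longlonglongrightarrow> 0"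
    by (rule Q.orthogonal_trivial_dense[OF Vsub V0 Vadd Vscale triv sqQ_sq_int[OF g]]) (assumption | blast)+
  have "\<forall>k. \<exists>\<phi>. \<phi> \<in> T \<and> (\<forall>t\<in>{0<..<1}. \<forall>x\<in>{0<..<1}. h k (t, x) = gen w \<phi> (t, x))"
    using h(1) unfolding V_def by blast
  then obtain \<phi> where \<phi>: "\<And>k. \<phi> k \<in> T" "\<And>k. \<forall>t\<in>{0<..<1}. \<forall>x\<in>{0<..<1}. h k (t, x) = gen w (\<phi> k) (t, x)" by metis
  have eq: "nrm unit_sq (\<lambda>p. gen w (\<phi> k) p - g p) = nrm unit_sq (\<lambda>p. h k p - g p)" for k
    unfolding nrm_def by (intro arg_cong[of _ _ sqrt] Bochner_Integration.integral_cong refl) 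
      (use \<phi>(2) in \<open>auto simp: space_pair_measure\<close>)
  have "(\<lambda>k. nrm unit_sq (\<lambda>p. gen w (\<phi> k) p - g p)) \<longlonglongrightarrow> 0" unfolding eq by (rule h(2))
  moreover have "\<phi> k \<in> smooth_square" "x \<in> {0..1} \<Longrightarrow> \<phi> k (x, 1) = 0" for k x using \<phi>(1)[of k] by (auto simp: T_def)
  ultimately show ?thesis using that by blast
qed

text \<open>The dual estimate bounds the pairing of \<open>f\<close> with
  \<open>gen w \<phi>\<close> by B times its L^1-in-time norm. Density extends this to all
  \<open>g\<close> in \<open>sqQ\<close>, since that norm is dominated by the norm on the square.
  Testing with \<open>f\<close> itself at the times where its norm exceeds B shows that such times
  are negligible.\<close>

lemma apriori_bound:
  assumes wk: "weakQ f0 f1 f w z" and f: "f \<in> sqQ" and w: "w \<in> sqQ" and z: "z \<in> sqQ" and f0: "f0 \<in> sq_int unit_leb"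
    and N: "4 * nrm unit_sq w \<le> real N"
  shows "AE t in unit_leb. nrm unit_leb (\<lambda>x. f (t, x)) \<le> 2 ^ (N + 3) * (nrm unit_leb f0 + nrm unit_sq z)"
proof -
  define B where "B = 2 ^ (N + 3) * (nrm unit_leb f0 + nrm unit_sq z)"
  have B0: "B \<ge> 0" by (simp add: B_def)
  define J where "J g = (LINT t|unit_leb. nrm unit_leb (\<lambda>x. g (t, x)))" for g :: "real \<times> real \<Rightarrow> real"
  have Ji: "integrable unit_leb (\<lambda>t. nrm unit_leb (\<lambda>x. g (t, x)))" if "g \<in> sqQ" for g
    by (rule U.sq_int_integrable[OF nrm_slice(1)[OF sqQ_sq_int[OF that]]])
  have J_le: "J g \<le> nrm unit_sq g" if "g \<in> sqQ" for g
    using L1_le_nrm[OF nrm_slice(1)[OF sqQ_sq_int[OF that]]] nrm_slice(2)[OF sqQ_sq_int[OF that]] by (simp add: J_def)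
  have gen_bd: "\<bar>LINT p|unit_sq. f p * gen w \<phi> p\<bar> \<le> B * J (gen w \<phi>)"
    if \<phi>: "\<phi> \<in> smooth_square" "\<And>x. x \<in> {0..1} \<Longrightarrow> \<phi> (x, 1) = 0" for \<phi>
  proof -
    define M where "M = 2 ^ (N + 3) * J (gen w \<phi>)"
    have en: "nrm unit_leb (\<lambda>x. \<phi> (x, t)) \<le> M" if "t \<in> {0..1}" for t
      unfolding M_def J_def by (rule dual_energy_estimate[OF \<phi>(1) w \<phi>(2) N that])
    have 1: "\<bar>LINT x|unit_leb. f0 x * \<phi> (x, 0)\<bar> \<le> nrm unit_leb f0 * M"
    proof -
      have "\<bar>LINT x|unit_leb. f0 x * \<phi> (x, 0)\<bar> \<le> nrm unit_leb f0 * nrm unit_leb (\<lambda>x. \<phi> (x, 0))"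
        by (rule cauchy_schwarz[OF f0 smooth_square_slice_sq_int[OF \<phi>(1)]]) simp
      also have "\<dots> \<le> nrm unit_leb f0 * M" by (rule mult_left_mono[OF en]) auto
      finally show ?thesis .
    qed
    have 2: "\<bar>LINT p|unit_sq. sw \<phi> p * z p\<bar> \<le> M * nrm unit_sq z"
    proof -
      have "\<bar>LINT p|unit_sq. sw \<phi> p * z p\<bar> \<le> (LINT t|unit_leb. nrm unit_leb (\<lambda>x. sw \<phi> (t, x)) * nrm unit_leb (\<lambda>x. z (t, x)))"
        by (rule mixed_cauchy_schwarz[OF smooth_square_sqQ(1)[OF \<phi>(1)] z])
      also have "\<dots> \<le> (LINT t|unit_leb. M * nrm unit_leb (\<lambda>x. z (t, x)))"
      proof (rule integral_mono)
        show "integrable unit_leb (\<lambda>t. nrm unit_leb (\<lambda>x. sw \<phi> (t, x)) * nrm unit_leb (\<lambda>x. z (t, x)))"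
          by (intro sq_int_mult nrm_slice(1) sqQ_sq_int smooth_square_sqQ(1)[OF \<phi>(1)] z)
        show "integrable unit_leb (\<lambda>t. M * nrm unit_leb (\<lambda>x. z (t, x)))" using Ji[OF z] by simp
        show "nrm unit_leb (\<lambda>x. sw \<phi> (t, x)) * nrm unit_leb (\<lambda>x. z (t, x)) \<le> M * nrm unit_leb (\<lambda>x. z (t, x))" 
          if "t \<in> space unit_leb" for t
          using en[of t] that by (intro mult_right_mono) (auto simp: sw_def)
      qed
      also have "\<dots> \<le> M * nrm unit_sq z"
      proof -
        have "0 \<le> M" using order_trans[OF nrm_nonneg en[of 0]] by simp
        then show ?thesis using mult_left_mono[OF J_le[OF z], of M] by (simp add: J_def)
      qed
      finally show ?thesis .
    qed
    have "\<bar>LINT p|unit_sq. f p * gen w \<phi> p\<bar> \<le> nrm unit_leb f0 * M + M * nrm unit_sq z"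
      using 1 2 weakQ_gen[OF wk f w \<phi>] by linarith
    also have "\<dots> = B * J (gen w \<phi>)" by (simp add: B_def M_def algebra_simps)
    finally show ?thesis .
  qed
  have bd: "\<bar>LINT p|unit_sq. f p * g p\<bar> \<le> B * J g" if g: "g \<in> sqQ" for g
  proof -
    obtain \<phi> where \<phi>: "\<And>k::nat. \<phi> k \<in> smooth_square" "\<And>k x. x \<in> {0..1} \<Longrightarrow> \<phi> k (x, 1) = 0"
      and lim: "(\<lambda>k. nrm unit_sq (\<lambda>p. gen w (\<phi> k) p - g p)) \<longlonglongrightarrow> 0"
      by (rule generators_dense[OF w g]) (assumption | blast)+
    have gs: "gen w (\<phi> k) \<in> sqQ" for k by (rule transport_terms_sqQ(4)[OF \<phi>(1) w])
    have L: "(\<lambda>k. LINT p|unit_sq. gen w (\<phi> k) p * f p) \<longlonglongrightarrow> (LINT p|unit_sq. g p * f p)"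
      by (rule ip_tendsto[OF sqQ_sq_int[OF gs] sqQ_sq_int[OF g] sqQ_sq_int[OF f] lim])
    have R: "(\<lambda>k. B * (nrm unit_sq (\<lambda>p. gen w (\<phi> k) p - g p) + J g)) \<longlonglongrightarrow> B * (0 + J g)"
      by (intro tendsto_intros lim)
    have "\<bar>LINT p|unit_sq. gen w (\<phi> k) p * f p\<bar> \<le> B * (nrm unit_sq (\<lambda>p. gen w (\<phi> k) p - g p) + J g)" for k
    proof -
      have "J (gen w (\<phi> k)) \<le> (LINT t|unit_leb. nrm unit_leb (\<lambda>x. gen w (\<phi> k) (t, x) - g (t, x)) + nrm unit_leb (\<lambda>x. g (t, x)))"
        unfolding J_def 
      proof (rule integral_mono)
        show "integrable unit_leb (\<lambda>t. nrm unit_leb (\<lambda>x. gen w (\<phi> k) (t, x) - g (t, x)) + nrm unit_leb (\<lambda>x. g (t, x)))"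
          using Ji[OF sqQ_diff[OF gs g]] Ji[OF g] by simp
        show "nrm unit_leb (\<lambda>x. gen w (\<phi> k) (t, x)) \<le> nrm unit_leb (\<lambda>x. gen w (\<phi> k) (t, x) - g (t, x)) + nrm unit_leb (\<lambda>x. g (t, x))"
          if "t \<in> space unit_leb" for t
          using that by (intro nrm_triangle2 sqQ_slice gs g) auto
      qed (rule Ji[OF gs])
      also have "\<dots> = J (\<lambda>p. gen w (\<phi> k) p - g p) + J g"
        using Ji[OF sqQ_diff[OF gs g]] Ji[OF g] by (simp add: J_def)
      also have "\<dots> \<le> nrm unit_sq (\<lambda>p. gen w (\<phi> k) p - g p) + J g" using J_le[OF sqQ_diff[OF gs g]] by simp
      finally have "B * J (gen w (\<phi> k)) \<le> B * (nrm unit_sq (\<lambda>p. gen w (\<phi> k) p - g p) + J g)" using B0 by (rule mult_left_mono)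
      moreover have "\<bar>LINT p|unit_sq. f p * gen w (\<phi> k) p\<bar> \<le> B * J (gen w (\<phi> k))" by (rule gen_bd[OF \<phi>])
      ultimately show ?thesis by (simp add: mult.commute)
    qed
    then have "\<bar>LINT p|unit_sq. g p * f p\<bar> \<le> B * (0 + J g)"
      by (intro LIMSEQ_le[OF tendsto_rabs[OF L] R]) blast
    then show ?thesis by (simp add: mult.commute)
  qed
  define k where "k t = nrm unit_leb (\<lambda>x. f (t, x))" for t
  have ks: "k \<in> sq_int unit_leb" unfolding k_def by (rule nrm_slice(1)[OF sqQ_sq_int[OF f]])
  note [measurable] = sq_int_meas[OF ks] sqQ_meas[OF f]
  define g where "g p = f p * (if B < k (fst p) then 1 else 0)" for p
  have g: "g \<in> sqQ" unfolding g_def by (rule sqQ_mult_bounded[where C=1, OF f]) auto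
  \<comment> \<open>Nonnegative by construction, while the duality bound makes its integral
    nonpositive.\<close>
  define q where "q t = (if B < k t then k t * (k t - B) else 0)" for t
  have Bk: "(\<lambda>t. if B < k t then B * k t else 0) \<in> borel_measurable unit_leb" by measurable
  have i1: "integrable unit_leb (\<lambda>t. if B < k t then (k t)\<^sup>2 else 0)"
    by (rule Bochner_Integration.integrable_bound[OF sq_int_sq[OF ks]]) auto
  have i2: "integrable unit_leb (\<lambda>t. if B < k t then B * k t else 0)"
    by (rule Bochner_Integration.integrable_bound[of _ "\<lambda>t. B * k t"]) (use U.sq_int_integrable[OF ks] in auto)
  have qi: "integrable unit_leb q"
    using Bochner_Integration.integrable_diff[OF i1 i2]
    by (rule Bochner_Integration.integrable_cong[THEN iffD1, rotated -1]) (auto simp: q_def algebra_simps power2_eq_square)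
  have q0: "q t \<ge> 0" for t using B0 by (simp add: q_def)
  have "(LINT p|unit_sq. f p * g p) = (LINT t|unit_leb. LINT x|unit_leb. f (t, x) * g (t, x))"
    by (rule integral_iterated[OF sq_int_mult[OF sqQ_sq_int[OF f] sqQ_sq_int[OF g]]])
  also have "\<dots> = (LINT t|unit_leb. (if B < k t then (k t)\<^sup>2 else 0))"
    by (rule Bochner_Integration.integral_cong) (auto simp: g_def k_def nrm_sq power2_eq_square[of "f _"])
  finally have A1: "(LINT p|unit_sq. f p * g p) = (LINT t|unit_leb. (if B < k t then (k t)\<^sup>2 else 0))" .
  have "nrm unit_leb (\<lambda>x. g (t, x)) = (if B < k t then k t else 0)" for t
    by (auto simp: g_def k_def) (simp add: nrm_def)
  then have "J g = (LINT t|unit_leb. (if B < k t then k t else 0))" unfolding J_def by presburger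
  then have "B * J g = (LINT t|unit_leb. B * (if B < k t then k t else 0))" by simp
  also have "\<dots> = (LINT t|unit_leb. (if B < k t then B * k t else 0))"
    by (rule Bochner_Integration.integral_cong) auto
  finally have A2: "B * J g = (LINT t|unit_leb. (if B < k t then B * k t else 0))" .
  have "(LINT t|unit_leb. q t) = (LINT t|unit_leb. (if B < k t then (k t)\<^sup>2 else 0) - (if B < k t then B * k t else 0))"
    by (rule Bochner_Integration.integral_cong) (auto simp: q_def algebra_simps power2_eq_square)
  also have "\<dots> = (LINT p|unit_sq. f p * g p) - B * J g" unfolding A1 A2 by (rule Bochner_Integration.integral_diff[OF i1 i2])
  also have "\<dots> \<le> 0" using bd[OF g] by linarith
  finally have "(LINT t|unit_leb. q t) = 0" 
    using Bochner_Integration.integral_nonneg[of unit_leb q] q0 by (simp add: antisym)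
  then have "AE t in unit_leb. q t = 0" using integral_nonneg_eq_0_iff_AE[OF qi] q0 by simp
  then show ?thesis
  proof eventually_elim
    case (elim t)
    have "\<not> B < k t"
    proof
      assume "B < k t"
      then have "k t * (k t - B) = 0" using elim by (simp add: q_def)
      then show False using \<open>B < k t\<close> B0 by simp
    qed
    then show ?case by (simp add: B_def k_def)
  qed
qed

section \<open>Stability of the transport equation under weak convergence\<close>

lemma sqQ_integral_slice:
  assumes F: "F \<in> sqQ" and g: "g \<in> sq_int unit_leb"
  shows "integrable unit_leb (\<lambda>t. LINT x|unit_leb. F (t, x) * g x)"
    "(\<lambda>t. LINT x|unit_leb. F (t, x) * g x) \<in> sq_int unit_leb"
proof -
  have i: "integrable unit_sq (\<lambda>p. F p * g (snd p))"
    by (rule sq_int_mult[OF sqQ_sq_int[OF F] sqQ_sq_int[OF sq_int_space[OF g]]])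
  show ii: "integrable unit_leb (\<lambda>t. LINT x|unit_leb. F (t, x) * g x)"
    using UU.integrable_fst'[OF i] by simp
  have b: "\<bar>LINT x|unit_leb. F (t, x) * g x\<bar> \<le> nrm unit_leb (\<lambda>x. F (t, x)) * nrm unit_leb g"
    if "t \<in> {0<..<1}" for t by (rule cauchy_schwarz[OF sqQ_slice[OF F that] g])
  have s: "(\<lambda>t. nrm unit_leb g * nrm unit_leb (\<lambda>x. F (t, x))) \<in> sq_int unit_leb"
    by (intro sq_int_scale nrm_slice(1) sqQ_sq_int F)
  show "(\<lambda>t. LINT x|unit_leb. F (t, x) * g x) \<in> sq_int unit_leb"
    by (rule sq_int_dominated[OF s borel_measurable_integrable[OF ii]]) 
      (rule AE_I2, use b in \<open>simp add: mult.commute\<close>)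
qed

text \<open>The time derivative of the moment of \<open>f\<close> against \<open>p\<close>, as
  prescribed by the equation.\<close>

definition evol :: "(real \<times> real \<Rightarrow> real) \<Rightarrow> (real \<times> real \<Rightarrow> real) \<Rightarrow> (real \<times> real \<Rightarrow> real) \<Rightarrow> real poly \<Rightarrow> real \<Rightarrow> real" where
  "evol f w z p s = (LINT x|unit_leb. f (s, x) * (poly p x * V1 w (s, x) + poly (pderiv p) x * V0 w (s, x)) + poly p x * z (s, x))"

lemma poly_bounded_unit:
  fixes p :: "real poly"
  obtains C where "C \<ge> 0" "\<And>x. x \<in> {0..1} \<Longrightarrow> \<bar>poly p x\<bar> \<le> C"
  using cont_bounded_unit[of "poly p"] continuous_on_poly[OF continuous_on_id] by blast

text \<open>The order of quantifiers matters in the second claim: the constant depends on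
  \<open>p\<close> alone, so one constant serves a whole sequence of velocities.\<close>

lemma evol_props:
  assumes f: "f \<in> sqQ" and w: "w \<in> sqQ" and z: "z \<in> sqQ"
  shows "integrable unit_leb (evol f w z p)" "\<exists>C\<ge>0. \<forall>w\<in>sqQ. \<forall>s\<in>{0<..<1}. 
    nrm unit_leb (\<lambda>x. poly p x * V1 w (s, x) + poly (pderiv p) x * V0 w (s, x)) \<le> C * nrm unit_leb (\<lambda>x. w (s, x))"
   "(\<lambda>q. poly p (snd q) * V1 w q + poly (pderiv p) (snd q) * V0 w q) \<in> sqQ"
proof -
  have \<phi>: "(\<lambda>(x, t). poly p x * poly 1 t) \<in> smooth_square" by (rule poly_tensor_smooth(1))
  have eq: "sw (\<lambda>(x, t). poly p x * poly 1 t) q * V1 w q + dx (\<lambda>(x, t). poly p x * poly 1 t) q * V0 w q = 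
    poly p (snd q) * V1 w q + poly (pderiv p) (snd q) * V0 w q" for q
    using poly_tensor_smooth(2)[of p 1 "fst q" "snd q"] by (simp add: sw_def)
  show T: "(\<lambda>q. poly p (snd q) * V1 w q + poly (pderiv p) (snd q) * V0 w q) \<in> sqQ"
    using transport_terms_sqQ(3)[OF \<phi> w] unfolding eq .
  have "integrable unit_sq (\<lambda>q. f q * (poly p (snd q) * V1 w q + poly (pderiv p) (snd q) * V0 w q) + poly p (snd q) * z q)"
    by (intro Bochner_Integration.integrable_add sq_int_mult sqQ_sq_int f z T sq_int_space poly_sq_int)
  from UU.integrable_fst'[OF this] show "integrable unit_leb (evol f w z p)"
    by (simp add: evol_def[abs_def])
  obtain A where A: "A \<ge> 0" "\<And>x. x \<in> {0..1} \<Longrightarrow> \<bar>poly p x\<bar> \<le> A" using poly_bounded_unit[of p] by blast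
  obtain B where B: "B \<ge> 0" "\<And>x. x \<in> {0..1} \<Longrightarrow> \<bar>poly (pderiv p) x\<bar> \<le> B" using poly_bounded_unit[of "pderiv p"] by blast
  have "nrm unit_leb (\<lambda>x. poly p x * V1 w (s, x) + poly (pderiv p) x * V0 w (s, x)) \<le> (2 * A + 2 * B) * nrm unit_leb (\<lambda>x. w (s, x))"
    if w: "w \<in> sqQ" and s: "s \<in> {0<..<1}" for w s
  proof (rule nrm_le_const)
    have wi: "integrable unit_leb (\<lambda>x. w (s, x))" by (rule sqQ_slice_int[OF w s])
    have "continuous_on {0..1} (\<lambda>x. V1 w (s, x))" "continuous_on {0..1} (\<lambda>x. V0 w (s, x))"
      unfolding V1_def V0_def fst_conv snd_conv using G1_continuous[OF wi] G0_continuous[OF wi] by auto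
    then show "(\<lambda>x. poly p x * V1 w (s, x) + poly (pderiv p) x * V0 w (s, x)) \<in> borel_measurable unit_leb"
      by (intro cont_imp_unit_leb continuous_intros)
    show "AE x in unit_leb. \<bar>poly p x * V1 w (s, x) + poly (pderiv p) x * V0 w (s, x)\<bar> \<le> (2 * A + 2 * B) * nrm unit_leb (\<lambda>x. w (s, x))"
    proof (rule AE_I2)
      fix x assume "x \<in> space unit_leb"
      then have x: "x \<in> {0..1}" by simp
      have "\<bar>poly p x * V1 w (s, x)\<bar> \<le> A * (2 * nrm unit_leb (\<lambda>x. w (s, x)))"
        unfolding abs_mult by (intro mult_mono A(2)[OF x] V_bound(1)[OF w s] A(1)) simp
      moreover have "\<bar>poly (pderiv p) x * V0 w (s, x)\<bar> \<le> B * (2 * nrm unit_leb (\<lambda>x. w (s, x)))"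
        unfolding abs_mult by (intro mult_mono B(2)[OF x] V_bound(2)[OF w s] B(1)) simp
      ultimately show "\<bar>poly p x * V1 w (s, x) + poly (pderiv p) x * V0 w (s, x)\<bar> \<le> (2 * A + 2 * B) * nrm unit_leb (\<lambda>x. w (s, x))"
        using abs_triangle_ineq[of "poly p x * V1 w (s, x)" "poly (pderiv p) x * V0 w (s, x)"] by (simp add: algebra_simps)
    qed
  qed (use A B in simp)
  then show "\<exists>C\<ge>0. \<forall>w\<in>sqQ. \<forall>s\<in>{0<..<1}. 
    nrm unit_leb (\<lambda>x. poly p x * V1 w (s, x) + poly (pderiv p) x * V0 w (s, x)) \<le> C * nrm unit_leb (\<lambda>x. w (s, x))"
    using A(1) B(1) by (intro exI[of _ "2 * A + 2 * B"]) auto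
qed

text \<open>Test functions p(x) q(t) reduce the equation to a scalar one in time. The choice q = 1
  yields the final moment; antiderivatives of t^k vanishing at 1 yield the almost everywhere
  identity, since time moments determine a function.\<close>

lemma moment_evolution:
  assumes wk: "weakQ f0 f1 f w z" and f: "f \<in> sqQ" and w: "w \<in> sqQ" and z: "z \<in> sqQ"
  shows "(LINT x|unit_leb. f1 x * poly p x) = (LINT x|unit_leb. f0 x * poly p x) + (LINT s|unit_leb. evol f w z p s)"
    "AE t in unit_leb. (LINT x|unit_leb. f (t, x) * poly p x) = (LINT x|unit_leb. f0 x * poly p x) + prim (evol f w z p) t"
proof -
  define c where "c = (LINT x|unit_leb. f0 x * poly p x)"
  define c1 where "c1 = (LINT x|unit_leb. f1 x * poly p x)"
  define a where "a t = (LINT x|unit_leb. f (t, x) * poly p x)" for t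
  define b where "b = evol f w z p"
  have bi: "integrable unit_leb b" unfolding b_def by (rule evol_props(1)[OF f w z])
  have as: "a \<in> sq_int unit_leb" unfolding a_def by (rule sqQ_integral_slice(2)[OF f poly_sq_int])
  have W: "- (LINT t|unit_leb. a t * poly (pderiv q) t) + poly q 1 * c1 - poly q 0 * c = (LINT t|unit_leb. b t * poly q t)" for q
  proof -
    define \<phi> where "\<phi> = (\<lambda>(x, t). poly p x * poly q t)"
    have \<phi>: "\<phi> \<in> smooth_square" unfolding \<phi>_def by (rule poly_tensor_smooth(1))
    have i1: "integrable unit_sq (\<lambda>r. f r * dt \<phi> r)"
      by (rule sq_int_mult[OF sqQ_sq_int[OF f] sqQ_sq_int[OF smooth_square_sqQ(3)[OF \<phi>]]])
    have i2: "integrable unit_sq (\<lambda>r. f r * (sw \<phi> r * V1 w r + dx \<phi> r * V0 w r))"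
      by (rule sq_int_mult[OF sqQ_sq_int[OF f] sqQ_sq_int[OF transport_terms_sqQ(3)[OF \<phi> w]]])
    have i3: "integrable unit_sq (\<lambda>r. sw \<phi> r * z r)"
      by (rule sq_int_mult[OF sqQ_sq_int[OF smooth_square_sqQ(1)[OF \<phi>]] sqQ_sq_int[OF z]])
    have "(LINT r|unit_sq. f r * dt \<phi> r) = (LINT t|unit_leb. LINT x|unit_leb. f (t, x) * dt \<phi> (t, x))" by (rule integral_iterated[OF i1])
    also have "\<dots> = (LINT t|unit_leb. a t * poly (pderiv q) t)"
      unfolding \<phi>_def poly_tensor_smooth(3) a_def by (simp add: mult.assoc[symmetric])
    finally have 1: "(LINT r|unit_sq. f r * dt \<phi> r) = (LINT t|unit_leb. a t * poly (pderiv q) t)" .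
    have "(LINT r|unit_sq. f r * (sw \<phi> r * V1 w r + dx \<phi> r * V0 w r)) + (LINT r|unit_sq. sw \<phi> r * z r) = 
        (LINT r|unit_sq. f r * (sw \<phi> r * V1 w r + dx \<phi> r * V0 w r) + sw \<phi> r * z r)"
      by (rule Bochner_Integration.integral_add[OF i2 i3, symmetric])
    also have "\<dots> = (LINT t|unit_leb. LINT x|unit_leb. f (t, x) * (sw \<phi> (t, x) * V1 w (t, x) + dx \<phi> (t, x) * V0 w (t, x)) + sw \<phi> (t, x) * z (t, x))"
      by (rule integral_iterated[OF Bochner_Integration.integrable_add[OF i2 i3]])
    also have "\<dots> = (LINT t|unit_leb. b t * poly q t)"
    proof (rule Bochner_Integration.integral_cong[OF refl])
      fix t
      have "(LINT x|unit_leb. f (t, x) * (sw \<phi> (t, x) * V1 w (t, x) + dx \<phi> (t, x) * V0 w (t, x)) + sw \<phi> (t, x) * z (t, x)) = 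
        (LINT x|unit_leb. (f (t, x) * (poly p x * V1 w (t, x) + poly (pderiv p) x * V0 w (t, x)) + poly p x * z (t, x)) * poly q t)"
        unfolding \<phi>_def poly_tensor_smooth(2) sw_def
        by (rule Bochner_Integration.integral_cong) (auto simp: algebra_simps)
      also have "\<dots> = b t * poly q t" by (simp add: b_def evol_def)
      finally show "(LINT x|unit_leb. f (t, x) * (sw \<phi> (t, x) * V1 w (t, x) + dx \<phi> (t, x) * V0 w (t, x)) + sw \<phi> (t, x) * z (t, x)) = b t * poly q t" .
    qed
    finally have 2: "(LINT r|unit_sq. f r * (sw \<phi> r * V1 w r + dx \<phi> r * V0 w r)) + (LINT r|unit_sq. sw \<phi> r * z r) = (LINT t|unit_leb. b t * poly q t)" .
    have 3: "(LINT x|unit_leb. g x * \<phi> (x, s)) = poly q s * (LINT x|unit_leb. g x * poly p x)" for g s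
      by (simp add: \<phi>_def mult.assoc[symmetric])
    from wk[unfolded weakQ_def, rule_format, OF \<phi>] show ?thesis
      unfolding 1 2 3 c_def c1_def by simp
  qed
  have c1: "c1 = c + (LINT t|unit_leb. b t)" using W[of 1] by (simp add: pderiv_1)
  then show "(LINT x|unit_leb. f1 x * poly p x) = (LINT x|unit_leb. f0 x * poly p x) + (LINT s|unit_leb. evol f w z p s)"
    by (simp add: c1_def c_def b_def)
  have ps: "(\<lambda>t. c + prim b t) \<in> sq_int unit_leb" by (intro sq_int_add U.sq_int_const prim_sq_int bi)
  have "AE t in unit_leb. a t - (c + prim b t) = 0"
  proof (rule monomial_orthogonal_zero)
    show "(\<lambda>t. a t - (c + prim b t)) \<in> sq_int unit_leb" by (rule sq_int_diff[OF as ps])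
    fix k
    have ts: "(\<lambda>x::real. x ^ k) \<in> sq_int unit_leb" by (intro cont_sq_int continuous_intros)
    define q where "q = - mono1 k"
    have q': "poly (pderiv q) t = t ^ k" for t by (simp add: q_def pderiv_minus pderiv_mono1 poly_monom)
    have q1: "poly q 1 = 0" by (simp add: q_def poly_mono1)
    have q0: "poly q 0 = - 1 / real (Suc k)" by (simp add: q_def poly_mono1)
    have tk: "(LINT t|unit_leb. t ^ k) = 1 / real (Suc k)"
    proof -
      have "prim (\<lambda>x. x ^ k) 1 = (- poly (mono1 k) 1) - (- poly (mono1 k) 0)"
      proof (rule prim_FTC[where F="\<lambda>x. - poly (mono1 k) x"])
        show "((\<lambda>x. - poly (mono1 k) x) has_real_derivative x ^ k) (at x within {0..1})" for x
          using DERIV_minus[OF has_field_derivative_at_within[OF poly_DERIV[of "mono1 k" x]], of "{0..1}"]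
          by (simp add: pderiv_mono1 poly_monom)
      qed (auto intro!: continuous_intros)
      then show ?thesis using prim_1[of 1 "\<lambda>x. x ^ k"] by (simp add: poly_mono1)
    qed
    have A: "(LINT t|unit_leb. a t * t ^ k) = - poly q 0 * c - (LINT t|unit_leb. b t * poly q t)"
      using W[of q] unfolding q' q1 by simp
    have B: "(LINT t|unit_leb. prim b t * t ^ k) = - (LINT t|unit_leb. b t * poly q t)"
      unfolding moment_by_parts[OF bi, symmetric] by (simp add: q_def)
    have "(LINT t|unit_leb. (a t - (c + prim b t)) * t ^ k) = (LINT t|unit_leb. a t * t ^ k - (c * t ^ k + prim b t * t ^ k))"
      by (rule Bochner_Integration.integral_cong) (auto simp: algebra_simps)
    also have "\<dots> = (LINT t|unit_leb. a t * t ^ k) - (c * (LINT t|unit_leb. t ^ k) + (LINT t|unit_leb. prim b t * t ^ k))"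
      using sq_int_mult[OF as ts] U.sq_int_integrable[OF ts] sq_int_mult[OF prim_sq_int[OF bi] ts] by simp
    also have "\<dots> = 0" unfolding A B tk q0 by (simp add: field_simps)
    finally show "(LINT t|unit_leb. (a t - (c + prim b t)) * t ^ k) = 0" .
  qed
  then show "AE t in unit_leb. (LINT x|unit_leb. f (t, x) * poly p x) = (LINT x|unit_leb. f0 x * poly p x) + prim (evol f w z p) t"
    unfolding a_def b_def c_def by eventually_elim simp
qed

text \<open>Cauchy-Schwarz against the indicator of the time interval, whose norm is the square root
  of its length.\<close>

lemma prim_holder:
  assumes g: "g \<in> sq_int unit_leb" and g0: "\<And>s. s \<in> {0<..<1} \<Longrightarrow> 0 \<le> g s" and e: "integrable unit_leb e"
    and le: "AE s in unit_leb. \<bar>e s\<bar> \<le> g s" and uv: "0 \<le> u" "u \<le> v" "v \<le> 1"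
  shows "\<bar>prim e v - prim e u\<bar> \<le> nrm unit_leb g * sqrt (v - u)"
proof -
  have gi: "integrable unit_leb g" by (rule U.sq_int_integrable[OF g])
  define \<eta> where "\<eta> s = (if s < v then 1 else 0) - (if s < u then 1 else (0::real))" for s
  have \<eta>m [measurable]: "\<eta> \<in> borel_measurable unit_leb" unfolding \<eta>_def by measurable
  have \<eta>s: "\<eta> \<in> sq_int unit_leb" by (rule U.sq_int_bounded[OF \<eta>m, where C=1]) (auto simp: \<eta>_def)
  have "(LINT s|unit_leb. (\<eta> s)\<^sup>2) = (LINT s|unit_leb. (if s < v then 1 else 0) - (if s < u then 1 else 0))"
    by (rule Bochner_Integration.integral_cong) (use uv in \<open>auto simp: \<eta>_def\<close>)
  also have "\<dots> = prim (\<lambda>_. 1) v - prim (\<lambda>_. 1) u"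
    unfolding prim_def by (rule Bochner_Integration.integral_diff) (rule integrable_if_less, simp)+
  also have "\<dots> = v - u" using uv by (simp add: prim_const)
  finally have n\<eta>: "nrm unit_leb \<eta> = sqrt (v - u)" by (simp add: nrm_def)
  have "\<bar>prim e v - prim e u\<bar> \<le> prim g v - prim g u"
    by (rule prim_increment_le[OF e gi uv(2)]) (use le in \<open>eventually_elim, simp\<close>)
  also have "\<dots> = (LINT s|unit_leb. (if s < v then g s else 0) - (if s < u then g s else 0))"
    unfolding prim_def by (rule Bochner_Integration.integral_diff[symmetric]) (intro integrable_if_less gi)+
  also have "\<dots> = (LINT s|unit_leb. g s * \<eta> s)"
    by (rule Bochner_Integration.integral_cong) (use uv in \<open>auto simp: \<eta>_def\<close>)
  also have "\<dots> \<le> nrm unit_leb g * sqrt (v - u)" using cauchy_schwarz[OF g \<eta>s] n\<eta> by simp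
  finally show ?thesis .
qed

text \<open>Averages over a short interval after \<open>s\<close> converge because the primitives
  do, and the common Holder bound makes each average close to the value at \<open>s\<close>.\<close>

lemma equicontinuous_weak_imp_pointwise:
  fixes A :: "nat \<Rightarrow> real \<Rightarrow> real"
  assumes hol: "\<And>n u v. 0 \<le> u \<Longrightarrow> u \<le> v \<Longrightarrow> v \<le> 1 \<Longrightarrow> \<bar>A n v - A n u\<bar> \<le> K * sqrt (v - u)"
    and Ai: "\<And>n. integrable unit_leb (A n)" and conv: "\<And>t. convergent (\<lambda>n. prim (A n) t)" and s: "s \<in> {0<..<1}"
  shows "convergent (\<lambda>n. A n s)"
proof -
  have "Cauchy (\<lambda>n. A n s)"
  proof (rule metric_CauchyI)
    fix e :: real assume e: "e > 0"
    have K0: "K \<ge> 0" using hol[of 0 1 0] by (simp add: order_trans[OF abs_ge_zero])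
    \<comment> \<open>The first entry keeps the interval inside [0, 1], the second makes the
      oscillation K sqrt(\<delta>) at most e/3.\<close>
    define \<delta> where "\<delta> = min (1 - s) ((e / (3 * (K + 1)))\<^sup>2)"
    have \<delta>: "\<delta> > 0" "s + \<delta> \<le> 1" using s e K0 by (auto simp: \<delta>_def)
    have "sqrt \<delta> \<le> sqrt ((e / (3 * (K + 1)))\<^sup>2)" by (rule real_sqrt_le_mono) (simp add: \<delta>_def)
    also have "\<dots> = e / (3 * (K + 1))" using e K0 by simp
    finally have "K * sqrt \<delta> \<le> K * (e / (3 * (K + 1)))" using K0 by (rule mult_left_mono)
    also have "\<dots> \<le> e / 3" using e K0 by (simp add: field_simps)
    finally have Kd: "K * sqrt \<delta> \<le> e / 3" .
    define I where "I n = prim (A n) (s + \<delta>) - prim (A n) s" for n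
    have close: "\<bar>I n - \<delta> * A n s\<bar> \<le> \<delta> * (e / 3)" for n
    proof -
      have p1: "prim (\<lambda>_. c) (s + \<delta>) - prim (\<lambda>_. c) s = \<delta> * c" for c using s \<delta> by (simp add: prim_const algebra_simps)
      have "\<bar>prim (\<lambda>t. A n t - A n s) (s + \<delta>) - prim (\<lambda>t. A n t - A n s) s\<bar> \<le> prim (\<lambda>_. e / 3) (s + \<delta>) - prim (\<lambda>_. e / 3) s"
      proof (rule prim_increment_le)
        show "AE t in unit_leb. s \<le> t \<longrightarrow> t < s + \<delta> \<longrightarrow> \<bar>A n t - A n s\<bar> \<le> e / 3"
        proof (intro AE_I2 impI)
          fix t assume t: "s \<le> t" "t < s + \<delta>"
          have "\<bar>A n t - A n s\<bar> \<le> K * sqrt (t - s)" using t s \<delta> by (intro hol) auto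
          also have "\<dots> \<le> K * sqrt \<delta>" using t K0 by (intro mult_left_mono) auto
          finally show "\<bar>A n t - A n s\<bar> \<le> e / 3" using Kd by simp
        qed
      qed (use Ai \<delta> in auto)
      moreover have "prim (\<lambda>t. A n t - A n s) x = prim (A n) x - prim (\<lambda>_. A n s) x" for x
        by (rule prim_diff[OF Ai]) simp
      then have "prim (\<lambda>t. A n t - A n s) (s + \<delta>) - prim (\<lambda>t. A n t - A n s) s = I n - \<delta> * A n s"
        unfolding I_def using p1[of "A n s"] by simp
      ultimately show ?thesis unfolding p1 by simp
    qed
    have "convergent I" unfolding I_def by (intro convergent_diff conv)
    then have "Cauchy I" by (simp add: Cauchy_convergent_iff)
    from metric_CauchyD[OF this, of "\<delta> * (e / 3)"] e \<delta>
    obtain M where M: "\<forall>m\<ge>M. \<forall>n\<ge>M. dist (I m) (I n) < \<delta> * (e / 3)" by auto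
    have "dist (A m s) (A n s) < e" if "m \<ge> M" "n \<ge> M" for m n
    proof -
      have "\<bar>\<delta> * A m s - \<delta> * A n s\<bar> < \<delta> * e"
        using M[rule_format, OF that] close[of m] close[of n] unfolding dist_real_def by linarith
      moreover have "\<bar>\<delta> * A m s - \<delta> * A n s\<bar> = \<delta> * \<bar>A m s - A n s\<bar>"
        using \<delta> by (simp add: abs_mult right_diff_distrib[symmetric])
      ultimately have "\<delta> * \<bar>A m s - A n s\<bar> < \<delta> * e" by simp
      then show ?thesis using \<delta> by (simp add: dist_real_def)
    qed
    then show "\<exists>M. \<forall>m\<ge>M. \<forall>n\<ge>M. dist (A m s) (A n s) < e" by blast
  qed
  then show ?thesis by (simp add: Cauchy_convergent_iff)
qed

definition weakly_to :: "'a measure \<Rightarrow> (nat \<Rightarrow> 'a \<Rightarrow> real) \<Rightarrow> ('a \<Rightarrow> real) \<Rightarrow> bool" where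
  "weakly_to M F f \<longleftrightarrow> (\<forall>h\<in>sq_int M. (\<lambda>n. LINT y|M. F n y * h y) \<longlonglongrightarrow> (LINT y|M. f y * h y))"

lemma weakly_toD: "weakly_to M F f \<Longrightarrow> h \<in> sq_int M \<Longrightarrow> (\<lambda>n. LINT y|M. F n y * h y) \<longlonglongrightarrow> (LINT y|M. f y * h y)"
  by (simp add: weakly_to_def)

text \<open>The bound \<open>B\<close> uniform in time makes the moment derivatives bounded in L^2
  in time, so the moments have a common Holder modulus. Weak convergence on the square makes their
  primitives converge, hence the moments themselves, and time polynomials identify the
  limit.\<close>

lemma moments_converge:
  assumes wk: "\<And>n. weakQ f0 f1 (F n) (W n) (Z n)"
    and F: "\<And>n. F n \<in> sqQ" and W: "\<And>n. W n \<in> sqQ" and Z: "\<And>n. Z n \<in> sqQ" and f: "f \<in> sqQ"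
    and Fb: "\<And>n. AE t in unit_leb. nrm unit_leb (\<lambda>x. F n (t, x)) \<le> B" and Wb: "\<And>n. nrm unit_sq (W n) \<le> CW" and Zb: "\<And>n. nrm unit_sq (Z n) \<le> CZ"
    and Ff: "weakly_to unit_sq F f"
  shows "AE t in unit_leb. (\<lambda>n. LINT x|unit_leb. F n (t, x) * poly p x) \<longlonglongrightarrow> (LINT x|unit_leb. f (t, x) * poly p x)"
proof -
  define c where "c = (LINT x|unit_leb. f0 x * poly p x)"
  define b where "b n = evol (F n) (W n) (Z n) p" for n
  define A where "A n t = c + prim (b n) t" for n t
  define a where "a t = (LINT x|unit_leb. f (t, x) * poly p x)" for t
  have bi: "integrable unit_leb (b n)" for n unfolding b_def by (rule evol_props(1)[OF F W Z])
  have ev: "AE t in unit_leb. (LINT x|unit_leb. F n (t, x) * poly p x) = A n t" for n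
    unfolding A_def b_def c_def by (rule moment_evolution(2)[OF wk F W Z])
  have As: "A n \<in> sq_int unit_leb" for n unfolding A_def by (intro sq_int_add U.sq_int_const prim_sq_int bi)
  have Ai: "integrable unit_leb (A n)" for n by (rule U.sq_int_integrable[OF As])
  have as: "a \<in> sq_int unit_leb" unfolding a_def by (rule sqQ_integral_slice(2)[OF f poly_sq_int])
  have B0: "B \<ge> 0"
  proof -
    have "ae_filter unit_leb \<noteq> bot" using emeasure_unit_leb by (simp add: ae_filter_eq_bot_iff)
    from eventually_happens'[OF this Fb[of 0]] show ?thesis using nrm_nonneg order_trans by blast
  qed
  obtain C where C: "C \<ge> 0" "\<And>w s. w \<in> sqQ \<Longrightarrow> s \<in> {0<..<1} \<Longrightarrow> 
    nrm unit_leb (\<lambda>x. poly p x * V1 w (s, x) + poly (pderiv p) x * V0 w (s, x)) \<le> C * nrm unit_leb (\<lambda>x. w (s, x))"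
    using evol_props(2)[OF f f f, of p] by blast
  define D where "D = nrm unit_leb (poly p)"
  \<comment> \<open>A square integrable majorant of the moment derivative whose norm is at most
    \<open>K\<close> for all \<open>n\<close>; this is where the three uniform bounds meet.\<close>
  define g where "g n s = B * C * nrm unit_leb (\<lambda>x. W n (s, x)) + D * nrm unit_leb (\<lambda>x. Z n (s, x))" for n s
  note nW = nrm_slice[OF sqQ_sq_int[OF W]] and nZ = nrm_slice[OF sqQ_sq_int[OF Z]]
  have gs: "g n \<in> sq_int unit_leb" for n unfolding g_def by (intro sq_int_add sq_int_scale nW nZ)
  have g0: "0 \<le> g n s" for n s using B0 C(1) by (simp add: g_def D_def)
  define K where "K = B * C * CW + D * CZ"
  have gn: "nrm unit_leb (g n) \<le> K" for n
  proof -
    have "nrm unit_leb (g n) \<le> nrm unit_leb (\<lambda>s. B * C * nrm unit_leb (\<lambda>x. W n (s, x))) + nrm unit_leb (\<lambda>s. D * nrm unit_leb (\<lambda>x. Z n (s, x)))"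
      unfolding g_def by (rule nrm_triangle) (intro sq_int_scale nW nZ)+
    also have "\<dots> = B * C * nrm unit_sq (W n) + D * nrm unit_sq (Z n)"
      unfolding nrm_scale nW nZ using B0 C(1) by (simp add: D_def)
    also have "\<dots> \<le> K" unfolding K_def by (intro add_mono mult_left_mono Wb Zb) (use B0 C(1) in \<open>auto simp: D_def\<close>)
    finally show ?thesis .
  qed
  have bg: "AE s in unit_leb. \<bar>b n s\<bar> \<le> g n s" for n
    using Fb[of n] AE_space
  proof eventually_elim
    case (elim s)
    then have s: "s \<in> {0<..<1}" by simp
    have T: "(\<lambda>x. poly p x * V1 (W n) (s, x) + poly (pderiv p) x * V0 (W n) (s, x)) \<in> sq_int unit_leb"
      using sqQ_slice[OF evol_props(3)[OF F[of n] W[of n] Z[of n], of p] s] by simp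
    note FT = cauchy_schwarz[OF sqQ_slice[OF F[of n] s] T] and pZ = cauchy_schwarz[OF poly_sq_int[of p] sqQ_slice[OF Z[of n] s]]
    have "b n s = (LINT x|unit_leb. F n (s, x) * (poly p x * V1 (W n) (s, x) + poly (pderiv p) x * V0 (W n) (s, x))) + (LINT x|unit_leb. poly p x * Z n (s, x))"
      unfolding b_def evol_def by (rule Bochner_Integration.integral_add) (intro sq_int_mult sqQ_slice[OF F s] sqQ_slice[OF Z s] T poly_sq_int)+
    moreover have "nrm unit_leb (\<lambda>x. F n (s, x)) * nrm unit_leb (\<lambda>x. poly p x * V1 (W n) (s, x) + poly (pderiv p) x * V0 (W n) (s, x)) 
        \<le> B * (C * nrm unit_leb (\<lambda>x. W n (s, x)))"
      by (rule mult_mono[OF elim(1) C(2)[OF W s] B0]) simp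
    ultimately show ?case using FT pZ unfolding g_def D_def by (simp add: mult.assoc)
  qed
  have hol: "\<bar>A n v - A n u\<bar> \<le> K * sqrt (v - u)" if "0 \<le> u" "u \<le> v" "v \<le> 1" for n u v
  proof -
    have "\<bar>prim (b n) v - prim (b n) u\<bar> \<le> nrm unit_leb (g n) * sqrt (v - u)"
      by (rule prim_holder[OF gs g0 bi bg that])
    also have "\<dots> \<le> K * sqrt (v - u)" using that by (intro mult_right_mono gn) auto
    finally show ?thesis by (simp add: A_def)
  qed
  \<comment> \<open>The primitive of a moment is the pairing of \<open>F n\<close> with a truncated
    polynomial, to which weak convergence applies.\<close>
  have primA: "prim (A n) t = (LINT q|unit_sq. F n q * (if fst q < t then poly p (snd q) else 0))" for n t
  proof -
    have h: "(\<lambda>q. if fst q < t then poly p (snd q) else 0) \<in> sq_int unit_sq"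
    proof -
      obtain E where E: "E \<ge> 0" "\<And>x. x \<in> {0..1} \<Longrightarrow> \<bar>poly p x\<bar> \<le> E" using poly_bounded_unit[of p] by blast
      note [measurable] = sqQ_meas[OF sq_int_space[OF poly_sq_int[of p]]]
      show ?thesis by (rule Q.sq_int_bounded[where C=E]) (measurable, rule AE_Q_I, use E in auto)
    qed
    have "prim (A n) t = prim (\<lambda>s. LINT x|unit_leb. F n (s, x) * poly p x) t"
      by (rule prim_cong_AE[symmetric, OF ev borel_measurable_integrable[OF sqQ_integral_slice(1)[OF F poly_sq_int]] sq_int_meas[OF As]])
    also have "\<dots> = (LINT s|unit_leb. LINT x|unit_leb. F n (s, x) * (if s < t then poly p x else 0))"
      unfolding prim_def by (rule Bochner_Integration.integral_cong) auto
    also have "\<dots> = (LINT q|unit_sq. F n q * (if fst q < t then poly p (snd q) else 0))"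
      using integral_iterated[OF sq_int_mult[OF sqQ_sq_int[OF F[of n]] h]] by (simp cong: if_cong)
    finally show ?thesis .
  qed
  have conv: "convergent (\<lambda>n. prim (A n) t)" for t
  proof -
    obtain E where E: "E \<ge> 0" "\<And>x. x \<in> {0..1} \<Longrightarrow> \<bar>poly p x\<bar> \<le> E" using poly_bounded_unit[of p] by blast
    note [measurable] = sqQ_meas[OF sq_int_space[OF poly_sq_int[of p]]]
    have "(\<lambda>q. if fst q < t then poly p (snd q) else 0) \<in> sq_int unit_sq"
      by (rule Q.sq_int_bounded[where C=E]) (measurable, rule AE_Q_I, use E in auto)
    from weakly_toD[OF Ff this] show ?thesis unfolding primA by (rule convergentI)
  qed
  define L where "L s = lim (\<lambda>n. A n s)" for s
  have L: "(\<lambda>n. A n s) \<longlonglongrightarrow> L s" if "s \<in> {0<..<1}" for s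
    using equicontinuous_weak_imp_pointwise[OF hol Ai conv that] by (simp add: L_def convergent_LIMSEQ_iff)
  have Ab: "\<bar>A n s\<bar> \<le> \<bar>c\<bar> + K" if "s \<in> {0<..<1}" for n s
  proof -
    have K0: "K \<ge> 0" using hol[of 0 1 0] by (simp add: order_trans[OF abs_ge_zero])
    have "\<bar>A n s - A n 0\<bar> \<le> K * sqrt (s - 0)" using that by (intro hol) auto
    also have "\<dots> \<le> K * 1" using that K0 by (intro mult_left_mono) auto
    finally show ?thesis by (simp add: A_def prim_0)
  qed
  have Lm: "L \<in> borel_measurable unit_leb"
    unfolding L_def by (rule borel_measurable_lim_metric) (rule sq_int_meas[OF As])
  have Lb: "\<bar>L s\<bar> \<le> \<bar>c\<bar> + K" if "s \<in> {0<..<1}" for s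
    by (rule LIMSEQ_le_const2[OF tendsto_rabs[OF L[OF that]]]) (use Ab[OF that] in blast)
  have Ls: "L \<in> sq_int unit_leb" by (rule U.sq_int_bounded[OF Lm]) (rule AE_I2, use Lb in simp)
  have AL: "(\<lambda>n. nrm unit_leb (\<lambda>s. A n s - L s)) \<longlonglongrightarrow> 0"
  proof (rule nrm_dominated[OF sq_int_meas[OF As] Lm U.sq_int_const[of "2 * (\<bar>c\<bar> + K)"]])
    show "AE s in unit_leb. (\<lambda>n. A n s) \<longlonglongrightarrow> L s" using L by (intro AE_I2) simp
    show "AE s in unit_leb. \<bar>A n s - L s\<bar> \<le> 2 * (\<bar>c\<bar> + K)" for n
    proof (rule AE_I2)
      fix s assume "s \<in> space unit_leb"
      then show "\<bar>A n s - L s\<bar> \<le> 2 * (\<bar>c\<bar> + K)" using Ab[of s n] Lb[of s] by simp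
    qed
  qed
  have "AE t in unit_leb. L t - a t = 0"
  proof (rule poly_orthogonal_zero)
    show "(\<lambda>t. L t - a t) \<in> sq_int unit_leb" by (rule sq_int_diff[OF Ls as])
    fix q
    have 1: "(\<lambda>n. LINT t|unit_leb. A n t * poly q t) \<longlonglongrightarrow> (LINT t|unit_leb. L t * poly q t)"
      by (rule ip_tendsto[OF As Ls poly_sq_int AL])
    have h: "(\<lambda>r. poly p (snd r) * poly q (fst r)) \<in> sq_int unit_sq"
      using sqQ_sq_int[OF smooth_square_sqQ(1)[OF poly_tensor_smooth(1)[of p q]]] by (simp add: sw_def[abs_def] case_prod_unfold)
    have it: "(LINT r|unit_sq. G r * (poly p (snd r) * poly q (fst r))) = (LINT t|unit_leb. (LINT x|unit_leb. G (t, x) * poly p x) * poly q t)"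
      if "G \<in> sqQ" for G
      using integral_iterated[OF sq_int_mult[OF sqQ_sq_int[OF that] h]] by (simp add: mult.assoc[symmetric])
    have "(LINT t|unit_leb. A n t * poly q t) = (LINT r|unit_sq. F n r * (poly p (snd r) * poly q (fst r)))" for n
      unfolding it[OF F]
    proof (rule integral_cong_AE)
      show "(\<lambda>t. A n t * poly q t) \<in> borel_measurable unit_leb"
        using sq_int_meas[OF As[of n]] sq_int_meas[OF poly_sq_int[of q]] by measurable
      show "(\<lambda>t. (LINT x|unit_leb. F n (t, x) * poly p x) * poly q t) \<in> borel_measurable unit_leb"
        using sq_int_meas[OF sqQ_integral_slice(2)[OF F poly_sq_int], of n p] sq_int_meas[OF poly_sq_int[of q]] by (rule borel_measurable_times)
      show "AE t in unit_leb. A n t * poly q t = (LINT x|unit_leb. F n (t, x) * poly p x) * poly q t"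
        using ev[of n] by eventually_elim simp
    qed
    then have "(\<lambda>n. LINT t|unit_leb. A n t * poly q t) \<longlonglongrightarrow> (LINT t|unit_leb. a t * poly q t)"
      using weakly_toD[OF Ff h] unfolding it[OF f] a_def by simp
    from LIMSEQ_unique[OF 1 this] show "(LINT t|unit_leb. (L t - a t) * poly q t) = 0"
      using sq_int_mult[OF Ls poly_sq_int] sq_int_mult[OF as poly_sq_int] by (simp add: left_diff_distrib)
  qed
  moreover have "AE t in unit_leb. \<forall>n. (LINT x|unit_leb. F n (t, x) * poly p x) = A n t"
    unfolding AE_all_countable using ev by blast
  ultimately show ?thesis using AE_space
  proof eventually_elim
    case (elim t)
    then show ?case using L[of t] by (simp add: a_def)
  qed
qed

text \<open>Monomials are countable, so one null set of times serves all of them; linearity reaches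
  all polynomials, and the uniform norm bound together with density reaches all square integrable
  test functions.\<close>

lemma slices_converge_weakly:
  assumes mom: "\<And>p. AE t in unit_leb. (\<lambda>n. LINT x|unit_leb. F n (t, x) * poly p x) \<longlonglongrightarrow> (LINT x|unit_leb. f (t, x) * poly p x)"
    and F: "\<And>n. F n \<in> sqQ" and f: "f \<in> sqQ"
    and Fb: "\<And>n. AE t in unit_leb. nrm unit_leb (\<lambda>x. F n (t, x)) \<le> B"
  shows "AE t in unit_leb. weakly_to unit_leb (\<lambda>n x. F n (t, x)) (\<lambda>x. f (t, x))"
proof -
  have "AE t in unit_leb. \<forall>k. (\<lambda>n. LINT x|unit_leb. F n (t, x) * poly (monom 1 k) x) \<longlonglongrightarrow> (LINT x|unit_leb. f (t, x) * poly (monom 1 k) x)"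
    unfolding AE_all_countable using mom by blast
  moreover have "AE t in unit_leb. \<forall>n. nrm unit_leb (\<lambda>x. F n (t, x)) \<le> B"
    unfolding AE_all_countable using Fb by blast
  ultimately show ?thesis using AE_space
  proof eventually_elim
    case (elim t)
    then have t: "t \<in> {0<..<1}" by simp
    have Fs: "(\<lambda>x. F n (t, x)) \<in> sq_int unit_leb" for n by (rule sqQ_slice[OF F t])
    have fs: "(\<lambda>x. f (t, x)) \<in> sq_int unit_leb" by (rule sqQ_slice[OF f t])
    have Bn: "nrm unit_leb (\<lambda>x. F n (t, x)) \<le> B" for n using elim(2) by blast
    have B0: "0 \<le> B" using order_trans[OF nrm_nonneg Bn] .
    have xs: "(\<lambda>x::real. x ^ k) \<in> sq_int unit_leb" for k by (intro cont_sq_int continuous_intros)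
    have polyc: "(\<lambda>n. LINT x|unit_leb. F n (t, x) * poly p x) \<longlonglongrightarrow> (LINT x|unit_leb. f (t, x) * poly p x)" for p
    proof -
      have e: "(LINT x|unit_leb. u x * poly p x) = (\<Sum>k\<le>degree p. coeff p k * (LINT x|unit_leb. u x * x ^ k))" if u: "u \<in> sq_int unit_leb" for u
      proof -
        have "(LINT x|unit_leb. u x * poly p x) = (LINT x|unit_leb. (\<Sum>i\<le>degree p. coeff p i * (u x * x ^ i)))"
          by (rule Bochner_Integration.integral_cong) (auto simp: poly_altdef sum_distrib_left mult_ac)
        also have "\<dots> = (\<Sum>i\<le>degree p. coeff p i * (LINT x|unit_leb. u x * x ^ i))"
          using sq_int_mult[OF u xs] by simp
        finally show ?thesis .
      qed
      show ?thesis unfolding e[OF Fs] e[OF fs]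
        by (intro tendsto_sum tendsto_mult_left) (use elim(1) in \<open>simp add: poly_monom\<close>)
    qed
    show ?case unfolding weakly_to_def
    proof
      fix h :: "real \<Rightarrow> real" assume h: "h \<in> sq_int unit_leb"
      show "(\<lambda>n. LINT x|unit_leb. F n (t, x) * h x) \<longlonglongrightarrow> (LINT x|unit_leb. f (t, x) * h x)"
      proof (rule LIMSEQ_I)
        fix e :: real assume e: "e > 0"
        define M where "M = B + nrm unit_leb (\<lambda>x. f (t, x)) + 1"
        have M: "M > 0" using B0 by (simp add: M_def add_nonneg_pos)
        obtain p where p: "nrm unit_leb (\<lambda>x. h x - poly p x) < e / (3 * M)"
          using poly_dense[OF h, of "e / (3 * M)"] e M by auto
        have hp: "(\<lambda>x. h x - poly p x) \<in> sq_int unit_leb" by (rule sq_int_diff[OF h poly_sq_int])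
        have close: "\<bar>(LINT x|unit_leb. u x * h x) - (LINT x|unit_leb. u x * poly p x)\<bar> \<le> e / 3" 
          if u: "u \<in> sq_int unit_leb" "nrm unit_leb u \<le> M" for u
        proof -
          have "(LINT x|unit_leb. u x * h x) - (LINT x|unit_leb. u x * poly p x) = (LINT x|unit_leb. u x * (h x - poly p x))"
            using sq_int_mult[OF u(1) h] sq_int_mult[OF u(1) poly_sq_int, of p] by (simp add: right_diff_distrib)
          also have "\<bar>\<dots>\<bar> \<le> nrm unit_leb u * nrm unit_leb (\<lambda>x. h x - poly p x)" by (rule cauchy_schwarz[OF u(1) hp])
          also have "\<dots> \<le> M * (e / (3 * M))" using u(2) p M by (intro mult_mono) auto
          also have "\<dots> = e / 3" using M by simp
          finally show ?thesis .
        qed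
        from LIMSEQ_D[OF polyc[of p], of "e/3"] e obtain N where
          N: "\<And>n. n \<ge> N \<Longrightarrow> norm ((LINT x|unit_leb. F n (t, x) * poly p x) - (LINT x|unit_leb. f (t, x) * poly p x)) < e/3" by auto
        have "norm ((LINT x|unit_leb. F n (t, x) * h x) - (LINT x|unit_leb. f (t, x) * h x)) < e" if n: "n \<ge> N" for n
        proof -
          have "nrm unit_leb (\<lambda>x. F n (t, x)) \<le> M" using Bn[of n] nrm_nonneg[of unit_leb "\<lambda>x. f (t, x)"] unfolding M_def by linarith
          note 1 = close[OF Fs this]
          have "nrm unit_leb (\<lambda>x. f (t, x)) \<le> M" using B0 unfolding M_def by simp
          note 2 = close[OF fs this]
          show ?thesis using 1 2 N[OF n] unfolding real_norm_def by linarith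
        qed
        then show "\<exists>N. \<forall>n\<ge>N. norm ((LINT x|unit_leb. F n (t, x) * h x) - (LINT x|unit_leb. f (t, x) * h x)) < e" by blast
      qed
    qed
  qed
qed

section \<open>Adjoints and convergence of the products\<close>

text \<open>The adjoint of \<open>G1\<close>; the adjoint of \<open>G0\<close> is minus this
  operator applied after \<open>prim\<close>. Its values are integrals of \<open>a\<close> over
  intervals, hence continuous under weak convergence.\<close>

definition adjG :: "(real \<Rightarrow> real) \<Rightarrow> real \<Rightarrow> real" where
  "adjG a y = y * (LINT x|unit_leb. a x) - prim a y"

lemma G1_adjoint:
  assumes a: "integrable unit_leb a" and w: "integrable unit_leb w"
  shows "(LINT x|unit_leb. a x * G1 w x) = (LINT y|unit_leb. adjG a y * w y)"
proof -
  define c where "c = (LINT y|unit_leb. (1 - y) * w y)"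
  define I where "I = (LINT x|unit_leb. a x)"
  have yw: "integrable unit_leb (\<lambda>y. y * w y)"
    using Bochner_Integration.integrable_diff[OF w weight_integrable[OF w]] by (simp add: left_diff_distrib)
  have pw: "integrable unit_leb (\<lambda>y. prim a y * w y)" using integrable_mult_prim[OF w a] by (simp add: mult.commute)
  have "(LINT x|unit_leb. a x * G1 w x) = (LINT x|unit_leb. a x * prim w x - c * a x)"
    by (rule Bochner_Integration.integral_cong) (auto simp: G1_def c_def algebra_simps)
  also have "\<dots> = (LINT x|unit_leb. a x * prim w x) - c * I"
    using integrable_mult_prim[OF a w] a by (simp add: I_def)
  also have "\<dots> = I * (LINT x|unit_leb. w x) - (LINT x|unit_leb. prim a x * w x) - c * I"
    using prim_by_parts_full[OF a w] by (simp add: I_def)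
  also have "c = (LINT x|unit_leb. w x) - (LINT y|unit_leb. y * w y)"
    unfolding c_def left_diff_distrib using w yw by simp
  also have "I * (LINT x|unit_leb. w x) - (LINT x|unit_leb. prim a x * w x) - ((LINT x|unit_leb. w x) - (LINT y|unit_leb. y * w y)) * I = 
     (LINT y|unit_leb. I * (y * w y) - prim a y * w y)"
  proof -
    have "(LINT y|unit_leb. I * (y * w y) - prim a y * w y) = I * (LINT y|unit_leb. y * w y) - (LINT x|unit_leb. prim a x * w x)"
      using yw pw by simp
    then show ?thesis by (simp only:) (simp only: algebra_simps)
  qed
  also have "\<dots> = (LINT y|unit_leb. adjG a y * w y)"
    by (rule Bochner_Integration.integral_cong) (auto simp: adjG_def I_def algebra_simps)
  finally show ?thesis .
qed

lemma G0_adjoint: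
  assumes a: "integrable unit_leb a" and w: "integrable unit_leb w"
  shows "(LINT x|unit_leb. a x * G0 w x) = - (LINT y|unit_leb. adjG (prim a) y * w y)"
  using prim_by_parts_full[OF a G1_integrable[OF w]] integral_G1[OF w]
    G1_adjoint[OF U.sq_int_integrable[OF prim_sq_int[OF a]] w] by (simp add: G0_def)

definition AQ :: "(real \<times> real \<Rightarrow> real) \<Rightarrow> real \<times> real \<Rightarrow> real" where
  "AQ F p = adjG (\<lambda>y. F (fst p, y)) (snd p)"

lemma AQ_bound:
  assumes F: "F \<in> sqQ" and t: "t \<in> {0<..<1}" and y: "y \<in> {0<..<1}"
  shows "\<bar>AQ F (t, y)\<bar> \<le> 2 * nrm unit_leb (\<lambda>x. F (t, x))"
proof -
  have i: "integrable unit_leb (\<lambda>x. F (t, x))" by (rule sqQ_slice_int[OF F t])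
  have "\<bar>LINT x|unit_leb. F (t, x)\<bar> \<le> nrm unit_leb (\<lambda>x. F (t, x))"
    using prim_nrm_bound[OF sqQ_slice[OF F t], of 1] prim_1[of 1 "\<lambda>x. F (t, x)"] by simp
  then have "\<bar>y * (LINT x|unit_leb. F (t, x))\<bar> \<le> 1 * nrm unit_leb (\<lambda>x. F (t, x))"
    unfolding abs_mult using y by (intro mult_mono) auto
  then show ?thesis using prim_nrm_bound[OF sqQ_slice[OF F t], of y] unfolding AQ_def adjG_def fst_conv snd_conv by linarith
qed

lemma AQ_sqQ:
  assumes F: "F \<in> sqQ" shows "AQ F \<in> sqQ"
proof (rule sqQ_dominated(1)[where a="\<lambda>t. 2 * nrm unit_leb (\<lambda>x. F (t, x))"])
  have "(\<lambda>t. LINT x|unit_leb. F (t, x)) \<in> borel_measurable unit_leb"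
    using borel_measurable_integrable[OF UU.integrable_fst'[OF Q.sq_int_integrable[OF sqQ_sq_int[OF F]]]] .
  then have "(\<lambda>p. LINT x|unit_leb. F (fst p, x)) \<in> borel_measurable unit_sq"
    by (rule measurable_compose[OF measurable_fst])
  then show "AQ F \<in> borel_measurable unit_sq"
    using PX_meas[OF sqQ_meas[OF F]] meas_snd unfolding AQ_def[abs_def] adjG_def PX_def[abs_def]
    by (intro borel_measurable_diff borel_measurable_times)
  show "(\<lambda>t. 2 * nrm unit_leb (\<lambda>x. F (t, x))) \<in> sq_int unit_leb" by (intro sq_int_scale nrm_slice(1) sqQ_sq_int F)
qed (rule AQ_bound[OF F])

lemma V1_adjoint:
  assumes F: "F \<in> sqQ" and w: "w \<in> sqQ"
  shows "(LINT p|unit_sq. F p * V1 w p) = (LINT p|unit_sq. AQ F p * w p)"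
proof -
  have "(LINT p|unit_sq. F p * V1 w p) = (LINT t|unit_leb. LINT x|unit_leb. F (t, x) * V1 w (t, x))"
    by (rule integral_iterated) (intro sq_int_mult sqQ_sq_int F V_sqQ w)
  also have "\<dots> = (LINT t|unit_leb. LINT x|unit_leb. AQ F (t, x) * w (t, x))"
    by (rule Bochner_Integration.integral_cong[OF refl])
      (simp add: V1_def AQ_def G1_adjoint[OF sqQ_slice_int[OF F] sqQ_slice_int[OF w]])
  also have "\<dots> = (LINT p|unit_sq. AQ F p * w p)"
    by (rule integral_iterated[symmetric]) (intro sq_int_mult sqQ_sq_int AQ_sqQ F w)
  finally show ?thesis .
qed

lemma V0_adjoint:
  assumes F: "F \<in> sqQ" and w: "w \<in> sqQ"
  shows "(LINT p|unit_sq. F p * V0 w p) = - (LINT p|unit_sq. AQ (PX F) p * w p)"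
proof -
  have "(LINT p|unit_sq. F p * V0 w p) = (LINT t|unit_leb. LINT x|unit_leb. F (t, x) * V0 w (t, x))"
    by (rule integral_iterated) (intro sq_int_mult sqQ_sq_int F V_sqQ w)
  also have "\<dots> = (LINT t|unit_leb. - (LINT x|unit_leb. AQ (PX F) (t, x) * w (t, x)))"
    by (rule Bochner_Integration.integral_cong[OF refl])
      (simp add: V0_def AQ_def PX_def G0_adjoint[OF sqQ_slice_int[OF F] sqQ_slice_int[OF w]])
  also have "\<dots> = - (LINT p|unit_sq. AQ (PX F) p * w p)"
    using integral_iterated[OF sq_int_mult[OF sqQ_sq_int[OF AQ_sqQ[OF PX_sqQ[OF F]]] sqQ_sq_int[OF w]]] by simp
  finally show ?thesis .
qed

lemma AE_Q_fst:
  assumes "AE t in unit_leb. P t"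
  shows "AE p in unit_sq. P (fst p)"
proof -
  obtain N where N: "{x \<in> space unit_leb. \<not> P x} \<subseteq> N" "emeasure unit_leb N = 0" "N \<in> sets unit_leb"
    using AE_E[OF assms] by blast
  have n: "AE t in unit_leb. t \<notin> N" using N by (intro AE_not_in null_setsI)
  have "AE p in unit_sq. fst p \<notin> N"
    by (rule AE_Q_collect) (use N(3) n in auto)
  then show ?thesis using AE_space
  proof eventually_elim
    case (elim p)
    then show ?case using N(1) by (auto simp: space_pair_measure)
  qed
qed

lemma weakly_to_prim:
  assumes "weakly_to unit_leb a b"
  shows "(\<lambda>n. prim (a n) y) \<longlonglongrightarrow> prim b y"
proof -
  have "(\<lambda>s. if s < y then 1 else 0) \<in> sq_int unit_leb"
    by (rule U.sq_int_bounded[where C=1]) auto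
  from weakly_toD[OF assms this]
  have "(\<lambda>n. LINT s|unit_leb. a n s * (if s < y then 1 else 0)) \<longlonglongrightarrow> (LINT s|unit_leb. b s * (if s < y then 1 else 0))" .
  moreover have "(LINT s|unit_leb. g s * (if s < y then 1 else 0)) = prim g y" for g
    unfolding prim_def by (rule Bochner_Integration.integral_cong) auto
  ultimately show ?thesis by simp
qed

lemma weakly_to_integral:
  assumes "weakly_to unit_leb a b"
  shows "(\<lambda>n. LINT s|unit_leb. a n s) \<longlonglongrightarrow> (LINT s|unit_leb. b s)"
  using weakly_toD[OF assms U.sq_int_const[of 1]] by simp

text \<open>At each point \<open>AQ (F n)\<close> is built from pairings of the slice with fixed
  functions, so weakly convergent slices give pointwise convergence; the bound \<open>C\<close>
  uniform in time supplies the dominating function.\<close>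

lemma AQ_strong:
  assumes F: "\<And>n. F n \<in> sqQ" and f: "f \<in> sqQ"
    and Fb: "\<And>n. AE t in unit_leb. nrm unit_leb (\<lambda>x. F n (t, x)) \<le> C"
    and wk: "AE t in unit_leb. weakly_to unit_leb (\<lambda>n x. F n (t, x)) (\<lambda>x. f (t, x))"
  shows "(\<lambda>n. nrm unit_sq (\<lambda>p. AQ (F n) p - AQ f p)) \<longlonglongrightarrow> 0"
proof (rule nrm_dominated[where g="\<lambda>p. 2 * C + 2 * nrm unit_leb (\<lambda>x. f (fst p, x))"])
  show "AQ (F n) \<in> borel_measurable unit_sq" "AQ f \<in> borel_measurable unit_sq" for n
    by (intro sqQ_meas AQ_sqQ F f)+
  show "(\<lambda>p. 2 * C + 2 * nrm unit_leb (\<lambda>x. f (fst p, x))) \<in> sq_int unit_sq"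
    by (intro sq_int_add sq_int_scale Q.sq_int_const sq_int_time(1) nrm_slice(1) sqQ_sq_int f)
  show "AE p in unit_sq. (\<lambda>n. AQ (F n) p) \<longlonglongrightarrow> AQ f p"
    using AE_Q_fst[OF wk]
  proof eventually_elim
    case (elim p)
    show ?case unfolding AQ_def adjG_def
      by (intro tendsto_diff tendsto_mult_left weakly_to_prim[OF elim] weakly_to_integral[OF elim])
  qed
  show "AE p in unit_sq. \<bar>AQ (F n) p - AQ f p\<bar> \<le> 2 * C + 2 * nrm unit_leb (\<lambda>x. f (fst p, x))" for n
    using AE_Q_fst[OF Fb[of n]] AE_space
  proof eventually_elim
    case (elim p)
    obtain t y where p: "p = (t, y)" by fastforce
    have ty: "t \<in> {0<..<1}" "y \<in> {0<..<1}" using elim(2) by (auto simp: p space_pair_measure)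
    show ?case using AQ_bound[OF F ty, of n] AQ_bound[OF f ty] elim(1) unfolding p fst_conv by linarith
  qed
qed

text \<open>Split the product as (K - k) W + k W: the first part is small by Cauchy-Schwarz, the
  second converges weakly.\<close>

lemma strong_weak:
  assumes K: "\<And>n. K n \<in> sq_int M" "k \<in> sq_int M" "(\<lambda>n. nrm M (\<lambda>p. K n p - k p)) \<longlonglongrightarrow> 0"
    and W: "\<And>n. W n \<in> sq_int M" "\<And>n. nrm M (W n) \<le> C" "weakly_to M W w" "w \<in> sq_int M"
  shows "(\<lambda>n. LINT p|M. K n p * W n p) \<longlonglongrightarrow> (LINT p|M. k p * w p)"
proof -
  have 1: "(\<lambda>n. LINT p|M. k p * W n p) \<longlonglongrightarrow> (LINT p|M. k p * w p)"
    using weakly_toD[OF W(3) K(2)] by (simp add: mult.commute)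
  have 2: "(\<lambda>n. (LINT p|M. K n p * W n p) - (LINT p|M. k p * W n p)) \<longlonglongrightarrow> 0"
  proof (rule Lim_null_comparison)
    show "(\<lambda>n. nrm M (\<lambda>p. K n p - k p) * C) \<longlonglongrightarrow> 0" using tendsto_mult_left_zero[OF K(3)] .
    have "\<bar>(LINT p|M. K n p * W n p) - (LINT p|M. k p * W n p)\<bar> \<le> nrm M (\<lambda>p. K n p - k p) * C" for n
    proof -
      have "(LINT p|M. K n p * W n p) - (LINT p|M. k p * W n p) = (LINT p|M. (K n p - k p) * W n p)"
        using sq_int_mult[OF K(1) W(1)] sq_int_mult[OF K(2) W(1)] by (simp add: left_diff_distrib)
      also have "\<bar>\<dots>\<bar> \<le> nrm M (\<lambda>p. K n p - k p) * nrm M (W n)"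
        by (rule cauchy_schwarz[OF sq_int_diff[OF K(1) K(2)] W(1)])
      also have "\<dots> \<le> nrm M (\<lambda>p. K n p - k p) * C" by (rule mult_left_mono[OF W(2)]) simp
      finally show ?thesis .
    qed
    then show "\<forall>\<^sub>F n in sequentially. norm ((LINT p|M. K n p * W n p) - (LINT p|M. k p * W n p)) \<le> nrm M (\<lambda>p. K n p - k p) * C"
      by simp
  qed
  from tendsto_add[OF 2 1] show ?thesis by simp
qed

lemma weakly_to_mult_bounded:
  assumes "weakly_to unit_leb a b" and g: "g \<in> borel_measurable unit_leb" "\<And>x. x \<in> {0<..<1} \<Longrightarrow> \<bar>g x\<bar> \<le> C"
  shows "weakly_to unit_leb (\<lambda>n x. a n x * g x) (\<lambda>x. b x * g x)"
  unfolding weakly_to_def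
proof
  fix h :: "real \<Rightarrow> real" assume "h \<in> sq_int unit_leb"
  then have "(\<lambda>x. h x * g x) \<in> sq_int unit_leb"
    by (rule U.sq_int_mult_bounded[OF _ g(1)]) (rule AE_I2, use g(2) in simp)
  from weakly_toD[OF assms(1) this]
  show "(\<lambda>n. LINT x|unit_leb. a n x * g x * h x) \<longlonglongrightarrow> (LINT x|unit_leb. b x * g x * h x)"
    by (simp add: mult_ac)
qed

lemma nrm_mult_bounded:
  assumes u: "u \<in> sq_int unit_leb" and g: "g \<in> borel_measurable unit_leb" "\<And>x. x \<in> {0<..<1} \<Longrightarrow> \<bar>g x\<bar> \<le> C" and C: "C \<ge> 0"
  shows "nrm unit_leb (\<lambda>x. u x * g x) \<le> C * nrm unit_leb u"
proof -
  have "(LINT x|unit_leb. (u x * g x)\<^sup>2) \<le> (LINT x|unit_leb. (C * u x)\<^sup>2)"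
  proof (rule integral_mono)
    have "(\<lambda>x. u x * g x) \<in> sq_int unit_leb"
      by (rule U.sq_int_mult_bounded[OF u g(1)]) (rule AE_I2, use g(2) in simp)
    then show "integrable unit_leb (\<lambda>x. (u x * g x)\<^sup>2)" by (rule sq_int_sq)
    show "integrable unit_leb (\<lambda>x. (C * u x)\<^sup>2)" by (rule sq_int_sq[OF sq_int_scale[OF u]])
    show "(u x * g x)\<^sup>2 \<le> (C * u x)\<^sup>2" if "x \<in> space unit_leb" for x
    proof -
      have "\<bar>u x\<bar> * \<bar>g x\<bar> \<le> \<bar>u x\<bar> * C" using g(2)[of x] that by (intro mult_left_mono) auto
      then have "\<bar>u x * g x\<bar> \<le> \<bar>C * u x\<bar>" using C by (simp add: abs_mult mult.commute)
      then show ?thesis by (simp add: abs_le_square_iff[symmetric])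
    qed
  qed
  then have "nrm unit_leb (\<lambda>x. u x * g x) \<le> nrm unit_leb (\<lambda>x. C * u x)" unfolding nrm_def by (rule real_sqrt_le_mono)
  then show ?thesis using C by (simp add: nrm_scale)
qed

text \<open>The primitives converge at every point and are uniformly bounded, so they converge even
  in norm.\<close>

lemma weakly_to_PX:
  assumes wk: "weakly_to unit_leb a b" and a: "\<And>n. a n \<in> sq_int unit_leb" and b: "b \<in> sq_int unit_leb" and C: "\<And>n. nrm unit_leb (a n) \<le> C"
  shows "weakly_to unit_leb (\<lambda>n. prim (a n)) (prim b)"
  unfolding weakly_to_def
proof
  fix h :: "real \<Rightarrow> real" assume h: "h \<in> sq_int unit_leb"
  have ps: "prim (a n) \<in> sq_int unit_leb" "prim b \<in> sq_int unit_leb" for n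
    by (intro prim_sq_int U.sq_int_integrable a b)+
  show "(\<lambda>n. LINT x|unit_leb. prim (a n) x * h x) \<longlonglongrightarrow> (LINT x|unit_leb. prim b x * h x)"
  proof (rule ip_tendsto[OF ps h])
    show "(\<lambda>n. nrm unit_leb (\<lambda>y. prim (a n) y - prim b y)) \<longlonglongrightarrow> 0"
    proof (rule nrm_dominated[OF sq_int_meas[OF ps(1)] sq_int_meas[OF ps(2)] U.sq_int_const[of "C + nrm unit_leb b"]])
      show "AE y in unit_leb. (\<lambda>n. prim (a n) y) \<longlonglongrightarrow> prim b y" by (intro AE_I2 weakly_to_prim[OF wk])
      show "AE y in unit_leb. \<bar>prim (a n) y - prim b y\<bar> \<le> C + nrm unit_leb b" for n
      proof (rule AE_I2)
        fix y
        show "\<bar>prim (a n) y - prim b y\<bar> \<le> C + nrm unit_leb b"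
          using prim_nrm_bound[OF a, of n y] prim_nrm_bound[OF b, of y] C[of n] by linarith
      qed
    qed
  qed
qed

text \<open>Here \<open>g\<close> stands for \<phi> or for its space derivative. A fixed bounded
  factor preserves weak convergence of the slices; the adjoint then puts the strongly convergent
  factor on the side of \<open>f\<close>.\<close>

lemma transport_product_limit:
  assumes F: "\<And>n. F n \<in> sqQ" and f: "f \<in> sqQ" and W: "\<And>n. W n \<in> sqQ" and w: "w \<in> sqQ" 
    and Fb: "\<And>n. AE t in unit_leb. nrm unit_leb (\<lambda>x. F n (t, x)) \<le> B" and Wb: "\<And>n. nrm unit_sq (W n) \<le> CW"
    and wk: "AE t in unit_leb. weakly_to unit_leb (\<lambda>n x. F n (t, x)) (\<lambda>x. f (t, x))"
    and Ww: "weakly_to unit_sq W w"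
    and g: "g \<in> borel_measurable unit_sq" "\<And>t x. t \<in> {0<..<1} \<Longrightarrow> x \<in> {0<..<1} \<Longrightarrow> \<bar>g (t, x)\<bar> \<le> C" and C: "C \<ge> 0"
  shows "(\<lambda>n. LINT p|unit_sq. (F n p * g p) * V1 (W n) p) \<longlonglongrightarrow> (LINT p|unit_sq. (f p * g p) * V1 w p)"
    "(\<lambda>n. LINT p|unit_sq. (F n p * g p) * V0 (W n) p) \<longlonglongrightarrow> (LINT p|unit_sq. (f p * g p) * V0 w p)"
proof -
  have Fg: "(\<lambda>p. F n p * g p) \<in> sqQ" for n by (rule sqQ_mult_bounded[OF F g])
  have fg: "(\<lambda>p. f p * g p) \<in> sqQ" by (rule sqQ_mult_bounded[OF f g])
  have Fgb: "AE t in unit_leb. nrm unit_leb (\<lambda>x. F n (t, x) * g (t, x)) \<le> C * B" for n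
    using Fb[of n] AE_space
  proof eventually_elim
    case (elim t)
    then have t: "t \<in> {0<..<1}" by simp
    have "nrm unit_leb (\<lambda>x. F n (t, x) * g (t, x)) \<le> C * nrm unit_leb (\<lambda>x. F n (t, x))"
      by (rule nrm_mult_bounded[OF sqQ_slice[OF F t] slice_meas[OF g(1) t] g(2)[OF t] C])
    also have "\<dots> \<le> C * B" by (rule mult_left_mono[OF elim(1) C])
    finally show ?case .
  qed
  have Fgw: "AE t in unit_leb. weakly_to unit_leb (\<lambda>n x. F n (t, x) * g (t, x)) (\<lambda>x. f (t, x) * g (t, x))"
    using wk AE_space
  proof eventually_elim
    case (elim t)
    then have t: "t \<in> {0<..<1}" by simp
    show ?case by (rule weakly_to_mult_bounded[OF elim(1) slice_meas[OF g(1) t] g(2)[OF t]])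
  qed
  show "(\<lambda>n. LINT p|unit_sq. (F n p * g p) * V1 (W n) p) \<longlonglongrightarrow> (LINT p|unit_sq. (f p * g p) * V1 w p)"
    unfolding V1_adjoint[OF Fg W] V1_adjoint[OF fg w]
    by (rule strong_weak[OF _ _ AQ_strong[OF Fg fg Fgb Fgw] sqQ_sq_int[OF W] Wb Ww sqQ_sq_int[OF w]])
      (intro sqQ_sq_int AQ_sqQ Fg fg)+
  have PFb: "AE t in unit_leb. nrm unit_leb (\<lambda>x. PX (\<lambda>p. F n p * g p) (t, x)) \<le> C * B" for n
    using Fgb[of n] AE_space
  proof eventually_elim
    case (elim t)
    then have t: "t \<in> {0<..<1}" by simp
    have "\<bar>PX (\<lambda>p. F n p * g p) (t, x)\<bar> \<le> C * B" for x
      using prim_nrm_bound[OF sqQ_slice[OF Fg t], of n x] elim(1) by (simp add: PX_def)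
    then show ?case using sqQ_slice[OF PX_sqQ[OF Fg] t, of n] order_trans[OF nrm_nonneg elim(1)]
      by (intro nrm_le_const) (auto dest: sq_int_meas)
  qed
  have PFw: "AE t in unit_leb. weakly_to unit_leb (\<lambda>n x. PX (\<lambda>p. F n p * g p) (t, x)) (\<lambda>x. PX (\<lambda>p. f p * g p) (t, x))"
  proof -
    have "AE t in unit_leb. \<forall>n. nrm unit_leb (\<lambda>x. F n (t, x) * g (t, x)) \<le> C * B"
      unfolding AE_all_countable using Fgb by blast
    then show ?thesis using Fgw AE_space
    proof eventually_elim
      case (elim t)
      then have t: "t \<in> {0<..<1}" by simp
      have "weakly_to unit_leb (\<lambda>n. prim (\<lambda>x. F n (t, x) * g (t, x))) (prim (\<lambda>x. f (t, x) * g (t, x)))"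
        by (rule weakly_to_PX[OF elim(2) sqQ_slice[OF Fg t] sqQ_slice[OF fg t]]) (use elim(1) in blast)
      then show ?case by (simp add: PX_def)
    qed
  qed
  show "(\<lambda>n. LINT p|unit_sq. (F n p * g p) * V0 (W n) p) \<longlonglongrightarrow> (LINT p|unit_sq. (f p * g p) * V0 w p)"
    unfolding V0_adjoint[OF Fg W] V0_adjoint[OF fg w]
    by (rule tendsto_minus, rule strong_weak[OF _ _ AQ_strong[OF PX_sqQ[OF Fg] PX_sqQ[OF fg] PFb PFw] sqQ_sq_int[OF W] Wb Ww sqQ_sq_int[OF w]])
      (intro sqQ_sq_int AQ_sqQ PX_sqQ Fg fg)+
qed

lemma weakQ_limit:
  assumes wk: "\<And>n. weakQ f0 f1 (F n) (W n) (Z n)"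
    and F: "\<And>n. F n \<in> sqQ" and W: "\<And>n. W n \<in> sqQ" and Z: "\<And>n. Z n \<in> sqQ" and f: "f \<in> sqQ" and w: "w \<in> sqQ" and z: "z \<in> sqQ"
    and Fb: "\<And>n. AE t in unit_leb. nrm unit_leb (\<lambda>x. F n (t, x)) \<le> B" and Wb: "\<And>n. nrm unit_sq (W n) \<le> CW" and Zb: "\<And>n. nrm unit_sq (Z n) \<le> CZ"
    and Ff: "weakly_to unit_sq F f" and Ww: "weakly_to unit_sq W w" and Zz: "weakly_to unit_sq Z z"
  shows "weakQ f0 f1 f w z"
  unfolding weakQ_def
proof
  fix \<phi> assume \<phi>: "\<phi> \<in> smooth_square"
  have sl: "AE t in unit_leb. weakly_to unit_leb (\<lambda>n x. F n (t, x)) (\<lambda>x. f (t, x))"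
    by (rule slices_converge_weakly[OF moments_converge[OF wk F W Z f Fb Wb Zb Ff] F f Fb])
  obtain C where C: "C \<ge> 0" "\<And>x t. x \<in> {0..1} \<Longrightarrow> t \<in> {0..1} \<Longrightarrow> \<bar>\<phi> (x, t)\<bar> \<le> C"
   "\<And>x t. x \<in> {0<..<1} \<Longrightarrow> t \<in> {0<..<1} \<Longrightarrow> \<bar>dx \<phi> (t, x)\<bar> \<le> C"
   "\<And>x t. x \<in> {0<..<1} \<Longrightarrow> t \<in> {0<..<1} \<Longrightarrow> \<bar>dt \<phi> (t, x)\<bar> \<le> C"
    using smooth_square_bounded[OF \<phi>] by blast
  note m = smooth_square_meas[OF \<phi>]
  have b1: "\<bar>sw \<phi> (t, x)\<bar> \<le> C" if "t \<in> {0<..<1}" "x \<in> {0<..<1}" for t x using C(2)[of x t] that by (simp add: sw_def)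
  have b2: "\<bar>dx \<phi> (t, x)\<bar> \<le> C" if "t \<in> {0<..<1}" "x \<in> {0<..<1}" for t x using C(3)[of x t] that by simp
  note L1 = transport_product_limit(1)[OF F f W w Fb Wb sl Ww m(1) b1 C(1)]
  note L2 = transport_product_limit(2)[OF F f W w Fb Wb sl Ww m(2) b2 C(1)]
  have split: "(LINT p|unit_sq. g p * (sw \<phi> p * V1 v p + dx \<phi> p * V0 v p)) = 
      (LINT p|unit_sq. (g p * sw \<phi> p) * V1 v p) + (LINT p|unit_sq. (g p * dx \<phi> p) * V0 v p)" if "g \<in> sqQ" "v \<in> sqQ" for g v
  proof -
    have "integrable unit_sq (\<lambda>p. (g p * sw \<phi> p) * V1 v p)"
      by (intro sq_int_mult sqQ_sq_int sqQ_mult_bounded[OF that(1) m(1) b1] V_sqQ that)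
    moreover have "integrable unit_sq (\<lambda>p. (g p * dx \<phi> p) * V0 v p)"
      by (intro sq_int_mult sqQ_sq_int sqQ_mult_bounded[OF that(1) m(2) b2] V_sqQ that)
    ultimately show ?thesis by (simp add: distrib_left mult.assoc)
  qed
  have L3: "(\<lambda>n. LINT p|unit_sq. F n p * (sw \<phi> p * V1 (W n) p + dx \<phi> p * V0 (W n) p)) \<longlonglongrightarrow> 
     (LINT p|unit_sq. f p * (sw \<phi> p * V1 w p + dx \<phi> p * V0 w p))"
    unfolding split[OF F W] split[OF f w] by (rule tendsto_add[OF L1 L2])
  have L4: "(\<lambda>n. LINT p|unit_sq. sw \<phi> p * Z n p) \<longlonglongrightarrow> (LINT p|unit_sq. sw \<phi> p * z p)"
    using weakly_toD[OF Zz sqQ_sq_int[OF smooth_square_sqQ(1)[OF \<phi>]]] by (simp add: mult.commute)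
  have L5: "(\<lambda>n. - (LINT p|unit_sq. F n p * dt \<phi> p) + (LINT x|unit_leb. f1 x * \<phi> (x, 1)) - (LINT x|unit_leb. f0 x * \<phi> (x, 0)))
    \<longlonglongrightarrow> - (LINT p|unit_sq. f p * dt \<phi> p) + (LINT x|unit_leb. f1 x * \<phi> (x, 1)) - (LINT x|unit_leb. f0 x * \<phi> (x, 0))"
    by (intro tendsto_intros weakly_toD[OF Ff sqQ_sq_int[OF smooth_square_sqQ(3)[OF \<phi>]]])
  have "(\<lambda>n. - (LINT p|unit_sq. F n p * dt \<phi> p) + (LINT x|unit_leb. f1 x * \<phi> (x, 1)) - (LINT x|unit_leb. f0 x * \<phi> (x, 0)))
    \<longlonglongrightarrow> (LINT p|unit_sq. f p * (sw \<phi> p * V1 w p + dx \<phi> p * V0 w p)) + (LINT p|unit_sq. sw \<phi> p * z p)"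
    unfolding wk[unfolded weakQ_def, rule_format, OF \<phi>] by (rule tendsto_add[OF L3 L4])
  from LIMSEQ_unique[OF L5 this]
  show "- (LINT p|unit_sq. f p * dt \<phi> p) + (LINT x|unit_leb. f1 x * \<phi> (x, 1)) - (LINT x|unit_leb. f0 x * \<phi> (x, 0)) = 
     (LINT p|unit_sq. f p * (sw \<phi> p * V1 w p + dx \<phi> p * V0 w p)) + (LINT p|unit_sq. sw \<phi> p * z p)" .
qed

section \<open>Lower semicontinuity and existence on the square\<close>

definition JQ :: "real \<Rightarrow> real \<Rightarrow> real \<Rightarrow> (real \<times> real \<Rightarrow> real) \<Rightarrow> (real \<times> real \<Rightarrow> real) \<Rightarrow> real" where
  "JQ \<kappa> \<mu> \<epsilon> w z = 1/2 * (\<kappa> * (nrm unit_sq (V0 w))\<^sup>2 + \<mu> * (nrm unit_sq (V1 w))\<^sup>2 + \<epsilon> * (nrm unit_sq w)\<^sup>2 + (nrm unit_sq z)\<^sup>2)"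

text \<open>Convexity: the squared norm lies above its tangent at \<open>v\<close>.\<close>

lemma nrm_sq_tangent:
  assumes u: "u \<in> sq_int M" and v: "v \<in> sq_int M"
  shows "2 * (LINT p|M. v p * u p) - (nrm M v)\<^sup>2 \<le> (nrm M u)\<^sup>2"
proof -
  have "0 \<le> (LINT p|M. (u p + (-1) * v p)\<^sup>2)" by simp
  then show ?thesis unfolding integral_quad[OF u v, of "-1"] nrm_sq by (simp add: mult.commute)
qed

text \<open>Each square is replaced by its tangent at the limit, an affine functional of
  \<open>W n\<close> or \<open>Z n\<close> that passes to the weak limit; for v and v_x this uses
  the adjoint operators.\<close>

lemma JQ_lsc:
  assumes W: "\<And>n. W n \<in> sqQ" and w: "w \<in> sqQ" and Z: "\<And>n. Z n \<in> sqQ" and z: "z \<in> sqQ"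
    and Ww: "weakly_to unit_sq W w" and Zz: "weakly_to unit_sq Z z"
    and pos: "\<kappa> \<ge> 0" "\<mu> \<ge> 0" "\<epsilon> \<ge> 0" and J: "(\<lambda>n. JQ \<kappa> \<mu> \<epsilon> (W n) (Z n)) \<longlonglongrightarrow> m"
  shows "JQ \<kappa> \<mu> \<epsilon> w z \<le> m"
proof -
  have t0: "(\<lambda>n. LINT p|unit_sq. V0 w p * V0 (W n) p) \<longlonglongrightarrow> (nrm unit_sq (V0 w))\<^sup>2"
  proof -
    have "(\<lambda>n. LINT p|unit_sq. V0 w p * V0 (W n) p) \<longlonglongrightarrow> (LINT p|unit_sq. V0 w p * V0 w p)"
      unfolding V0_adjoint[OF V_sqQ(2)[OF w] W] V0_adjoint[OF V_sqQ(2)[OF w] w]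
      using tendsto_minus[OF weakly_toD[OF Ww sqQ_sq_int[OF AQ_sqQ[OF PX_sqQ[OF V_sqQ(2)[OF w]]]]]] by (simp add: mult.commute)
    then show ?thesis by (simp add: nrm_sq power2_eq_square[of "V0 w _"])
  qed
  have t1: "(\<lambda>n. LINT p|unit_sq. V1 w p * V1 (W n) p) \<longlonglongrightarrow> (nrm unit_sq (V1 w))\<^sup>2"
  proof -
    have "(\<lambda>n. LINT p|unit_sq. V1 w p * V1 (W n) p) \<longlonglongrightarrow> (LINT p|unit_sq. V1 w p * V1 w p)"
      unfolding V1_adjoint[OF V_sqQ(1)[OF w] W] V1_adjoint[OF V_sqQ(1)[OF w] w]
      using weakly_toD[OF Ww sqQ_sq_int[OF AQ_sqQ[OF V_sqQ(1)[OF w]]]] by (simp add: mult.commute)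
    then show ?thesis by (simp add: nrm_sq power2_eq_square[of "V1 w _"])
  qed
  have t2: "(\<lambda>n. LINT p|unit_sq. w p * W n p) \<longlonglongrightarrow> (nrm unit_sq w)\<^sup>2"
    using weakly_toD[OF Ww sqQ_sq_int[OF w]] by (simp add: nrm_sq power2_eq_square[of "w _"] mult.commute)
  have t3: "(\<lambda>n. LINT p|unit_sq. z p * Z n p) \<longlonglongrightarrow> (nrm unit_sq z)\<^sup>2"
    using weakly_toD[OF Zz sqQ_sq_int[OF z]] by (simp add: nrm_sq power2_eq_square[of "z _"] mult.commute)
  define L where "L n = 1/2 * (\<kappa> * (2 * (LINT p|unit_sq. V0 w p * V0 (W n) p) - (nrm unit_sq (V0 w))\<^sup>2) + 
     \<mu> * (2 * (LINT p|unit_sq. V1 w p * V1 (W n) p) - (nrm unit_sq (V1 w))\<^sup>2) +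
     \<epsilon> * (2 * (LINT p|unit_sq. w p * W n p) - (nrm unit_sq w)\<^sup>2) + (2 * (LINT p|unit_sq. z p * Z n p) - (nrm unit_sq z)\<^sup>2))" for n
  have "L \<longlonglongrightarrow> 1/2 * (\<kappa> * (2 * (nrm unit_sq (V0 w))\<^sup>2 - (nrm unit_sq (V0 w))\<^sup>2) + 
     \<mu> * (2 * (nrm unit_sq (V1 w))\<^sup>2 - (nrm unit_sq (V1 w))\<^sup>2) +
     \<epsilon> * (2 * (nrm unit_sq w)\<^sup>2 - (nrm unit_sq w)\<^sup>2) + (2 * (nrm unit_sq z)\<^sup>2 - (nrm unit_sq z)\<^sup>2))"
    unfolding L_def by (intro tendsto_intros t0 t1 t2 t3)
  then have L: "L \<longlonglongrightarrow> JQ \<kappa> \<mu> \<epsilon> w z" by (simp add: JQ_def)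
  have "L n \<le> JQ \<kappa> \<mu> \<epsilon> (W n) (Z n)" for n
    unfolding L_def JQ_def
    by (intro mult_left_mono add_mono nrm_sq_tangent sqQ_sq_int V_sqQ W w Z z pos) simp
  then show ?thesis by (intro LIMSEQ_le[OF L J]) blast
qed

lemma weak_compact_sqQ:
  assumes F: "\<And>n. F n \<in> sqQ" and b: "\<And>n. nrm unit_sq (F n) \<le> C"
  obtains r f where "strict_mono (r :: nat \<Rightarrow> nat)" "f \<in> sqQ" "weakly_to unit_sq (\<lambda>n. F (r n)) f"
proof -
  obtain r :: "nat \<Rightarrow> nat" and g where r: "strict_mono r" and g: "g \<in> sq_int unit_sq" 
    and c: "\<And>h. h \<in> sq_int unit_sq \<Longrightarrow> (\<lambda>n. LINT y|unit_sq. F (r n) y * h y) \<longlonglongrightarrow> (LINT y|unit_sq. g y * h y)"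
    by (rule Q.weak_compact[where f=F and C=C, OF sqQ_sq_int[OF F] b]) (assumption | blast)+
  obtain f where f: "f \<in> sqQ" "AE p in unit_sq. f p = g p" using sq_int_regular[OF g] by blast
  have "weakly_to unit_sq (\<lambda>n. F (r n)) f"
    unfolding weakly_to_def
  proof
    fix h :: "real \<times> real \<Rightarrow> real" assume h: "h \<in> sq_int unit_sq"
    have "(LINT y|unit_sq. f y * h y) = (LINT y|unit_sq. g y * h y)"
    proof (rule integral_cong_AE)
      show "(\<lambda>y. f y * h y) \<in> borel_measurable unit_sq" "(\<lambda>y. g y * h y) \<in> borel_measurable unit_sq"
        by (intro borel_measurable_times sqQ_meas f sq_int_meas g h)+
      show "AE y in unit_sq. f y * h y = g y * h y" using f(2) by eventually_elim simp
    qed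
    with c[OF h] show "(\<lambda>n. LINT y|unit_sq. F (r n) y * h y) \<longlonglongrightarrow> (LINT y|unit_sq. f y * h y)" by simp
  qed
  with r f(1) show ?thesis by (rule that)
qed

lemma weakly_to_subseq: "weakly_to M F f \<Longrightarrow> strict_mono (r :: nat \<Rightarrow> nat) \<Longrightarrow> weakly_to M (\<lambda>n. F (r n)) f"
  unfolding weakly_to_def
proof
  fix h assume a: "\<forall>h\<in>sq_int M. (\<lambda>n. LINT y|M. F n y * h y) \<longlonglongrightarrow> (LINT y|M. f y * h y)" "strict_mono r" "h \<in> sq_int M"
  from LIMSEQ_subseq_LIMSEQ[OF a(1)[rule_format, OF a(3)] a(2)]
  show "(\<lambda>n. LINT y|M. F (r n) y * h y) \<longlonglongrightarrow> (LINT y|M. f y * h y)" by (simp add: o_def)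
qed

lemma exists_minimizer_Q:
  assumes pos: "\<kappa> > 0" "\<mu> \<ge> 0" "\<epsilon> > 0" and f0: "f0 \<in> sq_int unit_leb"
    and ne: "weakQ f0 f1 g v y" "g \<in> sqQ" "v \<in> sqQ" "y \<in> sqQ"
  obtains f w z where "f \<in> sqQ" "w \<in> sqQ" "z \<in> sqQ" "weakQ f0 f1 f w z"
    "\<And>g v y. g \<in> sqQ \<Longrightarrow> v \<in> sqQ \<Longrightarrow> y \<in> sqQ \<Longrightarrow> weakQ f0 f1 g v y \<Longrightarrow> JQ \<kappa> \<mu> \<epsilon> w z \<le> JQ \<kappa> \<mu> \<epsilon> v y"
proof -
  define S where "S = {(f, w, z). f \<in> sqQ \<and> w \<in> sqQ \<and> z \<in> sqQ \<and> weakQ f0 f1 f w z}"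
  define J where "J = (\<lambda>(f :: real \<times> real \<Rightarrow> real, w, z). JQ \<kappa> \<mu> \<epsilon> w z)"
  have J0: "0 \<le> J s" for s using pos by (auto simp: J_def JQ_def split: prod.split)
  have S0: "(g, v, y) \<in> S" using ne by (simp add: S_def)
  define m where "m = (INF s\<in>S. J s)"
  have bdd: "bdd_below (J ` S)" using J0 by (auto intro!: bdd_belowI2)
  have m_le: "m \<le> J s" if "s \<in> S" for s unfolding m_def by (rule cINF_lower[OF bdd that])
  have "\<exists>s\<in>S. J s < m + 1 / real (Suc n)" for n
  proof (rule ccontr)
    assume a: "\<not> ?thesis"
    have "m + 1 / real (Suc n) \<le> (INF s\<in>S. J s)"
      by (rule cINF_greatest) (use S0 a in \<open>auto simp: not_less\<close>)
    then show False by (simp add: m_def)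
  qed
  then obtain s where s: "\<And>n. s n \<in> S" "\<And>n. J (s n) < m + 1 / real (Suc n)" by metis
  define F where "F n = fst (s n)" for n
  define W where "W n = fst (snd (s n))" for n
  define Z where "Z n = snd (snd (s n))" for n
  have F: "F n \<in> sqQ" and W: "W n \<in> sqQ" and Z: "Z n \<in> sqQ" and wk: "weakQ f0 f1 (F n) (W n) (Z n)" for n
    using s(1)[of n] by (auto simp: S_def F_def W_def Z_def)
  have Js: "J (s n) = JQ \<kappa> \<mu> \<epsilon> (W n) (Z n)" for n by (simp add: J_def W_def Z_def case_prod_unfold)
  have Jlim: "(\<lambda>n. JQ \<kappa> \<mu> \<epsilon> (W n) (Z n)) \<longlonglongrightarrow> m"
  proof (rule tendsto_sandwich[where f="\<lambda>_. m" and h="\<lambda>n. m + 1 / real (Suc n)"])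
    show "\<forall>\<^sub>F n in sequentially. m \<le> JQ \<kappa> \<mu> \<epsilon> (W n) (Z n)" using m_le[OF s(1)] Js by simp
    show "\<forall>\<^sub>F n in sequentially. JQ \<kappa> \<mu> \<epsilon> (W n) (Z n) \<le> m + 1 / real (Suc n)" using s(2) Js by (simp add: less_imp_le)
    have "(\<lambda>n. m + 1 / real (Suc n)) \<longlonglongrightarrow> m + 0" by (intro tendsto_intros LIMSEQ_Suc[OF lim_1_over_n])
    then show "(\<lambda>n. m + 1 / real (Suc n)) \<longlonglongrightarrow> m" by simp
  qed simp
  have Jb: "JQ \<kappa> \<mu> \<epsilon> (W n) (Z n) \<le> m + 1" for n
  proof -
    have "1 / real (Suc n) \<le> 1" by simp
    then show ?thesis using s(2)[of n] Js[of n] by linarith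
  qed
  \<comment> \<open>Coercivity: the second derivative of the velocity and the source are controlled
    by the action.\<close>
  have E: "\<epsilon> * (nrm unit_sq (W n))\<^sup>2 + (nrm unit_sq (Z n))\<^sup>2 \<le> 2 * (m + 1)" for n
  proof -
    have "0 \<le> \<kappa> * (nrm unit_sq (V0 (W n)))\<^sup>2" "0 \<le> \<mu> * (nrm unit_sq (V1 (W n)))\<^sup>2" using pos by auto
    moreover have "c + d \<le> 2 * (m + 1)" if "1/2 * (a + b + c + d) \<le> m + 1" "0 \<le> a" "0 \<le> b" for a b c d :: real
      using that by simp
    ultimately show ?thesis using Jb[of n] unfolding JQ_def by blast
  qed
  define CW where "CW = sqrt (2 * (m + 1) / \<epsilon>)"
  define CZ where "CZ = sqrt (2 * (m + 1))"
  have Wb: "nrm unit_sq (W n) \<le> CW" for n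
    unfolding CW_def
  proof (rule real_le_rsqrt)
    have "\<epsilon> * (nrm unit_sq (W n))\<^sup>2 \<le> 2 * (m + 1)" using E[of n] zero_le_power2[of "nrm unit_sq (Z n)"] by linarith
    then show "(nrm unit_sq (W n))\<^sup>2 \<le> 2 * (m + 1) / \<epsilon>" using pos by (simp add: field_simps)
  qed
  have Zb: "nrm unit_sq (Z n) \<le> CZ" for n
    unfolding CZ_def
  proof (rule real_le_rsqrt)
    have "0 \<le> \<epsilon> * (nrm unit_sq (W n))\<^sup>2" using pos by simp
    then show "(nrm unit_sq (Z n))\<^sup>2 \<le> 2 * (m + 1)" using E[of n] by linarith
  qed
  \<comment> \<open>One \<open>N\<close> for the whole sequence, so the exponential constant of the
    a priori bound is uniform in \<open>n\<close>.\<close>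
  obtain N :: nat where N: "4 * CW \<le> real N" using real_arch_simple by blast
  define B where "B = 2 ^ (N + 3) * (nrm unit_leb f0 + CZ)"
  have Fb: "AE t in unit_leb. nrm unit_leb (\<lambda>x. F n (t, x)) \<le> B" for n
  proof -
    have "4 * nrm unit_sq (W n) \<le> real N" using Wb[of n] N by linarith
    from apriori_bound[OF wk F W Z f0 this] show ?thesis
    proof eventually_elim
      case (elim t)
      have "2 ^ (N + 3) * (nrm unit_leb f0 + nrm unit_sq (Z n)) \<le> B"
        unfolding B_def by (intro mult_left_mono add_left_mono Zb) simp
      with elim show ?case by linarith
    qed
  qed
  have "0 \<le> CZ" using order_trans[OF nrm_nonneg Zb] .
  then have B0: "B \<ge> 0" by (simp add: B_def)
  have Fn: "nrm unit_sq (F n) \<le> B" for n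
    unfolding nrm_slice(2)[OF sqQ_sq_int[OF F], symmetric]
    by (rule nrm_le_const[OF sq_int_meas[OF nrm_slice(1)[OF sqQ_sq_int[OF F]]]]) (use Fb B0 in auto)
  \<comment> \<open>Three successive extractions; weak convergence obtained earlier survives passage
    to later subsequences.\<close>
  obtain r1 f where r1: "strict_mono r1" "f \<in> sqQ" "weakly_to unit_sq (\<lambda>n. F (r1 n)) f"
    by (rule weak_compact_sqQ[of F B, OF F Fn]) (assumption | blast)+
  obtain r2 w where r2: "strict_mono r2" "w \<in> sqQ" "weakly_to unit_sq (\<lambda>n. W (r1 (r2 n))) w"
    by (rule weak_compact_sqQ[of "\<lambda>n. W (r1 n)" CW, OF W Wb]) (assumption | blast)+
  obtain r3 z where r3: "strict_mono r3" "z \<in> sqQ" "weakly_to unit_sq (\<lambda>n. Z (r1 (r2 (r3 n)))) z"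
    by (rule weak_compact_sqQ[of "\<lambda>n. Z (r1 (r2 n))" CZ, OF Z Zb]) (assumption | blast)+
  define r where "r n = r1 (r2 (r3 n))" for n
  have rm: "strict_mono r" using r1(1) r2(1) r3(1) by (simp add: r_def strict_mono_def)
  have r23: "strict_mono (\<lambda>n. r2 (r3 n))" using r2(1) r3(1) by (simp add: strict_mono_def)
  have Ff: "weakly_to unit_sq (\<lambda>n. F (r n)) f" using weakly_to_subseq[OF r1(3) r23] by (simp add: r_def)
  have Ww: "weakly_to unit_sq (\<lambda>n. W (r n)) w" using weakly_to_subseq[OF r2(3) r3(1)] by (simp add: r_def)
  have Zz: "weakly_to unit_sq (\<lambda>n. Z (r n)) z" using r3(3) by (simp add: r_def)
  have lim: "weakQ f0 f1 f w z"
    by (rule weakQ_limit[of f0 f1 "\<lambda>n. F (r n)" "\<lambda>n. W (r n)" "\<lambda>n. Z (r n)", OF wk F W Z r1(2) r2(2) r3(2) Fb Wb Zb Ff Ww Zz])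
  have "(\<lambda>n. JQ \<kappa> \<mu> \<epsilon> (W (r n)) (Z (r n))) \<longlonglongrightarrow> m"
    using LIMSEQ_subseq_LIMSEQ[OF Jlim rm] by (simp add: o_def)
  then have Jm: "JQ \<kappa> \<mu> \<epsilon> w z \<le> m"
    by (rule JQ_lsc[OF W r2(2) Z r3(2) Ww Zz, rotated -1]) (use pos in auto)
  have min: "JQ \<kappa> \<mu> \<epsilon> w z \<le> JQ \<kappa> \<mu> \<epsilon> v y" if "g \<in> sqQ" "v \<in> sqQ" "y \<in> sqQ" "weakQ f0 f1 g v y" for g v y
  proof -
    have "m \<le> J (g, v, y)" by (rule m_le) (use that in \<open>simp add: S_def\<close>)
    then show ?thesis using Jm by (simp add: J_def)
  qed
  show ?thesis by (rule that[OF r1(2) r2(2) r3(2) lim min])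
qed

section \<open>Jointly measurable representatives\<close>

text \<open>Completeness of Lebesgue measure. The definitions determine time-dependent functions
  only up to null sets of times, so measurability must survive arbitrary changes on such
  sets.\<close>

lemma unit_leb_AE_measurable:
  fixes g :: "real \<Rightarrow> real"
  assumes f: "f \<in> borel_measurable unit_leb" and AE: "AE t in unit_leb. f t = g t"
  shows "g \<in> borel_measurable unit_leb"
proof -
  have S: "{0<..<1::real} \<in> sets lebesgue" by simp
  have "(\<lambda>x. if x \<in> {0<..<1} then f x else 0) \<in> borel_measurable lebesgue"
    using f borel_measurable_if[OF S] by blast
  moreover have "AE x in lebesgue. x \<in> {0<..<1} \<longrightarrow> f x = g x"
    using AE by (subst (asm) AE_restrict_space_iff) auto
  then have "AE x in lebesgue. (if x \<in> {0<..<1} then f x else 0) = (if x \<in> {0<..<1} then g x else 0)"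
    by eventually_elim auto
  ultimately have "(\<lambda>x. if x \<in> {0<..<1} then g x else 0) \<in> borel_measurable lebesgue"
    by (rule borel_measurable_AE)
  then show ?thesis using borel_measurable_if[OF S] by blast
qed

lemma unit_leb_integral_cong_AE:
  fixes g :: "real \<Rightarrow> real"
  assumes "f \<in> borel_measurable unit_leb" "AE t in unit_leb. f t = g t"
  shows "(LINT t|unit_leb. f t) = (LINT t|unit_leb. g t)"
  by (rule integral_cong_AE[OF assms(1) unit_leb_AE_measurable[OF assms] assms(2)])

text \<open>A simple function with values in a function space has finitely many values, so as a
  function of time and position it is a finite sum of products.\<close>

lemma simple_joint:
  assumes s: "simple_function unit_leb \<sigma>" and m: "\<And>t. t \<in> {0<..<1} \<Longrightarrow> \<sigma> t \<in> borel_measurable unit_leb"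
  shows "(\<lambda>p. \<sigma> (fst p) (snd p) :: real) \<in> borel_measurable unit_sq"
proof -
  let ?R = "\<sigma> ` {0<..<1}"
  have fin: "finite ?R" using simple_functionD(1)[OF s] by simp
  have "(\<lambda>p. \<Sum>g\<in>?R. if \<sigma> (fst p) = g then g (snd p) else 0) \<in> borel_measurable unit_sq"
  proof (intro borel_measurable_sum measurable_If)
    fix g assume "g \<in> ?R"
    then have "g \<in> borel_measurable unit_leb" using m by auto
    then show "(\<lambda>p. g (snd p)) \<in> borel_measurable unit_sq" by (rule measurable_compose[OF measurable_snd])
    have "\<sigma> -` {g} \<inter> space unit_leb \<in> sets unit_leb" by (rule simple_functionD(2)[OF s])
    then have "Measurable.pred unit_leb (\<lambda>t. \<sigma> t = g)"
      by (simp add: pred_def vimage_def Int_def conj_commute)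
    from measurable_compose[OF measurable_fst this]
    have "Measurable.pred unit_sq (\<lambda>p. \<sigma> (fst p) = g)" .
    then show "{p \<in> space unit_sq. \<sigma> (fst p) = g} \<in> sets unit_sq" by (simp add: pred_def)
  qed simp
  then show ?thesis
  proof (rule measurable_cong[THEN iffD1, rotated])
    fix p assume "p \<in> space unit_sq"
    then have "\<sigma> (fst p) \<in> ?R" by (auto simp: space_pair_measure)
    then show "(\<Sum>g\<in>?R. if \<sigma> (fst p) = g then g (snd p) else 0) = \<sigma> (fst p) (snd p)"
      using fin by (simp add: sum.delta)
  qed
qed

text \<open>A subsequence of the simple approximations converges summably fast in \<open>L\<^sup>2\<close> at almost every time, 
  hence pointwise almost everywhere in space.\<close>

lemma strongly_measurable_joint:
  assumes sm: "strongly_measurable L2 L2_norm u" and uL: "AE t in unit_leb. u t \<in> L2"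
  obtains G where "G \<in> borel_measurable unit_sq" "AE t in unit_leb. AE x in unit_leb. G (t, x) = u t x"
proof -
  obtain s where s: "\<And>n::nat. simple_function unit_leb (s n)" and sL: "\<And>n t. t \<in> {0<..<1} \<Longrightarrow> s n t \<in> sq_int unit_leb"
    and conv: "AE t in unit_leb. (\<lambda>n. nrm unit_leb (\<lambda>x. s n t x - u t x)) \<longlonglongrightarrow> 0"
    using sm unfolding strongly_measurable_def L2_norm_eq_nrm L2_eq_sq_int by blast
  have sj: "(\<lambda>p. s n (fst p) (snd p)) \<in> borel_measurable unit_sq" for n
    by (rule simple_joint[OF s]) (rule sq_int_meas[OF sL])
  note [measurable] = sj
  define e where "e n m t = nrm unit_leb (\<lambda>x. s n t x - s m t x)" for n m t
  have em: "e n m \<in> borel_measurable unit_leb" for n m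
    using nrm_slice_meas[OF borel_measurable_diff[OF sj[of n] sj[of m]]] by (simp add: e_def[abs_def])
  \<comment> \<open>The distance from \<open>s n\<close> to \<open>u\<close> is not known to be
    measurable in time, since \<open>u\<close> is not known to be jointly measurable. It is
    recovered as a limit of the measurable distances between simple functions.\<close>
  define E where "E n t = lim (\<lambda>m. e n m t)" for n t
  have Em: "E n \<in> borel_measurable unit_leb" for n
    unfolding E_def by (rule borel_measurable_lim_metric) (rule em)
  have EU: "AE t in unit_leb. \<forall>n. E n t = nrm unit_leb (\<lambda>x. s n t x - u t x)"
    using conv uL AE_space
  proof eventually_elim
    case (elim t)
    then have t: "t \<in> {0<..<1}" and us: "u t \<in> sq_int unit_leb" by (simp_all add: L2_eq_sq_int)
    show ?case
    proof
      fix n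
      have "(\<lambda>m. e n m t) \<longlonglongrightarrow> nrm unit_leb (\<lambda>x. s n t x - u t x)"
        unfolding e_def
      proof (rule nrm_tendsto)
        show "(\<lambda>x. s n t x - s m t x) \<in> sq_int unit_leb" for m by (intro sq_int_diff sL t)
        show "(\<lambda>x. s n t x - u t x) \<in> sq_int unit_leb" by (intro sq_int_diff sL t us)
        show "(\<lambda>m. nrm unit_leb (\<lambda>y. s n t y - s m t y - (s n t y - u t y))) \<longlonglongrightarrow> 0"
          using elim(1) nrm_minus_commute[of unit_leb "u t"] by simp
      qed
      then show "E n t = nrm unit_leb (\<lambda>x. s n t x - u t x)" unfolding E_def by (rule limI)
    qed
  qed
  \<comment> \<open>Truncation at 1 turns convergence at almost every time into convergence of
    integrals.\<close>
  define h where "h n t = min 1 (E n t)" for n t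
  have hm: "h n \<in> borel_measurable unit_leb" for n unfolding h_def using Em by measurable
  have h01: "AE t in unit_leb. \<forall>n. 0 \<le> h n t \<and> h n t \<le> 1"
    using EU by eventually_elim (simp add: h_def)
  have hi: "integrable unit_leb (h n)" for n
  proof (rule U.integrable_const_bound[OF _ hm, of _ 1])
    show "AE t in unit_leb. norm (h n t) \<le> 1" using h01 by eventually_elim simp
  qed
  have lim: "(\<lambda>n. LINT t|unit_leb. \<bar>h n t\<bar>) \<longlonglongrightarrow> (LINT t|unit_leb. (0::real))"
  proof (rule integral_dominated_convergence[where w="\<lambda>_. 1"])
    show "(\<lambda>t. \<bar>h n t\<bar>) \<in> borel_measurable unit_leb" for n using hm by measurable
    show "AE t in unit_leb. norm \<bar>h n t\<bar> \<le> 1" for n using h01 by eventually_elim simp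
    show "AE t in unit_leb. (\<lambda>n. \<bar>h n t\<bar>) \<longlonglongrightarrow> 0"
      using conv EU
    proof eventually_elim
      case (elim t)
      then have "(\<lambda>n. E n t) \<longlonglongrightarrow> 0" by simp
      then have "(\<lambda>n. \<bar>min 1 (E n t)\<bar>) \<longlonglongrightarrow> \<bar>min 1 0\<bar>" by (intro tendsto_intros)
      then show ?case by (simp add: h_def)
    qed
  qed auto
  have "\<exists>n. (LINT t|unit_leb. \<bar>h n t\<bar>) < (1/2)^k" for k :: nat
  proof -
    from LIMSEQ_D[OF lim, of "(1/2)^k"] show ?thesis by auto
  qed
  \<comment> \<open>\<open>r\<close> need not be increasing; only summability of the errors is
    used.\<close>
  then obtain r where r: "\<And>k. (LINT t|unit_leb. \<bar>h (r k) t\<bar>) < (1/2)^k" by metis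
  have "summable (\<lambda>k. LINT t|unit_leb. \<bar>h (r k) t\<bar>)"
  proof (rule summable_comparison_test')
    show "summable (\<lambda>k. (1/2::real)^k)" by (rule summable_geometric) simp
    show "norm (LINT t|unit_leb. \<bar>h (r k) t\<bar>) \<le> (1/2)^k" if "k \<ge> 0" for k using r[of k] by simp
  qed
  from AE_summable_L1[OF hi this] have hs: "AE t in unit_leb. summable (\<lambda>k. \<bar>h (r k) t\<bar>)" .
  define G where "G p = lim (\<lambda>k. s (r k) (fst p) (snd p))" for p
  have Gm: "G \<in> borel_measurable unit_sq" unfolding G_def by (rule borel_measurable_lim_metric) (rule sj)
  have "AE t in unit_leb. AE x in unit_leb. G (t, x) = u t x"
    using hs h01 EU uL AE_space
  proof eventually_elim
    case (elim t)
    then have t: "t \<in> {0<..<1}" and us: "u t \<in> sq_int unit_leb" by (simp_all add: L2_eq_sq_int)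
    have E0: "0 \<le> E n t" for n using elim(3) by simp
    \<comment> \<open>Terms of a summable series are eventually below 1, where the truncation is
      inactive, so the untruncated distances are summable too.\<close>
    have "(\<lambda>k. \<bar>h (r k) t\<bar>) \<longlonglongrightarrow> 0" by (rule summable_LIMSEQ_zero[OF elim(1)])
    then have "\<forall>\<^sub>F k in sequentially. \<bar>h (r k) t\<bar> < 1" by (rule order_tendstoD) simp
    then have "\<forall>\<^sub>F k in sequentially. norm (E (r k) t) \<le> \<bar>h (r k) t\<bar>"
      by eventually_elim (use E0 in \<open>auto simp: h_def min_def split: if_splits\<close>)
    then have Es: "summable (\<lambda>k. E (r k) t)" by (rule summable_comparison_test_ev[OF _ elim(1)])
    have ds: "(\<lambda>x. s (r k) t x - u t x) \<in> sq_int unit_leb" for k by (intro sq_int_diff sL t us)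
    have "summable (\<lambda>k. LINT x|unit_leb. \<bar>s (r k) t x - u t x\<bar>)"
    proof (rule summable_comparison_test'[OF Es])
      show "norm (LINT x|unit_leb. \<bar>s (r k) t x - u t x\<bar>) \<le> E (r k) t" if "k \<ge> 0" for k
        using L1_le_nrm[OF ds[of k]] elim(3) by simp
    qed
    from AE_summable_L1[OF U.sq_int_integrable[OF ds] this]
    show ?case
    proof eventually_elim
      case (elim x)
      then have "(\<lambda>k. \<bar>s (r k) t x - u t x\<bar>) \<longlonglongrightarrow> 0" by (rule summable_LIMSEQ_zero)
      then have "(\<lambda>k. s (r k) t x) \<longlonglongrightarrow> u t x" by (simp add: tendsto_rabs_zero_iff LIM_zero_iff)
      then show ?case unfolding G_def by (simp add: limI)
    qed
  qed
  with Gm show ?thesis by (rule that)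
qed

text \<open>The majorant \<open>h\<close> is kept general because \<open>u\<close> may be the second
  derivative of a velocity, whose square integrability is known through \<open>H2_norm\<close>.
  Tonelli on the joint representative gives integrability on the square.\<close>

lemma Bochner_joint:
  assumes sm: "strongly_measurable L2 L2_norm u" and uL: "AE t in unit_leb. u t \<in> L2"
    and b: "AE t in unit_leb. (L2_norm (u t))\<^sup>2 \<le> h t" and h: "integrable unit_leb h"
  obtains G where "G \<in> sqQ" "AE t in unit_leb. AE x in unit_leb. G (t, x) = u t x"
proof -
  obtain F where F: "F \<in> borel_measurable unit_sq" "AE t in unit_leb. AE x in unit_leb. F (t, x) = u t x"
    by (rule strongly_measurable_joint[OF sm uL]) (assumption | blast)+
  note [measurable] = F(1)
  have "(\<integral>\<^sup>+p. ennreal ((F p)\<^sup>2) \<partial>unit_sq) = (\<integral>\<^sup>+t. \<integral>\<^sup>+x. ennreal ((F (t, x))\<^sup>2) \<partial>unit_leb \<partial>unit_leb)"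
    by (rule U.nn_integral_fst[symmetric]) measurable
  also have "\<dots> \<le> (\<integral>\<^sup>+t. ennreal (h t) \<partial>unit_leb)"
  proof (rule nn_integral_mono_AE)
    show "AE t in unit_leb. (\<integral>\<^sup>+x. ennreal ((F (t, x))\<^sup>2) \<partial>unit_leb) \<le> ennreal (h t)"
      using F(2) uL b
    proof eventually_elim
      case (elim t)
      then have us: "u t \<in> sq_int unit_leb" by (simp add: L2_eq_sq_int)
      have "(\<integral>\<^sup>+x. ennreal ((F (t, x))\<^sup>2) \<partial>unit_leb) = (\<integral>\<^sup>+x. ennreal ((u t x)\<^sup>2) \<partial>unit_leb)"
        by (rule nn_integral_cong_AE) (use elim(1) in \<open>eventually_elim, simp\<close>)
      also have "\<dots> = ennreal ((L2_norm (u t))\<^sup>2)"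
        unfolding L2_norm_eq_nrm nrm_sq by (rule nn_integral_eq_integral[OF sq_int_sq[OF us]]) simp
      also have "\<dots> \<le> ennreal (h t)" using elim(3) by (rule ennreal_leI)
      finally show ?case .
    qed
  qed
  also have "\<dots> \<le> (\<integral>\<^sup>+t. ennreal (norm (h t)) \<partial>unit_leb)"
    by (intro nn_integral_mono ennreal_leI) simp
  also have "\<dots> < \<infinity>"
    using h unfolding integrable_iff_bounded by blast
  finally have fin: "(\<integral>\<^sup>+p. ennreal ((F p)\<^sup>2) \<partial>unit_sq) < \<infinity>" .
  have "integrable unit_sq (\<lambda>p. (F p)\<^sup>2)"
    by (rule integrableI_nonneg) (use fin in auto)
  then have "F \<in> sq_int unit_sq" by (rule sq_intI[OF F(1)])
  then obtain G where G: "G \<in> sqQ" "AE t in unit_leb. \<forall>x. G (t, x) = F (t, x)" using sq_int_regular by blast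
  have "AE t in unit_leb. AE x in unit_leb. G (t, x) = u t x"
    using G(2) F(2)
  proof eventually_elim
    case (elim t)
    from elim(2) show ?case by eventually_elim (use elim(1) in simp)
  qed
  with G(1) show ?thesis by (rule that)
qed

lemma Bochner_L2_joint:
  assumes u: "u \<in> Bochner_L2 L2 L2_norm"
  obtains G where "G \<in> sqQ" "AE t in unit_leb. AE x in unit_leb. G (t, x) = u t x"
proof -
  have 1: "strongly_measurable L2 L2_norm u" "AE t in unit_leb. u t \<in> L2" "integrable unit_leb (\<lambda>t. (L2_norm (u t))\<^sup>2)"
    using u by (auto simp: Bochner_L2_def)
  show ?thesis by (rule Bochner_joint[OF 1(1,2) _ 1(3)]) (simp, rule that)
qed

text \<open>Equality of functions, not only almost everywhere: both sides are the same choice, since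
  the two functions have the same set of weak derivatives.\<close>

lemma weak_deriv_cong:
  assumes "AE x in unit_leb. u x = u' x" "u \<in> borel_measurable unit_leb" "u' \<in> borel_measurable unit_leb"
  shows "weak_deriv u = weak_deriv u'"
  unfolding weak_deriv_def is_weak_deriv_cong_AE[OF assms] ..

lemma weak_deriv2_diff:
  assumes u: "u \<in> H2" and v: "v \<in> H2"
  shows "(\<lambda>x. u x - v x) \<in> H2" 
    "AE x in unit_leb. weak_deriv (weak_deriv (\<lambda>x. u x - v x)) x = weak_deriv (weak_deriv u) x - weak_deriv (weak_deriv v) x"
proof -
  have H: "u \<in> H1" "v \<in> H1" "weak_deriv u \<in> H1" "weak_deriv v \<in> H1" using u v by (auto simp: H2_def)
  note d1 = H1_diff[OF H(1,2)] and d2 = H1_diff[OF H(3,4)]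
  have eq: "weak_deriv (weak_deriv (\<lambda>x. u x - v x)) = weak_deriv (\<lambda>x. weak_deriv u x - weak_deriv v x)"
    by (rule weak_deriv_cong[OF d1(2)]) (intro sq_int_meas H1D d1 d2)+
  have m: "weak_deriv (\<lambda>x. u x - v x) \<in> borel_measurable unit_leb" by (intro sq_int_meas H1D d1)
  show "AE x in unit_leb. weak_deriv (weak_deriv (\<lambda>x. u x - v x)) x = weak_deriv (weak_deriv u) x - weak_deriv (weak_deriv v) x"
    unfolding eq by (rule d2(2))
  have "is_weak_deriv (weak_deriv (\<lambda>x. u x - v x)) (weak_deriv (\<lambda>x. weak_deriv u x - weak_deriv v x))"
    using is_weak_deriv_cong_AE[OF d1(2) m sq_int_meas[OF H1D(1)[OF d2(1)]]] H1D(3)[OF d2(1)] by simp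
  then have "weak_deriv (\<lambda>x. u x - v x) \<in> H1"
    unfolding H1_def L2_eq_sq_int using H1D(2)[OF d1(1)] H1D(2)[OF d2(1)] by blast
  then show "(\<lambda>x. u x - v x) \<in> H2" using d1(1) by (simp add: H2_def)
qed

lemma H2_norm_ge: "nrm unit_leb (weak_deriv (weak_deriv u)) \<le> H2_norm u"
  unfolding H2_norm_def L2_norm_eq_nrm by (rule real_le_rsqrt) simp

lemma G1_cong_AE:
  assumes "AE y in unit_leb. u y = w y" "u \<in> borel_measurable unit_leb" "w \<in> borel_measurable unit_leb"
  shows "G1 u = G1 w" "G0 u = G0 w"
proof -
  have "(LINT y|unit_leb. (1 - y) * u y) = (LINT y|unit_leb. (1 - y) * w y)"
  proof (rule integral_cong_AE)
    note [measurable] = assms(2,3)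
    show "(\<lambda>y. (1 - y) * u y) \<in> borel_measurable unit_leb" "(\<lambda>y. (1 - y) * w y) \<in> borel_measurable unit_leb" by measurable
    show "AE y in unit_leb. (1 - y) * u y = (1 - y) * w y" using assms(1) by eventually_elim simp
  qed
  then show 1: "G1 u = G1 w" using prim_cong_AE[OF assms] by (simp add: fun_eq_iff G1_def)
  then show "G0 u = G0 w" by (simp add: G0_def)
qed

text \<open>Only the second derivative is made jointly measurable, by differentiating the simple
  approximations, which does not increase the distance. The velocity and its first derivative are
  then recovered through \<open>V0\<close> and \<open>V1\<close>.\<close>

lemma Bochner_H2_joint:
  assumes v: "v \<in> Bochner_L2 (H2 \<inter> H10) H2_norm"
  obtains W where "W \<in> sqQ" "AE t in unit_leb. AE x in unit_leb. weak_deriv (weak_deriv (v t)) x = W (t, x)"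
    "AE t in unit_leb. AE x in unit_leb. weak_deriv (v t) x = V1 W (t, x)"
    "AE t in unit_leb. AE x in unit_leb. v t x = V0 W (t, x)"
    "AE t in unit_leb. v t \<in> H2 \<inter> H10"
proof -
  have vH: "AE t in unit_leb. v t \<in> H2 \<inter> H10" and sm: "strongly_measurable (H2 \<inter> H10) H2_norm v"
    and vi: "integrable unit_leb (\<lambda>t. (H2_norm (v t))\<^sup>2)" using v by (auto simp: Bochner_L2_def)
  obtain s where s: "\<And>n::nat. simple_function unit_leb (s n)" and sH: "\<And>n t. t \<in> {0<..<1} \<Longrightarrow> s n t \<in> H2 \<inter> H10"
    and conv: "AE t in unit_leb. (\<lambda>n. H2_norm (\<lambda>x. s n t x - v t x)) \<longlonglongrightarrow> 0"
    using sm unfolding strongly_measurable_def by blast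
  define u where "u t = weak_deriv (weak_deriv (v t))" for t
  have uL: "AE t in unit_leb. u t \<in> L2"
    using vH by eventually_elim (simp add: u_def L2_eq_sq_int H2_H10_rep(1))
  have "strongly_measurable L2 L2_norm u"
    unfolding strongly_measurable_def L2_norm_eq_nrm L2_eq_sq_int
  proof (intro exI[of _ "\<lambda>n t. weak_deriv (weak_deriv (s n t))"] conjI allI ballI)
    show "simple_function unit_leb (\<lambda>t. weak_deriv (weak_deriv (s n t)))" for n
      by (rule simple_function_compose1[OF s])
    show "weak_deriv (weak_deriv (s n t)) \<in> sq_int unit_leb" if "t \<in> {0<..<1}" for n t
      using H2_H10_rep(1) sH[OF that] by blast
    show "AE t in unit_leb. (\<lambda>n. nrm unit_leb (\<lambda>x. weak_deriv (weak_deriv (s n t)) x - u t x)) \<longlonglongrightarrow> 0"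
      using conv vH AE_space
    proof eventually_elim
      case (elim t)
      then have t: "t \<in> {0<..<1}" and vt: "v t \<in> H2" by simp_all
      have st: "s n t \<in> H2" for n using sH[OF t] by blast
      have "nrm unit_leb (\<lambda>x. weak_deriv (weak_deriv (s n t)) x - u t x) \<le> H2_norm (\<lambda>x. s n t x - v t x)" for n
      proof -
        note d = weak_deriv2_diff[OF st[of n] vt]
        have "nrm unit_leb (\<lambda>x. weak_deriv (weak_deriv (s n t)) x - u t x) = nrm unit_leb (weak_deriv (weak_deriv (\<lambda>x. s n t x - v t x)))"
          unfolding u_def
        proof (rule nrm_cong_AE)
          show "AE x in unit_leb. weak_deriv (weak_deriv (s n t)) x - weak_deriv (weak_deriv (v t)) x = weak_deriv (weak_deriv (\<lambda>x. s n t x - v t x)) x"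
            using d(2) by eventually_elim simp
          show "(\<lambda>x. weak_deriv (weak_deriv (s n t)) x - weak_deriv (weak_deriv (v t)) x) \<in> borel_measurable unit_leb"
            by (intro borel_measurable_diff sq_int_meas H1D) (use st vt in \<open>auto simp: H2_def\<close>)
          show "weak_deriv (weak_deriv (\<lambda>x. s n t x - v t x)) \<in> borel_measurable unit_leb"
            by (intro sq_int_meas H1D) (use d(1) in \<open>auto simp: H2_def\<close>)
        qed
        then show ?thesis using H2_norm_ge by simp
      qed
      then show ?case by (intro Lim_null_comparison[OF _ elim(1)]) simp
    qed
  qed
  moreover have "AE t in unit_leb. (L2_norm (u t))\<^sup>2 \<le> (H2_norm (v t))\<^sup>2"
    unfolding L2_norm_eq_nrm u_def by (intro AE_I2 power_mono H2_norm_ge) simp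
  ultimately obtain W where W: "W \<in> sqQ" "AE t in unit_leb. AE x in unit_leb. W (t, x) = u t x"
    using Bochner_joint[OF _ uL _ vi] by blast
  have all: "AE t in unit_leb. (AE x in unit_leb. weak_deriv (weak_deriv (v t)) x = W (t, x)) \<and> 
     (AE x in unit_leb. weak_deriv (v t) x = V1 W (t, x)) \<and> (AE x in unit_leb. v t x = V0 W (t, x))"
    using W(2) vH AE_space
  proof eventually_elim
    case (elim t)
    then have t: "t \<in> {0<..<1}" and vt: "v t \<in> H2" "v t \<in> H10" by simp_all
    note r = H2_H10_rep[OF vt]
    have eq: "AE x in unit_leb. weak_deriv (weak_deriv (v t)) x = W (t, x)"
      using elim(1) by eventually_elim (simp add: u_def)
    note c = G1_cong_AE[OF eq sq_int_meas[OF r(1)] sq_int_meas[OF sqQ_slice[OF W(1) t]]]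
    show ?case using eq r(2,3) unfolding c by (simp add: V1_def V0_def)
  qed
  show ?thesis
    by (rule that[OF W(1) _ _ _ vH]) (use all in \<open>eventually_elim, simp\<close>)+
qed

section \<open>Comparison of the two formulations\<close>

text \<open>The right-hand function \<open>h\<close> is given only slice by slice; agreement on
  almost all slices with an integrable function on the square suffices, thanks to completeness of
  the measure.\<close>

lemma iterated_cong:
  fixes H :: "real \<times> real \<Rightarrow> real"
  assumes H: "integrable unit_sq H" and AE: "AE t in unit_leb. AE x in unit_leb. H (t, x) = h t x"
  shows "(LINT t|unit_leb. LINT x|unit_leb. h t x) = (LINT p|unit_sq. H p)"
proof -
  have "(LINT p|unit_sq. H p) = (LINT t|unit_leb. LINT x|unit_leb. H (t, x))" by (rule integral_iterated[OF H])
  also have "\<dots> = (LINT t|unit_leb. LINT x|unit_leb. h t x)"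
  proof (rule unit_leb_integral_cong_AE[OF borel_measurable_integrable[OF UU.integrable_fst'[OF H]]])
    show "AE t in unit_leb. (LINT x|unit_leb. H (t, x)) = (LINT x|unit_leb. h t x)"
      using AE AE_space
    proof eventually_elim
      case (elim t)
      then have t: "t \<in> {0<..<1}" by simp
      show ?case by (rule unit_leb_integral_cong_AE[OF slice_meas[OF borel_measurable_integrable[OF H] t] elim(1)])
    qed
  qed
  finally show ?thesis by simp
qed

lemma weak_transport_iff_weakQ:
  assumes F: "F \<in> sqQ" and W: "W \<in> sqQ" and Z: "Z \<in> sqQ"
    and f: "AE t in unit_leb. AE x in unit_leb. F (t, x) = f t x"
    and v0: "AE t in unit_leb. AE x in unit_leb. v t x = V0 W (t, x)"
    and v1: "AE t in unit_leb. AE x in unit_leb. weak_deriv (v t) x = V1 W (t, x)"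
    and z: "AE t in unit_leb. AE x in unit_leb. Z (t, x) = z t x"
  shows "weak_transport f0 f1 f v z \<longleftrightarrow> weakQ f0 f1 F W Z"
proof -
  have "(- (LINT t|unit_leb. LINT x|unit_leb. f t x * deriv (\<lambda>s. \<phi> (x, s)) t)
        + (LINT x|unit_leb. f1 x * \<phi> (x, 1)) - (LINT x|unit_leb. f0 x * \<phi> (x, 0))
      = (LINT t|unit_leb. LINT x|unit_leb. f t x * \<phi> (x, t) * weak_deriv (v t) x)
        + (LINT t|unit_leb. LINT x|unit_leb. f t x * deriv (\<lambda>y. \<phi> (y, t)) x * v t x)
        + (LINT t|unit_leb. LINT x|unit_leb. \<phi> (x, t) * z t x)) \<longleftrightarrow>
     (- (LINT p|unit_sq. F p * dt \<phi> p) + (LINT x|unit_leb. f1 x * \<phi> (x, 1)) - (LINT x|unit_leb. f0 x * \<phi> (x, 0))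
     = (LINT p|unit_sq. F p * (sw \<phi> p * V1 W p + dx \<phi> p * V0 W p)) + (LINT p|unit_sq. sw \<phi> p * Z p))"
    if \<phi>: "\<phi> \<in> smooth_square" for \<phi>
  proof -
    note sQ = sqQ_sq_int[OF F] sqQ_sq_int[OF Z] sqQ_sq_int[OF smooth_square_sqQ(1)[OF \<phi>]] 
      sqQ_sq_int[OF smooth_square_sqQ(3)[OF \<phi>]] sqQ_sq_int[OF transport_terms_sqQ(1)[OF \<phi> W]] sqQ_sq_int[OF transport_terms_sqQ(2)[OF \<phi> W]]
    have 1: "(LINT t|unit_leb. LINT x|unit_leb. f t x * deriv (\<lambda>s. \<phi> (x, s)) t) = (LINT p|unit_sq. F p * dt \<phi> p)"
    proof (rule iterated_cong[OF sq_int_mult[OF sQ(1,4)]])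
      show "AE t in unit_leb. AE x in unit_leb. F (t, x) * dt \<phi> (t, x) = f t x * deriv (\<lambda>s. \<phi> (x, s)) t"
        using f
      proof eventually_elim
        case (elim t)
        then show ?case by eventually_elim (simp add: dt_def)
      qed
    qed
    have 2: "(LINT t|unit_leb. LINT x|unit_leb. f t x * \<phi> (x, t) * weak_deriv (v t) x) = (LINT p|unit_sq. F p * (sw \<phi> p * V1 W p))"
    proof (rule iterated_cong[OF sq_int_mult[OF sQ(1,5)]])
      show "AE t in unit_leb. AE x in unit_leb. F (t, x) * (sw \<phi> (t, x) * V1 W (t, x)) = f t x * \<phi> (x, t) * weak_deriv (v t) x"
        using f v1
      proof eventually_elim
        case (elim t)
        then show ?case by eventually_elim (simp add: sw_def)
      qed
    qed
    have 3: "(LINT t|unit_leb. LINT x|unit_leb. f t x * deriv (\<lambda>y. \<phi> (y, t)) x * v t x) = (LINT p|unit_sq. F p * (dx \<phi> p * V0 W p))"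
    proof (rule iterated_cong[OF sq_int_mult[OF sQ(1,6)]])
      show "AE t in unit_leb. AE x in unit_leb. F (t, x) * (dx \<phi> (t, x) * V0 W (t, x)) = f t x * deriv (\<lambda>y. \<phi> (y, t)) x * v t x"
        using f v0
      proof eventually_elim
        case (elim t)
        then show ?case by eventually_elim (simp add: dx_def)
      qed
    qed
    have 4: "(LINT t|unit_leb. LINT x|unit_leb. \<phi> (x, t) * z t x) = (LINT p|unit_sq. sw \<phi> p * Z p)"
    proof (rule iterated_cong[OF sq_int_mult[OF sQ(3,2)]])
      show "AE t in unit_leb. AE x in unit_leb. sw \<phi> (t, x) * Z (t, x) = \<phi> (x, t) * z t x"
        using z
      proof eventually_elim
        case (elim t)
        then show ?case by eventually_elim (simp add: sw_def)
      qed
    qed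
    have 5: "(LINT p|unit_sq. F p * (sw \<phi> p * V1 W p + dx \<phi> p * V0 W p)) = 
      (LINT p|unit_sq. F p * (sw \<phi> p * V1 W p)) + (LINT p|unit_sq. F p * (dx \<phi> p * V0 W p))"
      unfolding distrib_left by (rule Bochner_Integration.integral_add[OF sq_int_mult[OF sQ(1,5)] sq_int_mult[OF sQ(1,6)]])
    show ?thesis unfolding 1 2 3 4 5 ..
  qed
  then show ?thesis unfolding weak_transport_def weakQ_def by (rule ball_cong[OF refl])
qed

lemma action_eq_JQ:
  assumes W: "W \<in> sqQ" and Z: "Z \<in> sqQ"
    and v0: "AE t in unit_leb. AE x in unit_leb. v t x = V0 W (t, x)"
    and v1: "AE t in unit_leb. AE x in unit_leb. weak_deriv (v t) x = V1 W (t, x)"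
    and v2: "AE t in unit_leb. AE x in unit_leb. weak_deriv (weak_deriv (v t)) x = W (t, x)"
    and z: "AE t in unit_leb. AE x in unit_leb. Z (t, x) = z t x"
  shows "action \<kappa> \<mu> \<epsilon> f v z = JQ \<kappa> \<mu> \<epsilon> W Z"
proof -
  note i = sq_int_sq[OF sqQ_sq_int[OF V_sqQ(2)[OF W]]] sq_int_sq[OF sqQ_sq_int[OF V_sqQ(1)[OF W]]]
    sq_int_sq[OF sqQ_sq_int[OF W]] sq_int_sq[OF sqQ_sq_int[OF Z]]
  define H where "H p = \<kappa> * (V0 W p)\<^sup>2 + \<mu> * (V1 W p)\<^sup>2 + \<epsilon> * (W p)\<^sup>2 + (Z p)\<^sup>2" for p
  have Hi: "integrable unit_sq H" unfolding H_def using i by simp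
  have "(LINT t|unit_leb. LINT x|unit_leb. \<kappa> * (v t x)\<^sup>2 + \<mu> * (weak_deriv (v t) x)\<^sup>2
        + \<epsilon> * (weak_deriv (weak_deriv (v t)) x)\<^sup>2 + (z t x)\<^sup>2) = (LINT p|unit_sq. H p)"
  proof (rule iterated_cong[OF Hi])
    show "AE t in unit_leb. AE x in unit_leb. H (t, x) = \<kappa> * (v t x)\<^sup>2 + \<mu> * (weak_deriv (v t) x)\<^sup>2
        + \<epsilon> * (weak_deriv (weak_deriv (v t)) x)\<^sup>2 + (z t x)\<^sup>2"
      using v0 v1 v2 z
    proof eventually_elim
      case (elim t)
      then show ?case by eventually_elim (simp add: H_def)
    qed
  qed
  also have "\<dots> = \<kappa> * (nrm unit_sq (V0 W))\<^sup>2 + \<mu> * (nrm unit_sq (V1 W))\<^sup>2 + \<epsilon> * (nrm unit_sq W)\<^sup>2 + (nrm unit_sq Z)\<^sup>2"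
    unfolding H_def nrm_sq using i by simp
  finally show ?thesis by (simp add: action_def JQ_def)
qed

lemma admissible_to_sqQ:
  assumes "(f, v, z) \<in> admissible f0 f1"
  obtains F W Z where "F \<in> sqQ" "W \<in> sqQ" "Z \<in> sqQ" "weakQ f0 f1 F W Z" "action \<kappa> \<mu> \<epsilon> f v z = JQ \<kappa> \<mu> \<epsilon> W Z"
proof -
  have a: "f \<in> Bochner_L2 L2 L2_norm" "v \<in> Bochner_L2 (H2 \<inter> H10) H2_norm" "z \<in> Bochner_L2 L2 L2_norm" "weak_transport f0 f1 f v z"
    using assms by (auto simp: admissible_def)
  obtain F where F: "F \<in> sqQ" "AE t in unit_leb. AE x in unit_leb. F (t, x) = f t x"
    by (rule Bochner_L2_joint[OF a(1)]) (assumption | blast)+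
  obtain Z where Z: "Z \<in> sqQ" "AE t in unit_leb. AE x in unit_leb. Z (t, x) = z t x"
    by (rule Bochner_L2_joint[OF a(3)]) (assumption | blast)+
  obtain W where W: "W \<in> sqQ" "AE t in unit_leb. AE x in unit_leb. weak_deriv (weak_deriv (v t)) x = W (t, x)"
    "AE t in unit_leb. AE x in unit_leb. weak_deriv (v t) x = V1 W (t, x)"
    "AE t in unit_leb. AE x in unit_leb. v t x = V0 W (t, x)"
    by (rule Bochner_H2_joint[OF a(2)]) (assumption | blast)+
  have "weakQ f0 f1 F W Z" 
    using weak_transport_iff_weakQ[OF F(1) W(1) Z(1) F(2) W(4) W(3) Z(2)] a(4) by blast
  moreover have "action \<kappa> \<mu> \<epsilon> f v z = JQ \<kappa> \<mu> \<epsilon> W Z"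
    by (rule action_eq_JQ[OF W(1) Z(1) W(4,3,2) Z(2)])
  ultimately show ?thesis by (rule that[OF F(1) W(1) Z(1)])
qed

section \<open>Strong measurability from joint measurability\<close>

text \<open>Rational polynomials enumerated through the encoding of lists as naturals. Countability
  lets a best approximation be selected measurably in time and lets exceptional null sets be
  united.\<close>

definition rat_poly :: "nat \<Rightarrow> real poly" where
  "rat_poly j = (\<Sum>i<length (from_nat j :: rat list). monom (of_rat ((from_nat j :: rat list) ! i)) i)"

definition rat_poly_int :: "nat \<Rightarrow> real poly" where
  "rat_poly_int j = (\<Sum>i<length (from_nat j :: rat list). monom (of_rat ((from_nat j :: rat list) ! i) / real (Suc i)) (Suc i))"

lemma pderiv_rat_poly_int: "pderiv (rat_poly_int j) = rat_poly j"
proof -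
  have "pderiv (\<Sum>i\<in>I. g i) = (\<Sum>i\<in>I. pderiv (g i))" for I and g :: "nat \<Rightarrow> real poly"
    by (induction I rule: infinite_finite_induct) (auto simp: pderiv_add)
  then show ?thesis unfolding rat_poly_int_def rat_poly_def by (simp add: pderiv_monom del: of_nat_Suc)
qed

lemma poly_rat_poly_int_0: "poly (rat_poly_int j) 0 = 0"
  unfolding rat_poly_int_def poly_sum poly_monom by simp

lemma rat_poly_dense:
  assumes u: "u \<in> sq_int unit_leb" and e: "e > 0"
  obtains j where "nrm unit_leb (\<lambda>x. u x - poly (rat_poly j) x) < e"
proof -
  obtain p where p: "nrm unit_leb (\<lambda>x. u x - poly p x) < e / 2" using poly_dense[OF u, of "e/2"] e by auto
  define d where "d = degree p"
  \<comment> \<open>There are d + 1 coefficients and the powers of x are at most 1, so the errors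
    add up to e/2.\<close>
  define \<delta> where "\<delta> = e / (2 * real (Suc d))"
  have \<delta>: "\<delta> > 0" using e by (simp add: \<delta>_def)
  have "\<exists>q :: rat. \<bar>coeff p i - of_rat q\<bar> < \<delta>" for i
  proof -
    obtain q where "coeff p i - \<delta> < real_of_rat q" "real_of_rat q < coeff p i + \<delta>"
      using of_rat_dense[of "coeff p i - \<delta>" "coeff p i + \<delta>"] \<delta> by auto
    then show ?thesis by (intro exI[of _ q]) (auto simp: abs_less_iff)
  qed
  then obtain q :: "nat \<Rightarrow> rat" where q: "\<And>i. \<bar>coeff p i - of_rat (q i)\<bar> < \<delta>" by metis
  define l where "l = map q [0..<Suc d]"
  define j where "j = to_nat l"
  have fl: "(from_nat j :: rat list) = l" by (simp add: j_def)
  have r: "poly (rat_poly j) x = (\<Sum>i\<le>d. of_rat (q i) * x ^ i)" for x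
  proof -
    have "poly (rat_poly j) x = (\<Sum>i<length l. of_rat (l ! i) * x ^ i)"
      unfolding rat_poly_def fl poly_sum poly_monom ..
    also have "\<dots> = (\<Sum>i<Suc d. of_rat (q i) * x ^ i)"
      by (rule sum.cong) (simp_all add: l_def del: upt_Suc)
    finally show ?thesis by (simp add: lessThan_Suc_atMost)
  qed
  have "nrm unit_leb (\<lambda>x. poly p x - poly (rat_poly j) x) \<le> e / 2"
  proof (rule nrm_le_const)
    show "(\<lambda>x. poly p x - poly (rat_poly j) x) \<in> borel_measurable unit_leb"
      by (intro borel_measurable_diff sq_int_meas poly_sq_int)
    show "AE x in unit_leb. \<bar>poly p x - poly (rat_poly j) x\<bar> \<le> e / 2"
    proof (rule AE_I2)
      fix x assume "x \<in> space unit_leb"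
      then have x: "0 \<le> x" "x \<le> 1" by auto
      have "\<bar>poly p x - poly (rat_poly j) x\<bar> = \<bar>\<Sum>i\<le>d. (coeff p i - of_rat (q i)) * x ^ i\<bar>"
        unfolding r by (simp add: poly_altdef d_def sum_subtractf left_diff_distrib)
      also have "\<dots> \<le> (\<Sum>i\<le>d. \<bar>(coeff p i - of_rat (q i)) * x ^ i\<bar>)" by (rule sum_abs)
      also have "\<dots> \<le> (\<Sum>i\<le>d. \<delta>)"
      proof (rule sum_mono)
        fix i
        have "\<bar>coeff p i - of_rat (q i)\<bar> * \<bar>x ^ i\<bar> \<le> \<delta> * 1"
          using q[of i] x \<delta> by (intro mult_mono) (auto simp: power_abs intro: power_le_one)
        then show "\<bar>(coeff p i - of_rat (q i)) * x ^ i\<bar> \<le> \<delta>" by (simp add: abs_mult)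
      qed
      also have "\<dots> = e / 2" by (simp add: \<delta>_def field_simps)
      finally show "\<bar>poly p x - poly (rat_poly j) x\<bar> \<le> e / 2" .
    qed
  qed (use e in simp)
  then have "nrm unit_leb (\<lambda>x. u x - poly (rat_poly j) x) < e"
    using nrm_triangle_diff[OF u poly_sq_int[of p] poly_sq_int[of "rat_poly j"]] p by simp
  then show ?thesis by (rule that)
qed

text \<open>At each time the simple function takes the first best approximation among finitely many
  rational polynomials.\<close>

lemma sqQ_simple_approx:
  assumes F: "F \<in> sqQ"
  obtains s where "\<And>n::nat. simple_function unit_leb (s n)" "\<And>n t. s n t \<in> sq_int unit_leb"
    "\<And>t. t \<in> {0<..<1} \<Longrightarrow> (\<lambda>n. nrm unit_leb (\<lambda>x. s n t x - F (t, x))) \<longlonglongrightarrow> 0"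
proof -
  define e where "e j t = nrm unit_leb (\<lambda>x. poly (rat_poly j) x - F (t, x))" for j t
  have em [measurable]: "e j \<in> borel_measurable unit_leb" for j
    using nrm_slice_meas[OF sqQ_meas[OF sqQ_diff[OF sq_int_space[OF poly_sq_int[of "rat_poly j"]] F]]] by (simp add: e_def[abs_def])
  define P where "P n t j \<longleftrightarrow> j \<le> n \<and> (\<forall>i\<le>n. e j t \<le> e i t)" for n t and j :: nat
  \<comment> \<open>\<open>LEAST\<close> fixes one optimal index among 0..n; its range is finite and
    its level sets are given by comparisons of measurable functions.\<close>
  define k where "k n t = (LEAST j. P n t j)" for n t
  have ex: "\<exists>j. P n t j" for n t
  proof -
    have m: "Min ((\<lambda>i. e i t) ` {..n}) \<in> (\<lambda>i. e i t) ` {..n}" by (rule Min_in) auto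
    then obtain j where j: "j \<le> n" "Min ((\<lambda>i. e i t) ` {..n}) = e j t" by blast
    have "e j t \<le> e i t" if "i \<le> n" for i
      unfolding j(2)[symmetric] by (rule Min_le) (use that in auto)
    then show ?thesis using j(1) unfolding P_def by blast
  qed
  have kP: "P n t (k n t)" for n t unfolding k_def by (rule LeastI_ex[OF ex])
  have "Measurable.pred unit_leb (\<lambda>t. P n t j)" for n j unfolding P_def by measurable
  then have km: "k n \<in> measurable unit_leb (count_space UNIV)" for n unfolding k_def[abs_def] by measurable
  have ks: "simple_function unit_leb (k n)" for n
    unfolding simple_function_def
  proof (intro conjI ballI)
    have "k n ` space unit_leb \<subseteq> {..n}" using kP by (auto simp: P_def)
    then show "finite (k n ` space unit_leb)" by (rule finite_subset) simp
    show "k n -` {x} \<inter> space unit_leb \<in> sets unit_leb" for x by (rule measurable_sets[OF km]) simp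
  qed
  define s where "s n t = poly (rat_poly (k n t))" for n t
  show ?thesis
  proof (rule that[of s])
    show "simple_function unit_leb (s n)" for n unfolding s_def by (rule simple_function_compose1[OF ks])
    show "s n t \<in> sq_int unit_leb" for n t unfolding s_def by (rule poly_sq_int)
    fix t :: real assume t: "t \<in> {0<..<1}"
    show "(\<lambda>n. nrm unit_leb (\<lambda>x. s n t x - F (t, x))) \<longlonglongrightarrow> 0"
    proof (rule LIMSEQ_I)
      fix r :: real assume "r > 0"
      then obtain j where j: "nrm unit_leb (\<lambda>x. F (t, x) - poly (rat_poly j) x) < r"
        using rat_poly_dense[OF sqQ_slice[OF F t]] by blast
      have "nrm unit_leb (\<lambda>x. s n t x - F (t, x)) < r" if "n \<ge> j" for n
      proof -
        have "e (k n t) t \<le> e j t" using kP[of n t] that by (simp add: P_def)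
        also have "\<dots> < r" using j nrm_minus_commute[of unit_leb "poly (rat_poly j)" "\<lambda>x. F (t, x)"] by (simp add: e_def)
        finally show ?thesis by (simp add: e_def s_def)
      qed
      then show "\<exists>N. \<forall>n\<ge>N. norm (nrm unit_leb (\<lambda>x. s n t x - F (t, x)) - 0) < r" by auto
    qed
  qed
qed

lemma sqQ_Bochner_L2:
  assumes F: "F \<in> sqQ"
  shows "(\<lambda>t x. F (t, x)) \<in> Bochner_L2 L2 L2_norm"
proof -
  obtain s where s: "\<And>n::nat. simple_function unit_leb (s n)" "\<And>n t. s n t \<in> sq_int unit_leb"
    "\<And>t. t \<in> {0<..<1} \<Longrightarrow> (\<lambda>n. nrm unit_leb (\<lambda>x. s n t x - F (t, x))) \<longlonglongrightarrow> 0"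
    by (rule sqQ_simple_approx[OF F]) (assumption | blast)+
  have "AE t in unit_leb. (\<lambda>x. F (t, x)) \<in> L2" unfolding L2_eq_sq_int by (rule AE_I2) (simp add: sqQ_slice[OF F])
  moreover have "strongly_measurable L2 L2_norm (\<lambda>t x. F (t, x))"
    unfolding strongly_measurable_def L2_eq_sq_int L2_norm_eq_nrm
    using s by (intro exI[of _ s]) (auto intro!: AE_I2)
  moreover have "integrable unit_leb (\<lambda>t. (L2_norm (\<lambda>x. F (t, x)))\<^sup>2)"
    unfolding L2_norm_eq_nrm by (rule sq_int_sq[OF nrm_slice(1)[OF sqQ_sq_int[OF F]]])
  ultimately show ?thesis by (simp add: Bochner_L2_def)
qed

text \<open>\<open>G0\<close> maps simple approximations of the slices of \<open>W\<close> to simple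
  approximations of the velocity, by linearity and its boundedness from L^2 into
  \<open>H2_norm\<close>.\<close>

lemma sqQ_Bochner_H2:
  assumes W: "W \<in> sqQ"
  shows "(\<lambda>t. G0 (\<lambda>y. W (t, y))) \<in> Bochner_L2 (H2 \<inter> H10) H2_norm"
proof -
  obtain s where s: "\<And>n::nat. simple_function unit_leb (s n)" "\<And>n t. s n t \<in> sq_int unit_leb"
    "\<And>t. t \<in> {0<..<1} \<Longrightarrow> (\<lambda>n. nrm unit_leb (\<lambda>x. s n t x - W (t, x))) \<longlonglongrightarrow> 0"
    by (rule sqQ_simple_approx[OF W]) (assumption | blast)+
  have "AE t in unit_leb. G0 (\<lambda>y. W (t, y)) \<in> H2 \<inter> H10"
  proof (rule AE_I2)
    fix t assume "t \<in> space unit_leb"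
    then show "G0 (\<lambda>y. W (t, y)) \<in> H2 \<inter> H10" by (intro G0_H2_H10(1) sqQ_slice[OF W]) simp
  qed
  moreover have "strongly_measurable (H2 \<inter> H10) H2_norm (\<lambda>t. G0 (\<lambda>y. W (t, y)))"
    unfolding strongly_measurable_def
  proof (intro exI[of _ "\<lambda>n t. G0 (s n t)"] conjI allI ballI)
    show "simple_function unit_leb (\<lambda>t. G0 (s n t))" for n by (rule simple_function_compose1[OF s(1)])
    show "G0 (s n t) \<in> H2 \<inter> H10" for n t by (rule G0_H2_H10(1)[OF s(2)])
    show "AE t in unit_leb. (\<lambda>n. H2_norm (\<lambda>x. G0 (s n t) x - G0 (\<lambda>y. W (t, y)) x)) \<longlonglongrightarrow> 0"
    proof (rule AE_I2)
      fix t assume "t \<in> space unit_leb"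
      then have t: "t \<in> {0<..<1}" by simp
      have Ws: "(\<lambda>y. W (t, y)) \<in> sq_int unit_leb" by (rule sqQ_slice[OF W t])
      have eq: "(\<lambda>x. G0 (s n t) x - G0 (\<lambda>y. W (t, y)) x) = G0 (\<lambda>y. s n t y - W (t, y))" for n
        using G0_diff[OF U.sq_int_integrable[OF s(2)] U.sq_int_integrable[OF Ws]] by auto
      have le: "H2_norm (G0 (\<lambda>y. s n t y - W (t, y))) \<le> 5 * nrm unit_leb (\<lambda>y. s n t y - W (t, y))" for n
        by (rule H2_norm_G0(2)[OF sq_int_diff[OF s(2) Ws]])
      have "(\<lambda>n. 5 * nrm unit_leb (\<lambda>y. s n t y - W (t, y))) \<longlonglongrightarrow> 5 * 0" by (intro tendsto_intros s(3) t)
      then have l: "(\<lambda>n. 5 * nrm unit_leb (\<lambda>y. s n t y - W (t, y))) \<longlonglongrightarrow> 0" by simp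
      show "(\<lambda>n. H2_norm (\<lambda>x. G0 (s n t) x - G0 (\<lambda>y. W (t, y)) x)) \<longlonglongrightarrow> 0"
        unfolding eq by (rule Lim_null_comparison[OF _ l]) (use le in \<open>simp add: H2_norm_def\<close>)
    qed
  qed
  moreover have "integrable unit_leb (\<lambda>t. (H2_norm (G0 (\<lambda>y. W (t, y))))\<^sup>2)"
  proof -
    have "integrable unit_leb (\<lambda>t. (nrm unit_leb (\<lambda>x. V0 W (t, x)))\<^sup>2 + (nrm unit_leb (\<lambda>x. V1 W (t, x)))\<^sup>2 + (nrm unit_leb (\<lambda>x. W (t, x)))\<^sup>2)"
      by (intro Bochner_Integration.integrable_add sq_int_sq nrm_slice(1) sqQ_sq_int V_sqQ W)
    then show ?thesis
    proof (rule Bochner_Integration.integrable_cong[THEN iffD1, OF refl, rotated])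
      fix t assume "t \<in> space unit_leb"
      then have t: "t \<in> {0<..<1}" by simp
      have "(H2_norm (G0 (\<lambda>y. W (t, y))))\<^sup>2 = (nrm unit_leb (G0 (\<lambda>y. W (t, y))))\<^sup>2 + (nrm unit_leb (G1 (\<lambda>y. W (t, y))))\<^sup>2 + (nrm unit_leb (\<lambda>y. W (t, y)))\<^sup>2"
        unfolding H2_norm_G0(1)[OF sqQ_slice[OF W t]] by simp
      then show "(nrm unit_leb (\<lambda>x. V0 W (t, x)))\<^sup>2 + (nrm unit_leb (\<lambda>x. V1 W (t, x)))\<^sup>2 + (nrm unit_leb (\<lambda>x. W (t, x)))\<^sup>2 = (H2_norm (G0 (\<lambda>y. W (t, y))))\<^sup>2"
        by (simp add: V0_def V1_def)
    qed
  qed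
  ultimately show ?thesis by (simp add: Bochner_L2_def)
qed

section \<open>The continuous representative with values in the dual space\<close>

text \<open>The right-hand side of the equation paired with a function \<open>a\<close> of
  derivative \<open>b\<close>. Treating \<open>a\<close> and \<open>b\<close> as independent L^2
  functions makes the expression bilinear in data and pair, and Lipschitz in the pair.\<close>

definition rhs :: "(real \<times> real \<Rightarrow> real) \<Rightarrow> (real \<times> real \<Rightarrow> real) \<Rightarrow> (real \<times> real \<Rightarrow> real) \<Rightarrow>
    (real \<Rightarrow> real) \<Rightarrow> (real \<Rightarrow> real) \<Rightarrow> real \<Rightarrow> real" where
  "rhs f w z a b s = (LINT x|unit_leb. f (s, x) * (a x * V1 w (s, x) + b x * V0 w (s, x)) + a x * z (s, x))"

lemma evol_eq_rhs: "evol f w z p = rhs f w z (poly p) (poly (pderiv p))"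
  by (simp add: fun_eq_iff evol_def rhs_def)

text \<open>An integrable function of time bounding the norm of the right-hand side as a functional
  of the pair (a, b); its primitive controls continuity in time.\<close>

definition rhs_bound :: "(real \<times> real \<Rightarrow> real) \<Rightarrow> (real \<times> real \<Rightarrow> real) \<Rightarrow> (real \<times> real \<Rightarrow> real) \<Rightarrow> real \<Rightarrow> real" where
  "rhs_bound f w z s = 2 * (nrm unit_leb (\<lambda>x. f (s, x)) * nrm unit_leb (\<lambda>x. w (s, x))) + nrm unit_leb (\<lambda>x. z (s, x))"

context
  fixes f w z :: "real \<times> real \<Rightarrow> real"
  assumes f: "f \<in> sqQ" and w: "w \<in> sqQ" and z: "z \<in> sqQ"
begin

lemma rhs_bound_integrable: "integrable unit_leb (rhs_bound f w z)"
  unfolding rhs_bound_def[abs_def]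
  using sq_int_mult[OF nrm_slice(1)[OF sqQ_sq_int[OF f]] nrm_slice(1)[OF sqQ_sq_int[OF w]]]
    U.sq_int_integrable[OF nrm_slice(1)[OF sqQ_sq_int[OF z]]] by simp

lemma rhs_bound_nonneg: "0 \<le> rhs_bound f w z s"
  by (simp add: rhs_bound_def)

lemma V_slice_bounded:
  assumes s: "s \<in> {0<..<1}" and a: "a \<in> sq_int unit_leb"
  shows "(\<lambda>x. a x * V1 w (s, x)) \<in> sq_int unit_leb" "nrm unit_leb (\<lambda>x. a x * V1 w (s, x)) \<le> 2 * nrm unit_leb (\<lambda>x. w (s, x)) * nrm unit_leb a"
    "(\<lambda>x. a x * V0 w (s, x)) \<in> sq_int unit_leb" "nrm unit_leb (\<lambda>x. a x * V0 w (s, x)) \<le> 2 * nrm unit_leb (\<lambda>x. w (s, x)) * nrm unit_leb a"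
proof -
  have m: "(\<lambda>x. V1 w (s, x)) \<in> borel_measurable unit_leb" "(\<lambda>x. V0 w (s, x)) \<in> borel_measurable unit_leb"
    by (intro sq_int_meas sqQ_slice V_sqQ w s)+
  show "(\<lambda>x. a x * V1 w (s, x)) \<in> sq_int unit_leb"
    by (rule U.sq_int_mult_bounded[OF a m(1)]) (rule AE_I2, rule V_bound(1)[OF w s])
  show "(\<lambda>x. a x * V0 w (s, x)) \<in> sq_int unit_leb"
    by (rule U.sq_int_mult_bounded[OF a m(2)]) (rule AE_I2, rule V_bound(2)[OF w s])
  show "nrm unit_leb (\<lambda>x. a x * V1 w (s, x)) \<le> 2 * nrm unit_leb (\<lambda>x. w (s, x)) * nrm unit_leb a"
    by (rule nrm_mult_bounded[OF a m(1) V_bound(1)[OF w s]]) simp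
  show "nrm unit_leb (\<lambda>x. a x * V0 w (s, x)) \<le> 2 * nrm unit_leb (\<lambda>x. w (s, x)) * nrm unit_leb a"
    by (rule nrm_mult_bounded[OF a m(2) V_bound(2)[OF w s]]) simp
qed

lemma rhs_terms:
  assumes s: "s \<in> {0<..<1}" and a: "a \<in> sq_int unit_leb" and b: "b \<in> sq_int unit_leb"
  shows "integrable unit_leb (\<lambda>x. f (s, x) * (a x * V1 w (s, x) + b x * V0 w (s, x)))" "integrable unit_leb (\<lambda>x. a x * z (s, x))"
    "\<bar>rhs f w z a b s\<bar> \<le> rhs_bound f w z s * (nrm unit_leb a + nrm unit_leb b)"
proof -
  note V = V_slice_bounded[OF s a] V_slice_bounded[OF s b]
  have T: "(\<lambda>x. a x * V1 w (s, x) + b x * V0 w (s, x)) \<in> sq_int unit_leb" by (rule sq_int_add[OF V(1,7)])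
  note fs = sqQ_slice[OF f s] and zs = sqQ_slice[OF z s]
  show i1: "integrable unit_leb (\<lambda>x. f (s, x) * (a x * V1 w (s, x) + b x * V0 w (s, x)))" by (rule sq_int_mult[OF fs T])
  show i2: "integrable unit_leb (\<lambda>x. a x * z (s, x))" by (rule sq_int_mult[OF a zs])
  have T_le: "nrm unit_leb (\<lambda>x. a x * V1 w (s, x) + b x * V0 w (s, x)) \<le> 2 * nrm unit_leb (\<lambda>x. w (s, x)) * (nrm unit_leb a + nrm unit_leb b)"
    using nrm_triangle[OF V(1,7)] V(2,8) by (simp add: distrib_left)
  have "\<bar>rhs f w z a b s\<bar> \<le> \<bar>LINT x|unit_leb. f (s, x) * (a x * V1 w (s, x) + b x * V0 w (s, x))\<bar> + \<bar>LINT x|unit_leb. a x * z (s, x)\<bar>"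
    unfolding rhs_def Bochner_Integration.integral_add[OF i1 i2] by (rule abs_triangle_ineq)
  also have "\<dots> \<le> nrm unit_leb (\<lambda>x. f (s, x)) * (2 * nrm unit_leb (\<lambda>x. w (s, x)) * (nrm unit_leb a + nrm unit_leb b)) + nrm unit_leb a * nrm unit_leb (\<lambda>x. z (s, x))"
  proof (rule add_mono)
    have "\<bar>LINT x|unit_leb. f (s, x) * (a x * V1 w (s, x) + b x * V0 w (s, x))\<bar> \<le> 
        nrm unit_leb (\<lambda>x. f (s, x)) * nrm unit_leb (\<lambda>x. a x * V1 w (s, x) + b x * V0 w (s, x))" by (rule cauchy_schwarz[OF fs T])
    also have "\<dots> \<le> nrm unit_leb (\<lambda>x. f (s, x)) * (2 * nrm unit_leb (\<lambda>x. w (s, x)) * (nrm unit_leb a + nrm unit_leb b))"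
      by (rule mult_left_mono[OF T_le]) simp
    finally show "\<bar>LINT x|unit_leb. f (s, x) * (a x * V1 w (s, x) + b x * V0 w (s, x))\<bar> \<le> 
      nrm unit_leb (\<lambda>x. f (s, x)) * (2 * nrm unit_leb (\<lambda>x. w (s, x)) * (nrm unit_leb a + nrm unit_leb b))" .
  qed (rule cauchy_schwarz[OF a zs])
  also have "\<dots> \<le> rhs_bound f w z s * (nrm unit_leb a + nrm unit_leb b)"
    unfolding rhs_bound_def by (simp add: algebra_simps)
  finally show "\<bar>rhs f w z a b s\<bar> \<le> rhs_bound f w z s * (nrm unit_leb a + nrm unit_leb b)" .
qed

lemma rhs_lincomb:
  assumes s: "s \<in> {0<..<1}" and a: "a \<in> sq_int unit_leb" "b \<in> sq_int unit_leb" and a': "a' \<in> sq_int unit_leb" "b' \<in> sq_int unit_leb"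
  shows "rhs f w z (\<lambda>x. a x + c * a' x) (\<lambda>x. b x + c * b' x) s = rhs f w z a b s + c * rhs f w z a' b' s"
proof -
  note i = rhs_terms(1,2)[OF s a] rhs_terms(1,2)[OF s a']
  have "rhs f w z (\<lambda>x. a x + c * a' x) (\<lambda>x. b x + c * b' x) s = 
    (LINT x|unit_leb. (f (s, x) * (a x * V1 w (s, x) + b x * V0 w (s, x)) + a x * z (s, x)) + 
       c * (f (s, x) * (a' x * V1 w (s, x) + b' x * V0 w (s, x)) + a' x * z (s, x)))"
    unfolding rhs_def by (rule Bochner_Integration.integral_cong) (auto simp: algebra_simps)
  also have "\<dots> = rhs f w z a b s + c * rhs f w z a' b' s"
    unfolding rhs_def using Bochner_Integration.integrable_add[OF i(1,2)] Bochner_Integration.integrable_add[OF i(3,4)] by simp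
  finally show ?thesis .
qed

lemma rhs_lipschitz:
  assumes s: "s \<in> {0<..<1}" and a: "a \<in> sq_int unit_leb" "b \<in> sq_int unit_leb" and a': "a' \<in> sq_int unit_leb" "b' \<in> sq_int unit_leb"
  shows "\<bar>rhs f w z a b s - rhs f w z a' b' s\<bar> \<le> rhs_bound f w z s * (nrm unit_leb (\<lambda>x. a x - a' x) + nrm unit_leb (\<lambda>x. b x - b' x))"
  using rhs_lincomb[OF s a a', of "-1"] rhs_terms(3)[OF s sq_int_diff[OF a(1) a'(1)] sq_int_diff[OF a(2) a'(2)]] by simp

lemma rhs_integrable:
  assumes a: "a \<in> sq_int unit_leb" and b: "b \<in> sq_int unit_leb"
  shows "integrable unit_leb (rhs f w z a b)"
proof -
  \<comment> \<open>The function \<open>c\<close> may be unbounded, so the product is dominated by a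
    tensor: a square integrable function of time times one of position.\<close>
  have T: "(\<lambda>p. c (snd p) * V p) \<in> sq_int unit_sq"
    if c: "c \<in> sq_int unit_leb" and V: "V \<in> sqQ" "\<And>t x. t \<in> {0<..<1} \<Longrightarrow> \<bar>V (t, x)\<bar> \<le> 2 * nrm unit_leb (\<lambda>y. w (t, y))" for c V
  proof (rule sq_intI)
    note [measurable] = sqQ_meas[OF V(1)] sqQ_meas[OF sq_int_space[OF c]]
    show m: "(\<lambda>p. c (snd p) * V p) \<in> borel_measurable unit_sq" by measurable
    define n where "n t = 2 * nrm unit_leb (\<lambda>y. w (t, y))" for t
    have ns: "n \<in> sq_int unit_leb" unfolding n_def by (intro sq_int_scale nrm_slice(1) sqQ_sq_int w)
    have i: "integrable unit_sq (\<lambda>p. (n (fst p))\<^sup>2 * (c (snd p))\<^sup>2)"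
      using integrable_tensor[OF sq_int_sq[OF ns] sq_int_sq[OF c]] by (simp add: case_prod_unfold)
    show "integrable unit_sq (\<lambda>p. (c (snd p) * V p)\<^sup>2)"
    proof (rule Bochner_Integration.integrable_bound[OF i])
      show "AE p in unit_sq. norm ((c (snd p) * V p)\<^sup>2) \<le> norm ((n (fst p))\<^sup>2 * (c (snd p))\<^sup>2)"
      proof (rule AE_Q_I)
        fix t x :: real assume "t \<in> {0<..<1}"
        then have "\<bar>V (t, x)\<bar> \<le> n t" using V(2) by (simp add: n_def)
        then have "(V (t, x))\<^sup>2 \<le> (n t)\<^sup>2" by (simp add: abs_le_square_iff[symmetric])
        then have "(c x)\<^sup>2 * (V (t, x))\<^sup>2 \<le> (c x)\<^sup>2 * (n t)\<^sup>2" by (rule mult_left_mono) simp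
        then show "norm ((c (snd (t, x)) * V (t, x))\<^sup>2) \<le> norm ((n (fst (t, x)))\<^sup>2 * (c (snd (t, x)))\<^sup>2)"
          by (simp add: power_mult_distrib mult.commute)
      qed
    qed measurable
  qed
  have 1: "(\<lambda>p. a (snd p) * V1 w p) \<in> sq_int unit_sq" by (rule T[OF a V_sqQ(1)[OF w] V_bound(1)[OF w]])
  have 2: "(\<lambda>p. b (snd p) * V0 w p) \<in> sq_int unit_sq" by (rule T[OF b V_sqQ(2)[OF w] V_bound(2)[OF w]])
  have "integrable unit_sq (\<lambda>p. f p * (a (snd p) * V1 w p + b (snd p) * V0 w p) + a (snd p) * z p)"
    by (intro Bochner_Integration.integrable_add sq_int_mult sq_int_add 1 2 sqQ_sq_int f z sq_int_space a)
  from UU.integrable_fst'[OF this] show ?thesis by (simp add: rhs_def[abs_def])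
qed

lemma prim_rhs_lipschitz:
  assumes a: "a \<in> sq_int unit_leb" "b \<in> sq_int unit_leb" and a': "a' \<in> sq_int unit_leb" "b' \<in> sq_int unit_leb"
  shows "\<bar>prim (rhs f w z a b) t - prim (rhs f w z a' b') t\<bar> \<le> 
    (LINT s|unit_leb. rhs_bound f w z s) * (nrm unit_leb (\<lambda>x. a x - a' x) + nrm unit_leb (\<lambda>x. b x - b' x))"
proof -
  let ?N = "nrm unit_leb (\<lambda>x. a x - a' x) + nrm unit_leb (\<lambda>x. b x - b' x)"
  have i: "integrable unit_leb (\<lambda>s. rhs f w z a b s - rhs f w z a' b' s)"
    using rhs_integrable[OF a] rhs_integrable[OF a'] by simp
  have "prim (rhs f w z a b) t - prim (rhs f w z a' b') t = prim (\<lambda>s. rhs f w z a b s - rhs f w z a' b' s) t"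
    by (rule prim_diff[OF rhs_integrable[OF a] rhs_integrable[OF a'], symmetric])
  then have "\<bar>prim (rhs f w z a b) t - prim (rhs f w z a' b') t\<bar> \<le> (LINT s|unit_leb. \<bar>rhs f w z a b s - rhs f w z a' b' s\<bar>)"
    using prim_bound[OF i, of t] by (simp only:)
  also have "\<dots> \<le> (LINT s|unit_leb. rhs_bound f w z s * ?N)"
  proof (rule integral_mono)
    show "integrable unit_leb (\<lambda>s. \<bar>rhs f w z a b s - rhs f w z a' b' s\<bar>)" by (rule integrable_abs[OF i])
    show "integrable unit_leb (\<lambda>s. rhs_bound f w z s * ?N)" by (rule integrable_mult_left[OF rhs_bound_integrable])
    show "\<bar>rhs f w z a b s - rhs f w z a' b' s\<bar> \<le> rhs_bound f w z s * ?N" if "s \<in> space unit_leb" for s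
      by (rule rhs_lipschitz[OF _ a a']) (use that in simp)
  qed
  also have "\<dots> = (LINT s|unit_leb. rhs_bound f w z s) * ?N" by (rule integral_mult_left_zero)
  finally show ?thesis .
qed

text \<open>It suffices to verify the equation on the antiderivatives of countably many polynomials.\<close>

lemma H10_poly_extension:
  assumes l: "\<And>a b a' b'. a \<in> sq_int unit_leb \<Longrightarrow> b \<in> sq_int unit_leb \<Longrightarrow> a' \<in> sq_int unit_leb \<Longrightarrow> b' \<in> sq_int unit_leb \<Longrightarrow>
      \<bar>l a b - l a' b'\<bar> \<le> K * (nrm unit_leb (\<lambda>x. a x - a' x) + nrm unit_leb (\<lambda>x. b x - b' x))"
    and K: "K \<ge> 0" and z: "\<And>j. l (poly (rat_poly_int j)) (poly (rat_poly j)) = 0" and u: "u \<in> H10"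
  shows "l u (weak_deriv u) = (0::real)"
proof -
  have u1: "u \<in> H1" using u by (simp add: H10_def)
  note us = H1D(1)[OF u1] and ps = H1D(2)[OF u1]
  obtain q where q: "q \<in> sq_int unit_leb" "AE x in unit_leb. u x = prim q x" using u unfolding H10_iff by blast
  have "AE x in unit_leb. weak_deriv u x = q x"
    using H1_primI(2)[OF sq_int_meas[OF us] q(1), of 0] q(2) by simp
  then have up: "AE x in unit_leb. u x = prim (weak_deriv u) x"
    using q(2) prim_cong_AE[OF _ sq_int_meas[OF ps] sq_int_meas[OF q(1)]] by simp
  have "\<bar>l u (weak_deriv u)\<bar> \<le> K * (2 * e)" if e: "e > 0" for e
  proof -
    \<comment> \<open>Approximating the derivative suffices: \<open>u\<close> and
      \<open>rat_poly_int j\<close> both vanish at 0, so integration carries the error over to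
      \<open>u\<close>.\<close>
    obtain j where j: "nrm unit_leb (\<lambda>x. weak_deriv u x - poly (rat_poly j) x) < e" by (rule rat_poly_dense[OF ps e])
    have i: "integrable unit_leb (weak_deriv u)" "integrable unit_leb (poly (rat_poly j))"
      by (intro U.sq_int_integrable ps poly_sq_int)+
    have P: "prim (poly (rat_poly j)) x = poly (rat_poly_int j) x" if "x \<in> {0..1}" for x
    proof -
      have "prim (poly (rat_poly j)) x = poly (rat_poly_int j) x - poly (rat_poly_int j) 0"
      proof (rule prim_FTC[OF _ _ that])
        show "(poly (rat_poly_int j) has_real_derivative poly (rat_poly j) x) (at x within {0..1})" for x
          using has_field_derivative_at_within[OF poly_DERIV[of "rat_poly_int j" x]] by (simp add: pderiv_rat_poly_int)
      qed (intro continuous_intros)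
      then show ?thesis by (simp add: poly_rat_poly_int_0)
    qed
    have "nrm unit_leb (\<lambda>x. u x - poly (rat_poly_int j) x) \<le> e"
    proof (rule nrm_le_const)
      show "(\<lambda>x. u x - poly (rat_poly_int j) x) \<in> borel_measurable unit_leb"
        by (intro borel_measurable_diff sq_int_meas us poly_sq_int)
      show "AE x in unit_leb. \<bar>u x - poly (rat_poly_int j) x\<bar> \<le> e"
        using up AE_space
      proof eventually_elim
        case (elim x)
        then have "u x - poly (rat_poly_int j) x = prim (\<lambda>x. weak_deriv u x - poly (rat_poly j) x) x"
          unfolding prim_diff[OF i] using P[of x] by simp
        then show ?case using prim_nrm_bound[OF sq_int_diff[OF ps poly_sq_int], of "rat_poly j" x] j by simp
      qed
    qed (use e in simp)
    then have "nrm unit_leb (\<lambda>x. u x - poly (rat_poly_int j) x) + nrm unit_leb (\<lambda>x. weak_deriv u x - poly (rat_poly j) x) \<le> 2 * e"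
      using j by simp
    then have "K * (nrm unit_leb (\<lambda>x. u x - poly (rat_poly_int j) x) + nrm unit_leb (\<lambda>x. weak_deriv u x - poly (rat_poly j) x)) \<le> K * (2 * e)"
      using K by (rule mult_left_mono)
    with l[OF us ps poly_sq_int[of "rat_poly_int j"] poly_sq_int[of "rat_poly j"]] z show ?thesis by simp
  qed
  note bd = this
  show ?thesis
  proof (rule ccontr)
    assume n: "l u (weak_deriv u) \<noteq> 0"
    \<comment> \<open>With this error the bound K(2e) is at most half of the quantity it should
      dominate.\<close>
    define e where "e = \<bar>l u (weak_deriv u)\<bar> / (4 * (K + 1))"
    have "e > 0" using n K by (simp add: e_def)
    from bd[OF this] have "\<bar>l u (weak_deriv u)\<bar> \<le> K * (2 * e)" .
    also have "\<dots> \<le> (K + 1) * (2 * e)" using \<open>e > 0\<close> by (intro mult_right_mono) auto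
    also have "\<dots> = \<bar>l u (weak_deriv u)\<bar> / 2" using K by (simp add: e_def field_simps)
    finally show False using n by simp
  qed
qed

text \<open>The representative is defined by integrating the equation in time from
  \<open>f0\<close>. Its increments are controlled in the dual norm by increments of the primitive
  of \<open>rhs_bound\<close>, hence continuity; its values are identified with \<open>f\<close> and
  \<open>f1\<close> on rational polynomials and then on all of \<open>H10\<close>.\<close>

lemma weakQ_continuous_representative:
  assumes f0: "f0 \<in> sq_int unit_leb" and f1: "f1 \<in> sq_int unit_leb" and wk: "weakQ f0 f1 f w z"
  shows "\<exists>F\<in>C_Hm1. (AE t in unit_leb. represents (F t) (\<lambda>x. f (t, x))) \<and> represents (F 0) f0 \<and> represents (F 1) f1"
proof -
  define F where "F t u = (LINT x|unit_leb. f0 x * u x) + prim (rhs f w z u (weak_deriv u)) t" for t u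
  define G where "G = (LINT s|unit_leb. rhs_bound f w z s)"
  have G0: "G \<ge> 0" unfolding G_def by (rule integral_nonneg_AE) (simp add: rhs_bound_nonneg)
  have H10_1: "u \<in> H1" if "u \<in> H10" for u using that by (simp add: H10_def)
  have N_le: "nrm unit_leb u + nrm unit_leb (weak_deriv u) \<le> 2 * H1_norm u" for u
    using H1_norm_ge[of u] by simp
  \<comment> \<open>\<open>weak_deriv\<close> of a sum is a chosen representative, equal to the sum
    of the derivatives only almost everywhere; the Lipschitz bound shows that such changes do not
    matter.\<close>
  have rcong: "prim (rhs f w z a b) t = prim (rhs f w z a' b') t"
    if "a \<in> sq_int unit_leb" "b \<in> sq_int unit_leb" "a' \<in> sq_int unit_leb" "b' \<in> sq_int unit_leb" 
      "AE x in unit_leb. a x = a' x" "AE x in unit_leb. b x = b' x" for a b a' b' t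
  proof -
    have "nrm unit_leb (\<lambda>x. a x - a' x) = nrm unit_leb (\<lambda>x. 0)"
      by (rule nrm_cong_AE) (use that in \<open>auto intro!: sq_int_meas sq_int_diff\<close>)
    moreover have "nrm unit_leb (\<lambda>x. b x - b' x) = nrm unit_leb (\<lambda>x. 0)"
      by (rule nrm_cong_AE) (use that in \<open>auto intro!: sq_int_meas sq_int_diff\<close>)
    moreover have "nrm unit_leb (\<lambda>x::real. 0) = 0" by (simp add: nrm_def)
    ultimately show ?thesis using prim_rhs_lipschitz[OF that(1-4), of t] by simp
  qed
  have lin: "F t (\<lambda>x. u x + c * v x) = F t u + c * F t v" if u: "u \<in> H10" and v: "v \<in> H10" for t u v c
  proof -
    note us = H1D[OF H10_1[OF u]] and vs = H1D[OF H10_1[OF v]] and lc = H1_lincomb[OF H10_1[OF u] H10_1[OF v], of c]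
    have "prim (rhs f w z (\<lambda>x. u x + c * v x) (weak_deriv (\<lambda>x. u x + c * v x))) t = 
        prim (rhs f w z (\<lambda>x. u x + c * v x) (\<lambda>x. weak_deriv u x + c * weak_deriv v x)) t"
      by (rule rcong) (intro H1D lc sq_int_add sq_int_scale us vs AE_I2 refl)+
    also have "\<dots> = prim (\<lambda>s. rhs f w z u (weak_deriv u) s + c * rhs f w z v (weak_deriv v) s) t"
      by (rule prim_cong) (rule rhs_lincomb[OF _ us(1,2) vs(1,2)])
    also have "\<dots> = prim (rhs f w z u (weak_deriv u)) t + c * prim (rhs f w z v (weak_deriv v)) t"
      using prim_add[OF rhs_integrable[OF us(1,2)], of "\<lambda>s. c * rhs f w z v (weak_deriv v) s" t] rhs_integrable[OF vs(1,2)]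
      by (simp add: prim_cmult)
    finally show ?thesis unfolding F_def
      using sq_int_mult[OF f0 us(1)] sq_int_mult[OF f0 vs(1)] by (simp add: algebra_simps)
  qed
  have z10: "(\<lambda>x. 0) \<in> H10" unfolding H10_iff 
    by (intro conjI bexI[of _ "\<lambda>x. 0"]) (simp_all add: sq_int_zero prim_def)
  have F0: "F t (\<lambda>x. 0) = 0" for t using lin[OF z10 z10, of t 1] by simp
  have inc: "\<bar>F t u - F s u\<bar> \<le> \<bar>prim (rhs_bound f w z) t - prim (rhs_bound f w z) s\<bar> * (2 * H1_norm u)" if u: "u \<in> H10" for t s u
  proof -
    have *: "\<bar>F t u - F s u\<bar> \<le> \<bar>prim (rhs_bound f w z) t - prim (rhs_bound f w z) s\<bar> * (2 * H1_norm u)" if st: "s \<le> t" for s t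
    proof -
      note us = H1D[OF H10_1[OF u]]
      let ?N = "nrm unit_leb u + nrm unit_leb (weak_deriv u)"
      have "\<bar>prim (rhs f w z u (weak_deriv u)) t - prim (rhs f w z u (weak_deriv u)) s\<bar> \<le> 
         prim (\<lambda>r. ?N * rhs_bound f w z r) t - prim (\<lambda>r. ?N * rhs_bound f w z r) s"
      proof (rule prim_increment_le[OF rhs_integrable[OF us(1,2)] _ st])
        show "integrable unit_leb (\<lambda>r. ?N * rhs_bound f w z r)" by (rule integrable_mult_right[OF rhs_bound_integrable])
        show "AE r in unit_leb. s \<le> r \<longrightarrow> r < t \<longrightarrow> \<bar>rhs f w z u (weak_deriv u) r\<bar> \<le> ?N * rhs_bound f w z r"
          using rhs_terms(3)[OF _ us(1,2)] by (intro AE_I2) (simp add: mult.commute)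
      qed
      also have "\<dots> = ?N * (prim (rhs_bound f w z) t - prim (rhs_bound f w z) s)"
        unfolding prim_cmult by (simp add: right_diff_distrib)
      also have "\<dots> \<le> (2 * H1_norm u) * \<bar>prim (rhs_bound f w z) t - prim (rhs_bound f w z) s\<bar>"
      proof (rule mult_mono[OF N_le abs_ge_self])
        have "0 \<le> nrm unit_leb u + nrm unit_leb (weak_deriv u)" by simp
        then show "0 \<le> 2 * H1_norm u" using N_le[of u] by linarith
        show "0 \<le> prim (rhs_bound f w z) t - prim (rhs_bound f w z) s"
          using prim_mono_nonneg[OF rhs_bound_integrable rhs_bound_nonneg st] by simp
      qed
      finally show ?thesis by (simp add: F_def mult.commute)
    qed
    show ?thesis
    proof (cases "s \<le> t")
      case True then show ?thesis by (rule *)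
    next
      case False
      then have "\<bar>F s u - F t u\<bar> \<le> \<bar>prim (rhs_bound f w z) s - prim (rhs_bound f w z) t\<bar> * (2 * H1_norm u)" by (intro *) simp
      then show ?thesis by (simp add: abs_minus_commute)
    qed
  qed
  have Hm1: "F t \<in> Hm1" for t
  proof -
    have "\<bar>F t u\<bar> \<le> (nrm unit_leb f0 + 2 * G) * H1_norm u" if u: "u \<in> H10" for u
    proof -
      note us = H1D[OF H10_1[OF u]]
      have zw: "weak_deriv (\<lambda>_. 0) \<in> sq_int unit_leb" by (rule H1D(2)[OF H10_1[OF z10]])
      have "\<bar>LINT x|unit_leb. f0 x * u x\<bar> \<le> nrm unit_leb f0 * H1_norm u"
        using cauchy_schwarz[OF f0 us(1)] mult_left_mono[OF H1_norm_ge(1)[of u], of "nrm unit_leb f0"] by simp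
      moreover have "\<bar>prim (rhs f w z u (weak_deriv u)) t\<bar> \<le> G * (2 * H1_norm u)"
      proof -
        have "prim (rhs f w z (\<lambda>x. 0) (\<lambda>x. 0)) t = 0" by (simp add: rhs_def[abs_def] prim_def)
        then have "\<bar>prim (rhs f w z u (weak_deriv u)) t\<bar> \<le> G * (nrm unit_leb u + nrm unit_leb (weak_deriv u))"
          using prim_rhs_lipschitz[OF us(1,2) sq_int_zero sq_int_zero, of t] by (simp add: G_def)
        also have "\<dots> \<le> G * (2 * H1_norm u)" by (rule mult_left_mono[OF N_le G0])
        finally show ?thesis .
      qed
      ultimately show ?thesis unfolding F_def by (simp add: algebra_simps abs_if split: if_splits)
    qed
    moreover have "F t (\<lambda>x. u x + v x) = F t u + F t v" if "u \<in> H10" "v \<in> H10" for u v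
      using lin[OF that, of t 1] by simp
    moreover have "F t (\<lambda>x. c * u x) = c * F t u" if "u \<in> H10" for c u
      using lin[OF z10 that, of t c] F0 by simp
    ultimately show ?thesis unfolding Hm1_def by blast
  qed
  have cont: "((\<lambda>t. Hm1_norm (\<lambda>u. F t u - F s u)) \<longlongrightarrow> 0) (at s within {0..1})" for s
  proof -
    have c: "((\<lambda>t. \<bar>prim (rhs_bound f w z) t - prim (rhs_bound f w z) s\<bar> * 2) \<longlongrightarrow> \<bar>prim (rhs_bound f w z) s - prim (rhs_bound f w z) s\<bar> * 2) (at s within {0..1})"
      using prim_continuous[OF rhs_bound_integrable, of UNIV]
      by (intro tendsto_intros) (simp add: continuous_on_eq_continuous_at isCont_def tendsto_within_subset[of _ _ _ UNIV])
    have b: "\<bar>F t u - F s u\<bar> \<le> \<bar>prim (rhs_bound f w z) t - prim (rhs_bound f w z) s\<bar> * 2" if "u \<in> H10" "H1_norm u \<le> 1" for t u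
    proof -
      have "\<bar>prim (rhs_bound f w z) t - prim (rhs_bound f w z) s\<bar> * (2 * H1_norm u) \<le> \<bar>prim (rhs_bound f w z) t - prim (rhs_bound f w z) s\<bar> * (2 * 1)"
        using that(2) by (intro mult_left_mono) auto
      with inc[OF that(1), of t s] show ?thesis by linarith
    qed
    have zn: "(\<lambda>x. 0) \<in> {u \<in> H10. H1_norm u \<le> 1}"
    proof -
      have "AE x in unit_leb. weak_deriv (\<lambda>_. 0) x = (0::real)"
        by (rule H1_primI(2)[OF _ sq_int_zero, of _ 0]) (simp_all add: prim_def)
      then have "nrm unit_leb (weak_deriv (\<lambda>_. 0)) = nrm unit_leb (\<lambda>x. 0)"
        by (rule nrm_cong_AE) (auto intro!: sq_int_meas H1D H10_1 z10)
      then show ?thesis using z10 by (simp add: H1_norm_def L2_norm_eq_nrm nrm_def)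
    qed
    have le: "Hm1_norm (\<lambda>u. F t u - F s u) \<le> \<bar>prim (rhs_bound f w z) t - prim (rhs_bound f w z) s\<bar> * 2" for t
      unfolding Hm1_norm_def by (rule cSUP_least) (use zn b in auto)
    have ge: "0 \<le> Hm1_norm (\<lambda>u. F t u - F s u)" for t
    proof -
      have "bdd_above ((\<lambda>u. \<bar>F t u - F s u\<bar>) ` {u \<in> H10. H1_norm u \<le> 1})"
        using b by (intro bdd_aboveI2) auto
      from cSUP_upper[OF zn this] show ?thesis unfolding Hm1_norm_def by (simp add: F0)
    qed
    show ?thesis
      by (rule Lim_null_comparison[where g="\<lambda>t. \<bar>prim (rhs_bound f w z) t - prim (rhs_bound f w z) s\<bar> * 2"])
        (use le ge c in auto)
  qed
  have "F \<in> C_Hm1" unfolding C_Hm1_def using Hm1 cont by blast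
  moreover have "represents (F 0) f0" unfolding represents_def by (simp add: F_def prim_0)
  moreover have rep: "represents (F t) g"
    if g: "g \<in> sq_int unit_leb" and e: "\<And>j. (LINT x|unit_leb. g x * poly (rat_poly_int j) x) = (LINT x|unit_leb. f0 x * poly (rat_poly_int j) x) + prim (evol f w z (rat_poly_int j)) t" for t g
    unfolding represents_def
  proof
    fix u assume u: "u \<in> H10"
    define l where "l a b = (LINT x|unit_leb. (f0 x - g x) * a x) + prim (rhs f w z a b) t" for a b
    have fg: "(\<lambda>x. f0 x - g x) \<in> sq_int unit_leb" by (rule sq_int_diff[OF f0 g])
    have "l u (weak_deriv u) = 0"
    proof (rule H10_poly_extension[where K="nrm unit_leb (\<lambda>x. f0 x - g x) + G", OF _ _ _ u])
      fix a b a' b' :: "real \<Rightarrow> real" 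
      assume s: "a \<in> sq_int unit_leb" "b \<in> sq_int unit_leb" "a' \<in> sq_int unit_leb" "b' \<in> sq_int unit_leb"
      have "(LINT x|unit_leb. (f0 x - g x) * a x) - (LINT x|unit_leb. (f0 x - g x) * a' x) = (LINT x|unit_leb. (f0 x - g x) * (a x - a' x))"
        using sq_int_mult[OF fg s(1)] sq_int_mult[OF fg s(3)] by (simp add: right_diff_distrib)
      then have 1: "\<bar>(LINT x|unit_leb. (f0 x - g x) * a x) - (LINT x|unit_leb. (f0 x - g x) * a' x)\<bar> \<le> nrm unit_leb (\<lambda>x. f0 x - g x) * nrm unit_leb (\<lambda>x. a x - a' x)"
        using cauchy_schwarz[OF fg sq_int_diff[OF s(1,3)]] by simp
      have 2: "nrm unit_leb (\<lambda>x. f0 x - g x) * nrm unit_leb (\<lambda>x. a x - a' x) \<le> 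
        nrm unit_leb (\<lambda>x. f0 x - g x) * (nrm unit_leb (\<lambda>x. a x - a' x) + nrm unit_leb (\<lambda>x. b x - b' x))"
        by (rule mult_left_mono) auto
      show "\<bar>l a b - l a' b'\<bar> \<le> (nrm unit_leb (\<lambda>x. f0 x - g x) + G) * (nrm unit_leb (\<lambda>x. a x - a' x) + nrm unit_leb (\<lambda>x. b x - b' x))"
        using 1 2 prim_rhs_lipschitz[OF s, of t] unfolding l_def G_def distrib_right by linarith
    next
      show "0 \<le> nrm unit_leb (\<lambda>x. f0 x - g x) + G" using G0 by simp
      show "l (poly (rat_poly_int j)) (poly (rat_poly j)) = 0" for j
        using e[of j] sq_int_mult[OF f0 poly_sq_int] sq_int_mult[OF g poly_sq_int] 
        by (simp add: l_def evol_eq_rhs pderiv_rat_poly_int left_diff_distrib)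
    qed
    then show "F t u = (LINT x|unit_leb. g x * u x)"
      using sq_int_mult[OF f0 H1D(1)[OF H10_1[OF u]]] sq_int_mult[OF g H1D(1)[OF H10_1[OF u]]] 
      by (simp add: l_def F_def left_diff_distrib)
  qed
  moreover have "represents (F 1) f1"
    by (rule rep[OF f1]) (simp add: moment_evolution(1)[OF wk f w z] prim_1)
  moreover have "AE t in unit_leb. represents (F t) (\<lambda>x. f (t, x))"
  proof -
    \<comment> \<open>The almost everywhere identity of moments is collected over the countable
      family into one null set of times.\<close>
    have "AE t in unit_leb. \<forall>j. (LINT x|unit_leb. f (t, x) * poly (rat_poly_int j) x) = (LINT x|unit_leb. f0 x * poly (rat_poly_int j) x) + prim (evol f w z (rat_poly_int j)) t"
      unfolding AE_all_countable using moment_evolution(2)[OF wk f w z] by blast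
    then show ?thesis using AE_space
    proof eventually_elim
      case (elim t)
      then show ?case by (intro rep sqQ_slice[OF f]) auto
    qed
  qed
  ultimately show ?thesis by blast
qed

end

lemma sqQ_to_admissible:
  assumes f: "f \<in> sqQ" and w: "w \<in> sqQ" and z: "z \<in> sqQ" and f0: "f0 \<in> sq_int unit_leb" and f1: "f1 \<in> sq_int unit_leb"
    and wk: "weakQ f0 f1 f w z"
  shows "(\<lambda>t x. f (t, x), \<lambda>t. G0 (\<lambda>y. w (t, y)), \<lambda>t x. z (t, x)) \<in> admissible f0 f1"
    "action \<kappa> \<mu> \<epsilon> (\<lambda>t x. f (t, x)) (\<lambda>t. G0 (\<lambda>y. w (t, y))) (\<lambda>t x. z (t, x)) = JQ \<kappa> \<mu> \<epsilon> w z"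
proof -
  have v0: "AE t in unit_leb. AE x in unit_leb. G0 (\<lambda>y. w (t, y)) x = V0 w (t, x)" by (simp add: V0_def)
  have v1: "AE t in unit_leb. AE x in unit_leb. weak_deriv (G0 (\<lambda>y. w (t, y))) x = V1 w (t, x)"
  proof (rule AE_I2)
    fix t assume "t \<in> space unit_leb"
    then show "AE x in unit_leb. weak_deriv (G0 (\<lambda>y. w (t, y))) x = V1 w (t, x)"
      using G0_H2_H10(2)[OF sqQ_slice[OF w, of t]] by (simp add: V1_def)
  qed
  have v2: "AE t in unit_leb. AE x in unit_leb. weak_deriv (weak_deriv (G0 (\<lambda>y. w (t, y)))) x = w (t, x)"
  proof (rule AE_I2)
    fix t assume "t \<in> space unit_leb"
    then show "AE x in unit_leb. weak_deriv (weak_deriv (G0 (\<lambda>y. w (t, y)))) x = w (t, x)"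
      using G0_H2_H10(3)[OF sqQ_slice[OF w, of t]] by simp
  qed
  have "weak_transport f0 f1 (\<lambda>t x. f (t, x)) (\<lambda>t. G0 (\<lambda>y. w (t, y))) (\<lambda>t x. z (t, x))"
    using weak_transport_iff_weakQ[OF f w z _ v0 v1] wk by simp
  then show "(\<lambda>t x. f (t, x), \<lambda>t. G0 (\<lambda>y. w (t, y)), \<lambda>t x. z (t, x)) \<in> admissible f0 f1"
    unfolding admissible_def using sqQ_Bochner_L2[OF f] sqQ_Bochner_L2[OF z] sqQ_Bochner_H2[OF w]
      weakQ_continuous_representative[OF f w z f0 f1 wk] by blast
  show "action \<kappa> \<mu> \<epsilon> (\<lambda>t x. f (t, x)) (\<lambda>t. G0 (\<lambda>y. w (t, y))) (\<lambda>t x. z (t, x)) = JQ \<kappa> \<mu> \<epsilon> w z"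
    by (rule action_eq_JQ[OF w z v0 v1 v2]) simp
qed

text \<open>With zero velocity the equation reads f_t = z, so linear interpolation with source f1 -
  f0 solves it. The class over which the infimum is taken is therefore nonempty for all end
  states.\<close>

lemma linear_interpolation_weakQ:
  assumes f0: "f0 \<in> sq_int unit_leb" and f1: "f1 \<in> sq_int unit_leb"
  defines "g \<equiv> \<lambda>p. f0 (snd p) + fst p * (f1 (snd p) - f0 (snd p))" and "y \<equiv> \<lambda>p. f1 (snd p) - f0 (snd p)"
  shows "g \<in> sqQ" "y \<in> sqQ" "(\<lambda>p. 0) \<in> sqQ" "weakQ f0 f1 g (\<lambda>p. 0) y"
proof -
  show y: "y \<in> sqQ" unfolding y_def by (rule sq_int_space[OF sq_int_diff[OF f1 f0]])
  have "(\<lambda>p. y p * fst p) \<in> sqQ" by (rule sqQ_mult_bounded[where C=1, OF y meas_fst]) simp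
  from sqQ_add[OF sq_int_space[OF f0] this] show g: "g \<in> sqQ" by (simp add: g_def y_def mult.commute)
  show z: "(\<lambda>p. 0) \<in> sqQ" by (simp add: sqQ_def sq_int_zero)
  have G1: "G1 (\<lambda>y. 0) x = 0" for x by (simp add: G1_def prim_def)
  have V: "V1 (\<lambda>p. 0) p = 0" "V0 (\<lambda>p. 0) p = 0" for p
    by (simp_all add: V1_def V0_def G0_def G1[abs_def] prim_def)
  show "weakQ f0 f1 g (\<lambda>p. 0) y"
    unfolding weakQ_def V
  proof
    fix \<phi> assume \<phi>: "\<phi> \<in> smooth_square"
    have i1: "integrable unit_sq (\<lambda>p. g p * dt \<phi> p)"
      by (rule sq_int_mult[OF sqQ_sq_int[OF g] sqQ_sq_int[OF smooth_square_sqQ(3)[OF \<phi>]]])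
    have i2: "integrable unit_sq (\<lambda>p. sw \<phi> p * y p)"
      by (rule sq_int_mult[OF sqQ_sq_int[OF smooth_square_sqQ(1)[OF \<phi>]] sqQ_sq_int[OF y]])
    have i: "integrable unit_sq (case_prod (\<lambda>t x. g (t, x) * dt \<phi> (t, x) + sw \<phi> (t, x) * y (t, x)))"
      using Bochner_Integration.integrable_add[OF i1 i2] by (simp add: case_prod_unfold)
    have "(LINT p|unit_sq. g p * dt \<phi> p) + (LINT p|unit_sq. sw \<phi> p * y p) = (LINT p|unit_sq. g p * dt \<phi> p + sw \<phi> p * y p)"
      by (rule Bochner_Integration.integral_add[OF i1 i2, symmetric])
    also have "\<dots> = (LINT x|unit_leb. LINT t|unit_leb. g (t, x) * dt \<phi> (t, x) + sw \<phi> (t, x) * y (t, x))"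
      using UU.integral_snd[OF i] by (simp add: case_prod_unfold)
    also have "\<dots> = (LINT x|unit_leb. f1 x * \<phi> (x, 1) - f0 x * \<phi> (x, 0))"
    proof (rule Bochner_Integration.integral_cong[OF refl])
      fix x assume "x \<in> space unit_leb"
      then have x: "x \<in> {0..1}" by simp
      obtain \<phi>x \<phi>t where C: "C1_data \<phi> \<phi>x \<phi>t" using smooth_square_C1[OF \<phi>] by blast
      define k where "k t = (f0 x + t * (f1 x - f0 x)) * \<phi>t (x, t) + \<phi> (x, t) * (f1 x - f0 x)" for t
      have "(LINT t|unit_leb. g (t, x) * dt \<phi> (t, x) + sw \<phi> (t, x) * y (t, x)) = (LINT t|unit_leb. k t)"
        by (rule Bochner_Integration.integral_cong) (use C1_dataD(7)[OF C x] in \<open>auto simp: k_def g_def y_def sw_def\<close>)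
      also have "\<dots> = prim k 1" by (simp add: prim_1)
      also have "\<dots> = (f0 x + 1 * (f1 x - f0 x)) * \<phi> (x, 1) - (f0 x + 0 * (f1 x - f0 x)) * \<phi> (x, 0)"
      proof (rule prim_FTC[where F="\<lambda>t. (f0 x + t * (f1 x - f0 x)) * \<phi> (x, t)"])
        fix t :: real assume t: "t \<in> {0..1}"
        show "((\<lambda>t. (f0 x + t * (f1 x - f0 x)) * \<phi> (x, t)) has_real_derivative k t) (at t within {0..1})"
          unfolding k_def
          by (rule DERIV_cong[OF DERIV_mult[OF _ C1_dataD(5)[OF C x t]]])
            (auto intro!: derivative_eq_intros simp: algebra_simps)
        next
        show "continuous_on {0..1} k" unfolding k_def
          by (intro continuous_intros cont_square_slices(2) C1_dataD[OF C] x)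
      qed simp
      finally show "(LINT t|unit_leb. g (t, x) * dt \<phi> (t, x) + sw \<phi> (t, x) * y (t, x)) = f1 x * \<phi> (x, 1) - f0 x * \<phi> (x, 0)" by simp
    qed
    also have "\<dots> = (LINT x|unit_leb. f1 x * \<phi> (x, 1)) - (LINT x|unit_leb. f0 x * \<phi> (x, 0))"
      by (rule Bochner_Integration.integral_diff) (intro sq_int_mult f0 f1 smooth_square_slice_sq_int[OF \<phi>], simp)+
    finally show "- (LINT p|unit_sq. g p * dt \<phi> p) + (LINT x|unit_leb. f1 x * \<phi> (x, 1)) - (LINT x|unit_leb. f0 x * \<phi> (x, 0)) = 
      (LINT p|unit_sq. g p * (sw \<phi> p * 0 + dx \<phi> p * 0)) + (LINT p|unit_sq. sw \<phi> p * y p)" by simp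
  qed
qed

theorem theorem2p6:
  fixes \<kappa> \<mu> \<epsilon> :: real and f0 f1 :: "real \<Rightarrow> real"
  assumes "\<kappa> > 0" and "\<mu> \<ge> 0" and "\<epsilon> > 0"
    and "f0 \<in> L2" and "f1 \<in> L2"
  shows "\<exists>f v z. (f, v, z) \<in> admissible f0 f1 \<and>
           (\<forall>g w y. (g, w, y) \<in> admissible f0 f1 \<longrightarrow>
              action \<kappa> \<mu> \<epsilon> f v z \<le> action \<kappa> \<mu> \<epsilon> g w y)"
proof -
  have f0: "f0 \<in> sq_int unit_leb" and f1: "f1 \<in> sq_int unit_leb"
    using assms(4,5) by (simp_all add: L2_eq_sq_int)
  note lin = linear_interpolation_weakQ[OF f0 f1]
  obtain f w z where f: "f \<in> sqQ" "w \<in> sqQ" "z \<in> sqQ" "weakQ f0 f1 f w z"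
    and min: "\<And>g v y. g \<in> sqQ \<Longrightarrow> v \<in> sqQ \<Longrightarrow> y \<in> sqQ \<Longrightarrow> weakQ f0 f1 g v y \<Longrightarrow> JQ \<kappa> \<mu> \<epsilon> w z \<le> JQ \<kappa> \<mu> \<epsilon> v y"
    by (rule exists_minimizer_Q[OF assms(1-3) f0 lin(4,1,3,2)]) (assumption | blast)+
  note adm = sqQ_to_admissible[OF f(1-3) f0 f1 f(4)]
  have "action \<kappa> \<mu> \<epsilon> (\<lambda>t x. f (t, x)) (\<lambda>t. G0 (\<lambda>y. w (t, y))) (\<lambda>t x. z (t, x)) \<le> action \<kappa> \<mu> \<epsilon> g v y"
    if a: "(g, v, y) \<in> admissible f0 f1" for g v y
  proof -
    obtain G W Y where G: "G \<in> sqQ" "W \<in> sqQ" "Y \<in> sqQ" "weakQ f0 f1 G W Y" "action \<kappa> \<mu> \<epsilon> g v y = JQ \<kappa> \<mu> \<epsilon> W Y"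
      by (rule admissible_to_sqQ[OF a, where \<kappa>=\<kappa> and \<mu>=\<mu> and \<epsilon>=\<epsilon>]) (assumption | blast)+
    show ?thesis unfolding adm(2) G(5) by (rule min[OF G(1-4)])
  qed
  with adm(1) show ?thesis by blast
qed

end
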